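(* Let $r\ge2$. Any inner fine grading on a real special linear Lie algebra of type $A_r$ is equivalent to exactly one of the gradings $\Gamma^{(\mathrm I)}_{\mathfrak{sl}_n(\Delta)}(m)$ where either $\Delta=\mathbb R$, $n=r+1$, $m\ge0$ or $\Delta=\mathbb H$, $2n=r+1$, $m\ge1$, and in both cases $2^m$ is a divisor of $r+1$ and $2^{-m}(r+1)\ge3$.
   Context: All grading groups are abelian. The real special linear Lie algebras of type $A_r$ are $\mathfrak{sl}_{r+1}(\mathbb R)$ and (for $r$ odd) $\mathfrak{sl}_{(r+1)/2}(\mathbb H)$, where $\mathfrak{sl}_n(\Delta)=[\mathfrak{gl}_n(\Delta),\mathfrak{gl}_n(\Delta)]$. A grading is fine if it has no proper refinement (a refinement: each component is contained in a component of the original grading; proper if some nonzero component is strictly smaller). Two gradings are equivalent if there is an isomorphism of the algebras mapping each nonzero component of one onto a component of the other. A $G$-grading on a real simple Lie algebra $\mathcal L$ is inner if the corresponding homomorphism from the diagonalizable group scheme $G^D$ to $\mathbf{Aut}(\mathcal L)$ has image in the connected component of the identity; equivalently, for every homomorphism $\chi:G\to\mathbb C^\times$, the automorphism of $\mathcal L\otimes\mathbb C$ acting as $\chi(g)$ on the component of degree $g$ is an inner automorphism; otherwise it is outer. Definition of $\Gamma^{(\mathrm I)}_{\mathfrak{sl}_n(\Delta)}(m)$. Let $T=\mathbb Z_2^{2m}$. $D=D(2m;+1)=M_2(\mathbb R)^{\otimes m}\simeq M_\ell(\mathbb R)$, $\ell=2^m$, if $\Delta=\mathbb R$; $D=D(2m;-1)=M_2(\mathbb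 R)^{\otimes(m-1)}\otimes\mathbb H\simeq M_\ell(\mathbb H)$, $\ell=2^{m-1}$, if $\Delta=\mathbb H$. $D$ is $T$-graded with one-dimensional components spanned by $X_{(\overline{i_1},\overline{j_1},\dots,\overline{i_m},\overline{j_m})}=X^{i_1}Y^{j_1}\otimes\cdots\otimes X^{i_m}Y^{j_m}$, where $X=\mathrm{diag}(-1,1)$, $Y=\begin{bmatrix}0&1\\1&0\end{bmatrix}$, except that in the last factor for $\Delta=\mathbb H$ one takes $\mathbf i,\mathbf j$ in place of $X,Y$. Let $n=k\ell$ and identify $M_n(\Delta)$ with $M_k(\mathbb R)\otimes D$. Grade it by $T\times\mathbb Z^k$ (with $e_1,\dots,e_k$ the standard basis of $\mathbb Z^k$) via $\deg(E_{ij}\otimes X_t)=(t,e_i-e_j)$. $\Gamma^{(\mathrm I)}_{\mathfrak{sl}_n(\Delta)}(m)$ is the restriction of this grading to the derived Lie subalgebra $\mathfrak{sl}_n(\Delta)$. In both cases $k=2^{-m}(r+1)$.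
   Formalization: "Inner" is required of the fine grading as graded by its universal abelian group, not by an arbitrary grading group G; for arbitrary G the claim fails, e.g. for the Pauli Z_2^4-grading on sl_4(R), which is fine and inner over Z_2^4 but equivalent to no listed grading. *)

theory Defs
  imports
    Complex_Main
    "HOL-Library.Function_Algebras"
    "HOL-Analysis.Product_Vector"
    "HOL-Algebra.Coset"
    "HOL-Algebra.Generated_Groups"
    "HOL-Algebra.Elementary_Groups"
    "HOL-Algebra.Product_Groups"
    "HOL-Algebra.Free_Abelian_Groups"
begin

section \<open>Quaternions\<close>

text \<open>\<open>Quat a b c d\<close> is $a + bi + cj + dk$.\<close>

datatype quat = Quat (qre: real) (qim_i: real) (qim_j: real) (qim_k: real)

instantiation quat :: real_algebra_1
begin

definition "0 = Quat 0 0 0 0"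
definition "1 = Quat 1 0 0 0"
definition "x + y = Quat (qre x + qre y) (qim_i x + qim_i y) (qim_j x + qim_j y) (qim_k x + qim_k y)"
definition "- x = Quat (- qre x) (- qim_i x) (- qim_j x) (- qim_k x)"
definition "x - y = Quat (qre x - qre y) (qim_i x - qim_i y) (qim_j x - qim_j y) (qim_k x - qim_k y)"
definition "x * y = Quat
  (qre x * qre y - qim_i x * qim_i y - qim_j x * qim_j y - qim_k x * qim_k y)
  (qre x * qim_i y + qim_i x * qre y + qim_j x * qim_k y - qim_k x * qim_j y)
  (qre x * qim_j y - qim_i x * qim_k y + qim_j x * qre y + qim_k x * qim_i y)
  (qre x * qim_k y + qim_i x * qim_j y - qim_j x * qim_i y + qim_k x * qre y)"
definition "c *\<^sub>R x = Quat (c * qre x) (c * qim_i x) (c * qim_j x) (c * qim_k x)"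

lemmas quat_defs = zero_quat_def one_quat_def plus_quat_def uminus_quat_def minus_quat_def
  times_quat_def scaleR_quat_def

instance
  by standard (simp_all add: quat_defs algebra_simps)

end

definition quat_i :: quat where "quat_i = Quat 0 1 0 0"
definition quat_j :: quat where "quat_j = Quat 0 0 1 0"


section \<open>Matrices over the reals and the quaternions\<close>

instantiation "fun" :: (type, real_vector) real_vector
begin

definition scaleR_fun :: "real \<Rightarrow> ('a \<Rightarrow> 'b) \<Rightarrow> 'a \<Rightarrow> 'b"
  where "scaleR_fun c f = (\<lambda>x. c *\<^sub>R f x)"

instance
  by standard (auto simp: scaleR_fun_def fun_eq_iff algebra_simps)

end

text \<open>
  The size of the matrices varies inside the statement, so an \<open>n \<times> n\<close> matrix is a function with
  entries in positions \<open>i, j < n\<close> (counting from 0) that vanishes everywhere else. Real matrices are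
  the quaternionic matrices with real entries, so that the algebras for both choices of
  \<open>\<Delta>\<close> live in one type.
\<close>

type_synonym qmat = "nat \<Rightarrow> nat \<Rightarrow> quat"

datatype division_alg = Reals_alg | Quaternions_alg

primrec entries :: "division_alg \<Rightarrow> quat set" where
  "entries Reals_alg = \<real>"
| "entries Quaternions_alg = UNIV"

definition gl :: "division_alg \<Rightarrow> nat \<Rightarrow> qmat set" where
  "gl \<Delta> n = {A. (\<forall>i j. A i j \<in> entries \<Delta>) \<and> (\<forall>i j. \<not> (i < n \<and> j < n) \<longrightarrow> A i j = 0)}"

definition mat_mult :: "nat \<Rightarrow> qmat \<Rightarrow> qmat \<Rightarrow> qmat" where
  "mat_mult n A B = (\<lambda>i j. \<Sum>k<n. A i k * B k j)"

definition mat_one :: "nat \<Rightarrow> qmat" where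
  "mat_one n = (\<lambda>i j. if i = j \<and> i < n then 1 else 0)"

definition mat_power :: "nat \<Rightarrow> qmat \<Rightarrow> nat \<Rightarrow> qmat" where
  "mat_power n A e = (mat_mult n A ^^ e) (mat_one n)"

definition mat_bracket :: "nat \<Rightarrow> qmat \<Rightarrow> qmat \<Rightarrow> qmat" where
  "mat_bracket n A B = mat_mult n A B - mat_mult n B A"

definition sl :: "division_alg \<Rightarrow> nat \<Rightarrow> qmat set" where
  "sl \<Delta> n = span {mat_bracket n A B | A B. A \<in> gl \<Delta> n \<and> B \<in> gl \<Delta> n}"

text \<open>
  Kronecker product with a \<open>p \<times> p\<close> matrix \<open>B\<close>; this is the identification of
  $M_k(\mathbb R) \otimes M_p(\Delta)$ with $M_{kp}(\Delta)$.
\<close>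

definition kron :: "nat \<Rightarrow> qmat \<Rightarrow> qmat \<Rightarrow> qmat" where
  "kron p A B = (\<lambda>i j. A (i div p) (j div p) * B (i mod p) (j mod p))"

definition mat_unit :: "nat \<Rightarrow> nat \<Rightarrow> qmat" where
  "mat_unit a b = (\<lambda>i j. if i = a \<and> j = b then 1 else 0)"


section \<open>Gradings by abelian groups on real Lie algebras\<close>

text \<open>
  A real Lie algebra is given by a subspace \<open>L\<close> of a real vector space and a bracket \<open>br\<close>.
  A grading by \<open>G\<close> is a family \<open>\<Gamma>\<close> of subspaces, of which only the members indexed by
  \<open>carrier G\<close> matter.
\<close>

definition lie_grading ::
    "'a::real_vector set \<Rightarrow> ('a \<Rightarrow> 'a \<Rightarrow> 'a) \<Rightarrow> ('g, 'm) monoid_scheme \<Rightarrow> ('g \<Rightarrow> 'a set) \<Rightarrow> bool" where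
  "lie_grading L br G \<Gamma> \<longleftrightarrow>
     comm_group G \<and>
     (\<forall>g\<in>carrier G. subspace (\<Gamma> g) \<and> \<Gamma> g \<subseteq> L) \<and>
     (\<forall>x\<in>L. \<exists>!f. (\<forall>g\<in>carrier G. f g \<in> \<Gamma> g) \<and> (\<forall>g. g \<notin> carrier G \<longrightarrow> f g = 0) \<and>
        finite {g. f g \<noteq> 0} \<and> x = (\<Sum>g | f g \<noteq> 0. f g)) \<and>
     (\<forall>g\<in>carrier G. \<forall>h\<in>carrier G. \<forall>x\<in>\<Gamma> g. \<forall>y\<in>\<Gamma> h. br x y \<in> \<Gamma> (g \<otimes>\<^bsub>G\<^esub> h))"

definition grading_support ::
    "('g, 'm) monoid_scheme \<Rightarrow> ('g \<Rightarrow> 'a::real_vector set) \<Rightarrow> 'g set" where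
  "grading_support G \<Gamma> = {g \<in> carrier G. \<Gamma> g \<noteq> {0}}"

definition refines ::
    "('h, 'n) monoid_scheme \<Rightarrow> ('h \<Rightarrow> 'a::real_vector set) \<Rightarrow>
     ('g, 'm) monoid_scheme \<Rightarrow> ('g \<Rightarrow> 'a set) \<Rightarrow> bool" where
  "refines H \<Gamma>' G \<Gamma> \<longleftrightarrow> (\<forall>h\<in>carrier H. \<exists>g\<in>carrier G. \<Gamma>' h \<subseteq> \<Gamma> g)"

definition properly_refines ::
    "('h, 'n) monoid_scheme \<Rightarrow> ('h \<Rightarrow> 'a::real_vector set) \<Rightarrow>
     ('g, 'm) monoid_scheme \<Rightarrow> ('g \<Rightarrow> 'a set) \<Rightarrow> bool" where
  "properly_refines H \<Gamma>' G \<Gamma> \<longleftrightarrow> refines H \<Gamma>' G \<Gamma> \<and>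
     (\<exists>h\<in>grading_support H \<Gamma>'. \<exists>g\<in>carrier G. \<Gamma>' h \<subset> \<Gamma> g)"

text \<open>
  HOL cannot quantify over all types that might carry the grading group of a refinement. Letting it
  range over the abelian groups whose carrier is a set of natural numbers loses nothing for finite
  dimensional \<open>L\<close>: the support of a grading is then finite, the grading group may be replaced by the
  subgroup generated by the support, and a finitely generated group is countable.
\<close>

definition fine_grading ::
    "'a::real_vector set \<Rightarrow> ('a \<Rightarrow> 'a \<Rightarrow> 'a) \<Rightarrow> ('g, 'm) monoid_scheme \<Rightarrow> ('g \<Rightarrow> 'a set) \<Rightarrow> bool" where
  "fine_grading L br G \<Gamma> \<longleftrightarrow> lie_grading L br G \<Gamma> \<and>
     \<not> (\<exists>(H :: nat monoid) \<Gamma>'. lie_grading L br H \<Gamma>' \<and> properly_refines H \<Gamma>' G \<Gamma>)"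

definition lie_isomorphism ::
    "'a::real_vector set \<Rightarrow> ('a \<Rightarrow> 'a \<Rightarrow> 'a) \<Rightarrow> 'b::real_vector set \<Rightarrow> ('b \<Rightarrow> 'b \<Rightarrow> 'b) \<Rightarrow>
     ('a \<Rightarrow> 'b) \<Rightarrow> bool" where
  "lie_isomorphism L br L' br' \<phi> \<longleftrightarrow>
     bij_betw \<phi> L L' \<and>
     (\<forall>x\<in>L. \<forall>y\<in>L. \<phi> (x + y) = \<phi> x + \<phi> y) \<and>
     (\<forall>c. \<forall>x\<in>L. \<phi> (c *\<^sub>R x) = c *\<^sub>R \<phi> x) \<and>
     (\<forall>x\<in>L. \<forall>y\<in>L. \<phi> (br x y) = br' (\<phi> x) (\<phi> y))"

definition equivalent_gradings ::
    "'a::real_vector set \<Rightarrow> ('a \<Rightarrow> 'a \<Rightarrow> 'a) \<Rightarrow> ('g, 'm) monoid_scheme \<Rightarrow> ('g \<Rightarrow> 'a set) \<Rightarrow>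
     'b::real_vector set \<Rightarrow> ('b \<Rightarrow> 'b \<Rightarrow> 'b) \<Rightarrow> ('h, 'n) monoid_scheme \<Rightarrow> ('h \<Rightarrow> 'b set) \<Rightarrow> bool" where
  "equivalent_gradings L br G \<Gamma> L' br' G' \<Gamma>' \<longleftrightarrow>
     (\<exists>\<phi>. lie_isomorphism L br L' br' \<phi> \<and>
        (\<forall>g\<in>grading_support G \<Gamma>. \<exists>g'\<in>carrier G'. \<phi> ` \<Gamma> g = \<Gamma>' g'))"


section \<open>Inner gradings\<close>

text \<open>
  The pair \<open>(x, y)\<close> stands for $x \otimes 1 + y \otimes \sqrt{-1}$; thus the complexification of
  \<open>L\<close> is \<open>L \<times> L\<close>.
\<close>

definition cscale :: "complex \<Rightarrow> 'a::real_vector \<times> 'a \<Rightarrow> 'a \<times> 'a" where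
  "cscale c z = (Re c *\<^sub>R fst z - Im c *\<^sub>R snd z, Re c *\<^sub>R snd z + Im c *\<^sub>R fst z)"

definition cbracket :: "('a::real_vector \<Rightarrow> 'a \<Rightarrow> 'a) \<Rightarrow> 'a \<times> 'a \<Rightarrow> 'a \<times> 'a \<Rightarrow> 'a \<times> 'a" where
  "cbracket br z w = (br (fst z) (fst w) - br (snd z) (snd w),
                      br (fst z) (snd w) + br (snd z) (fst w))"

definition ad_nilpotent ::
    "'a::real_vector set \<Rightarrow> ('a \<Rightarrow> 'a \<Rightarrow> 'a) \<Rightarrow> 'a \<times> 'a \<Rightarrow> bool" where
  "ad_nilpotent L br x \<longleftrightarrow> (\<exists>N. \<forall>z\<in>L \<times> L. (cbracket br x ^^ N) z = 0)"

definition exp_ad :: "('a::real_vector \<Rightarrow> 'a \<Rightarrow> 'a) \<Rightarrow> 'a \<times> 'a \<Rightarrow> 'a \<times> 'a \<Rightarrow> 'a \<times> 'a" where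
  "exp_ad br x z =
     (\<Sum>k | (cbracket br x ^^ k) z \<noteq> 0. (1 / fact k) *\<^sub>R (cbracket br x ^^ k) z)"

text \<open>
  Inner automorphisms of $L \otimes \mathbb C$: the group generated by $\exp(\mathrm{ad}\,x)$ for
  ad-nilpotent \<open>x\<close> (closed under inverses because \<open>- x\<close> is ad-nilpotent as well). The values outside
  \<open>L \<times> L\<close> are irrelevant. For semisimple \<open>L\<close> this is the identity component of the
  automorphism group.
\<close>

inductive inner_automorphism ::
    "'a::real_vector set \<Rightarrow> ('a \<Rightarrow> 'a \<Rightarrow> 'a) \<Rightarrow> ('a \<times> 'a \<Rightarrow> 'a \<times> 'a) \<Rightarrow> bool"
  for L br where
  inner_id: "inner_automorphism L br (\<lambda>z. z)"
| inner_exp: "inner_automorphism L br \<phi> \<Longrightarrow> x \<in> L \<times> L \<Longrightarrow> ad_nilpotent L br x \<Longrightarrow>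
    inner_automorphism L br (\<lambda>z. exp_ad br x (\<phi> z))"

definition complex_units :: "complex monoid" where
  "complex_units = \<lparr>carrier = UNIV - {0}, monoid.mult = (*), one = 1\<rparr>"

definition inner_grading ::
    "'a::real_vector set \<Rightarrow> ('a \<Rightarrow> 'a \<Rightarrow> 'a) \<Rightarrow> ('g, 'm) monoid_scheme \<Rightarrow> ('g \<Rightarrow> 'a set) \<Rightarrow> bool" where
  "inner_grading L br G \<Gamma> \<longleftrightarrow>
     (\<forall>\<chi>\<in>hom G complex_units. \<exists>\<phi>. inner_automorphism L br \<phi> \<and>
        (\<forall>g\<in>carrier G. \<forall>z\<in>\<Gamma> g \<times> \<Gamma> g. \<phi> z = cscale (\<chi> g) z))"

text \<open>
  Whether a grading is inner depends on the group by which it is indexed, not only on the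
  components. For example, the Pauli grading on $\mathfrak{sl}_4(\mathbb R)$ has one-dimensional
  components and is inner as a $\mathbb Z_2^4$-grading, but the same components also form an outer
  grading by $\mathbb Z_2^5$. A fine grading, being considered up to equivalence, is therefore
  indexed by its universal abelian group: the generators are the elements \<open>g\<close> of the support,
  subject to the relations \<open>g + h = gh\<close> whenever the components of degrees \<open>g\<close> and \<open>h\<close> do not
  commute.
\<close>

definition universal_relators ::
    "('a::real_vector \<Rightarrow> 'a \<Rightarrow> 'a) \<Rightarrow> ('g, 'm) monoid_scheme \<Rightarrow> ('g \<Rightarrow> 'a set) \<Rightarrow> ('g \<Rightarrow>\<^sub>0 int) set" where
  "universal_relators br G \<Gamma> =
     {frag_of g + frag_of h - frag_of (g \<otimes>\<^bsub>G\<^esub> h) | g h.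
        g \<in> grading_support G \<Gamma> \<and> h \<in> grading_support G \<Gamma> \<and>
        (\<exists>x\<in>\<Gamma> g. \<exists>y\<in>\<Gamma> h. br x y \<noteq> 0)}"

definition universal_relations ::
    "('a::real_vector \<Rightarrow> 'a \<Rightarrow> 'a) \<Rightarrow> ('g, 'm) monoid_scheme \<Rightarrow> ('g \<Rightarrow> 'a set) \<Rightarrow> ('g \<Rightarrow>\<^sub>0 int) set" where
  "universal_relations br G \<Gamma> =
     generate (free_Abelian_group (grading_support G \<Gamma>)) (universal_relators br G \<Gamma>)"

definition universal_group ::
    "('a::real_vector \<Rightarrow> 'a \<Rightarrow> 'a) \<Rightarrow> ('g, 'm) monoid_scheme \<Rightarrow> ('g \<Rightarrow> 'a set) \<Rightarrow>
     ('g \<Rightarrow>\<^sub>0 int) set monoid" where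
  "universal_group br G \<Gamma> =
     free_Abelian_group (grading_support G \<Gamma>) Mod universal_relations br G \<Gamma>"

definition universal_degree ::
    "('a::real_vector \<Rightarrow> 'a \<Rightarrow> 'a) \<Rightarrow> ('g, 'm) monoid_scheme \<Rightarrow> ('g \<Rightarrow> 'a set) \<Rightarrow> 'g \<Rightarrow>
     ('g \<Rightarrow>\<^sub>0 int) set" where
  "universal_degree br G \<Gamma> g =
     universal_relations br G \<Gamma> #>\<^bsub>free_Abelian_group (grading_support G \<Gamma>)\<^esub> frag_of g"

text \<open>
  The union below has at most one member, since \<open>universal_degree\<close> is injective on the support of a
  grading; the span turns an empty union into the zero component.
\<close>

definition universal_grading ::
    "('a::real_vector \<Rightarrow> 'a \<Rightarrow> 'a) \<Rightarrow> ('g, 'm) monoid_scheme \<Rightarrow> ('g \<Rightarrow> 'a set) \<Rightarrow>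
     ('g \<Rightarrow>\<^sub>0 int) set \<Rightarrow> 'a set" where
  "universal_grading br G \<Gamma> u =
     span (\<Union>g\<in>{g \<in> grading_support G \<Gamma>. universal_degree br G \<Gamma> g = u}. \<Gamma> g)"

definition inner_fine_grading ::
    "'a::real_vector set \<Rightarrow> ('a \<Rightarrow> 'a \<Rightarrow> 'a) \<Rightarrow> ('g, 'm) monoid_scheme \<Rightarrow> ('g \<Rightarrow> 'a set) \<Rightarrow> bool" where
  "inner_fine_grading L br G \<Gamma> \<longleftrightarrow>
     fine_grading L br G \<Gamma> \<and>
     inner_grading L br (universal_group br G \<Gamma>) (universal_grading br G \<Gamma>)"


section \<open>The gradings of the first type on special linear Lie algebras\<close>

definition pauli_X :: qmat where
  "pauli_X = mat_unit 1 1 - mat_unit 0 0"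

definition pauli_Y :: qmat where
  "pauli_Y = mat_unit 0 1 + mat_unit 1 0"

text \<open>
  An element $(\overline{i_1}, \overline{j_1}, \dots, \overline{i_m}, \overline{j_m})$ of
  $\mathbb Z_2^{2m}$ is a function \<open>t\<close> on \<open>{..<2 * m}\<close> with values 0 and 1, where
  \<open>t (2 * s)\<close> is $i_{s+1}$ and \<open>t (2 * s + 1)\<close> is $j_{s+1}$.
\<close>

primrec real_basis :: "nat \<Rightarrow> (nat \<Rightarrow> int) \<Rightarrow> qmat" where
  "real_basis 0 t = mat_one 1"
| "real_basis (Suc s) t = kron 2 (real_basis s t)
     (mat_mult 2 (mat_power 2 pauli_X (nat (t (2 * s)))) (mat_power 2 pauli_Y (nat (t (2 * s + 1)))))"

definition scalar_mat :: "quat \<Rightarrow> qmat" where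
  "scalar_mat q = (\<lambda>i j. if i = 0 \<and> j = 0 then q else 0)"

text \<open>The element $X_t$ of $D(2m; \pm 1)$; for the quaternions, \<open>m \<ge> 1\<close> is intended.\<close>

primrec D_basis :: "division_alg \<Rightarrow> nat \<Rightarrow> (nat \<Rightarrow> int) \<Rightarrow> qmat" where
  "D_basis Reals_alg m t = real_basis m t"
| "D_basis Quaternions_alg m t = kron 1 (real_basis (m - 1) t)
     (scalar_mat (quat_i ^ nat (t (2 * (m - 1))) * quat_j ^ nat (t (2 * (m - 1) + 1))))"

primrec D_size :: "division_alg \<Rightarrow> nat \<Rightarrow> nat" where
  "D_size Reals_alg m = 2 ^ m"
| "D_size Quaternions_alg m = 2 ^ (m - 1)"

definition type_I_group ::
    "division_alg \<Rightarrow> nat \<Rightarrow> nat \<Rightarrow> ((nat \<Rightarrow> int) \<times> (nat \<Rightarrow> int)) monoid" where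
  "type_I_group \<Delta> n m =
     product_group {..<2 * m} (\<lambda>_. integer_mod_group 2) \<times>\<times>
     product_group {..<n div D_size \<Delta> m} (\<lambda>_. integer_group)"

text \<open>$e_i - e_j$ in $\mathbb Z^k$.\<close>

definition basis_diff :: "nat \<Rightarrow> nat \<Rightarrow> nat \<Rightarrow> nat \<Rightarrow> int" where
  "basis_diff k i j = (\<lambda>a\<in>{..<k}. of_bool (a = i) - of_bool (a = j))"

definition type_I_grading ::
    "division_alg \<Rightarrow> nat \<Rightarrow> nat \<Rightarrow> (nat \<Rightarrow> int) \<times> (nat \<Rightarrow> int) \<Rightarrow> qmat set" where
  "type_I_grading \<Delta> n m = (\<lambda>(t, v).
     (let k = n div D_size \<Delta> m in
        span {kron (D_size \<Delta> m) (mat_unit i j) (D_basis \<Delta> m t) | i j.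
                i < k \<and> j < k \<and> basis_diff k i j = v})
     \<inter> sl \<Delta> n)"

definition sl_has_type_A :: "nat \<Rightarrow> division_alg \<Rightarrow> nat \<Rightarrow> bool" where
  "sl_has_type_A r \<Delta> n \<longleftrightarrow>
     (case \<Delta> of Reals_alg \<Rightarrow> n = r + 1 | Quaternions_alg \<Rightarrow> 2 * n = r + 1)"

end

theory Submission
  imports Defs "HOL-Computational_Algebra.Fundamental_Theorem_Algebra" "HOL-Library.Countable_Set"
begin

text \<open>
  Because the grading by the universal group is inner, every character acts by the restriction of an
  automorphism of the complexified matrix algebra. Since characters separate the elements of a
  finitely generated abelian group, adjoining the scalars to the identity component turns the Lie
  grading into a grading of the associative algebra $R = M_n(\Delta)$. A minimal homogeneous left
  ideal yields homogeneous matrix units \<open>E i j\<close> whose centralizer \<open>C\<close> is a graded division algebra.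

  Fineness enters through one principle: an automorphism of the Lie algebra that is diagonalizable over
  the reals and preserves all components acts as a scalar on each of them, since otherwise its
  eigenspaces refine the grading. Conjugation automorphisms then show that the identity component of
  \<open>C\<close> is $\mathbb R$ and that the components are the expected ones, and \<open>C\<close> is spanned by a group of elements with
  squares $\pm 1$, which has a symplectic basis and hence the multiplication table of $D(2m; \pm 1)$.
  Matrix size $k \le 2$ is excluded by the outer automorphism that negates an antiautomorphism:
  for $k = 1$ it is given by a character, contradicting innerness, and for $k = 2$ it gives a proper
  refinement.

  For uniqueness, $m$ and $\Delta$ are recovered from the number of components that contain an \<open>a\<close>
  with $[a, [a, z]] = c z$ for some $c < 0$ and $z \ne 0$. These are the components of the $X_t$ with
  $X_t^2 = -1$, and there are $2^{m-1}(2^m \mp 1)$ of them.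
\<close>

text \<open>The obstacle is that the Lie algebra sees neither the unit nor the associative product:
  an automorphism of its complexification may be the negative of an antiautomorphism, whose
  eigenspaces do not grade \<open>R\<close>. Inner automorphisms are composed of exponentials of
  maps \<open>ad x\<close>, which are derivations of the associative product as well; this is the
  gain from innerness. The universal group matters because every function on the support that
  respects the nonzero brackets is one of its characters, whether or not it comes from a character
  of \<open>G\<close>.

  Source and target are compared only through the multiplication table of the elements
  \<open>E_ij \<otimes> X_t\<close> (locale \<open>type_I\<close>). Its structure constants depend
  on k, m and one flag for a quaternion factor; one flag is enough since H \<otimes> H is a real
  matrix algebra. The division algebra and m of the answer are thus read off a symplectic basis.

  In the final count, equality for the two choices of \<Delta> would give two powers of 2 that
  differ by 1, the smaller one having a positive exponent.\<close>

locale ralg =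
  fixes mult :: "'a::real_vector \<Rightarrow> 'a \<Rightarrow> 'a"  (infixl "\<star>" 70)
  assumes mult_assoc: "(x \<star> y) \<star> z = x \<star> (y \<star> z)"
    and mult_add_left: "(x + y) \<star> z = x \<star> z + y \<star> z"
    and mult_add_right: "x \<star> (y + z) = x \<star> y + x \<star> z"
    and mult_scaleR_left [simp]: "(c *\<^sub>R x) \<star> y = c *\<^sub>R (x \<star> y)"
    and mult_scaleR_right [simp]: "x \<star> (c *\<^sub>R y) = c *\<^sub>R (x \<star> y)"
begin

lemma linear_mult_left: "linear (\<lambda>x. x \<star> y)"
  by (rule linearI) (simp_all add: mult_add_left)

lemma linear_mult_right: "linear (\<lambda>y. x \<star> y)"
  by (rule linearI) (simp_all add: mult_add_right)

lemma mult_zero_left [simp]: "0 \<star> y = 0"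
  by (rule linear_0[OF linear_mult_left])

lemma mult_zero_right [simp]: "x \<star> 0 = 0"
  by (rule linear_0[OF linear_mult_right])

lemma mult_minus_left [simp]: "(- x) \<star> y = - (x \<star> y)"
  by (rule linear_neg[OF linear_mult_left])

lemma mult_minus_right [simp]: "x \<star> (- y) = - (x \<star> y)"
  by (rule linear_neg[OF linear_mult_right])

lemma mult_diff_left: "(x - y) \<star> z = x \<star> z - y \<star> z"
  by (rule linear_diff[OF linear_mult_left])

lemma mult_diff_right: "x \<star> (y - z) = x \<star> y - x \<star> z"
  by (rule linear_diff[OF linear_mult_right])

lemma mult_sum_left: "(\<Sum>i\<in>I. f i) \<star> y = (\<Sum>i\<in>I. f i \<star> y)"
  by (rule linear_sum[OF linear_mult_left])

lemma mult_sum_right: "x \<star> (\<Sum>i\<in>I. f i) = (\<Sum>i\<in>I. x \<star> f i)"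
  by (rule linear_sum[OF linear_mult_right])

lemmas distribs = mult_add_left mult_add_right mult_diff_left mult_diff_right

lemma mult_in_span:
  assumes "x \<in> span S" "y \<in> span T" "\<And>s t. s \<in> S \<Longrightarrow> t \<in> T \<Longrightarrow> s \<star> t \<in> W" "subspace W"
  shows "x \<star> y \<in> W"
  using assms(1)
proof (induction rule: span_induct)
  case base
  show ?case
    using assms(4) unfolding subspace_def by (auto simp: mult_add_left)
next
  case (step s)
  show ?case using assms(2)
  proof (induction rule: span_induct)
    case base
    show ?case using assms(4) unfolding subspace_def by (auto simp: mult_add_right)
  next
    case (step t)
    then show ?case using assms(3) \<open>s \<in> S\<close> by auto
  qed
qed

definition br :: "'a \<Rightarrow> 'a \<Rightarrow> 'a" where "br x y = x \<star> y - y \<star> x"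

end

section \<open>Linear independence and spans of indexed families\<close>

lemma family_independent:
  fixes b :: "'i \<Rightarrow> 'a::real_vector"
  assumes "finite I"
    and "\<And>c. (\<Sum>i\<in>I. c i *\<^sub>R b i) = 0 \<Longrightarrow> \<forall>i\<in>I. c i = 0"
  shows "inj_on b I" "independent (b ` I)"
proof -
  show inj: "inj_on b I"
  proof (rule inj_onI, rule ccontr)
    fix i j assume ij: "i \<in> I" "j \<in> I" "b i = b j" "i \<noteq> j"
    \<comment> \<open>Equal members at \<open>i\<close> and \<open>j\<close> would give the
      nontrivial relation \<open>b i - b j = 0\<close>.\<close>
    define c :: "'i \<Rightarrow> real" where "c = (\<lambda>l. if l = i then 1 else if l = j then -1 else 0)"
    have "(\<Sum>l\<in>I. c l *\<^sub>R b l) = (\<Sum>l\<in>{i,j}. c l *\<^sub>R b l)"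
      using assms(1) ij by (intro sum.mono_neutral_right) (auto simp: c_def)
    also have "\<dots> = 0" using ij by (simp add: c_def)
    finally have "c i = 0" using assms(2) ij(1) by blast
    then show False by (simp add: c_def)
  qed
  show "independent (b ` I)"
    unfolding independent_explicit_finite_subsets
  proof (intro allI impI ballI)
    fix A u v assume A: "A \<subseteq> b ` I" "finite A" "(\<Sum>v\<in>A. u v *\<^sub>R v) = 0" "v \<in> A"
    define c where "c = (\<lambda>i. if b i \<in> A then u (b i) else 0)"
    have "(\<Sum>i\<in>I. c i *\<^sub>R b i) = (\<Sum>v\<in>b ` I. (if v \<in> A then u v else 0) *\<^sub>R v)"
      by (subst sum.reindex[OF inj]) (simp add: c_def)
    also have "\<dots> = (\<Sum>v\<in>A. u v *\<^sub>R v)"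
      using A assms(1) by (intro sum.mono_neutral_cong_right) auto
    finally have "(\<Sum>i\<in>I. c i *\<^sub>R b i) = 0" using A(3) by simp
    moreover obtain i where "i \<in> I" "b i = v" using A by auto
    ultimately have "c i = 0" using assms(2) by blast
    then show "u v = 0" using \<open>b i = v\<close> A(4) by (simp add: c_def)
  qed
qed

lemma span_image_coeffs:
  fixes b :: "'i \<Rightarrow> 'a::real_vector"
  assumes "finite I" "x \<in> span (b ` I)"
  obtains c where "x = (\<Sum>i\<in>I. c i *\<^sub>R b i)"
proof -
  have "\<exists>c. x = (\<Sum>i\<in>I. c i *\<^sub>R b i)"
    using assms(2)
  proof (induction rule: span_induct)
    case base
    show ?case
      unfolding subspace_def
    proof (intro conjI ballI allI)
      show "0 \<in> {x. \<exists>c. x = (\<Sum>i\<in>I. c i *\<^sub>R b i)}"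
        by (auto intro!: exI[of _ "\<lambda>_. 0"])
    next
      fix x y assume "x \<in> {x. \<exists>c. x = (\<Sum>i\<in>I. c i *\<^sub>R b i)}" "y \<in> {x. \<exists>c. x = (\<Sum>i\<in>I. c i *\<^sub>R b i)}"
      then obtain c d where "x = (\<Sum>i\<in>I. c i *\<^sub>R b i)" "y = (\<Sum>i\<in>I. d i *\<^sub>R b i)" by auto
      then show "x + y \<in> {x. \<exists>c. x = (\<Sum>i\<in>I. c i *\<^sub>R b i)}"
        by (auto intro!: exI[of _ "\<lambda>i. c i + d i"] simp: scaleR_add_left sum.distrib)
    next
      fix r x assume "x \<in> {x. \<exists>c. x = (\<Sum>i\<in>I. c i *\<^sub>R b i)}"
      then obtain c where "x = (\<Sum>i\<in>I. c i *\<^sub>R b i)" by auto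
      then show "r *\<^sub>R x \<in> {x. \<exists>c. x = (\<Sum>i\<in>I. c i *\<^sub>R b i)}"
        by (auto intro!: exI[of _ "\<lambda>i. r * c i"] simp: scaleR_sum_right)
    qed
  next
    case (step v)
    then obtain i where "i \<in> I" "v = b i" by auto
    then show ?case
      using assms(1) by (auto intro!: exI[of _ "\<lambda>l. if l = i then 1 else 0"] simp: if_distribR cong: if_cong)
         (simp add: if_distrib[of "\<lambda>c. c *\<^sub>R _"] cong: if_cong)
  qed
  then show thesis using that by blast
qed

lemma linear_eqI_span:
  assumes "linear f" "linear g" "\<And>b. b \<in> S \<Longrightarrow> f b = g b" "x \<in> span S"
  shows "f x = g x"
  using assms linear_eq_on by metis

section \<open>Pauli multiplication tables\<close>

text \<open>Extensional functions represent Z_2^(2m), so that this set is literally a carrier of a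
  product of copies of Z/2, as in the group that indexes the gradings
  (\<open>carrier_type_I_group\<close>).\<close>

definition pidx :: "nat \<Rightarrow> (nat \<Rightarrow> int) set" where
  "pidx m = ({..<2 * m} \<rightarrow>\<^sub>E {0, 1})"

definition padd :: "nat \<Rightarrow> (nat \<Rightarrow> int) \<Rightarrow> (nat \<Rightarrow> int) \<Rightarrow> nat \<Rightarrow> int" where
  "padd m s t = (\<lambda>i\<in>{..<2 * m}. (s i + t i) mod 2)"

definition pzero :: "nat \<Rightarrow> nat \<Rightarrow> int" where
  "pzero m = (\<lambda>i\<in>{..<2 * m}. 0)"

text \<open>For basis elements \<open>P^a Q^b\<close> and \<open>P^c Q^d\<close> of one tensor
  factor, moving \<open>Q^b\<close> past \<open>P^c\<close> gives the first sign, because P and Q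
  anticommute. In the quaternion algebra, reducing the exponents a + c and b + d modulo 2 gives the
  other two, because i^2 = j^2 = -1.\<close>

definition pair_sign :: "bool \<Rightarrow> int \<Rightarrow> int \<Rightarrow> int \<Rightarrow> int \<Rightarrow> real" where
  "pair_sign h a b c d =
     (if b = 1 \<and> c = 1 then -1 else 1) * (if h \<and> a = 1 \<and> c = 1 then -1 else 1) *
     (if h \<and> b = 1 \<and> d = 1 then -1 else 1)"

text \<open>
  The sign in $X_s X_t = \pm X_{s+t}$; the flag \<open>h\<close> says that the last of the \<open>m\<close> tensor factors
  is the quaternion algebra.
\<close>

definition psign :: "bool \<Rightarrow> nat \<Rightarrow> (nat \<Rightarrow> int) \<Rightarrow> (nat \<Rightarrow> int) \<Rightarrow> real" where
  "psign h m s t =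
     (\<Prod>i<m. pair_sign (h \<and> Suc i = m) (s (2 * i)) (s (2 * i + 1)) (t (2 * i)) (t (2 * i + 1)))"

lemma finite_pidx [simp]: "finite (pidx m)"
  unfolding pidx_def by (intro finite_PiE) auto

lemma card_pidx: "card (pidx m) = 4 ^ m"
  unfolding pidx_def by (simp add: card_PiE power_mult numeral_2_eq_2[symmetric])

lemma pidx_cases: "t \<in> pidx m \<Longrightarrow> i < 2 * m \<Longrightarrow> t i = 0 \<or> t i = 1"
  unfolding pidx_def by auto

lemma pzero_in [simp]: "pzero m \<in> pidx m"
  unfolding pidx_def pzero_def by auto

lemma padd_in [simp]: "padd m s t \<in> pidx m"
  unfolding pidx_def padd_def by (auto simp: PiE_iff)

lemma padd_commute: "padd m s t = padd m t s"
  unfolding padd_def by (simp add: add.commute)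

lemma padd_zero [simp]: "t \<in> pidx m \<Longrightarrow> padd m t (pzero m) = t" "t \<in> pidx m \<Longrightarrow> padd m (pzero m) t = t"
  unfolding pidx_def padd_def pzero_def
  by (auto simp: PiE_iff fun_eq_iff extensional_def) (metis lessThan_iff mod_0 one_mod_two_eq_one)+

lemma padd_self [simp]: "t \<in> pidx m \<Longrightarrow> padd m t t = pzero m"
  unfolding pidx_def padd_def pzero_def by (auto simp: PiE_iff fun_eq_iff extensional_def)

lemma padd_assoc: "padd m (padd m s t) u = padd m s (padd m t u)"
  unfolding padd_def by (auto simp: fun_eq_iff mod_simps add.assoc)

lemma padd_cancel [simp]: "s \<in> pidx m \<Longrightarrow> t \<in> pidx m \<Longrightarrow> padd m (padd m t s) s = t"
  by (simp add: padd_assoc)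

lemma padd_eq_zero_iff [simp]: "s \<in> pidx m \<Longrightarrow> t \<in> pidx m \<Longrightarrow> padd m s t = pzero m \<longleftrightarrow> s = t"
  by (metis padd_cancel padd_self padd_zero(2))

lemma psign_cases: "psign h m s t = 1 \<or> psign h m s t = -1"
proof -
  have "(psign h m s t)\<^sup>2 = 1"
    unfolding psign_def prod_power_distrib
    by (intro prod.neutral) (auto simp: pair_sign_def power2_eq_square)
  then show ?thesis by (simp add: power2_eq_1_iff)
qed

lemma psign_square [simp]: "psign h m s t * psign h m s t = 1"
  using psign_cases[of h m s t] by auto

lemma psign_nz [simp]: "psign h m s t \<noteq> 0"
  using psign_cases[of h m s t] by auto

lemma psign_zero_left [simp]: "psign h m (pzero m) t = 1"
  unfolding psign_def by (intro prod.neutral) (auto simp: pair_sign_def pzero_def)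

lemma psign_zero_right [simp]: "psign h m t (pzero m) = 1"
  unfolding psign_def by (intro prod.neutral) (auto simp: pair_sign_def pzero_def)

text \<open>The commutation sign is an alternating form that pairs the two coordinates of each
  tensor factor. A coordinate \<open>j\<close> with \<open>t j = 1\<close> is detected by the unit
  vector at its partner; the signs caused by squares are symmetric in \<open>s\<close> and
  \<open>t\<close> and cancel.\<close>

lemma psign_nondegenerate:
  assumes t: "t \<in> pidx m" "t \<noteq> pzero m"
  obtains s where "s \<in> pidx m" "psign h m s t = - psign h m t s"
proof -
  obtain j where j: "j < 2 * m" "t j \<noteq> 0"
  proof -
    have "\<exists>j<2 * m. t j \<noteq> 0"
    proof (rule ccontr)
      assume "\<not> ?thesis"
      then have "t = pzero m"
        using t(1) unfolding pidx_def pzero_def by (auto simp: fun_eq_iff PiE_iff extensional_def)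
      then show False using t(2) by simp
    qed
    then show thesis using that by auto
  qed
  then have tj: "t j = 1" using pidx_cases[OF t(1)] by blast
  define i where "i = j div 2"
  \<comment> \<open>The partner of \<open>j\<close> in the same tensor factor: 2i and 2i + 1 are
    exchanged.\<close>
  define l where "l = (if even j then Suc j else j - 1)"
  have l: "l < 2 * m" "l div 2 = i" "l \<noteq> j"
    using j(1) unfolding l_def i_def by (auto elim!: oddE)
  define s :: "nat \<Rightarrow> int" where "s = (\<lambda>a\<in>{..<2 * m}. if a = l then 1 else 0)"
  have s: "s \<in> pidx m" unfolding s_def pidx_def by auto
  define f where "f = (\<lambda>s t :: nat \<Rightarrow> int. \<lambda>i. pair_sign (h \<and> Suc i = m) (s (2 * i)) (s (2 * i + 1)) (t (2 * i)) (t (2 * i + 1)))"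
  have i: "i < m" using j(1) unfolding i_def by auto
  have "psign h m s t * psign h m t s = (\<Prod>a<m. f s t a * f t s a)"
    unfolding psign_def f_def by (simp add: prod.distrib)
  also have "\<dots> = (\<Prod>a\<in>{i}. f s t a * f t s a)"
  proof (rule prod.mono_neutral_right)
    show "\<forall>a\<in>{..<m} - {i}. f s t a * f t s a = 1"
    proof
      fix a assume a: "a \<in> {..<m} - {i}"
      then have "s (2 * a) = 0" "s (2 * a + 1) = 0" using l(2) unfolding s_def by auto
      then show "f s t a * f t s a = 1" unfolding f_def pair_sign_def by auto
    qed
  qed (use i in auto)
  also have "\<dots> = -1"
  proof (cases "even j")
    case True
    then have "j = 2 * i" "l = 2 * i + 1" unfolding i_def l_def by auto
    then show ?thesis using tj l(1) pidx_cases[OF t(1), of l] unfolding f_def pair_sign_def s_def by auto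
  next
    case False
    then have "j = 2 * i + 1" "l = 2 * i" unfolding i_def l_def by (auto elim!: oddE)
    then show ?thesis using tj l(1) pidx_cases[OF t(1), of l] unfolding f_def pair_sign_def s_def by auto
  qed
  finally have "psign h m s t * psign h m t s = -1" .
  then have "psign h m s t = - psign h m t s"
    using psign_cases[of h m s t] psign_cases[of h m t s] by auto
  then show thesis using that s by blast
qed

text \<open>\<open>B i j t\<close> stands for \<open>E_ij \<otimes> X_t\<close> in M_k(R) \<otimes>
  D. Only the table and the nonvanishing of one element are assumed; the table is that of a simple
  algebra, which makes the \<open>B i j t\<close> linearly independent. Hence any elements that
  multiply this way span a copy of the algebra. Instances are the matrix algebras
  (\<open>type_I_gl\<close>) and the homogeneous basis found inside a fine grading
  (\<open>type_I_BY\<close>).\<close>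

locale type_I = ralg mult for mult :: "'a::real_vector \<Rightarrow> 'a \<Rightarrow> 'a" (infixl "\<star>" 70) +
  fixes hq :: bool and k m :: nat and B :: "nat \<Rightarrow> nat \<Rightarrow> (nat \<Rightarrow> int) \<Rightarrow> 'a"
  assumes k_pos: "0 < k"
    and B_mult: "\<lbrakk>i < k; j < k; p < k; q < k; s \<in> pidx m; t \<in> pidx m\<rbrakk> \<Longrightarrow>
      B i j s \<star> B p q t = (if j = p then psign hq m s t *\<^sub>R B i q (padd m s t) else 0)"
    and B_nz: "B 0 0 (pzero m) \<noteq> 0"
begin

definition idx :: "(nat \<times> nat \<times> (nat \<Rightarrow> int)) set" where
  "idx = {..<k} \<times> {..<k} \<times> pidx m"

definition b :: "nat \<times> nat \<times> (nat \<Rightarrow> int) \<Rightarrow> 'a" where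
  "b = (\<lambda>(i, j, t). B i j t)"

definition R :: "'a set" where "R = span (b ` idx)"

definition u :: 'a where "u = (\<Sum>i<k. B i i (pzero m))"

lemma finite_idx [simp]: "finite idx" unfolding idx_def by simp

lemma card_idx: "card idx = k\<^sup>2 * 4 ^ m"
  unfolding idx_def by (simp add: card_cartesian_product card_pidx power2_eq_square)

lemma subspace_R [simp]: "subspace R" unfolding R_def by simp

lemma B_in_R [simp]: "i < k \<Longrightarrow> j < k \<Longrightarrow> t \<in> pidx m \<Longrightarrow> B i j t \<in> R"
  unfolding R_def b_def idx_def by (rule span_base) force

lemma R_mult [intro]: "x \<in> R \<Longrightarrow> y \<in> R \<Longrightarrow> x \<star> y \<in> R"
  unfolding R_def
proof (erule mult_in_span, assumption)
  fix s t assume "s \<in> b ` idx" "t \<in> b ` idx"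
  then obtain i j a p q c where "s = B i j a" "t = B p q c" "i < k" "j < k" "a \<in> pidx m"
    "p < k" "q < k" "c \<in> pidx m" unfolding b_def idx_def by auto
  then show "s \<star> t \<in> span (b ` idx)"
    using B_in_R[of i q "padd m a c"] unfolding R_def
    by (auto simp: B_mult intro: span_scale span_0)
qed auto

lemma u_in_R [simp]: "u \<in> R"
  unfolding u_def by (intro subspace_sum) auto

lemma u_B [simp]: "i < k \<Longrightarrow> j < k \<Longrightarrow> t \<in> pidx m \<Longrightarrow> u \<star> B i j t = B i j t"
  unfolding u_def mult_sum_left
  by (subst sum.cong[where h = "\<lambda>a. if a = i then B i j t else 0", OF refl]) (auto simp: B_mult)

lemma B_u [simp]: "i < k \<Longrightarrow> j < k \<Longrightarrow> t \<in> pidx m \<Longrightarrow> B i j t \<star> u = B i j t"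
  unfolding u_def mult_sum_right
  by (subst sum.cong[where h = "\<lambda>a. if a = j then B i j t else 0", OF refl]) (auto simp: B_mult)

lemma u_left [simp]: "x \<in> R \<Longrightarrow> u \<star> x = x"
  unfolding R_def
  by (rule linear_eqI_span[of "\<lambda>x. u \<star> x" "\<lambda>x. x" "b ` idx"])
     (auto simp: linear_mult_right b_def idx_def linear_id[unfolded id_def])

lemma u_right [simp]: "x \<in> R \<Longrightarrow> x \<star> u = x"
  unfolding R_def
  by (rule linear_eqI_span[of "\<lambda>x. x \<star> u" "\<lambda>x. x" "b ` idx"])
     (auto simp: linear_mult_left b_def idx_def linear_id[unfolded id_def])

lemma R_coeffs:
  assumes "x \<in> R"
  obtains c where "x = (\<Sum>l\<in>idx. c l *\<^sub>R b l)"
  using span_image_coeffs[of idx x b] assms unfolding R_def by auto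

definition ideal :: "'a set \<Rightarrow> bool" where
  "ideal J \<longleftrightarrow> subspace J \<and> (\<forall>x\<in>J. \<forall>i<k. \<forall>j<k. \<forall>t\<in>pidx m. B i j t \<star> x \<in> J \<and> x \<star> B i j t \<in> J)"

text \<open>\<open>psign hq m s s *\<^sub>R B 0 0 s\<close> is the inverse of \<open>B 0 0 s\<close>
  in its corner, so this is conjugation by \<open>X_s\<close>, which multiplies \<open>X_t\<close>
  by their commutation sign.\<close>

lemma B_conj:
  assumes "s \<in> pidx m" "t \<in> pidx m"
  shows "psign hq m s s *\<^sub>R (B 0 0 s \<star> B 0 0 t \<star> B 0 0 s) =
    (psign hq m s t * psign hq m t s) *\<^sub>R B 0 0 t"
proof -
  have "B 0 0 s \<star> B 0 0 t = (psign hq m s t * psign hq m t s) *\<^sub>R (B 0 0 t \<star> B 0 0 s)"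
    using assms k_pos by (simp add: B_mult padd_commute[of m s t] mult.assoc)
  then have "B 0 0 s \<star> B 0 0 t \<star> B 0 0 s = (psign hq m s t * psign hq m t s) *\<^sub>R (B 0 0 t \<star> (B 0 0 s \<star> B 0 0 s))"
    by (simp add: mult_assoc)
  also have "\<dots> = (psign hq m s t * psign hq m t s) *\<^sub>R (psign hq m s s *\<^sub>R B 0 0 t)"
    using assms k_pos by (simp add: B_mult)
  finally show ?thesis by (simp add: mult.commute mult.left_commute)
qed

text \<open>
  Conjugating by an \<open>X\<^sub>s\<close> that anticommutes with \<open>X\<^sub>t\<close> and averaging removes the \<open>t\<close>-term.
\<close>

lemma ideal_unit:
  assumes J: "ideal J" and S: "finite S" "S \<subseteq> pidx m" "pzero m \<in> S" "c (pzero m) \<noteq> 0"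
    and x: "(\<Sum>t\<in>S. c t *\<^sub>R B 0 0 t) \<in> J"
  shows "B 0 0 (pzero m) \<in> J"
  using S x
proof (induction "card S" arbitrary: S c rule: less_induct)
  case less
  show ?case
  proof (cases "S = {pzero m}")
    case True
    then have "c (pzero m) *\<^sub>R B 0 0 (pzero m) \<in> J" using less.prems by simp
    then have "(1 / c (pzero m)) *\<^sub>R (c (pzero m) *\<^sub>R B 0 0 (pzero m)) \<in> J"
      using J unfolding ideal_def by (blast intro: subspace_scale)
    then show ?thesis using less.prems by simp
  next
    case False
    then obtain t where t: "t \<in> S" "t \<noteq> pzero m" using less.prems by auto
    then obtain s where s: "s \<in> pidx m" "psign hq m s t = - psign hq m t s"
      using less.prems psign_nondegenerate[of t m hq] by blast
    define x where "x = (\<Sum>t\<in>S. c t *\<^sub>R B 0 0 t)"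
    \<comment> \<open>Terms commuting with \<open>X_s\<close> are doubled, anticommuting ones
      vanish. The unit term survives with twice its coefficient, and at least \<open>t\<close>
      leaves the support.\<close>
    define c' where "c' = (\<lambda>t. c t * (1 + psign hq m s t * psign hq m t s))"
    have "x + psign hq m s s *\<^sub>R (B 0 0 s \<star> x \<star> B 0 0 s) \<in> J"
      using J less.prems s k_pos unfolding ideal_def x_def by (auto intro!: subspace_add subspace_scale)
    also have "x + psign hq m s s *\<^sub>R (B 0 0 s \<star> x \<star> B 0 0 s) =
        (\<Sum>t\<in>S. c t *\<^sub>R B 0 0 t + c t *\<^sub>R (psign hq m s s *\<^sub>R (B 0 0 s \<star> B 0 0 t \<star> B 0 0 s)))"
      unfolding x_def by (simp add: mult_sum_left mult_sum_right sum.distrib scaleR_sum_right mult.commute)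
    also have "\<dots> = (\<Sum>t\<in>S. c' t *\<^sub>R B 0 0 t)"
      using less.prems s by (intro sum.cong refl) (subst B_conj, auto simp: c'_def algebra_simps)
    also have "\<dots> = (\<Sum>t\<in>S - {t}. c' t *\<^sub>R B 0 0 t)"
      using less.prems t s(2) by (intro sum.mono_neutral_right) (auto simp: c'_def)
    finally have "(\<Sum>t\<in>S - {t}. c' t *\<^sub>R B 0 0 t) \<in> J" .
    moreover have "card (S - {t}) < card S" using less.prems t by (meson card_Diff1_less)
    ultimately show ?thesis
      using less.hyps[of "S - {t}" c'] less.prems t by (auto simp: c'_def)
  qed
qed

text \<open>Sandwiching between \<open>B 0 p\<close> and \<open>B q 0 s\<close> extracts the block
  (p, q) and shifts the index \<open>s\<close> to the unit, where \<open>ideal_unit\<close> applies.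
  The matrix units then generate everything from \<open>B 0 0 (pzero m)\<close>.\<close>

lemma ideal_all:
  assumes J: "ideal J" and x: "(\<Sum>l\<in>idx. c l *\<^sub>R b l) \<in> J" and pqs: "(p, q, s) \<in> idx" "c (p, q, s) \<noteq> 0"
  shows "R \<subseteq> J"
proof -
  let ?x = "\<Sum>l\<in>idx. c l *\<^sub>R b l"
  have pq: "p < k" "q < k" "s \<in> pidx m" using pqs unfolding idx_def by auto
  have JD: "B i j t \<star> y \<in> J" "y \<star> B i j t \<in> J" if "y \<in> J" "i < k" "j < k" "t \<in> pidx m" for y i j t
    using J that unfolding ideal_def by auto
  have "?x = (\<Sum>i<k. \<Sum>j<k. \<Sum>t\<in>pidx m. c (i, j, t) *\<^sub>R B i j t)"
    unfolding idx_def b_def by (simp add: sum.cartesian_product case_prod_unfold)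
  then have "B 0 p (pzero m) \<star> ?x \<star> B q 0 s = (\<Sum>i<k. \<Sum>j<k. \<Sum>t\<in>pidx m.
      c (i, j, t) *\<^sub>R (B 0 p (pzero m) \<star> B i j t \<star> B q 0 s))"
    by (simp add: mult_sum_left mult_sum_right)
  also have "\<dots> = (\<Sum>i<k. \<Sum>j<k. \<Sum>t\<in>pidx m.
      if i = p \<and> j = q then (c (p, q, t) * psign hq m t s) *\<^sub>R B 0 0 (padd m t s) else 0)"
    using pq k_pos by (intro sum.cong refl) (auto simp: B_mult)
  also have "\<dots> = (\<Sum>i<k. \<Sum>j<k. if j = q then (if i = p then
      (\<Sum>t\<in>pidx m. (c (p, q, t) * psign hq m t s) *\<^sub>R B 0 0 (padd m t s)) else 0) else 0)"
    by (intro sum.cong refl) auto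
  also have "\<dots> = (\<Sum>t\<in>pidx m. (c (p, q, t) * psign hq m t s) *\<^sub>R B 0 0 (padd m t s))"
    using pq by (subst sum.delta) simp_all
  \<comment> \<open>Adding \<open>s\<close> is an involution; after the substitution the coefficient
    \<open>c (p, q, s)\<close> stands at the unit.\<close>
  also have "\<dots> = (\<Sum>t\<in>pidx m. (c (p, q, padd m t s) * psign hq m (padd m t s) s) *\<^sub>R B 0 0 t)"
    using pq by (intro sum.reindex_bij_witness[of _ "\<lambda>t. padd m t s" "\<lambda>t. padd m t s"]) auto
  finally have "(\<Sum>t\<in>pidx m. (c (p, q, padd m t s) * psign hq m (padd m t s) s) *\<^sub>R B 0 0 t) \<in> J"
    using JD[of ?x 0 p "pzero m"] JD[of _ q 0 s] x pq k_pos by (metis pzero_in)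
  then have B0: "B 0 0 (pzero m) \<in> J"
    using pq pqs(2) by (intro ideal_unit[OF J finite_pidx, where c="\<lambda>t. c (p, q, padd m t s) * psign hq m (padd m t s) s"]) auto
  show ?thesis unfolding R_def
  proof (rule span_minimal)
    show "b ` idx \<subseteq> J"
    proof (safe)
      fix i j t assume "(i, j, t) \<in> idx"
      then have i: "i < k" "j < k" "t \<in> pidx m" unfolding idx_def by auto
      have "B i j t = B i 0 (pzero m) \<star> B 0 0 (pzero m) \<star> B 0 j t"
        using i k_pos by (simp add: B_mult)
      also have "\<dots> \<in> J" using i k_pos by (intro JD B0) auto
      finally show "b (i, j, t) \<in> J" by (simp add: b_def)
    qed
    show "subspace J" using J unfolding ideal_def by simp
  qed
qed

text \<open>Independence out of simplicity: {0} is an ideal, so by \<open>ideal_all\<close> a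
  nontrivial relation would force \<open>R\<close> to be zero, against \<open>B_nz\<close>.\<close>

lemma coeffs_zero:
  assumes "(\<Sum>l\<in>idx. c l *\<^sub>R b l) = 0" "l \<in> idx"
  shows "c l = 0"
proof (rule ccontr)
  assume "c l \<noteq> 0"
  moreover obtain p q s where "l = (p, q, s)" by (cases l)
  moreover have "ideal {0}" unfolding ideal_def by simp
  ultimately have "R \<subseteq> {0}" using ideal_all[of "{0}" c p q s] assms by auto
  then show False using B_in_R[of 0 0 "pzero m"] B_nz k_pos by (metis pzero_in singletonD subsetD)
qed

lemma b_inj: "inj_on b idx" and b_independent: "independent (b ` idx)"
  using family_independent[of idx b] coeffs_zero by auto

lemma card_b: "card (b ` idx) = k\<^sup>2 * 4 ^ m"
  by (simp add: card_image[OF b_inj] card_idx)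

lemma B_neq_0: "i < k \<Longrightarrow> j < k \<Longrightarrow> t \<in> pidx m \<Longrightarrow> B i j t \<noteq> 0"
  using b_independent dependent_zero[of "b ` idx"] unfolding b_def idx_def by force

lemma ideal_simple:
  assumes "ideal J" "x \<in> J" "x \<in> R" "x \<noteq> 0" shows "R \<subseteq> J"
proof -
  obtain c where c: "x = (\<Sum>l\<in>idx. c l *\<^sub>R b l)" using R_coeffs assms(3) by blast
  then obtain l where "l \<in> idx" "c l \<noteq> 0" using assms(4) by (metis (no_types, lifting) scaleR_zero_left sum.neutral)
  then show ?thesis using ideal_all[OF assms(1), of c] assms(2) c by (metis prod_cases3)
qed

lemma R_simple:
  assumes "subspace J" "\<And>x y. x \<in> J \<Longrightarrow> y \<in> R \<Longrightarrow> x \<star> y \<in> J" "\<And>x y. x \<in> J \<Longrightarrow> y \<in> R \<Longrightarrow> y \<star> x \<in> J"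
    and "x \<in> J" "x \<in> R" "x \<noteq> 0"
  shows "R \<subseteq> J"
  using assms by (intro ideal_simple[of J x]) (auto simp: ideal_def)

text \<open>Simple rings are prime: the \<open>w\<close> with \<open>x R w R = 0\<close> form a
  two-sided ideal. If it contained \<open>y\<close> it would contain \<open>u\<close>, and then
  \<open>x\<close> would be 0.\<close>

lemma R_prime:
  assumes "x \<in> R" "y \<in> R" "x \<noteq> 0" "y \<noteq> 0"
  obtains r where "r \<in> R" "x \<star> r \<star> y \<noteq> 0"
proof -
  have "\<exists>r\<in>R. x \<star> r \<star> y \<noteq> 0"
  proof (rule ccontr)
    assume "\<not> ?thesis"
    then have *: "x \<star> r \<star> y = 0" if "r \<in> R" for r using that by blast
    define J where "J = {w. \<forall>r\<in>R. \<forall>r'\<in>R. x \<star> (r \<star> w \<star> r') = 0}"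
    have "R \<subseteq> J"
    proof (rule R_simple)
      show "subspace J" unfolding subspace_def J_def by (auto simp: distribs)
      show "y \<in> J" using * unfolding J_def by (auto simp: mult_assoc[symmetric])
      fix w v assume w: "w \<in> J" "v \<in> R"
      show "w \<star> v \<in> J" unfolding J_def
      proof (safe)
        fix r r' assume r: "r \<in> R" "r' \<in> R"
        have "r \<star> (w \<star> v) \<star> r' = r \<star> w \<star> (v \<star> r')" by (simp add: mult_assoc)
        then show "x \<star> (r \<star> (w \<star> v) \<star> r') = 0" using w r R_mult unfolding J_def by auto
      qed
      show "v \<star> w \<in> J" unfolding J_def
      proof (safe)
        fix r r' assume r: "r \<in> R" "r' \<in> R"
        have "r \<star> (v \<star> w) \<star> r' = (r \<star> v) \<star> w \<star> r'" by (simp add: mult_assoc)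
        then show "x \<star> (r \<star> (v \<star> w) \<star> r') = 0" using w r R_mult unfolding J_def by auto
      qed
    qed (use assms in auto)
    then have "u \<in> J" by auto
    then have "x \<star> (u \<star> u \<star> u) = 0" using u_in_R unfolding J_def by blast
    then show False using assms by simp
  qed
  then show thesis using that by blast
qed

lemma u_nz: "u \<noteq> 0"
  using u_left[of "B 0 0 (pzero m)"] B_nz k_pos by (metis B_in_R mult_zero_left pzero_in)

end

section \<open>The trace form, the derived algebra and the centre\<close>

context type_I
begin

text \<open>The coefficient of the unit, summed over the diagonal: up to a factor the reduced trace,
  scaled so that \<open>tr u = k\<close>. The choice picks some linear extension to the whole type;
  only the values on \<open>R\<close> are meaningful.\<close>

definition tr :: "'a \<Rightarrow> real" where
  "tr = (SOME f. linear f \<and> (\<forall>i<k. \<forall>j<k. \<forall>t\<in>pidx m. f (B i j t) = of_bool (i = j \<and> t = pzero m)))"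

lemma tr_ex: "\<exists>f :: 'a \<Rightarrow> real. linear f \<and> (\<forall>i<k. \<forall>j<k. \<forall>t\<in>pidx m. f (B i j t) = of_bool (i = j \<and> t = pzero m))"
proof -
  define f0 :: "nat \<times> nat \<times> (nat \<Rightarrow> int) \<Rightarrow> real" where "f0 = (\<lambda>(i, j, t). of_bool (i = j \<and> t = pzero m))"
  obtain f where f: "linear f" "\<forall>x\<in>b ` idx. f x = f0 (inv_into idx b x)"
    using real_vector.linear_independent_extend[OF b_independent, where f = "\<lambda>x. f0 (inv_into idx b x)"]
    unfolding linear_def by auto
  have "f (B i j t) = of_bool (i = j \<and> t = pzero m)" if "i < k" "j < k" "t \<in> pidx m" for i j t
  proof -
    have "(i, j, t) \<in> idx" using that unfolding idx_def by auto
    then have "f (b (i, j, t)) = f0 (i, j, t)" using f(2) b_inj by (simp add: inv_into_f_f)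
    then show ?thesis by (simp add: b_def f0_def)
  qed
  then show ?thesis using f(1) by (intro exI[of _ f]) auto
qed

lemma linear_tr: "linear tr"
  using someI_ex[OF tr_ex] unfolding tr_def by blast

lemma tr_B [simp]: "i < k \<Longrightarrow> j < k \<Longrightarrow> t \<in> pidx m \<Longrightarrow> tr (B i j t) = of_bool (i = j \<and> t = pzero m)"
  using someI_ex[OF tr_ex] unfolding tr_def by blast

lemma tr_simps [simp]: "tr 0 = 0" "tr (x + y) = tr x + tr y" "tr (c *\<^sub>R x) = c * tr x"
  "tr (x - y) = tr x - tr y" "tr (- x) = - tr x"
  using linear_tr by (simp_all add: linear_0 linear_add linear_cmul linear_diff linear_neg)

lemma tr_u [simp]: "tr u = k"
  unfolding u_def by (simp add: linear_sum[OF linear_tr])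

lemma tr_commute:
  assumes "x \<in> R" "y \<in> R" shows "tr (x \<star> y) = tr (y \<star> x)"
proof -
  \<comment> \<open>\<open>X_s X_t\<close> has a unit part only for s = t, and then both orders
    agree.\<close>
  have sg: "psign hq m s t * of_bool (padd m s t = pzero m) = psign hq m t s * of_bool (padd m t s = pzero m)"
    if "s \<in> pidx m" "t \<in> pidx m" for s t using that by auto
  have *: "tr (B i j s \<star> y) = tr (y \<star> B i j s)" if "i < k" "j < k" "s \<in> pidx m" for i j s
    using assms(2) unfolding R_def
  proof (rule linear_eqI_span[rotated -1])
    show "linear (\<lambda>y. tr (B i j s \<star> y))" "linear (\<lambda>y. tr (y \<star> B i j s))"
      by (auto intro!: linearI simp: distribs)
    fix c assume "c \<in> b ` idx"
    then obtain p q t where "p < k" "q < k" "t \<in> pidx m" "c = B p q t" by (auto simp: idx_def b_def)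
    then show "tr (B i j s \<star> c) = tr (c \<star> B i j s)"
      using that sg[of s t] by (auto simp: B_mult)
  qed
  show ?thesis using assms(1) unfolding R_def
  proof (rule linear_eqI_span[rotated -1])
    show "linear (\<lambda>x. tr (x \<star> y))" "linear (\<lambda>x. tr (y \<star> x))"
      by (auto intro!: linearI simp: distribs)
  qed (use * in \<open>auto simp: idx_def b_def\<close>)
qed

definition L :: "'a set" where "L = span {br x y | x y. x \<in> R \<and> y \<in> R}"

lemma subspace_L [simp]: "subspace L" unfolding L_def by simp

lemma br_in_L [intro]: "x \<in> R \<Longrightarrow> y \<in> R \<Longrightarrow> br x y \<in> L"
  unfolding L_def by (rule span_base) auto

lemma L_subset: "L \<subseteq> R"
  unfolding L_def by (rule span_minimal) (auto simp: br_def intro!: subspace_diff)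

lemma L_R [simp]: "x \<in> L \<Longrightarrow> x \<in> R" using L_subset by auto

lemma tr_L [simp]: assumes "x \<in> L" shows "tr x = 0"
proof -
  have "tr x = (\<lambda>_. 0) x"
    using assms unfolding L_def
    by (rule linear_eqI_span[OF linear_tr, rotated -1]) (auto simp: br_def tr_commute intro!: linearI)
  then show ?thesis by simp
qed

lemma B_offdiag_L [simp]: assumes "i < k" "j < k" "t \<in> pidx m" "i \<noteq> j" shows "B i j t \<in> L"
proof -
  have "br (B i i (pzero m)) (B i j t) = B i j t" using assms by (simp add: br_def B_mult)
  then show ?thesis using br_in_L[of "B i i (pzero m)" "B i j t"] assms by auto
qed

text \<open>If \<open>X_s\<close> anticommutes with \<open>X_t\<close>, the commutator of
  \<open>X_s\<close> and \<open>X_s X_t\<close> is \<open>2 X_s^2 X_t\<close>, a nonzero multiple of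
  \<open>X_t\<close>.\<close>

lemma B_diag_L [simp]: assumes "i < k" "t \<in> pidx m" "t \<noteq> pzero m" shows "B i i t \<in> L"
proof -
  obtain s where s: "s \<in> pidx m" "psign hq m s t = - psign hq m t s" using psign_nondegenerate assms by blast
  have "B i i s \<star> (B i i s \<star> B i i t) = psign hq m s s *\<^sub>R B i i t"
  proof -
    have "B i i s \<star> B i i s = psign hq m s s *\<^sub>R B i i (pzero m)" "B i i (pzero m) \<star> B i i t = B i i t"
      using assms s by (simp_all add: B_mult)
    then show ?thesis by (metis mult_assoc mult_scaleR_left)
  qed
  moreover have "B i i s \<star> B i i t = - (B i i t \<star> B i i s)"
    using assms s by (simp add: B_mult padd_commute)
  then have "(B i i s \<star> B i i t) \<star> B i i s = - (B i i t \<star> (B i i s \<star> B i i s))"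
    by (simp add: mult_assoc)
  then have "(B i i s \<star> B i i t) \<star> B i i s = - (psign hq m s s *\<^sub>R B i i t)"
  proof -
    have "B i i s \<star> B i i s = psign hq m s s *\<^sub>R B i i (pzero m)" "B i i t \<star> B i i (pzero m) = B i i t"
      using assms s by (simp_all add: B_mult)
    then show ?thesis using \<open>(B i i s \<star> B i i t) \<star> B i i s = - (B i i t \<star> (B i i s \<star> B i i s))\<close> by simp
  qed
  ultimately have "br (B i i s) (B i i s \<star> B i i t) = (2 * psign hq m s s) *\<^sub>R B i i t"
    by (simp add: br_def scaleR_add_left[symmetric])
  then have "(2 * psign hq m s s) *\<^sub>R B i i t \<in> L"
    using br_in_L[of "B i i s" "B i i s \<star> B i i t"] assms s R_mult by auto
  then have "(1 / (2 * psign hq m s s)) *\<^sub>R ((2 * psign hq m s s) *\<^sub>R B i i t) \<in> L"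
    by (rule subspace_scale[OF subspace_L])
  then show ?thesis by simp
qed

lemma B_diff_L [simp]: assumes "i < k" "j < k" shows "B i i (pzero m) - B j j (pzero m) \<in> L"
proof -
  have "br (B i j (pzero m)) (B j i (pzero m)) = B i i (pzero m) - B j j (pzero m)" if "i \<noteq> j"
    using assms that by (simp add: br_def B_mult)
  then show ?thesis using br_in_L[of "B i j (pzero m)" "B j i (pzero m)"] assms subspace_0[OF subspace_L]
    by (cases "i = j") auto
qed

text \<open>Gives R as the sum of \<open>L\<close> and the multiples of \<open>u\<close>, with an
  explicit scalar part; \<open>tr u = k\<close> makes the remainder traceless. This is how elements
  of \<open>R\<close> are moved into the Lie algebra throughout.\<close>

lemma traceless_in_L: assumes "x \<in> R" shows "x - (tr x / k) *\<^sub>R u \<in> L"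
proof -
  have "x - (tr x / k) *\<^sub>R u \<in> L"
    using assms unfolding R_def
  proof (rule span_induct[where P = "\<lambda>x. x - (tr x / k) *\<^sub>R u \<in> L"])
    show "subspace {x. x - (tr x / k) *\<^sub>R u \<in> L}"
      unfolding subspace_def
    proof (intro conjI ballI allI)
      fix x y assume "x \<in> {x. x - (tr x / k) *\<^sub>R u \<in> L}" "y \<in> {x. x - (tr x / k) *\<^sub>R u \<in> L}"
      then have "(x - (tr x / k) *\<^sub>R u) + (y - (tr y / k) *\<^sub>R u) \<in> L" by (auto intro: subspace_add)
      then show "x + y \<in> {x. x - (tr x / k) *\<^sub>R u \<in> L}" by (simp add: algebra_simps add_divide_distrib)
    next
      fix c x assume "x \<in> {x. x - (tr x / k) *\<^sub>R u \<in> L}"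
      then have "c *\<^sub>R (x - (tr x / k) *\<^sub>R u) \<in> L" by (auto intro: subspace_scale)
      then show "c *\<^sub>R x \<in> {x. x - (tr x / k) *\<^sub>R u \<in> L}" by (simp add: algebra_simps)
    qed (auto intro: subspace_0)
    fix x assume "x \<in> b ` idx"
    then obtain i j t where x: "i < k" "j < k" "t \<in> pidx m" "x = B i j t" by (auto simp: idx_def b_def)
    show "x - (tr x / k) *\<^sub>R u \<in> L"
    proof (cases "i = j \<and> t = pzero m")
      case True
      \<comment> \<open>\<open>E_ii - u / k\<close> is the average over p of the differences
        \<open>E_ii - E_pp\<close>.\<close>
      have "x - (tr x / k) *\<^sub>R u = (\<Sum>p<k. (1 / k) *\<^sub>R (B i i (pzero m) - B p p (pzero m)))"
        using x True k_pos unfolding u_def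
        by (simp add: scaleR_sum_right[symmetric] sum_subtractf scaleR_diff_right)
           (simp add: scaleR_sum_right sum_constant_scaleR)
      then show ?thesis using x by (auto intro!: subspace_sum subspace_scale)
    next
      case False
      then show ?thesis using x by (cases "i = j") auto
    qed
  qed
  then show ?thesis by simp
qed

lemma L_iff: "x \<in> L \<longleftrightarrow> x \<in> R \<and> tr x = 0"
  using traceless_in_L[of x] k_pos by (metis L_R div_0 diff_zero scaleR_zero_left tr_L)

text \<open>The radical of the trace form is a two-sided ideal, and it does not contain
  \<open>u\<close> because \<open>tr (u \<star> u) = k\<close> is nonzero.\<close>

lemma tr_nondegenerate:
  assumes "x \<in> R" "\<And>y. y \<in> R \<Longrightarrow> tr (x \<star> y) = 0" shows "x = 0"
proof (rule ccontr)
  assume x: "x \<noteq> 0"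
  define J where "J = {w \<in> R. \<forall>y\<in>R. tr (w \<star> y) = 0}"
  have "R \<subseteq> J"
  proof (rule R_simple)
    show "subspace J" unfolding subspace_def J_def
      using subspace_R unfolding subspace_def by (auto simp: distribs)
    show "x \<in> J" using assms unfolding J_def by auto
    fix w v assume w: "w \<in> J" "v \<in> R"
    show "w \<star> v \<in> J" using w R_mult unfolding J_def by (auto simp: mult_assoc)
    show "v \<star> w \<in> J" unfolding J_def
    proof (safe)
      show "v \<star> w \<in> R" using w R_mult unfolding J_def by auto
      fix y assume "y \<in> R"
      then show "tr (v \<star> w \<star> y) = 0" using w R_mult tr_commute[of v "w \<star> y"] unfolding J_def
        by (auto simp: mult_assoc)
    qed
  qed (use assms x in auto)
  then have "tr (u \<star> u) = 0" using u_in_R unfolding J_def by blast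
  then show False using k_pos by simp
qed

text \<open>Subtract the scalar part. The remaining central traceless \<open>l\<close> is orthogonal
  to all commutators, as the trace of \<open>l (v v' - v' v)\<close> vanishes for central
  \<open>l\<close>, and it is orthogonal to \<open>u\<close>; so it lies in the radical of the trace
  form.\<close>

lemma center:
  assumes "x \<in> R" "\<And>y. y \<in> R \<Longrightarrow> x \<star> y = y \<star> x"
  shows "x = (tr x / k) *\<^sub>R u"
proof -
  define l where "l = x - (tr x / k) *\<^sub>R u"
  have l: "l \<in> R" "tr l = 0" using traceless_in_L[OF assms(1)] unfolding l_def[symmetric] by (rule L_R, rule tr_L)
  have c: "l \<star> y = y \<star> l" if "y \<in> R" for y using that assms unfolding l_def by (simp add: distribs)
  have "l = 0"
  proof (rule tr_nondegenerate[OF l(1)])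
    fix y assume y: "y \<in> R"
    have 0: "tr (l \<star> w) = 0" if "w \<in> L" for w
    proof -
      have "tr (l \<star> w) = (\<lambda>_. 0) w"
        using that unfolding L_def
      proof (rule linear_eqI_span[rotated -1])
        show "linear (\<lambda>w. tr (l \<star> w))" by (auto intro!: linearI simp: distribs)
        fix w assume "w \<in> {br x y |x y. x \<in> R \<and> y \<in> R}"
        then obtain v v' where w: "w = br v v'" "v \<in> R" "v' \<in> R" by auto
        have "tr (l \<star> (v \<star> v')) = tr (l \<star> (v' \<star> v))"
          using w l R_mult c[of v'] tr_commute[of "l \<star> v" v'] by (metis mult_assoc)
        then show "tr (l \<star> w) = 0" by (simp add: w br_def distribs)
      qed (auto intro!: linearI)
      then show ?thesis by simp
    qed
    have "l \<star> y = l \<star> (y - (tr y / k) *\<^sub>R u) + (tr y / k) *\<^sub>R l"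
      using l by (simp add: distribs)
    then show "tr (l \<star> y) = 0" using 0[OF traceless_in_L[OF y]] l(2) by simp
  qed
  then show ?thesis unfolding l_def by simp
qed

end

section \<open>Matrix algebras over the reals and the quaternions as instances\<close>

lemma quat_Reals_commute: "x \<in> \<real> \<Longrightarrow> x * y = y * (x::quat)"
  unfolding Reals_def of_real_def by auto

text \<open>Summation over k < n makes the product associative and bilinear on the whole function
  type, so the algebra laws carry no membership conditions; a unit exists only on subspaces such as
  \<open>gl\<close>.\<close>

interpretation mat: ralg "mat_mult n" for n
proof
  fix A B C :: qmat
  show "mat_mult n (mat_mult n A B) C = mat_mult n A (mat_mult n B C)"
    unfolding mat_mult_def sum_distrib_left sum_distrib_right
    by (intro ext, subst sum.swap, simp add: mult.assoc)
qed (auto simp: mat_mult_def fun_eq_iff plus_fun_def scaleR_fun_def distrib_left distrib_right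
  sum.distrib scaleR_sum_right)

lemma mat_bracket_eq: "mat_bracket n = mat.br n"
  by (intro ext) (simp add: mat_bracket_def mat.br_def)

lemma sum_div_mod:
  fixes f :: "nat \<Rightarrow> nat \<Rightarrow> 'b::comm_monoid_add"
  assumes "0 < p"
  shows "(\<Sum>c<k * p. f (c div p) (c mod p)) = (\<Sum>a<k. \<Sum>d<p. f a d)"
proof -
  have "(\<Sum>c<k * p. f (c div p) (c mod p)) = (\<Sum>(a, d)\<in>{..<k} \<times> {..<p}. f a d)"
  proof (rule sum.reindex_bij_witness[of _ "\<lambda>(a, d). a * p + d" "\<lambda>c. (c div p, c mod p)"])
    fix c assume "c \<in> {..<k * p}"
    then show "(c div p, c mod p) \<in> {..<k} \<times> {..<p}"
      using assms by (simp add: less_mult_imp_div_less)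
  next
    fix x assume "x \<in> {..<k} \<times> {..<p}"
    then obtain a d where x: "x = (a, d)" "a < k" "d < p" by auto
    then have "a * p + d < Suc a * p" by simp
    also have "\<dots> \<le> k * p" using x by (intro mult_right_mono) auto
    finally show "(case x of (a, d) \<Rightarrow> a * p + d) \<in> {..<k * p}" using x by simp
  qed (use assms in auto)
  then show ?thesis by (simp add: sum.cartesian_product)
qed

text \<open>The mixed-product rule moves entries of \<open>B\<close> past entries of
  \<open>A'\<close>. Over the quaternions this requires \<open>comm\<close>, which holds in the
  applications because \<open>A'\<close> has real entries.\<close>

lemma kron_mult:
  assumes p: "0 < p" and comm: "\<And>a b c d. B a b * A' c d = A' c d * (B a b :: quat)"
  shows "mat_mult (k * p) (kron p A B) (kron p A' B') = kron p (mat_mult k A A') (mat_mult p B B')"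
proof (intro ext)
  fix i j
  have "mat_mult (k * p) (kron p A B) (kron p A' B') i j =
    (\<Sum>c<k * p. (\<lambda>a d. (A (i div p) a * A' a (j div p)) * (B (i mod p) d * B' d (j mod p))) (c div p) (c mod p))"
    unfolding mat_mult_def kron_def
    by (intro sum.cong refl) (metis comm mult.assoc)
  also have "\<dots> = (\<Sum>a<k. \<Sum>d<p. (A (i div p) a * A' a (j div p)) * (B (i mod p) d * B' d (j mod p)))"
    by (rule sum_div_mod[OF p])
  also have "\<dots> = kron p (mat_mult k A A') (mat_mult p B B') i j"
    unfolding mat_mult_def kron_def by (simp add: sum_product) 
  finally show "mat_mult (k * p) (kron p A B) (kron p A' B') i j = kron p (mat_mult k A A') (mat_mult p B B') i j" .
qed

lemma kron_scaleR: "kron p (c *\<^sub>R A) B = c *\<^sub>R kron p A B"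
  "kron p A (d *\<^sub>R B) = d *\<^sub>R kron p A B" "kron p 0 B = 0"
  by (auto simp: kron_def fun_eq_iff scaleR_fun_def)

definition pauli2 :: "int \<Rightarrow> int \<Rightarrow> qmat" where
  "pauli2 a b = mat_mult 2 (mat_power 2 pauli_X (nat a)) (mat_power 2 pauli_Y (nat b))"

lemma pauli2_eq:
  "pauli2 0 0 = (\<lambda>i j. if i < 2 \<and> j = i then 1 else 0)"
  "pauli2 1 0 = (\<lambda>i j. if i < 2 \<and> j = i then (if i = 0 then -1 else 1) else 0)"
  "pauli2 0 1 = (\<lambda>i j. if i < 2 \<and> j = 1 - i then 1 else 0)"
  "pauli2 1 1 = (\<lambda>i j. if i < 2 \<and> j = 1 - i then (if i = 0 then -1 else 1) else 0)"
  by (auto simp: pauli2_def fun_eq_iff mat_power_def mat_mult_def mat_one_def pauli_X_def pauli_Y_def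
      mat_unit_def numeral_2_eq_2 less_Suc_eq)

lemma pauli2_mult:
  assumes "a \<in> {0, 1}" "b \<in> {0, 1}" "c \<in> {0, 1}" "d \<in> {0, 1}"
  shows "mat_mult 2 (pauli2 a b) (pauli2 c d) =
    pair_sign False a b c d *\<^sub>R pauli2 ((a + c) mod 2) ((b + d) mod 2)"
  using assms
  by (auto simp: pauli2_eq pair_sign_def mat_mult_def fun_eq_iff scaleR_fun_def numeral_2_eq_2 less_Suc_eq)

lemma psign_Suc:
  "psign h (Suc s) t t' = psign False s t t' *
     pair_sign h (t (2 * s)) (t (2 * s + 1)) (t' (2 * s)) (t' (2 * s + 1))"
  unfolding psign_def by simp

lemma real_basis_cong: "(\<And>i. i < 2 * s \<Longrightarrow> t i = t' i) \<Longrightarrow> real_basis s t = real_basis s t'"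
  by (induction s) auto

lemma real_basis_Reals: "real_basis s t i j \<in> \<real>"
proof (induction s arbitrary: i j)
  case 0
  then show ?case by (simp add: mat_one_def)
next
  case (Suc s)
  have X: "pauli_X i j \<in> \<real>" "pauli_Y i j \<in> \<real>" for i j by (auto simp: pauli_X_def pauli_Y_def mat_unit_def)
  have P: "mat_power 2 A e i j \<in> \<real>" if "\<And>i j. A i j \<in> \<real>" for A e i j
    using that unfolding mat_power_def
    by (induction e arbitrary: i j) (auto simp: mat_one_def mat_mult_def intro!: sum_in_Reals)
  show ?case using Suc P[of pauli_X] P[of pauli_Y] X
    by (auto simp: kron_def mat_mult_def intro!: Reals_mult sum_in_Reals)
qed

lemma real_basis_Suc: "real_basis (Suc s) t = kron 2 (real_basis s t) (pauli2 (t (2 * s)) (t (2 * s + 1)))"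
  by (simp add: pauli2_def)

lemma real_basis_mult:
  assumes "\<And>i. i < 2 * s \<Longrightarrow> t i \<in> {0, 1}" "\<And>i. i < 2 * s \<Longrightarrow> t' i \<in> {0, 1}"
  shows "mat_mult (2 ^ s) (real_basis s t) (real_basis s t') =
    psign False s t t' *\<^sub>R real_basis s (\<lambda>i. (t i + t' i) mod 2)"
  using assms
proof (induction s)
  case 0
  show ?case by (auto simp: mat_mult_def mat_one_def psign_def fun_eq_iff scaleR_fun_def)
next
  case (Suc s)
  have "mat_mult (2 ^ s * 2) (real_basis (Suc s) t) (real_basis (Suc s) t') =
    kron 2 (mat_mult (2 ^ s) (real_basis s t) (real_basis s t'))
      (mat_mult 2 (pauli2 (t (2 * s)) (t (2 * s + 1))) (pauli2 (t' (2 * s)) (t' (2 * s + 1))))"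
    unfolding real_basis_Suc by (intro kron_mult) (auto simp: quat_Reals_commute[OF real_basis_Reals])
  also have "\<dots> = kron 2 (psign False s t t' *\<^sub>R real_basis s (\<lambda>i. (t i + t' i) mod 2))
     (pair_sign False (t (2 * s)) (t (2 * s + 1)) (t' (2 * s)) (t' (2 * s + 1)) *\<^sub>R
      pauli2 ((t (2 * s) + t' (2 * s)) mod 2) ((t (2 * s + 1) + t' (2 * s + 1)) mod 2))"
    using Suc by (subst pauli2_mult) auto
  finally show ?case unfolding kron_scaleR real_basis_Suc psign_Suc by (simp add: mult.commute)
qed

lemma quat_basis_mult:
  assumes "a \<in> {0, 1}" "b \<in> {0, 1}" "c \<in> {0, 1}" "d \<in> {0, 1::int}"
  shows "mat_mult 1 (scalar_mat (quat_i ^ nat a * quat_j ^ nat b)) (scalar_mat (quat_i ^ nat c * quat_j ^ nat d)) =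
    pair_sign True a b c d *\<^sub>R scalar_mat (quat_i ^ nat ((a + c) mod 2) * quat_j ^ nat ((b + d) mod 2))"
  using assms
  by (auto simp: scalar_mat_def mat_mult_def fun_eq_iff scaleR_fun_def pair_sign_def quat_defs quat_i_def quat_j_def)

abbreviation is_quat :: "division_alg \<Rightarrow> bool" where "is_quat \<Delta> \<equiv> \<Delta> = Quaternions_alg"

lemma D_size_pos [simp]: "0 < D_size \<Delta> m" by (cases \<Delta>) auto

lemma D_basis_mult:
  assumes "is_quat \<Delta> \<Longrightarrow> 0 < m" "t \<in> pidx m" "t' \<in> pidx m"
  shows "mat_mult (D_size \<Delta> m) (D_basis \<Delta> m t) (D_basis \<Delta> m t') =
    psign (is_quat \<Delta>) m t t' *\<^sub>R D_basis \<Delta> m (padd m t t')"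
proof (cases \<Delta>)
  case Reals_alg
  have "real_basis m (padd m t t') = real_basis m (\<lambda>i. (t i + t' i) mod 2)"
    by (rule real_basis_cong) (auto simp: padd_def)
  then show ?thesis using Reals_alg assms real_basis_mult[of m t t'] pidx_cases by (auto simp: insert_iff)
next
  case Quaternions_alg
  then obtain s where m: "m = Suc s" using assms(1) by (cases m) auto
  have v: "t i \<in> {0, 1}" "t' i \<in> {0, 1}" if "i < 2 * m" for i using that pidx_cases assms by auto
  have "mat_mult (2 ^ s * 1) (D_basis \<Delta> m t) (D_basis \<Delta> m t') =
    kron 1 (mat_mult (2 ^ s) (real_basis s t) (real_basis s t'))
     (mat_mult 1 (scalar_mat (quat_i ^ nat (t (2 * s)) * quat_j ^ nat (t (2 * s + 1))))
       (scalar_mat (quat_i ^ nat (t' (2 * s)) * quat_j ^ nat (t' (2 * s + 1)))))"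
    unfolding Quaternions_alg m by (simp, intro kron_mult[where p = 1, simplified]) (auto simp: quat_Reals_commute[OF real_basis_Reals])
  also have "\<dots> = kron 1 (psign False s t t' *\<^sub>R real_basis s (\<lambda>i. (t i + t' i) mod 2))
     (pair_sign True (t (2 * s)) (t (2 * s + 1)) (t' (2 * s)) (t' (2 * s + 1)) *\<^sub>R
      scalar_mat (quat_i ^ nat ((t (2 * s) + t' (2 * s)) mod 2) * quat_j ^ nat ((t (2 * s + 1) + t' (2 * s + 1)) mod 2)))"
    using v m by (subst quat_basis_mult; (subst real_basis_mult)?) auto
  also have "real_basis s (\<lambda>i. (t i + t' i) mod 2) = real_basis s (padd m t t')"
    by (rule real_basis_cong) (auto simp: padd_def m)
  finally show ?thesis unfolding kron_scaleR using m Quaternions_alg by (simp add: psign_Suc padd_def)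
qed

lemma real_basis_origin: "real_basis s (pzero m) 0 0 = 1" if "s \<le> m"
  using that
proof (induction s)
  case (Suc s)
  have "pauli2 (pzero m (2 * s)) (pzero m (2 * s + 1)) 0 0 = 1"
    using Suc.prems by (simp add: pzero_def pauli2_eq)
  then show ?case using Suc unfolding real_basis_Suc by (simp add: kron_def)
qed (simp add: mat_one_def)

lemma D_basis_origin: "D_basis \<Delta> m (pzero m) 0 0 = 1" if "is_quat \<Delta> \<Longrightarrow> 0 < m"
proof (cases \<Delta>)
  case Quaternions_alg
  then show ?thesis using that real_basis_origin[of "m - 1" m] by (auto simp: kron_def scalar_mat_def pzero_def)
qed (simp add: real_basis_origin)

definition gl_basis :: "division_alg \<Rightarrow> nat \<Rightarrow> nat \<Rightarrow> nat \<Rightarrow> (nat \<Rightarrow> int) \<Rightarrow> qmat" where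
  "gl_basis \<Delta> m i j t = kron (D_size \<Delta> m) (mat_unit i j) (D_basis \<Delta> m t)"

lemma type_I_gl:
  assumes "is_quat \<Delta> \<Longrightarrow> 0 < m" "0 < k"
  shows "type_I (mat_mult (k * D_size \<Delta> m)) (is_quat \<Delta>) k m (gl_basis \<Delta> m)"
proof
  fix i j p q s t assume *: "i < k" "j < k" "p < k" "q < k" "s \<in> pidx m" "t \<in> pidx m"
  have "mat_mult (k * D_size \<Delta> m) (gl_basis \<Delta> m i j s) (gl_basis \<Delta> m p q t) =
    kron (D_size \<Delta> m) (mat_mult k (mat_unit i j) (mat_unit p q)) (mat_mult (D_size \<Delta> m) (D_basis \<Delta> m s) (D_basis \<Delta> m t))"
    unfolding gl_basis_def by (intro kron_mult) (auto simp: mat_unit_def)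
  also have "mat_mult k (mat_unit i j) (mat_unit p q) = (if j = p then mat_unit i q else 0)"
  proof (intro ext)
    fix a c
    have "mat_mult k (mat_unit i j) (mat_unit p q) a c =
      (\<Sum>l<k. if l = j then (if a = i \<and> j = p \<and> c = q then 1 else 0) else 0)"
      unfolding mat_mult_def mat_unit_def by (intro sum.cong) auto
    then show "mat_mult k (mat_unit i j) (mat_unit p q) a c = (if j = p then mat_unit i q else 0) a c"
      using * by (simp add: mat_unit_def)
  qed
  finally show "mat_mult (k * D_size \<Delta> m) (gl_basis \<Delta> m i j s) (gl_basis \<Delta> m p q t) =
       (if j = p then psign (is_quat \<Delta>) m s t *\<^sub>R gl_basis \<Delta> m i q (padd m s t) else 0)"
    using D_basis_mult[of \<Delta> m s t] assms * by (auto simp: gl_basis_def kron_scaleR)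
next
  have "gl_basis \<Delta> m 0 0 (pzero m) 0 0 = 1"
    using D_basis_origin assms by (simp add: gl_basis_def kron_def mat_unit_def)
  then show "gl_basis \<Delta> m 0 0 (pzero m) \<noteq> 0" by auto
qed (use assms in auto)

lemma sum_fun_apply: "(\<Sum>i\<in>I. f i) x = (\<Sum>i\<in>I. f i x)"
  by (induction I rule: infinite_finite_induct) (auto simp: plus_fun_def zero_fun_def)

lemma gl_entries:
  assumes "A \<in> gl \<Delta> n"
  shows "A i j \<in> entries \<Delta>" "\<not> (i < n \<and> j < n) \<Longrightarrow> A i j = 0"
  using assms unfolding gl_def by auto

lemma subspace_gl [simp]: "subspace (gl \<Delta> n)"
  by (cases \<Delta>) (auto simp: gl_def subspace_def scaleR_fun_def scaleR_conv_of_real)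

lemma gl_basis_in_gl:
  assumes "is_quat \<Delta> \<Longrightarrow> 0 < m" "i < k" "j < k" "t \<in> pidx m"
  shows "gl_basis \<Delta> m i j t \<in> gl \<Delta> (k * D_size \<Delta> m)"
proof -
  have "gl_basis \<Delta> m i j t a c = 0" if "\<not> (a < k * D_size \<Delta> m \<and> c < k * D_size \<Delta> m)" for a c
  proof -
    have "\<not> (a div D_size \<Delta> m < k \<and> c div D_size \<Delta> m < k)"
      using that by (simp add: div_less_iff_less_mult)
    then show ?thesis using assms by (auto simp: gl_basis_def kron_def mat_unit_def)
  qed
  moreover have "gl_basis \<Delta> m i j t a c \<in> entries \<Delta>" for a c
    by (cases \<Delta>) (auto simp: gl_basis_def kron_def mat_unit_def real_basis_Reals)
  ultimately show ?thesis unfolding gl_def by blast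
qed

text \<open>The least admissible m for each \<Delta>, where D is \<Delta> itself and has size 1. It
  supplies the standard basis of \<open>gl\<close>, hence its real dimension, and a first
  \<open>type_I\<close> structure on the given algebra.\<close>

definition m0 :: "division_alg \<Rightarrow> nat" where "m0 \<Delta> = (if is_quat \<Delta> then 1 else 0)"

lemma D_size_m0 [simp]: "D_size \<Delta> (m0 \<Delta>) = 1" by (cases \<Delta>) (auto simp: m0_def)

definition two_idx :: "int \<Rightarrow> int \<Rightarrow> nat \<Rightarrow> int" where
  "two_idx a b = (\<lambda>i\<in>{..<2}. if i = 0 then a else b)"

lemma gl_subset_m0:
  assumes "0 < n"
  shows "gl \<Delta> n \<subseteq> type_I.R n (m0 \<Delta>) (gl_basis \<Delta> (m0 \<Delta>))"
proof
  fix A assume A: "A \<in> gl \<Delta> n"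
  interpret type_I "mat_mult (n * D_size \<Delta> (m0 \<Delta>))" "is_quat \<Delta>" n "m0 \<Delta>" "gl_basis \<Delta> (m0 \<Delta>)"
    using assms by (intro type_I_gl) (auto simp: m0_def)
  show "A \<in> R"
  proof (cases \<Delta>)
    case Reals_alg
    have "A = (\<Sum>i<n. \<Sum>j<n. qre (A i j) *\<^sub>R gl_basis \<Delta> (m0 \<Delta>) i j (pzero (m0 \<Delta>)))"
    proof (intro ext)
      fix a c
      have "of_real (qre q) = q" if "q \<in> \<real>" for q :: quat
        using that by (auto simp: Reals_def of_real_def quat_defs)
      then have 1: "qre (A a c) *\<^sub>R 1 = A a c" using gl_entries(1)[OF A, of a c] Reals_alg by (simp add: of_real_def)
      have "(\<Sum>i<n. \<Sum>j<n. qre (A i j) *\<^sub>R gl_basis \<Delta> (m0 \<Delta>) i j (pzero (m0 \<Delta>))) a c =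
        (\<Sum>i<n. \<Sum>j<n. qre (A i j) *\<^sub>R (if i = a \<and> j = c then 1 else 0))"
        by (simp add: sum_fun_apply scaleR_fun_def)
           (intro sum.cong refl, auto simp: Reals_alg gl_basis_def kron_def mat_unit_def m0_def mat_one_def)
      also have "\<dots> = (\<Sum>i<n. \<Sum>j<n. if j = c then (if i = a then qre (A a c) *\<^sub>R 1 else 0) else 0)"
        by (intro sum.cong refl) auto
      also have "\<dots> = (if a < n \<and> c < n then A a c else 0)" using 1 by (cases "c < n") simp_all
      also have "\<dots> = A a c" using gl_entries(2)[OF A] by auto
      finally show "A a c = (\<Sum>i<n. \<Sum>j<n. qre (A i j) *\<^sub>R gl_basis \<Delta> (m0 \<Delta>) i j (pzero (m0 \<Delta>))) a c" ..
    qed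
    then show ?thesis
      by (metis (no_types, lifting) B_in_R lessThan_iff pzero_in subspace_R subspace_scale subspace_sum)
  next
    case Quaternions_alg
    have ti: "two_idx a c \<in> pidx (m0 \<Delta>)" if "a \<in> {0, 1}" "c \<in> {0, 1}" for a c
      using that Quaternions_alg by (auto simp: two_idx_def pidx_def m0_def)
    define e where "e = (\<lambda>a c i j. gl_basis \<Delta> (m0 \<Delta>) i j (two_idx a c))"
    have e: "e x y i j a c = (if i = a \<and> j = c then quat_i ^ nat x * quat_j ^ nat y else 0)" for x y i j a c
      unfolding e_def by (auto simp: Quaternions_alg gl_basis_def kron_def mat_unit_def m0_def mat_one_def scalar_mat_def two_idx_def)
    have "A = (\<Sum>i<n. \<Sum>j<n. qre (A i j) *\<^sub>R e 0 0 i j + qim_i (A i j) *\<^sub>R e 1 0 i j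
       + qim_j (A i j) *\<^sub>R e 0 1 i j + qim_k (A i j) *\<^sub>R e 1 1 i j)" (is "A = ?S")
    proof (intro ext)
      fix a c
      have 1: "qre q *\<^sub>R 1 + qim_i q *\<^sub>R quat_i + qim_j q *\<^sub>R quat_j + qim_k q *\<^sub>R (quat_i * quat_j) = q" for q
        by (cases q) (simp add: quat_defs quat_i_def quat_j_def)
      have "?S a c =
        (\<Sum>i<n. \<Sum>j<n. (if i = a \<and> j = c then qre (A i j) *\<^sub>R 1 + qim_i (A i j) *\<^sub>R quat_i
          + qim_j (A i j) *\<^sub>R quat_j + qim_k (A i j) *\<^sub>R (quat_i * quat_j) else 0))"
        by (simp add: sum_fun_apply scaleR_fun_def plus_fun_def e) (intro sum.cong refl, auto)
      also have "\<dots> = (\<Sum>i<n. \<Sum>j<n. if j = c then (if i = a then A a c else 0) else 0)"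
        by (intro sum.cong refl) (auto simp: 1)
      also have "\<dots> = (if a < n \<and> c < n then A a c else 0)" by (cases "c < n") simp_all
      also have "\<dots> = A a c" using gl_entries(2)[OF A] by auto
      finally show "A a c = ?S a c" ..
    qed
    moreover have "e x y i j \<in> R" if "x \<in> {0, 1}" "y \<in> {0, 1}" "i < n" "j < n" for x y i j
      unfolding e_def using that ti by simp
    then have "?S \<in> R"
      by (intro subspace_sum subspace_add subspace_scale subspace_R) auto
    ultimately show ?thesis by simp
  qed
qed

lemma R_subset_gl:
  assumes "is_quat \<Delta> \<Longrightarrow> 0 < m" "0 < k"
  shows "type_I.R k m (gl_basis \<Delta> m) \<subseteq> gl \<Delta> (k * D_size \<Delta> m)"
proof -
  interpret type_I "mat_mult (k * D_size \<Delta> m)" "is_quat \<Delta>" k m "gl_basis \<Delta> m"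
    using assms by (intro type_I_gl) auto
  show ?thesis unfolding R_def using assms
    by (intro span_minimal) (auto simp: b_def idx_def intro!: gl_basis_in_gl)
qed

lemma independent_card_span:
  assumes "independent S" "S \<subseteq> V" "V \<subseteq> span T" "finite T" "card T \<le> card S"
  shows "V \<subseteq> span S"
proof
  fix v assume v: "v \<in> V"
  show "v \<in> span S"
  proof (rule ccontr)
    assume nv: "v \<notin> span S"
    then have i: "independent (insert v S)" using assms(1) by (simp add: independent_insertI)
    then have "finite (insert v S) \<and> card (insert v S) \<le> card T"
      using real_vector.independent_span_bound[OF assms(4)] assms(2,3) v by (metis insert_subset subset_trans)
    moreover have "v \<notin> S" using nv span_base by blast
    ultimately show False using assms(5) by auto
  qed
qed

text \<open>By counting: there are \<open>k^2 4^m\<close> independent elements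
  \<open>E_ij \<otimes> X_t\<close> in \<open>gl\<close>, as many as there are in the spanning set
  provided by \<open>m0\<close>.\<close>

theorem gl_eq_R:
  assumes "is_quat \<Delta> \<Longrightarrow> 0 < m" "0 < k"
  shows "type_I.R k m (gl_basis \<Delta> m) = gl \<Delta> (k * D_size \<Delta> m)"
proof (rule antisym[OF R_subset_gl])
  let ?n = "k * D_size \<Delta> m"
  interpret X: type_I "mat_mult (?n * D_size \<Delta> (m0 \<Delta>))" "is_quat \<Delta>" ?n "m0 \<Delta>" "gl_basis \<Delta> (m0 \<Delta>)"
    using assms by (intro type_I_gl) (auto simp: m0_def)
  interpret Y: type_I "mat_mult ?n" "is_quat \<Delta>" k m "gl_basis \<Delta> m"
    using assms by (intro type_I_gl) auto
  have "card (X.b ` X.idx) = card (Y.b ` Y.idx)"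
  proof (cases \<Delta>)
    case Reals_alg
    have "(4::nat) ^ m = 2 ^ m * 2 ^ m" by (simp add: power_mult_distrib[symmetric])
    then show ?thesis using Reals_alg unfolding X.card_b Y.card_b by (simp add: m0_def power2_eq_square)
  next
    case Quaternions_alg
    then obtain s where "m = Suc s" using assms(1) by (cases m) auto
    moreover have "(4::nat) ^ s = 2 ^ s * 2 ^ s" by (simp add: power_mult_distrib[symmetric])
    ultimately show ?thesis using Quaternions_alg unfolding X.card_b Y.card_b
      by (simp add: m0_def power2_eq_square)
  qed
  then show "gl \<Delta> ?n \<subseteq> Y.R"
    unfolding Y.R_def using gl_subset_m0[of ?n \<Delta>] R_subset_gl[of \<Delta> m k] assms
    by (intro independent_card_span[OF Y.b_independent _ _ finite_imageI[OF X.finite_idx]])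
       (auto simp: Y.R_def X.R_def intro: span_base)
qed (use assms in auto)

section \<open>Characters of finitely generated abelian groups\<close>

text \<open>Values outside \<open>H\<close> are irrelevant, so a character can be extended by one
  element at a time until its domain contains a given finite set.\<close>

definition is_character :: "('g, 'm) monoid_scheme \<Rightarrow> 'g set \<Rightarrow> ('g \<Rightarrow> complex) \<Rightarrow> bool" where
  "is_character G H \<chi> \<longleftrightarrow> (\<forall>x\<in>H. \<chi> x \<noteq> 0) \<and> (\<forall>x\<in>H. \<forall>y\<in>H. \<chi> (x \<otimes>\<^bsub>G\<^esub> y) = \<chi> x * \<chi> y)"

context comm_group
begin

text \<open>The value \<open>w\<close> at \<open>a\<close> defines an extension to the subgroup
  generated by \<open>H\<close> and \<open>a\<close> as soon as it agrees with \<open>\<chi>\<close>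
  on the powers of \<open>a\<close> that lie in \<open>H\<close>.\<close>

lemma character_extend_with:
  assumes H: "subgroup H G" and chi: "is_character G H \<chi>" and a: "a \<in> carrier G" and w: "w \<noteq> 0"
    and compat: "\<And>i::int. a [^] i \<in> H \<Longrightarrow> \<chi> (a [^] i) = w powi i"
  obtains H' \<chi>' where "subgroup H' G" "H \<subseteq> H'" "a \<in> H'" "is_character G H' \<chi>'"
    "\<And>x. x \<in> H \<Longrightarrow> \<chi>' x = \<chi> x" "\<chi>' a = w"
proof -
  define H' where "H' = {x \<otimes> a [^] i | x (i::int). x \<in> H}"
  \<comment> \<open>Any representation of \<open>y\<close> as an element of \<open>H\<close> times a
    power of \<open>a\<close> may be chosen; \<open>compat\<close> makes the value independent of
    it, which is \<open>val\<close>.\<close>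
  define \<chi>' where "\<chi>' = (\<lambda>y. SOME v. \<exists>x\<in>H. \<exists>i::int. y = x \<otimes> a [^] i \<and> v = \<chi> x * w powi i)"
  have Hc: "x \<in> carrier G" if "x \<in> H" for x using subgroup.mem_carrier[OF H that] .
  have val: "\<chi>' (x \<otimes> a [^] i) = \<chi> x * w powi i" if x: "x \<in> H" for x and i :: int
  proof -
    have "\<exists>v. \<exists>x'\<in>H. \<exists>j::int. x \<otimes> a [^] i = x' \<otimes> a [^] j \<and> v = \<chi> x' * w powi j" using x by blast
    from someI_ex[OF this] obtain x' j where
      j: "x' \<in> H" "x \<otimes> a [^] i = x' \<otimes> a [^] j" "\<chi>' (x \<otimes> a [^] i) = \<chi> x' * w powi j"
      unfolding \<chi>'_def by blast
    have "x \<otimes> a [^] (i - j) = (x \<otimes> a [^] i) \<otimes> inv (a [^] j)"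
      using x a Hc by (simp add: int_pow_diff m_assoc)
    also have "\<dots> = x'" using j x a Hc by (simp add: m_assoc)
    finally have x': "x \<otimes> a [^] (i - j) = x'" .
    have "inv x \<otimes> (x \<otimes> a [^] (i - j)) = a [^] (i - j)"
      using x a Hc by (simp add: m_assoc[symmetric])
    then have "a [^] (i - j) = inv x \<otimes> x'" unfolding x' by (rule sym)
    then have "a [^] (i - j) \<in> H" using x j(1) H by (simp add: subgroup.m_closed subgroup.m_inv_closed)
    then have "\<chi> x' = \<chi> x * w powi (i - j)"
      using compat x' x chi unfolding is_character_def by metis
    then show ?thesis using j(3) w by (simp add: power_int_diff)
  qed
  have one: "\<one> \<in> H" using subgroup.one_closed[OF H] .
  have chi1: "\<chi> \<one> = 1"
    using chi one unfolding is_character_def by (metis mult_cancel_left1 one_closed r_one)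
  show thesis
  proof
    show sub: "H \<subseteq> H'"
    proof
      fix x assume "x \<in> H"
      then show "x \<in> H'" unfolding H'_def using Hc by (auto intro!: exI[of _ x] exI[of _ "0::int"])
    qed
    show "a \<in> H'"
      unfolding H'_def using a one by (auto intro!: exI[of _ \<one>] exI[of _ "1::int"])
    have mult: "(x \<otimes> a [^] i) \<otimes> (y \<otimes> a [^] j) = (x \<otimes> y) \<otimes> a [^] (i + j)" if "x \<in> H" "y \<in> H" for x y and i j :: int
      using that Hc a by (simp add: int_pow_mult m_ac)
    show "subgroup H' G"
    proof (rule subgroupI)
      show "H' \<subseteq> carrier G" unfolding H'_def using Hc a by auto
      show "H' \<noteq> {}" using sub one by auto
      fix y assume "y \<in> H'"
      then obtain x i where y: "y = x \<otimes> a [^] (i::int)" "x \<in> H" unfolding H'_def by auto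
      then have "inv y = inv x \<otimes> a [^] (- i)" using Hc a by (simp add: inv_mult int_pow_neg)
      then show "inv y \<in> H'" unfolding H'_def using y(2) H by (auto simp: subgroup.m_inv_closed)
      fix z assume "z \<in> H'"
      then obtain x' j where z: "z = x' \<otimes> a [^] (j::int)" "x' \<in> H" unfolding H'_def by auto
      show "y \<otimes> z \<in> H'" unfolding y(1) z(1) mult[OF y(2) z(2)]
        unfolding H'_def using y(2) z(2) H by (auto simp: subgroup.m_closed)
    qed
    show "is_character G H' \<chi>'"
      unfolding is_character_def
    proof (intro conjI ballI)
      fix y assume "y \<in> H'"
      then obtain x i where y: "y = x \<otimes> a [^] (i::int)" "x \<in> H" unfolding H'_def by auto
      show "\<chi>' y \<noteq> 0" using y val chi w unfolding is_character_def by simp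
      fix z assume "z \<in> H'"
      then obtain x' j where z: "z = x' \<otimes> a [^] (j::int)" "x' \<in> H" unfolding H'_def by auto
      show "\<chi>' (y \<otimes> z) = \<chi>' y * \<chi>' z"
        unfolding y(1) z(1) mult[OF y(2) z(2)]
        using y z val H chi w by (simp add: subgroup.m_closed power_int_add is_character_def)
    qed
    show "\<chi>' x = \<chi> x" if "x \<in> H" for x
      using val[OF that, of 0] that Hc by simp
    show "\<chi>' a = w" using val[OF one, of 1] a chi1 by simp
  qed
qed

text \<open>The exponents with \<open>a [^] i \<in> H\<close> form a subgroup of the integers,
  generated by its least positive element: divide \<open>i\<close> by \<open>d\<close> and use
  minimality on the remainder.\<close>

lemma int_pow_mem_dvd:
  assumes H: "subgroup H G" and a: "a \<in> carrier G"
    and d: "d = (LEAST i::nat. 0 < i \<and> a [^] i \<in> H)" "0 < i0" "a [^] (i0::nat) \<in> H"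
    and i: "a [^] (i::int) \<in> H"
  shows "0 < d" "a [^] d \<in> H" "int d dvd i"
proof -
  have "0 < d \<and> a [^] d \<in> H" unfolding d(1) by (rule LeastI[of _ i0]) (use d in auto)
  then show pos: "0 < d" "a [^] d \<in> H" by auto
  then have "a [^] int d \<in> H" by (simp add: int_pow_int)
  then have "(a [^] int d) [^] (i div int d) \<in> H" using H by (metis subgroup_int_pow_closed)
  then have "a [^] (int d * (i div int d)) \<in> H" using a by (simp add: int_pow_pow)
  then have "a [^] i \<otimes> inv (a [^] (int d * (i div int d))) \<in> H"
    using i H by (simp add: subgroup.m_closed subgroup.m_inv_closed)
  then have "a [^] (i mod int d) \<in> H"
    using a by (simp add: int_pow_diff[symmetric] minus_mult_div_eq_mod)
  then have "a [^] nat (i mod int d) \<in> H" using pos by (metis int_pow_int of_nat_0_less_iff int_nat_eq pos_mod_sign)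
  moreover have "nat (i mod int d) < d" using pos by (simp add: nat_less_iff)
  moreover have least: "\<not> (0 < l \<and> a [^] l \<in> H)" if "l < d" for l
    using that unfolding d(1) by (rule not_less_Least)
  ultimately have "nat (i mod int d) = 0" using least[of "nat (i mod int d)"] by (metis gr0I)
  moreover have "0 \<le> i mod int d" using pos(1) by simp
  ultimately have "i mod int d = 0" by linarith
  then show "int d dvd i" by (rule mod_0_imp_dvd)
qed

text \<open>The group of complex units is divisible: \<open>a\<close> is sent to a d-th root of the
  value already fixed at its d-th power, where d is the order of \<open>a\<close> modulo
  \<open>H\<close>, and to 1 if that order is infinite.\<close>

lemma character_extend:
  assumes H: "subgroup H G" and chi: "is_character G H \<chi>" and a: "a \<in> carrier G"
  obtains H' \<chi>' where "subgroup H' G" "H \<subseteq> H'" "a \<in> H'" "is_character G H' \<chi>'"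
    "\<And>x. x \<in> H \<Longrightarrow> \<chi>' x = \<chi> x"
proof -
  have one: "\<one> \<in> H" using subgroup.one_closed[OF H] .
  have chi1: "\<chi> \<one> = 1"
    using chi one unfolding is_character_def by (metis mult_cancel_left1 one_closed r_one)
  have "\<exists>w. w \<noteq> 0 \<and> (\<forall>i::int. a [^] i \<in> H \<longrightarrow> \<chi> (a [^] i) = w powi i)"
  proof (cases "\<exists>i::nat. 0 < i \<and> a [^] i \<in> H")
    case True
    then obtain i0 :: nat where i0: "0 < i0" "a [^] i0 \<in> H" by auto
    define d where "d = (LEAST i::nat. 0 < i \<and> a [^] i \<in> H)"
    note dd = int_pow_mem_dvd[OF H a d_def i0]
    have d: "0 < d" "a [^] d \<in> H" using dd(1,2)[of 0] one by auto
    define z where "z = \<chi> (a [^] d)"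
    have z: "z \<noteq> 0" using chi d unfolding is_character_def z_def by auto
    \<comment> \<open>A d-th root of \<open>z\<close> in polar form.\<close>
    define w where "w = rcis (root d (cmod z)) (Arg z / d)"
    have wd: "w ^ d = z" using d unfolding w_def DeMoivre2 by (simp add: rcis_cmod_Arg)
    then have w0: "w \<noteq> 0" using z d by auto
    have "\<chi> (a [^] i) = w powi i" if i: "a [^] i \<in> H" for i :: int
    proof -
      obtain j where j: "i = int d * j" using dd(3)[OF i] by auto
      have nat: "\<chi> (x [^] n) = \<chi> x ^ n" if "x \<in> H" for x and n :: nat
      proof (induction n)
        case (Suc n)
        have "x [^] n \<in> H" using that H by (metis int_pow_int subgroup_int_pow_closed)
        then show ?case using Suc that chi unfolding is_character_def by (simp add: mult.commute)
      qed (use chi1 in simp)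
      have inv: "\<chi> (inv x) = inverse (\<chi> x)" if "x \<in> H" for x
      proof -
        have "\<chi> (inv x) * \<chi> x = \<chi> (inv x \<otimes> x)"
          using that chi subgroup.m_inv_closed[OF H that] unfolding is_character_def by simp
        also have "\<dots> = 1" using that subgroup.mem_carrier[OF H that] chi1 by simp
        finally show ?thesis by (metis inverse_unique mult.commute)
      qed
      have "a [^] i = (a [^] d) [^] j" using a by (simp add: j int_pow_pow[symmetric] int_pow_int)
      also have "\<chi> \<dots> = z powi j"
      proof (cases j)
        case (nonneg n)
        then show ?thesis using nat[OF d(2)] by (simp add: z_def int_pow_int)
      next
        case (neg n)
        have "(a [^] d) [^] j = inv ((a [^] d) [^] Suc n)"
          using a neg by (metis int_pow_neg_int nat_pow_closed)
        moreover have "(a [^] d) [^] Suc n \<in> H" using d(2) H by (metis int_pow_int subgroup_int_pow_closed)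
        moreover have "z powi j = inverse (z ^ Suc n)" unfolding neg by (metis power_int_minus power_int_of_nat)
        ultimately show ?thesis using nat[OF d(2), of "Suc n"] inv[of "(a [^] d) [^] Suc n"]
          unfolding z_def by metis
      qed
      also have "\<dots> = w powi i" unfolding wd[symmetric] j by (simp add: power_int_mult)
      finally show ?thesis .
    qed
    then show ?thesis using w0 by blast
  next
    case False
    have "i = 0" if i: "a [^] i \<in> H" for i :: int
    proof (rule ccontr)
      assume "i \<noteq> 0"
      have "a [^] (- i) \<in> H" using i a H by (simp add: int_pow_neg subgroup.m_inv_closed)
      then have "a [^] (int (nat \<bar>i\<bar>)) \<in> H" using i by (cases "0 \<le> i") auto
      then have "a [^] nat \<bar>i\<bar> \<in> H" unfolding int_pow_int .
      moreover have "0 < nat \<bar>i\<bar>" using \<open>i \<noteq> 0\<close> by simp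
      ultimately show False using False by blast
    qed
    then have "\<chi> (a [^] i) = 1 powi i" if "a [^] i \<in> H" for i :: int
      using chi1 that by (metis int_pow_0 power_int_1_left)
    then show ?thesis using one_neq_zero by blast
  qed
  then obtain w where "w \<noteq> 0" "\<And>i::int. a [^] i \<in> H \<Longrightarrow> \<chi> (a [^] i) = w powi i" by auto
  from character_extend_with[OF H chi a this] that show thesis by metis
qed

text \<open>Starting from the trivial subgroup, \<open>a\<close> is sent to a primitive d-th root of
  unity if it has finite order d and to 2 otherwise. Extending to the elements of \<open>A\<close>
  keeps this value.\<close>

lemma characters_separate:
  assumes a: "a \<in> carrier G" "a \<noteq> \<one>" and A: "finite A" "A \<subseteq> carrier G"
  obtains H \<chi> where "subgroup H G" "a \<in> H" "A \<subseteq> H" "is_character G H \<chi>" "\<chi> a \<noteq> 1"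
proof -
  have "\<exists>H \<chi>. subgroup H G \<and> a \<in> H \<and> A \<subseteq> H \<and> is_character G H \<chi> \<and> \<chi> a \<noteq> 1"
    using A
  proof (induction A rule: finite_induct)
    case empty
    have sub: "subgroup {\<one>} G" by (rule triv_subgroup)
    have triv: "is_character G {\<one>} (\<lambda>_. 1)" unfolding is_character_def by auto
    have "\<exists>w::complex. w \<noteq> 0 \<and> w \<noteq> 1 \<and> (\<forall>i::int. a [^] i \<in> {\<one>} \<longrightarrow> 1 = w powi i)"
    proof (cases "\<exists>i::nat. 0 < i \<and> a [^] i \<in> {\<one>}")
      case True
      then obtain i0 :: nat where i0: "0 < i0" "a [^] i0 \<in> {\<one>}" by auto
      define d where "d = (LEAST i::nat. 0 < i \<and> a [^] i \<in> {\<one>})"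
      note dd = int_pow_mem_dvd[OF sub a(1) d_def i0]
      have d: "0 < d" "a [^] d \<in> {\<one>}" using dd(1,2)[of 0] by auto
      have d1: "1 < d" using d a by (cases "d = 1") auto
      define w where "w = cis (2 * pi / d)"
      have wd: "w ^ d = 1" using d unfolding w_def DeMoivre by simp
      have "w \<noteq> 1"
      proof
        assume "w = 1"
        then have "cos (2 * pi / d) = 1" unfolding w_def by (metis cis.sel(1) one_complex.sel(1))
        then obtain n :: int where "2 * pi / d = real_of_int n * 2 * pi" using cos_one_2pi_int by auto
        then have "(2 * pi) * (1 / d) = (2 * pi) * real_of_int n" by (simp add: mult.commute)
        then have "1 / d = real_of_int n" using pi_neq_zero by (simp only: mult_cancel_left) auto
        moreover have "0 < 1 / real d" "1 / real d < 1" using d1 by auto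
        ultimately have "0 < real_of_int n" "real_of_int n < 1" by (metis, metis)
        then show False unfolding of_int_0_less_iff of_int_less_1_iff by linarith
      qed
      moreover have "1 = w powi i" if i: "a [^] i \<in> {\<one>}" for i :: int
      proof -
        obtain j where "i = int d * j" using dd(3)[OF i] by auto
        then have "w powi i = (w powi int d) powi j" by (simp only: power_int_mult)
        then show ?thesis by (simp only: power_int_of_nat wd power_int_1_left)
      qed
      moreover have "w \<noteq> 0" unfolding w_def by simp
      ultimately show ?thesis by blast
    next
      case False
      have "i = 0" if i: "a [^] i \<in> {\<one>}" for i :: int
      proof (rule ccontr)
        assume "i \<noteq> 0"
        have "a [^] (- i) \<in> {\<one>}" using i a by (simp add: int_pow_neg)
        then have "a [^] (int (nat \<bar>i\<bar>)) \<in> {\<one>}" using i by (cases "0 \<le> i") auto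
        then have "a [^] nat \<bar>i\<bar> \<in> {\<one>}" unfolding int_pow_int .
        moreover have "0 < nat \<bar>i\<bar>" using \<open>i \<noteq> 0\<close> by simp
        ultimately show False using False by blast
      qed
      then have "(1::complex) = 2 powi i" if "a [^] i \<in> {\<one>}" for i :: int
        using that by (metis power_int_0_right)
      then show ?thesis by (intro exI[of _ 2]) auto
    qed
    then obtain w :: complex where w: "w \<noteq> 0" "w \<noteq> 1" "\<And>i::int. a [^] i \<in> {\<one>} \<Longrightarrow> 1 = w powi i" by auto
    show ?case
      by (rule character_extend_with[OF sub triv a(1) w(1) w(3)]) (use w(2) in auto)
  next
    case (insert c A)
    then obtain H \<chi> where H: "subgroup H G" "a \<in> H" "A \<subseteq> H" "is_character G H \<chi>" "\<chi> a \<noteq> 1" by auto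
    from insert.prems have "c \<in> carrier G" by simp
    from character_extend[OF H(1,4) this] obtain H' \<chi>' where
      "subgroup H' G" "H \<subseteq> H'" "c \<in> H'" "is_character G H' \<chi>'" "\<And>x. x \<in> H \<Longrightarrow> \<chi>' x = \<chi> x" by metis
    then show ?case using H by (intro exI[of _ H'] exI[of _ \<chi>']) auto
  qed
  then show thesis using that by blast
qed

end

section \<open>The universal group\<close>

lemma comm_group_complex_units: "comm_group complex_units"
proof (rule comm_groupI)
  fix x assume "x \<in> carrier complex_units"
  then show "\<exists>y\<in>carrier complex_units. y \<otimes>\<^bsub>complex_units\<^esub> x = \<one>\<^bsub>complex_units\<^esub>"
    by (intro bexI[of _ "inverse x"]) (auto simp: complex_units_def)
qed (auto simp: complex_units_def mult.assoc mult.commute)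

text \<open>\<open>\<kappa>\<close> respects the relators, so it induces a character of the
  universal group, to which innerness applies. The condition concerns only pairs with a nonzero
  bracket, which admits functions that need not come from a character of \<open>G\<close>.\<close>

lemma inner_grading_character:
  assumes gr: "lie_grading L br G \<Gamma>"
    and inner: "inner_grading L br (universal_group br G \<Gamma>) (universal_grading br G \<Gamma>)"
    and nz: "\<And>g. g \<in> grading_support G \<Gamma> \<Longrightarrow> \<kappa> g \<noteq> 0"
    and mult: "\<And>g h x y. \<lbrakk>g \<in> grading_support G \<Gamma>; h \<in> grading_support G \<Gamma>; x \<in> \<Gamma> g; y \<in> \<Gamma> h; br x y \<noteq> 0\<rbrakk>
       \<Longrightarrow> \<kappa> (g \<otimes>\<^bsub>G\<^esub> h) = \<kappa> g * \<kappa> h"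
  obtains \<phi> where "inner_automorphism L br \<phi>"
    "\<And>g z. g \<in> grading_support G \<Gamma> \<Longrightarrow> z \<in> \<Gamma> g \<times> \<Gamma> g \<Longrightarrow> \<phi> z = cscale (\<kappa> g) z"
proof -
  define S where "S = grading_support G \<Gamma>"
  define F where "F = free_Abelian_group S"
  interpret C: comm_group complex_units by (rule comm_group_complex_units)
  interpret F: comm_group F unfolding F_def by (rule abelian_free_Abelian_group)
  interpret G: comm_group G using gr unfolding lie_grading_def by simp
  \<comment> \<open>A nonzero bracket lies in a nonzero component, so the third generator of each
    relator belongs to the support.\<close>
  have closed: "g \<otimes>\<^bsub>G\<^esub> h \<in> S" if "g \<in> S" "h \<in> S" "x \<in> \<Gamma> g" "y \<in> \<Gamma> h" "br x y \<noteq> 0" for g h x y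
  proof -
    have "g \<in> carrier G" "h \<in> carrier G" using that unfolding S_def grading_support_def by auto
    moreover then have "br x y \<in> \<Gamma> (g \<otimes>\<^bsub>G\<^esub> h)" using gr that unfolding lie_grading_def by blast
    ultimately show ?thesis using that(5) unfolding S_def grading_support_def by auto
  qed
  have "\<kappa> ` S \<subseteq> carrier complex_units" using nz unfolding S_def complex_units_def by auto
  then obtain f where f: "f \<in> hom F complex_units" "\<And>x. x \<in> S \<Longrightarrow> f (frag_of x) = \<kappa> x"
    unfolding F_def using C.free_Abelian_group_universal by metis
  interpret f: group_hom F complex_units f
    using f(1) by (simp add: group_hom_def group_hom_axioms_def)
  define N where "N = universal_relations br G \<Gamma>"
  have rel: "universal_relators br G \<Gamma> \<subseteq> kernel F complex_units f"
  proof
    fix r assume "r \<in> universal_relators br G \<Gamma>"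
    then obtain g h x y where r: "r = frag_of g + frag_of h - frag_of (g \<otimes>\<^bsub>G\<^esub> h)" "g \<in> S" "h \<in> S"
      "x \<in> \<Gamma> g" "y \<in> \<Gamma> h" "br x y \<noteq> 0" unfolding universal_relators_def S_def by blast
    have gh: "g \<otimes>\<^bsub>G\<^esub> h \<in> S" using closed r by blast
    have c: "frag_of g \<in> carrier F" "frag_of h \<in> carrier F" "frag_of (g \<otimes>\<^bsub>G\<^esub> h) \<in> carrier F"
      using r gh unfolding F_def by auto
    have req: "r = (frag_of g \<otimes>\<^bsub>F\<^esub> frag_of h) \<otimes>\<^bsub>F\<^esub> inv\<^bsub>F\<^esub> (frag_of (g \<otimes>\<^bsub>G\<^esub> h))"
      using gh unfolding r(1) F_def by simp
    have rc: "r \<in> carrier F" unfolding req using c by simp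
    have "r \<otimes>\<^bsub>F\<^esub> frag_of (g \<otimes>\<^bsub>G\<^esub> h) = frag_of g \<otimes>\<^bsub>F\<^esub> frag_of h"
      unfolding req using c by (simp add: F.m_assoc)
    then have "f r * \<kappa> (g \<otimes>\<^bsub>G\<^esub> h) = \<kappa> g * \<kappa> h"
      using f.hom_mult[OF rc c(3)] f.hom_mult[OF c(1,2)] f(2) r gh by (simp add: complex_units_def)
    moreover have "\<kappa> (g \<otimes>\<^bsub>G\<^esub> h) = \<kappa> g * \<kappa> h" using mult r unfolding S_def by blast
    moreover have "\<kappa> (g \<otimes>\<^bsub>G\<^esub> h) \<noteq> 0" using nz gh unfolding S_def by blast
    ultimately have "f r = 1" by simp
    then show "r \<in> kernel F complex_units f" using rc unfolding kernel_def by (simp add: complex_units_def)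
  qed
  have rel_c: "universal_relators br G \<Gamma> \<subseteq> carrier F" using rel unfolding kernel_def by auto
  have N: "N = generate F (universal_relators br G \<Gamma>)"
    unfolding N_def universal_relations_def F_def S_def ..
  have "subgroup N F" unfolding N by (rule F.generate_is_subgroup[OF rel_c])
  then have normal: "N \<lhd> F" by (rule F.subgroup_imp_normal)
  have "N \<subseteq> kernel F complex_units f"
    unfolding N by (rule F.generate_subgroup_incl[OF rel f.subgroup_kernel])
  from f.FactGroup_universal_kernel[OF normal this] obtain \<chi> where
    chi: "\<chi> \<in> hom (F Mod N) complex_units" "\<And>x. x \<in> carrier F \<Longrightarrow> \<chi> (N #>\<^bsub>F\<^esub> x) = f x" by metis
  have U: "universal_group br G \<Gamma> = F Mod N" unfolding universal_group_def F_def N_def S_def ..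
  from inner chi(1) obtain \<phi> where phi: "inner_automorphism L br \<phi>"
    "\<And>g z. g \<in> carrier (F Mod N) \<Longrightarrow> z \<in> universal_grading br G \<Gamma> g \<times> universal_grading br G \<Gamma> g \<Longrightarrow> \<phi> z = cscale (\<chi> g) z"
    unfolding inner_grading_def U by blast
  show thesis
  proof (rule that[OF phi(1)])
    fix g z assume g: "g \<in> grading_support G \<Gamma>" "z \<in> \<Gamma> g \<times> \<Gamma> g"
    have gF: "frag_of g \<in> carrier F" using g unfolding F_def S_def by auto
    have ud: "universal_degree br G \<Gamma> g = N #>\<^bsub>F\<^esub> frag_of g"
      unfolding universal_degree_def F_def N_def S_def ..
    have "\<Gamma> g \<subseteq> universal_grading br G \<Gamma> (N #>\<^bsub>F\<^esub> frag_of g)"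
      unfolding universal_grading_def using g ud by (auto intro!: span_base)
    moreover have "N #>\<^bsub>F\<^esub> frag_of g \<in> carrier (F Mod N)"
      using gF unfolding FactGroup_def RCOSETS_def by auto
    ultimately have "\<phi> z = cscale (\<chi> (N #>\<^bsub>F\<^esub> frag_of g)) z" using phi(2) g(2) by (meson Sigma_mono subsetD)
    then show "\<phi> z = cscale (\<kappa> g) z" using chi(2)[OF gF] f(2) g unfolding S_def by simp
  qed
qed

section \<open>Exponentials of nilpotent derivations\<close>

locale derivation = ralg mult for mult :: "'a::real_vector \<Rightarrow> 'a \<Rightarrow> 'a" (infixl "\<star>" 70) +
  fixes D :: "'a \<Rightarrow> 'a"
  assumes linear_D: "linear D"
    and Leibniz: "D (x \<star> y) = D x \<star> y + x \<star> D y"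
begin

definition expD :: "'a \<Rightarrow> 'a" where
  "expD z = (\<Sum>i | (D ^^ i) z \<noteq> 0. (1 / fact i) *\<^sub>R (D ^^ i) z)"

lemma linear_pow: "linear (D ^^ i)"
  by (induction i) (auto simp: linear_id[unfolded id_def] linear_compose[OF _ linear_D, unfolded comp_def] id_def)

lemma pow_zero: assumes "(D ^^ N) z = 0" "N \<le> i" shows "(D ^^ i) z = 0"
proof -
  have "(D ^^ i) z = (D ^^ (i - N)) ((D ^^ N) z)"
    using assms(2) by (metis comp_apply funpow_add le_add_diff_inverse2)
  then show ?thesis using assms(1) linear_0[OF linear_pow] by simp
qed

lemma expD_eq: assumes "(D ^^ N) z = 0" shows "expD z = (\<Sum>i<N. (1 / fact i) *\<^sub>R (D ^^ i) z)"
  unfolding expD_def using pow_zero[OF assms]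
  by (intro sum.mono_neutral_cong_left) (auto simp: not_le[symmetric])

lemma expD_add:
  assumes "(D ^^ N) x = 0" "(D ^^ N) y = 0"
  shows "expD (x + y) = expD x + expD y"
  using assms expD_eq[of N] linear_add[OF linear_pow]
  by (simp add: scaleR_add_right sum.distrib)

lemma Leibniz_pow:
  "(D ^^ n) (x \<star> y) = (\<Sum>i\<le>n. real (n choose i) *\<^sub>R ((D ^^ i) x \<star> (D ^^ (n - i)) y))"
proof (induction n)
  case (Suc n)
  let ?a = "\<lambda>i j. (D ^^ i) x \<star> (D ^^ j) y"
  have "(D ^^ Suc n) (x \<star> y) = (\<Sum>i\<le>n. real (n choose i) *\<^sub>R (?a (Suc i) (n - i) + ?a i (Suc (n - i))))"
    using Suc by (simp add: linear_sum[OF linear_D] linear_cmul[OF linear_D] Leibniz)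
  also have "\<dots> = (\<Sum>i\<le>n. real (n choose i) *\<^sub>R ?a (Suc i) (n - i)) + (\<Sum>i\<le>n. real (n choose i) *\<^sub>R ?a i (Suc n - i))"
    by (simp add: scaleR_add_right sum.distrib Suc_diff_le)
  also have "(\<Sum>i\<le>n. real (n choose i) *\<^sub>R ?a i (Suc n - i)) =
     ?a 0 (Suc n) + (\<Sum>i\<le>n. real (n choose Suc i) *\<^sub>R ?a (Suc i) (n - i))"
  proof -
    have "(\<Sum>i\<le>n. real (n choose i) *\<^sub>R ?a i (Suc n - i)) = (\<Sum>i\<le>Suc n. real (n choose i) *\<^sub>R ?a i (Suc n - i))"
      by simp
    also have "\<dots> = ?a 0 (Suc n) + (\<Sum>i\<le>n. real (n choose Suc i) *\<^sub>R ?a (Suc i) (n - i))"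
      by (subst sum.atMost_Suc_shift) simp
    finally show ?thesis .
  qed
  finally show ?case
    by (simp add: sum.atMost_Suc_shift sum.distrib[symmetric] scaleR_add_left del: sum.atMost_Suc funpow.simps)
qed simp

text \<open>In the Cauchy product of the two exponentials only terms with i, j < N are nonzero, and
  they all satisfy i + j < 2N. So the sum over the triangle for the product and the sum over the
  square for the two factors agree.\<close>

lemma expD_mult:
  assumes N: "(D ^^ N) x = 0" "(D ^^ N) y = 0"
  shows "(D ^^ (2 * N)) (x \<star> y) = 0" "expD (x \<star> y) = expD x \<star> expD y"
proof -
  let ?a = "\<lambda>i. (1 / fact i) *\<^sub>R (D ^^ i) x"
  let ?c = "\<lambda>i. (1 / fact i) *\<^sub>R (D ^^ i) y"
  have tm: "(D ^^ i) x \<star> (D ^^ j) y = 0" if "2 * N \<le> i + j" for i j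
    using pow_zero[OF N(1), of i] pow_zero[OF N(2), of j] that by (cases "N \<le> i") auto
  show z: "(D ^^ (2 * N)) (x \<star> y) = 0"
    unfolding Leibniz_pow by (intro sum.neutral ballI) (simp add: tm)
  have "expD (x \<star> y) = (\<Sum>n<2 * N. \<Sum>i\<le>n. ?a i \<star> ?c (n - i))"
    unfolding expD_eq[OF z] Leibniz_pow scaleR_sum_right
    by (intro sum.cong refl) (simp add: binomial_fact)
  also have "\<dots> = (\<Sum>(i, j)\<in>{(i, j). i + j < 2 * N}. ?a i \<star> ?c j)"
    by (rule sum.triangle_reindex[symmetric])
  also have "\<dots> = (\<Sum>(i, j)\<in>{..<N} \<times> {..<N}. ?a i \<star> ?c j)"
  proof (rule sum.mono_neutral_right)
    have "{(i, j). i + j < 2 * N} \<subseteq> {..<2 * N} \<times> {..<2 * N}" by auto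
    then show "finite {(i, j). i + j < 2 * N}" by (rule finite_subset) simp
    show "\<forall>p\<in>{(i, j). i + j < 2 * N} - {..<N} \<times> {..<N}. (case p of (i, j) \<Rightarrow> ?a i \<star> ?c j) = 0"
    proof
      fix p assume p: "p \<in> {(i, j). i + j < 2 * N} - {..<N} \<times> {..<N}"
      obtain i j where ij: "p = (i, j)" by (cases p)
      then have "N \<le> i \<or> N \<le> j" using p by auto
      then show "(case p of (i, j) \<Rightarrow> ?a i \<star> ?c j) = 0"
        using pow_zero[OF N(1), of i] pow_zero[OF N(2), of j] ij by auto
    qed
  qed auto
  also have "\<dots> = expD x \<star> expD y"
    unfolding expD_eq[OF N(1)] expD_eq[OF N(2)]
    unfolding mult_sum_left mult_sum_right sum.cartesian_product[symmetric] by (rule sum.swap)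
  finally show "expD (x \<star> y) = expD x \<star> expD y" .
qed

end

section \<open>From Lie gradings to associative gradings\<close>

lemma ex1_eq: "\<exists>!x. P x \<Longrightarrow> P a \<Longrightarrow> P b \<Longrightarrow> a = b"
  by blast

lemma lie_grading_indep:
  assumes gr: "lie_grading L br G \<Gamma>" and L: "0 \<in> L"
    and T: "finite T" "T \<subseteq> carrier G" "\<And>g. g \<in> T \<Longrightarrow> f g \<in> \<Gamma> g" "(\<Sum>g\<in>T. f g) = 0" "g \<in> T"
  shows "f g = 0"
proof -
  define f' where "f' = (\<lambda>g. if g \<in> T then f g else 0)"
  have sub: "subspace (\<Gamma> g)" if "g \<in> carrier G" for g using gr that unfolding lie_grading_def by blast
  have "\<exists>!f. (\<forall>g\<in>carrier G. f g \<in> \<Gamma> g) \<and> (\<forall>g. g \<notin> carrier G \<longrightarrow> f g = 0) \<and>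
        finite {g. f g \<noteq> 0} \<and> 0 = (\<Sum>g | f g \<noteq> 0. f g)" (is "\<exists>!f. ?P f")
    using gr L unfolding lie_grading_def by blast
  moreover have "?P f'"
  proof (intro conjI ballI allI impI)
    have "{g. f' g \<noteq> 0} \<subseteq> T" unfolding f'_def by auto
    then show "finite {g. f' g \<noteq> 0}" using T(1) finite_subset by blast
    have "(\<Sum>g | f' g \<noteq> 0. f' g) = (\<Sum>g\<in>T. f g)"
      using T(1) by (intro sum.mono_neutral_cong_left) (auto simp: f'_def)
    then show "0 = (\<Sum>g | f' g \<noteq> 0. f' g)" using T by simp
  qed (use T sub in \<open>auto simp: f'_def subspace_0\<close>)
  moreover have "?P (\<lambda>_. 0)" using sub by (auto simp: subspace_0)
  ultimately have "f' = (\<lambda>_. 0)" by (rule ex1_eq[where P = "?P" and b = "\<lambda>_. 0"])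
  then show ?thesis using T(5) unfolding f'_def by (metis (full_types))
qed

text \<open>Nonzero vectors chosen from distinct components are independent, so their number is
  bounded by the size of a spanning set.\<close>

lemma lie_grading_finite_support:
  assumes gr: "lie_grading L br G \<Gamma>" and L: "subspace L" "L \<subseteq> span T" "finite T"
  shows "finite (grading_support G \<Gamma>)"
proof -
  let ?S = "grading_support G \<Gamma>"
  have sub: "subspace (\<Gamma> g)" "\<Gamma> g \<subseteq> L" if "g \<in> carrier G" for g using gr that unfolding lie_grading_def by auto
  have "\<exists>x. x \<in> \<Gamma> g \<and> x \<noteq> 0" if "g \<in> ?S" for g
    using that sub(1)[of g] subspace_0[of "\<Gamma> g"] unfolding grading_support_def by auto
  then obtain v where v: "\<And>g. g \<in> ?S \<Longrightarrow> v g \<in> \<Gamma> g \<and> v g \<noteq> 0" by metis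
  have "card I \<le> card T" if I: "finite I" "I \<subseteq> ?S" for I
  proof -
    have Ic: "I \<subseteq> carrier G" using I unfolding grading_support_def by auto
    have *: "\<forall>g\<in>I. c g = 0" if c: "(\<Sum>g\<in>I. c g *\<^sub>R v g) = 0" for c
    proof
      fix g assume g: "g \<in> I"
      have m: "c g *\<^sub>R v g \<in> \<Gamma> g" if "g \<in> I" for g
        using subspace_scale[OF sub(1)] Ic v I that by blast
      have "c g *\<^sub>R v g = 0"
        by (rule lie_grading_indep[OF gr subspace_0[OF L(1)] I(1) Ic m c g])
      then show "c g = 0" using v g I by auto
    qed
    have "inj_on v I" "independent (v ` I)" using family_independent[OF I(1), of v] * by auto
    moreover have "v ` I \<subseteq> span T" using v I Ic sub L(2) by blast
    ultimately show ?thesis using real_vector.independent_span_bound[OF L(3)] card_image by metis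
  qed
  then show ?thesis using finite_if_finite_subsets_card_bdd[of ?S "card T"] by simp
qed

lemma lie_grading_sum:
  assumes gr: "lie_grading L br G \<Gamma>" and fin: "finite (grading_support G \<Gamma>)" and x: "x \<in> L"
  obtains f where "\<And>g. g \<in> grading_support G \<Gamma> \<Longrightarrow> f g \<in> \<Gamma> g" "x = (\<Sum>g\<in>grading_support G \<Gamma>. f g)"
proof -
  obtain f where f: "\<forall>g\<in>carrier G. f g \<in> \<Gamma> g" "\<forall>g. g \<notin> carrier G \<longrightarrow> f g = 0" "x = (\<Sum>g | f g \<noteq> 0. f g)"
    using gr x unfolding lie_grading_def by blast
  have "x = (\<Sum>g\<in>grading_support G \<Gamma>. f g)" unfolding f(3)
    by (rule sum.mono_neutral_left[OF fin]) (use f in \<open>force simp: grading_support_def\<close>)+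
  then show thesis using that f(1) unfolding grading_support_def by blast
qed

section \<open>The associative product on the complexification\<close>

context ralg
begin

definition cm :: "'a \<times> 'a \<Rightarrow> 'a \<times> 'a \<Rightarrow> 'a \<times> 'a" where
  "cm z w = (fst z \<star> fst w - snd z \<star> snd w, fst z \<star> snd w + snd z \<star> fst w)"

lemma ralg_cm: "ralg cm"
  by unfold_locales (auto simp: cm_def prod_eq_iff distribs mult_assoc algebra_simps)

lemma cbracket_eq: "cbracket br x z = cm x z - cm z x"
  by (simp add: cbracket_def cm_def br_def prod_eq_iff)

lemma derivation_cbracket: "derivation cm (cbracket br x)"
proof -
  interpret c: ralg cm by (rule ralg_cm)
  show ?thesis
  proof (intro derivation.intro derivation_axioms.intro ralg_cm)
    show "linear (cbracket br x)"
      by (rule linearI) (simp_all add: cbracket_eq c.distribs algebra_simps)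
    show "cbracket br x (cm y z) = cm (cbracket br x y) z + cm y (cbracket br x z)" for y z
      by (simp add: cbracket_eq c.distribs c.mult_assoc)
  qed
qed

lemma exp_ad_eq: "exp_ad br x = derivation.expD (cbracket br x)"
  unfolding exp_ad_def derivation.expD_def[OF derivation_cbracket] ..

end

context type_I
begin

text \<open>Carries exactly what survives composition with an exponential and is evaluated later:
  additivity, multiplicativity, and that real multiples of the unit are fixed. The last clause is
  what forces a product with a scalar part to have character value 1.\<close>

definition multiplicative_extension :: "('a \<times> 'a \<Rightarrow> 'a \<times> 'a) \<Rightarrow> ('a \<times> 'a \<Rightarrow> 'a \<times> 'a) \<Rightarrow> bool" where
  "multiplicative_extension \<phi> \<Phi> \<longleftrightarrow>
     (\<forall>z\<in>L \<times> L. \<Phi> z = \<phi> z) \<and> (\<forall>z\<in>R \<times> R. \<Phi> z \<in> R \<times> R) \<and>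
     (\<forall>z\<in>R \<times> R. \<forall>w\<in>R \<times> R. \<Phi> (z + w) = \<Phi> z + \<Phi> w \<and> \<Phi> (cm z w) = cm (\<Phi> z) (\<Phi> w)) \<and>
     (\<forall>c. \<Phi> (c *\<^sub>R u, 0) = (c *\<^sub>R u, 0))"

lemma cm_R: "z \<in> R \<times> R \<Longrightarrow> w \<in> R \<times> R \<Longrightarrow> cm z w \<in> R \<times> R"
  unfolding cm_def by (auto intro!: subspace_add subspace_diff R_mult)

text \<open>
  A derivation of the complexified associative algebra is nilpotent as soon as it is nilpotent on the
  complexification of \<open>L\<close>, because it kills the unit; its exponential is then multiplicative.
\<close>

lemma inner_automorphism_extends:
  assumes "inner_automorphism L br \<phi>"
  shows "\<exists>\<Phi>. multiplicative_extension \<phi> \<Phi>"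
  using assms
proof (induction rule: inner_automorphism.induct)
  case inner_id
  show ?case by (rule exI[of _ "\<lambda>z. z"]) (auto simp: multiplicative_extension_def)
next
  case (inner_exp \<phi> x)
  then obtain \<Phi> where Phi: "multiplicative_extension \<phi> \<Phi>" by blast
  interpret c: ralg cm by (rule ralg_cm)
  interpret d: derivation cm "cbracket br x" by (rule derivation_cbracket)
  let ?D = "cbracket br x"
  have xR: "x \<in> R \<times> R" using inner_exp.hyps(2) by auto
  have RR: "subspace (R \<times> R)" by (intro subspace_Times subspace_R)
  have D_R: "?D z \<in> R \<times> R" if "z \<in> R \<times> R" for z
    unfolding cbracket_eq using that xR by (intro subspace_diff[OF RR] cm_R)
  have Dpow_R: "(?D ^^ i) z \<in> R \<times> R" if "z \<in> R \<times> R" for z i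
    using that by (induction i) (use D_R in auto)
  obtain N where N: "\<And>z. z \<in> L \<times> L \<Longrightarrow> (?D ^^ N) z = 0"
    using inner_exp.hyps(3) unfolding ad_nilpotent_def by blast
  have Du: "?D (c *\<^sub>R u, c' *\<^sub>R u) = 0" for c c'
    using xR unfolding cbracket_eq cm_def by (auto simp: prod_eq_iff)
  \<comment> \<open>\<open>z\<close> and its traceless part \<open>l\<close> differ by scalars,
    which one application of \<open>?D\<close> removes; the other N applications kill what
    remains.\<close>
  have nil: "(?D ^^ Suc N) z = 0" if z: "z \<in> R \<times> R" for z
  proof -
    define l where "l = (fst z - (tr (fst z) / k) *\<^sub>R u, snd z - (tr (snd z) / k) *\<^sub>R u)"
    have l: "l \<in> L \<times> L" using z traceless_in_L unfolding l_def by auto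
    have "z = l + ((tr (fst z) / k) *\<^sub>R u, (tr (snd z) / k) *\<^sub>R u)" unfolding l_def by (simp add: prod_eq_iff)
    then have "?D z = ?D l" using Du linear_add[OF d.linear_D] by (metis add.right_neutral)
    then have "(?D ^^ Suc N) z = (?D ^^ N) (?D l)" by (simp add: funpow_swap1)
    also have "\<dots> = ?D ((?D ^^ N) l)" by (simp add: funpow_swap1)
    finally show ?thesis using N[OF l] linear_0[OF d.linear_D] by simp
  qed
  have E_R: "d.expD z \<in> R \<times> R" if "z \<in> R \<times> R" for z
    unfolding d.expD_eq[OF nil[OF that]]
    by (intro subspace_sum[OF RR] subspace_scale[OF RR] Dpow_R that)
  show ?case
  proof (rule exI[of _ "\<lambda>z. exp_ad br x (\<Phi> z)"], unfold multiplicative_extension_def, intro conjI ballI allI)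
    show "exp_ad br x (\<Phi> (c *\<^sub>R u, 0)) = (c *\<^sub>R u, 0)" for c
    proof -
      have "(?D ^^ 1) (c *\<^sub>R u, 0) = 0" using Du[of c 0] by simp
      then have "d.expD (c *\<^sub>R u, 0) = (c *\<^sub>R u, 0)" using d.expD_eq[of 1] by simp
      then show ?thesis using Phi unfolding exp_ad_eq multiplicative_extension_def by simp
    qed
    fix z w assume z: "z \<in> R \<times> R" and w: "w \<in> R \<times> R"
    then have zw: "\<Phi> z \<in> R \<times> R" "\<Phi> w \<in> R \<times> R" using Phi unfolding multiplicative_extension_def by blast+
    have "\<Phi> (z + w) = \<Phi> z + \<Phi> w" using Phi z w unfolding multiplicative_extension_def by blast
    then show "exp_ad br x (\<Phi> (z + w)) = exp_ad br x (\<Phi> z) + exp_ad br x (\<Phi> w)"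
      using d.expD_add[OF nil[OF zw(1)] nil[OF zw(2)]] unfolding exp_ad_eq by simp
    have "\<Phi> (cm z w) = cm (\<Phi> z) (\<Phi> w)" using Phi z w unfolding multiplicative_extension_def by blast
    then show "exp_ad br x (\<Phi> (cm z w)) = cm (exp_ad br x (\<Phi> z)) (exp_ad br x (\<Phi> w))"
      using d.expD_mult(2)[OF nil[OF zw(1)] nil[OF zw(2)]] unfolding exp_ad_eq by simp
  next
    fix z assume "z \<in> R \<times> R"
    then have "\<Phi> z \<in> R \<times> R" using Phi unfolding multiplicative_extension_def by blast
    then show "exp_ad br x (\<Phi> z) \<in> R \<times> R" unfolding exp_ad_eq by (rule E_R)
  qed (use Phi in \<open>auto simp: multiplicative_extension_def\<close>)
qed

definition unital :: "('g, 'n) monoid_scheme \<Rightarrow> ('g \<Rightarrow> 'a set) \<Rightarrow> 'g \<Rightarrow> 'a set" where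
  "unital G \<Gamma> g = (if g = \<one>\<^bsub>G\<^esub> then {x + c *\<^sub>R u | x c. x \<in> \<Gamma> g} else \<Gamma> g)"

lemma finite_support: "lie_grading L br G \<Gamma> \<Longrightarrow> finite (grading_support G \<Gamma>)"
  using lie_grading_finite_support[OF _ subspace_L _ finite_imageI[OF finite_idx, of b]] L_subset
  unfolding R_def by blast

lemma cm_cscale: "cm (cscale a (x, 0)) (cscale c (y, 0)) = cscale (a * c) (x \<star> y, 0)"
  by (auto simp: cm_def cscale_def prod_eq_iff algebra_simps)

text \<open>The multiplicative extension of \<open>\<phi>\<close> scales \<open>x \<star> y\<close>
  by \<open>\<kappa> g * \<kappa> h\<close>, each part \<open>f s\<close> by
  \<open>\<kappa> s\<close>, and the unit by 1. Components and unit are independent, so the factors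
  agree wherever a part is nonzero. As the parts are vectors over the reals, real and imaginary
  parts of the factors are compared separately.\<close>

lemma inner_multiplicative:
  assumes gr: "lie_grading L br G \<Gamma>"
    and phi: "inner_automorphism L br \<phi>"
       "\<And>g z. g \<in> grading_support G \<Gamma> \<Longrightarrow> z \<in> \<Gamma> g \<times> \<Gamma> g \<Longrightarrow> \<phi> z = cscale (\<kappa> g) z"
    and gh: "g \<in> grading_support G \<Gamma>" "h \<in> grading_support G \<Gamma>" "x \<in> \<Gamma> g" "y \<in> \<Gamma> h"
    and f: "\<And>s. s \<in> grading_support G \<Gamma> \<Longrightarrow> f s \<in> \<Gamma> s" 
      "x \<star> y = (\<Sum>s\<in>grading_support G \<Gamma>. f s) + c *\<^sub>R u"
  shows "s \<in> grading_support G \<Gamma> \<Longrightarrow> f s \<noteq> 0 \<Longrightarrow> \<kappa> s = \<kappa> g * \<kappa> h" "c \<noteq> 0 \<Longrightarrow> \<kappa> g * \<kappa> h = 1"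
proof -
  let ?S = "grading_support G \<Gamma>"
  have fin: "finite ?S" using finite_support gr by blast
  have Sc: "?S \<subseteq> carrier G" unfolding grading_support_def by auto
  have sub: "subspace (\<Gamma> s)" "\<Gamma> s \<subseteq> L" if "s \<in> ?S" for s using gr that Sc unfolding lie_grading_def by auto
  have in0: "(v, 0) \<in> \<Gamma> s \<times> \<Gamma> s" "(v, 0) \<in> L \<times> L" "(v, 0) \<in> R \<times> R" if "s \<in> ?S" "v \<in> \<Gamma> s" for v s
    using sub[OF that(1)] that(2) by (auto simp: subspace_0)
  obtain \<Phi> where Phi: "multiplicative_extension \<phi> \<Phi>" using inner_automorphism_extends[OF phi(1)] by blast
  have PhiG: "\<Phi> (v, 0) = cscale (\<kappa> s) (v, 0)" if "s \<in> ?S" "v \<in> \<Gamma> s" for v s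
    using Phi in0[OF that] phi(2)[OF that(1) in0(1)[OF that]] unfolding multiplicative_extension_def by simp
  have Phi_mult: "\<Phi> (cm z w) = cm (\<Phi> z) (\<Phi> w)" and Phi_add: "\<Phi> (z + w) = \<Phi> z + \<Phi> w"
    if "z \<in> R \<times> R" "w \<in> R \<times> R" for z w
    using Phi that unfolding multiplicative_extension_def by blast+
  let ?d = "\<kappa> g * \<kappa> h"
  have 1: "\<Phi> (x \<star> y, 0) = cscale ?d (x \<star> y, 0)"
  proof -
    have "\<Phi> (cm (x, 0) (y, 0)) = cm (cscale (\<kappa> g) (x, 0)) (cscale (\<kappa> h) (y, 0))"
      using Phi_mult[OF in0(3)[OF gh(1,3)] in0(3)[OF gh(2,4)]] PhiG[OF gh(1,3)] PhiG[OF gh(2,4)] by simp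
    then show ?thesis unfolding cm_cscale by (simp add: cm_def)
  qed
  have sum: "(\<Sum>s\<in>T. f s) \<in> R \<and> \<Phi> (\<Sum>s\<in>T. f s, 0) = (\<Sum>s\<in>T. cscale (\<kappa> s) (f s, 0))"
    if "T \<subseteq> ?S" for T
    using finite_subset[OF that fin] that
  proof (induction T rule: finite_induct)
    case empty
    have "\<Phi> (0 *\<^sub>R u, 0) = (0 *\<^sub>R u, 0)" using Phi unfolding multiplicative_extension_def by blast
    then show ?case by (simp add: subspace_0 zero_prod_def)
  next
    case (insert t T)
    then have t: "t \<in> ?S" "f t \<in> \<Gamma> t" using f by auto
    have "\<Phi> ((f t, 0) + (\<Sum>s\<in>T. f s, 0)) = \<Phi> (f t, 0) + \<Phi> (\<Sum>s\<in>T. f s, 0)"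
      using in0(3)[OF t] insert by (intro Phi_add) (auto simp: subspace_0)
    then show ?case using insert in0(3)[OF t] PhiG[OF t] by (simp add: subspace_add)
  qed
  have "\<Phi> (x \<star> y, 0) = (\<Sum>s\<in>?S. cscale (\<kappa> s) (f s, 0)) + (c *\<^sub>R u, 0)"
  proof -
    have "\<Phi> ((\<Sum>s\<in>?S. f s, 0) + (c *\<^sub>R u, 0)) = \<Phi> (\<Sum>s\<in>?S. f s, 0) + \<Phi> (c *\<^sub>R u, 0)"
      using sum by (intro Phi_add) (auto simp: subspace_0 subspace_scale)
    then show ?thesis using f(2) sum[OF order.refl] Phi unfolding multiplicative_extension_def by simp
  qed
  then have eq: "cscale ?d (x \<star> y, 0) = (\<Sum>s\<in>?S. cscale (\<kappa> s) (f s, 0)) + (c *\<^sub>R u, 0)" using 1 by simp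
  have cs: "(\<Sum>s\<in>?S. cscale (\<kappa> s) (f s, 0)) = (\<Sum>s\<in>?S. Re (\<kappa> s) *\<^sub>R f s, \<Sum>s\<in>?S. Im (\<kappa> s) *\<^sub>R f s)"
    by (simp add: cscale_def prod_eq_iff fst_sum snd_sum)
  have re: "(\<Sum>s\<in>?S. (Re ?d - Re (\<kappa> s)) *\<^sub>R f s) + ((Re ?d - 1) * c) *\<^sub>R u = 0"
    and im: "(\<Sum>s\<in>?S. (Im ?d - Im (\<kappa> s)) *\<^sub>R f s) + (Im ?d * c) *\<^sub>R u = 0"
  proof -
    have e: "Re ?d *\<^sub>R (sum f ?S + c *\<^sub>R u) = (\<Sum>s\<in>?S. Re (\<kappa> s) *\<^sub>R f s) + c *\<^sub>R u"
      "Im ?d *\<^sub>R (sum f ?S + c *\<^sub>R u) = (\<Sum>s\<in>?S. Im (\<kappa> s) *\<^sub>R f s)"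
      using eq unfolding cs f(2) cscale_def by (simp_all only: prod_eq_iff fst_conv snd_conv fst_add snd_add) (simp_all add: fst_sum snd_sum)
    have l: "(\<Sum>s\<in>?S. (a - a' s) *\<^sub>R f s) = a *\<^sub>R sum f ?S - (\<Sum>s\<in>?S. a' s *\<^sub>R f s)" for a :: real and a'
      by (simp add: scaleR_diff_left sum_subtractf scaleR_sum_right)
    show "(\<Sum>s\<in>?S. (Re ?d - Re (\<kappa> s)) *\<^sub>R f s) + ((Re ?d - 1) * c) *\<^sub>R u = 0"
    proof -
      have aux: "x - y + (p - q) = (x + p) - (y + q)" for x y p q :: 'a by simp
      show ?thesis
        unfolding l using e(1)
        by (simp add: scaleR_add_right scaleR_diff_left left_diff_distrib aux del: times_complex.sel)
    qed
    show "(\<Sum>s\<in>?S. (Im ?d - Im (\<kappa> s)) *\<^sub>R f s) + (Im ?d * c) *\<^sub>R u = 0"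
    proof -
      have aux: "x - y + p = (x + p) - y" for x y p :: 'a by simp
      show ?thesis
        unfolding l using e(2) by (simp add: scaleR_add_right aux del: times_complex.sel)
    qed
  qed
  \<comment> \<open>All components are traceless, so the trace isolates the coefficient of
    \<open>u\<close>; the rest is independence of the components.\<close>
  have key: "(\<forall>s\<in>?S. a s *\<^sub>R f s = 0) \<and> e = 0" if ae: "(\<Sum>s\<in>?S. a s *\<^sub>R f s) + e *\<^sub>R u = 0" for a :: "_ \<Rightarrow> real" and e
  proof -
    have m: "a s *\<^sub>R f s \<in> \<Gamma> s" if "s \<in> ?S" for s using sub(1)[OF that] f(1)[OF that] by (rule subspace_scale)
    then have "(\<Sum>s\<in>?S. a s *\<^sub>R f s) \<in> L" using sub(2) by (intro subspace_sum[OF subspace_L]) auto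
    moreover have "(\<Sum>s\<in>?S. a s *\<^sub>R f s) = (- e) *\<^sub>R u" using ae by (simp add: add_eq_0_iff2)
    ultimately have "tr ((- e) *\<^sub>R u) = 0" using tr_L by metis
    then have "e = 0" using k_pos by simp
    then have "(\<Sum>s\<in>?S. a s *\<^sub>R f s) = 0" using ae by simp
    then show ?thesis using lie_grading_indep[OF gr subspace_0[OF subspace_L] fin Sc m] \<open>e = 0\<close> by blast
  qed
  show "\<kappa> s = ?d" if "s \<in> ?S" "f s \<noteq> 0"
    using key[OF re] key[OF im] that by (auto simp add: complex_eq_iff)
  show "?d = 1" if "c \<noteq> 0"
    using key[OF re] key[OF im] that by (simp add: complex_eq_iff)
qed

text \<open>Write the product of elements of degrees g and h as a sum of parts \<open>f s\<close>
  plus a scalar. If \<open>f s\<close> is nonzero, every character takes the same value at s and at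
  gh; if the scalar is nonzero, every character is 1 at gh. Characters separate points, so only
  degree gh occurs, and a scalar only if gh is the identity.\<close>

theorem associative_grading:
  assumes gr: "lie_grading L br G \<Gamma>"
    and inner: "inner_grading L br (universal_group br G \<Gamma>) (universal_grading br G \<Gamma>)"
    and g: "g \<in> carrier G" "h \<in> carrier G" "x \<in> unital G \<Gamma> g" "y \<in> unital G \<Gamma> h"
  shows "x \<star> y \<in> unital G \<Gamma> (g \<otimes>\<^bsub>G\<^esub> h)"
proof -
  interpret G: comm_group G using gr unfolding lie_grading_def by simp
  let ?S = "grading_support G \<Gamma>"
  have fin: "finite ?S" using finite_support gr by blast
  have Sc: "?S \<subseteq> carrier G" unfolding grading_support_def by auto
  have sub: "subspace (\<Gamma> s)" "\<Gamma> s \<subseteq> L" if "s \<in> carrier G" for s using gr that unfolding lie_grading_def by auto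
  have zero: "x = 0" if "x \<in> \<Gamma> s" "s \<in> carrier G" "s \<notin> ?S" for x s using that unfolding grading_support_def by auto
  have subU: "subspace (unital G \<Gamma> s)" if "s \<in> carrier G" for s
  proof (cases "s = \<one>\<^bsub>G\<^esub>")
    case True
    have "{x + c *\<^sub>R u | x c. x \<in> \<Gamma> s} = {x + y | x y. x \<in> \<Gamma> s \<and> y \<in> span {u}}"
      by (auto simp: span_singleton)
    then show ?thesis using subspace_sums[OF sub(1)[OF that] subspace_span[of "{u}"]] True unfolding unital_def by simp
  qed (use sub that in \<open>simp add: unital_def\<close>)
  have uU: "d *\<^sub>R u \<in> unital G \<Gamma> \<one>\<^bsub>G\<^esub>" for d
  proof -
    have "0 \<in> \<Gamma> \<one>\<^bsub>G\<^esub>" using sub(1)[OF G.one_closed] by (simp add: subspace_0)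
    then show ?thesis unfolding unital_def by (auto intro!: exI[of _ "0::'a"] exI[of _ d])
  qed
  have main: "x \<star> y \<in> unital G \<Gamma> (g \<otimes>\<^bsub>G\<^esub> h)"
    if gh: "g \<in> ?S" "h \<in> ?S" and xy: "x \<in> \<Gamma> g" "y \<in> \<Gamma> h" for g h x y
  proof -
    have c: "g \<in> carrier G" "h \<in> carrier G" using gh Sc by auto
    have xyR: "x \<star> y \<in> R" using xy sub c by (meson L_R R_mult subsetD)
    define c where "c = tr (x \<star> y) / k"
    obtain f where f: "\<And>s. s \<in> ?S \<Longrightarrow> f s \<in> \<Gamma> s" "x \<star> y - c *\<^sub>R u = (\<Sum>s\<in>?S. f s)"
      using lie_grading_sum[OF gr fin traceless_in_L[OF xyR]] unfolding c_def by blast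
    then have f2: "x \<star> y = (\<Sum>s\<in>?S. f s) + c *\<^sub>R u" by (simp add: algebra_simps)
    have sep': "(\<forall>s\<in>?S. f s \<noteq> 0 \<longrightarrow> \<chi> s = \<chi> g * \<chi> h) \<and> (c \<noteq> 0 \<longrightarrow> \<chi> g * \<chi> h = 1)"
      if H: "subgroup H G" "?S \<subseteq> H" and chi: "is_character G H \<chi>" for H \<chi>
    proof -
      have nz: "\<chi> s \<noteq> 0" if "s \<in> ?S" for s using chi H that unfolding is_character_def by blast
      have mul: "\<chi> (s \<otimes>\<^bsub>G\<^esub> t) = \<chi> s * \<chi> t" if "s \<in> ?S" "t \<in> ?S" for s t
        using chi H that unfolding is_character_def by blast
      obtain \<phi> where phi: "inner_automorphism L br \<phi>"
        "\<And>g z. g \<in> ?S \<Longrightarrow> z \<in> \<Gamma> g \<times> \<Gamma> g \<Longrightarrow> \<phi> z = cscale (\<chi> g) z"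
        by (rule inner_grading_character[OF gr inner, where \<kappa> = \<chi>]) (use nz mul in blast)+
      show ?thesis
        using inner_multiplicative[where \<kappa> = \<chi> and f = f and c = c, OF gr phi gh xy f(1) f2] by blast
    qed
    have only: "s = g \<otimes>\<^bsub>G\<^esub> h" if s: "s \<in> ?S" "f s \<noteq> 0" for s
    proof (rule ccontr)
      assume ne: "s \<noteq> g \<otimes>\<^bsub>G\<^esub> h"
      have sc: "s \<in> carrier G" using s Sc by auto
      let ?a = "inv\<^bsub>G\<^esub> s \<otimes>\<^bsub>G\<^esub> (g \<otimes>\<^bsub>G\<^esub> h)"
      have "?a \<noteq> \<one>\<^bsub>G\<^esub>" using ne sc c by (metis G.inv_equality G.inv_inv G.m_closed G.inv_closed)
      moreover have "?a \<in> carrier G" using sc c by simp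
      ultimately obtain H \<chi> where H: "subgroup H G" "?a \<in> H" "?S \<subseteq> H" "is_character G H \<chi>" "\<chi> ?a \<noteq> 1"
        using G.characters_separate[OF _ _ fin Sc] by metis
      have "g \<in> H" "h \<in> H" "s \<in> H" using H(3) gh s by auto
      then have ghH: "g \<otimes>\<^bsub>G\<^esub> h \<in> H" "g \<in> H" "h \<in> H" "s \<in> H" using subgroup.m_closed[OF H(1)] by simp_all
      have "g \<otimes>\<^bsub>G\<^esub> h = s \<otimes>\<^bsub>G\<^esub> ?a" using sc c by (simp add: G.m_assoc[symmetric])
      then have "\<chi> g * \<chi> h = \<chi> s * \<chi> ?a" using H(2,4) ghH unfolding is_character_def by metis
      moreover have "\<chi> s = \<chi> g * \<chi> h" using sep'[OF H(1,3,4)] s by blast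
      moreover have "\<chi> s \<noteq> 0" using H(4) ghH unfolding is_character_def by blast
      ultimately show False using H(5) by simp
    qed
    have c1: "g \<otimes>\<^bsub>G\<^esub> h = \<one>\<^bsub>G\<^esub>" if "c \<noteq> 0"
    proof (rule ccontr)
      assume "g \<otimes>\<^bsub>G\<^esub> h \<noteq> \<one>\<^bsub>G\<^esub>"
      moreover have "g \<otimes>\<^bsub>G\<^esub> h \<in> carrier G" using c by simp
      ultimately obtain H \<chi> where H: "subgroup H G" "g \<otimes>\<^bsub>G\<^esub> h \<in> H" "?S \<subseteq> H" "is_character G H \<chi>" "\<chi> (g \<otimes>\<^bsub>G\<^esub> h) \<noteq> 1"
        using G.characters_separate[OF _ _ fin Sc] by metis
      have "g \<in> H" "h \<in> H" using H(3) gh by auto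
      then have "\<chi> (g \<otimes>\<^bsub>G\<^esub> h) = \<chi> g * \<chi> h" using H(4) unfolding is_character_def by blast
      then show False using sep'[OF H(1,3,4)] that H(5) by simp
    qed
    have ghc: "g \<otimes>\<^bsub>G\<^esub> h \<in> carrier G" using c by simp
    have inU: "\<Gamma> (g \<otimes>\<^bsub>G\<^esub> h) \<subseteq> unital G \<Gamma> (g \<otimes>\<^bsub>G\<^esub> h)"
      unfolding unital_def by (auto intro!: exI[of _ "0::real"])
    have "f s \<in> unital G \<Gamma> (g \<otimes>\<^bsub>G\<^esub> h)" if "s \<in> ?S" for s
      using only[OF that] f(1)[OF that] inU subspace_0[OF subU[OF ghc]] by (cases "f s = 0") auto
    moreover have "c *\<^sub>R u \<in> unital G \<Gamma> (g \<otimes>\<^bsub>G\<^esub> h)"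
    proof (cases "c = 0")
      case False
      then show ?thesis using c1 uU by simp
    qed (simp add: subspace_0[OF subU[OF ghc]])
    ultimately show ?thesis unfolding f2 by (intro subspace_add subspace_sum subU ghc) auto
  qed
  have main': "x \<star> y \<in> unital G \<Gamma> (g \<otimes>\<^bsub>G\<^esub> h)"
    if "g \<in> carrier G" "h \<in> carrier G" "x \<in> \<Gamma> g" "y \<in> \<Gamma> h" for g h x y
    using main[of g h x y] that zero[of x g] zero[of y h] subspace_0[OF subU[OF G.m_closed[OF that(1,2)]]]
    by (cases "g \<in> ?S"; cases "h \<in> ?S") auto
  have inU: "\<Gamma> s \<subseteq> unital G \<Gamma> s" for s
    unfolding unital_def by (auto intro!: exI[of _ "0::real"])
  have split: "\<exists>x' c. x = x' + c *\<^sub>R u \<and> x' \<in> \<Gamma> g \<and> (c \<noteq> 0 \<longrightarrow> g = \<one>\<^bsub>G\<^esub>)" if "x \<in> unital G \<Gamma> g" for x g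
  proof (cases "g = \<one>\<^bsub>G\<^esub>")
    case False
    then show ?thesis using that unfolding unital_def by (auto intro!: exI[of _ x] exI[of _ "0::real"])
  qed (use that in \<open>auto simp: unital_def\<close>)
  obtain x' c where x: "x = x' + c *\<^sub>R u" "x' \<in> \<Gamma> g" "c \<noteq> 0 \<Longrightarrow> g = \<one>\<^bsub>G\<^esub>" using split[OF g(3)] by blast
  obtain y' d where y: "y = y' + d *\<^sub>R u" "y' \<in> \<Gamma> h" "d \<noteq> 0 \<Longrightarrow> h = \<one>\<^bsub>G\<^esub>" using split[OF g(4)] by blast
  have R': "x' \<in> R" "y' \<in> R" using x(2) y(2) sub(2)[OF g(1)] sub(2)[OF g(2)] L_R by blast+
  have eq: "x \<star> y = x' \<star> y' + d *\<^sub>R x' + c *\<^sub>R y' + (c * d) *\<^sub>R u"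
    unfolding x(1) y(1) using R' by (simp add: distribs algebra_simps)
  have ghc: "g \<otimes>\<^bsub>G\<^esub> h \<in> carrier G" using g by simp
  let ?W = "unital G \<Gamma> (g \<otimes>\<^bsub>G\<^esub> h)"
  have W: "subspace ?W" by (rule subU[OF ghc])
  have "d *\<^sub>R x' \<in> ?W"
  proof (cases "d = 0")
    case False
    then have "x' \<in> ?W" using x(2) y(3) inU g by auto
    then show ?thesis by (rule subspace_scale[OF W])
  qed (simp add: subspace_0[OF W])
  moreover have "c *\<^sub>R y' \<in> ?W"
  proof (cases "c = 0")
    case False
    then have "y' \<in> ?W" using y(2) x(3) inU g by auto
    then show ?thesis by (rule subspace_scale[OF W])
  qed (simp add: subspace_0[OF W])
  moreover have "(c * d) *\<^sub>R u \<in> ?W"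
  proof (cases "c * d = 0")
    case False
    then show ?thesis using x(3) y(3) uU by simp
  qed (use subspace_0[OF W] in auto)
  ultimately show ?thesis unfolding eq using main'[OF g(1,2) x(2) y(2)] by (intro subspace_add[OF W])
qed

end

section \<open>Graded matrix units\<close>

lemma subspace_eq_by_dim:
  fixes A A' :: "'a::real_vector set"
  assumes "subspace A" "subspace A'" "A \<subseteq> A'" "A' \<subseteq> span T" "finite T" "dim A' \<le> dim A"
  shows "A = A'"
proof -
  obtain BA where BA: "BA \<subseteq> A" "independent BA" "A \<subseteq> span BA" "card BA = dim A"
    using real_vector.basis_exists by blast
  obtain BB where BB: "BB \<subseteq> A'" "independent BB" "A' \<subseteq> span BB" "card BB = dim A'"
    using real_vector.basis_exists by blast
  have "finite BB" using real_vector.independent_span_bound[OF assms(5) BB(2)] BB(1) assms(4) by auto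
  then have "A' \<subseteq> span BA"
    using independent_card_span[OF BA(2) _ BB(3)] BA BB assms by auto
  then show ?thesis using span_minimal[OF BA(1) assms(1)] assms(3) by auto
qed

locale graded_type_I = type_I mult hq k m B + comm_group G
  for mult :: "'a::real_vector \<Rightarrow> 'a \<Rightarrow> 'a" (infixl "\<star>" 70)
    and hq k m B and G :: "('g, 'n) monoid_scheme" (structure) +
  fixes S :: "'g set" and V :: "'g \<Rightarrow> 'a set"
  assumes finite_S: "finite S" and S_carrier: "S \<subseteq> carrier G"
    and subspace_V: "g \<in> carrier G \<Longrightarrow> subspace (V g)"
    and V_R: "g \<in> carrier G \<Longrightarrow> x \<in> V g \<Longrightarrow> x \<in> R"
    and V_zero: "g \<in> carrier G \<Longrightarrow> g \<notin> S \<Longrightarrow> x \<in> V g \<Longrightarrow> x = 0"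
    and V_mult: "g \<in> carrier G \<Longrightarrow> g' \<in> carrier G \<Longrightarrow> x \<in> V g \<Longrightarrow> y \<in> V g' \<Longrightarrow> x \<star> y \<in> V (g \<otimes> g')"
    and V_sum: "x \<in> R \<Longrightarrow> \<exists>f. (\<forall>g\<in>S. f g \<in> V g) \<and> x = (\<Sum>g\<in>S. f g)"
    and V_indep: "(\<And>g. g \<in> S \<Longrightarrow> f g \<in> V g) \<Longrightarrow> (\<Sum>g\<in>S. f g) = 0 \<Longrightarrow> g \<in> S \<Longrightarrow> f g = 0"
    and u_V: "u \<in> V \<one>"
begin

lemma V_indep':
  assumes T: "finite T" "T \<subseteq> carrier G" "\<And>t. t \<in> T \<Longrightarrow> f t \<in> V t" "(\<Sum>t\<in>T. f t) = 0" "t \<in> T"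
  shows "f t = 0"
proof -
  define f' where "f' = (\<lambda>s. if s \<in> T then f s else 0)"
  have out: "f t = 0" if "t \<in> T" "t \<notin> S" for t using V_zero[of t "f t"] T that by auto
  have "(\<Sum>s\<in>S. f' s) = (\<Sum>s\<in>S \<inter> T. f s)"
    unfolding f'_def using finite_S by (simp add: sum.If_cases)
  also have "\<dots> = (\<Sum>t\<in>T. f t)"
    using T(1) out by (intro sum.mono_neutral_left) auto
  finally have "(\<Sum>s\<in>S. f' s) = 0" using T by simp
  moreover have "f' s \<in> V s" if "s \<in> S" for s
    using that T(3) S_carrier subspace_0[OF subspace_V] unfolding f'_def by auto
  ultimately have "f' s = 0" if "s \<in> S" for s using V_indep that by blast
  then show ?thesis using out T(5) unfolding f'_def by (cases "t \<in> S") metis+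
qed

lemma V_disjoint:
  assumes "x \<in> V g" "x \<in> V g'" "g \<in> carrier G" "g' \<in> carrier G" "g \<noteq> g'" shows "x = 0"
proof -
  have "(\<lambda>t. if t = g then x else - x) g = 0"
  proof (rule V_indep'[where T = "{g, g'}" and t = g and f = "\<lambda>t. if t = g then x else - x"])
    have "- x \<in> V g'" using subspace_neg[OF subspace_V[OF assms(4)] assms(2)] .
    then show "(if t = g then x else - x) \<in> V t" if "t \<in> {g, g'}" for t
      using that assms(1) by auto
    show "(\<Sum>t\<in>{g, g'}. if t = g then x else - x) = 0" using assms(5) by simp
  qed (use assms(3,4) in auto)
  then show ?thesis by simp
qed

text \<open>\<open>f\<close> shifts degrees by \<open>c\<close>, so the part of \<open>f r\<close>
  in degree \<open>d\<close> comes from the part of \<open>r\<close> in degree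
  \<open>d \<otimes> inv c\<close> alone. This makes solutions of linear equations in
  \<open>R\<close> homogeneous.\<close>

lemma hom_solve:
  assumes f: "linear f" and c: "c \<in> carrier G" "\<And>s x. s \<in> carrier G \<Longrightarrow> x \<in> V s \<Longrightarrow> f x \<in> V (s \<otimes> c)"
    and r: "r \<in> R" "f r \<in> V d" "d \<in> carrier G"
  obtains r' where "r' \<in> V (d \<otimes> inv c)" "f r' = f r"
proof -
  obtain w where w: "\<And>s. s \<in> S \<Longrightarrow> w s \<in> V s" "r = (\<Sum>s\<in>S. w s)" using V_sum[OF r(1)] by blast
  define T where "T = insert d ((\<lambda>s. s \<otimes> c) ` S)"
  \<comment> \<open>\<open>w1\<close> lists the homogeneous parts of \<open>f r\<close>, and
    \<open>w2\<close> places all of \<open>f r\<close> in degree \<open>d\<close>. Uniqueness of the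
    decomposition makes them agree at \<open>d\<close>.\<close>
  define w1 where "w1 = (\<lambda>t. if t \<otimes> inv c \<in> S then f (w (t \<otimes> inv c)) else 0)"
  define w2 where "w2 = (\<lambda>t. if t = d then f r else 0)"
  have Tc: "finite T" "T \<subseteq> carrier G" unfolding T_def using finite_S S_carrier c r by auto
  have canc: "t \<otimes> inv c \<otimes> c = t" "t \<otimes> c \<otimes> inv c = t" if "t \<in> carrier G" for t
    using that c by (simp_all add: m_assoc)
  have w1V: "w1 t \<in> V t" if "t \<in> carrier G" for t
    using that w c(2)[of "t \<otimes> inv c" "w (t \<otimes> inv c)"] canc(1)[OF that] c subspace_0[OF subspace_V[OF that]]
    unfolding w1_def by auto
  have inj: "inj_on (\<lambda>s. s \<otimes> c) S" using canc(2) S_carrier by (intro inj_on_inverseI[of _ "\<lambda>t. t \<otimes> inv c"]) auto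
  have "(\<Sum>t\<in>T. w1 t) = (\<Sum>t\<in>(\<lambda>s. s \<otimes> c) ` S. w1 t)"
  proof (rule sum.mono_neutral_right)
    show "\<forall>t\<in>T - (\<lambda>s. s \<otimes> c) ` S. w1 t = 0"
      unfolding w1_def using canc Tc by (auto simp: image_iff) (metis canc(1) subsetD)
  qed (use Tc in \<open>auto simp: T_def\<close>)
  also have "\<dots> = (\<Sum>s\<in>S. f (w s))"
    unfolding sum.reindex[OF inj] using canc(2) S_carrier by (intro sum.cong) (auto simp: w1_def)
  also have "\<dots> = f r" unfolding w(2) by (rule linear_sum[OF f, symmetric])
  finally have s1: "(\<Sum>t\<in>T. w1 t) = f r" .
  have s2: "(\<Sum>t\<in>T. w2 t) = f r" unfolding w2_def using Tc by (simp add: T_def)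
  have "w1 d - w2 d = 0"
  proof (rule V_indep'[OF Tc])
    show "w1 t - w2 t \<in> V t" if "t \<in> T" for t
      using that Tc w1V r subspace_0[OF subspace_V[of t]] unfolding w2_def
      by (intro subspace_diff[OF subspace_V]) auto
    show "(\<Sum>t\<in>T. w1 t - w2 t) = 0" by (simp add: sum_subtractf s1 s2)
  qed (simp add: T_def)
  then have *: "f r = w1 d" unfolding w2_def by simp
  show thesis
  proof (cases "d \<otimes> inv c \<in> S")
    case True
    then show thesis using that[of "w (d \<otimes> inv c)"] w * unfolding w1_def by auto
  next
    case False
    then show thesis using that[of 0] * r c linear_0[OF f] subspace_0[OF subspace_V] unfolding w1_def by auto
  qed
qed

lemma hom_left:
  assumes "r \<in> R" "a \<in> V c" "r \<star> a \<in> V d" "c \<in> carrier G" "d \<in> carrier G"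
  obtains r' where "r' \<in> V (d \<otimes> inv c)" "r' \<star> a = r \<star> a"
  using hom_solve[of "\<lambda>r. r \<star> a" c r d] linear_mult_left assms V_mult by metis

lemma hom_nonzero:
  assumes "linear f" "r \<in> R" "f r \<noteq> 0"
  obtains s r' where "s \<in> carrier G" "r' \<in> V s" "f r' \<noteq> 0"
proof -
  obtain w where w: "\<And>s. s \<in> S \<Longrightarrow> w s \<in> V s" "r = (\<Sum>s\<in>S. w s)" using V_sum[OF assms(2)] by blast
  have "f r = (\<Sum>s\<in>S. f (w s))" unfolding w(2) by (rule linear_sum[OF assms(1)])
  then obtain s where "s \<in> S" "f (w s) \<noteq> 0" using assms(3) by (metis sum.neutral)
  then show thesis using that w S_carrier by blast
qed

text \<open>A graded form of Brauer's lemma. Among nonzero homogeneous \<open>x\<close> take one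
  with \<open>R x\<close> of least dimension. Primeness gives a homogeneous \<open>y\<close> in
  \<open>R x\<close> with xy nonzero; minimality makes \<open>R x y\<close> equal to
  \<open>R x\<close>, so y = r2 x y, and \<open>e = r2 \<star> x\<close> fixes \<open>y\<close>.
  That every nonzero homogeneous element of \<open>R e\<close> can be multiplied back to
  \<open>e\<close> is minimality again.\<close>

lemma minimal_idempotent:
  obtains e where "e \<in> V \<one>" "e \<noteq> 0" "e \<star> e = e"
    "\<And>g y. g \<in> carrier G \<Longrightarrow> y \<in> V g \<Longrightarrow> y \<noteq> 0 \<Longrightarrow> y \<star> e = y \<Longrightarrow> \<exists>r\<in>V (inv g). r \<star> y = e"
proof -
  define I where "I = (\<lambda>x. (\<lambda>r. r \<star> x) ` R)"
  define P where "P = (\<lambda>x. x \<noteq> 0 \<and> (\<exists>g\<in>carrier G. x \<in> V g))"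
  have "P u" unfolding P_def using u_nz u_V by blast
  then obtain x where x: "P x" "\<And>y. P y \<Longrightarrow> dim (I x) \<le> dim (I y)"
    using ex_has_least_nat[of P u "\<lambda>x. dim (I x)"] by blast
  have PR: "y \<in> R" if "P y" for y using that V_R unfolding P_def by blast
  have IR: "I y \<subseteq> R" if "y \<in> R" for y unfolding I_def using that by auto
  have Isub: "subspace (I y)" for y unfolding I_def
    by (rule linear_subspace_image[OF linear_mult_left subspace_R])
  have self: "y \<in> I y" if "y \<in> R" for y unfolding I_def using that by (auto intro!: image_eqI[of _ _ u])
  have min: "I y = I x" if y: "P y" "y \<in> I x" for y
  proof (rule subspace_eq_by_dim[OF Isub Isub])
    show "I y \<subseteq> I x" using y(2) unfolding I_def by (auto simp: mult_assoc[symmetric] intro!: imageI R_mult)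
    show "I x \<subseteq> span (b ` idx)" using IR[OF PR[OF x(1)]] unfolding R_def .
  qed (use x(2)[OF y(1)] in auto)
  obtain g where g: "g \<in> carrier G" "x \<in> V g" "x \<noteq> 0" using x(1) unfolding P_def by blast
  obtain r0 where r0: "r0 \<in> R" "x \<star> r0 \<star> x \<noteq> 0" using R_prime[of x x] g V_R by metis
  have lin: "linear (\<lambda>r. x \<star> r \<star> x)" by (rule linearI) (simp_all add: distribs)
  obtain s r where r: "s \<in> carrier G" "r \<in> V s" "x \<star> r \<star> x \<noteq> 0"
    using hom_nonzero[OF lin r0] by blast
  define y where "y = r \<star> x"
  define d where "d = s \<otimes> g"
  have d: "d \<in> carrier G" unfolding d_def using r g by simp
  have y: "y \<in> V d" "x \<star> y \<noteq> 0" unfolding y_def d_def using V_mult r g by (auto simp: mult_assoc)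
  have y0: "y \<noteq> 0" using y(2) by auto
  have rR: "r \<in> R" using r V_R by blast
  have yI: "y \<in> I x" unfolding y_def I_def using rR by auto
  have xy: "P (x \<star> y)" "x \<star> y \<in> I x" "x \<star> y \<in> V (g \<otimes> d)"
    using V_mult[OF g(1) d g(2) y(1)] y(2) g(1) d rR V_R[OF g(1,2)] unfolding P_def I_def y_def
    by (auto simp: mult_assoc[symmetric] intro!: imageI bexI[of _ "g \<otimes> d"])
  have "y \<in> I (x \<star> y)" using min[OF xy(1,2)] yI by simp
  then obtain r1 where r1: "r1 \<in> R" "y = r1 \<star> (x \<star> y)" unfolding I_def by auto
  obtain r2 where r2: "r2 \<in> V (d \<otimes> inv (g \<otimes> d))" "r2 \<star> (x \<star> y) = y"
    using hom_left[OF r1(1) xy(3), of d] r1(2) y(1) g d by (metis m_closed)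
  have dg: "d \<otimes> inv (g \<otimes> d) = inv g"
    using g d by (simp add: inv_mult m_assoc[symmetric] m_comm)
  have r2V: "r2 \<in> V (inv g)" using r2 dg by simp
  define e where "e = r2 \<star> x"
  have eV: "e \<in> V \<one>" using V_mult[OF _ g(1) r2V g(2)] g unfolding e_def by simp
  have ey: "e \<star> y = y" using r2 unfolding e_def by (simp add: mult_assoc)
  have e0: "e \<noteq> 0" using ey y0 by auto
  have r2R: "r2 \<in> R" using r2V V_R g by blast
  have eI: "e \<in> I x" unfolding e_def I_def using r2R by auto
  have eR: "e \<in> R" using eV V_R by blast
  \<comment> \<open>\<open>w\<close> kills \<open>y\<close> from the left. If it were nonzero,
    minimality would put \<open>x\<close> into \<open>R w\<close>, and xy would vanish.\<close>
  define w where "w = e \<star> e - e"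
  have wV: "w \<in> V \<one>" unfolding w_def
    using V_mult[OF one_closed one_closed eV eV] eV by (intro subspace_diff[OF subspace_V]) auto
  have wI: "w \<in> I x" unfolding w_def
  proof (rule subspace_diff[OF Isub _ eI])
    show "e \<star> e \<in> I x" unfolding I_def using eR r2R by (subst (2) e_def) (auto simp: mult_assoc[symmetric] intro!: imageI)
  qed
  have wy: "w \<star> y = 0" unfolding w_def by (simp add: distribs mult_assoc ey)
  have "w = 0"
  proof (rule ccontr)
    assume "w \<noteq> 0"
    then have "I w = I x" using min wI wV unfolding P_def by blast
    then obtain r where "x = r \<star> w" using self[of x] V_R g unfolding I_def by blast
    then have "x \<star> y = r \<star> (w \<star> y)" by (simp add: mult_assoc)
    then show False using wy y by simp
  qed
  then have ee: "e \<star> e = e" unfolding w_def by simp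
  have Ie: "I e = I x" using min eI eV e0 unfolding P_def by blast
  show thesis
  proof (rule that[OF eV e0 ee])
    fix g y assume y: "g \<in> carrier G" "y \<in> V g" "y \<noteq> 0" "y \<star> e = y"
    have "y \<in> I e" unfolding I_def using y V_R by (auto intro!: image_eqI[of _ _ y])
    then have "I y = I x" using Ie min[of y] y unfolding P_def by auto
    then have "e \<in> I y" using eI by simp
    then obtain r where r: "r \<in> R" "e = r \<star> y" unfolding I_def by auto
    obtain r' where "r' \<in> V (\<one> \<otimes> inv g)" "r' \<star> y = e"
      using hom_left[OF r(1) y(2), of \<one>] r(2) eV y(1) by (metis one_closed)
    then show "\<exists>r\<in>V (inv g). r \<star> y = e" using y(1) by auto
  qed
qed

end

text \<open>Presents \<open>R\<close> as matrices of size \<open>n\<close> over the centralizer of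
  the \<open>E i j\<close>; \<open>E_division\<close> makes this centralizer a graded division
  algebra.\<close>

locale graded_matrix = graded_type_I +
  fixes n :: nat and E :: "nat \<Rightarrow> nat \<Rightarrow> 'a" and d :: "nat \<Rightarrow> 'c"
  assumes n_pos: "0 < n" and d_carrier: "i < n \<Longrightarrow> d i \<in> carrier G"
    and E_V: "i < n \<Longrightarrow> j < n \<Longrightarrow> E i j \<in> V (d i \<otimes> inv (d j))"
    and E_mult: "i < n \<Longrightarrow> j < n \<Longrightarrow> p < n \<Longrightarrow> q < n \<Longrightarrow> E i j \<star> E p q = (if j = p then E i q else 0)"
    and E_sum: "(\<Sum>i<n. E i i) = u"
    and E_division: "g \<in> carrier G \<Longrightarrow> c \<in> V g \<Longrightarrow> c \<noteq> 0 \<Longrightarrow>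
      (\<And>i j. i < n \<Longrightarrow> j < n \<Longrightarrow> c \<star> E i j = E i j \<star> c) \<Longrightarrow>
      \<exists>c'\<in>V (inv g). (\<forall>i<n. \<forall>j<n. c' \<star> E i j = E i j \<star> c') \<and> c \<star> c' = u \<and> c' \<star> c = u"

context graded_type_I
begin

text \<open>Take a maximal system with \<open>x i\<close> in \<open>e R\<close>, \<open>y i\<close>
  in \<open>R e\<close> and \<open>x i \<star> y j\<close> equal to \<open>e\<close> or 0 as in an
  orthonormal basis, and let \<open>y i \<star> x j\<close> be the matrix units. The idempotent
  \<open>f\<close> that completes the diagonal to \<open>u\<close> is orthogonal to the system; if
  it were nonzero, primeness and the property of \<open>e\<close> would yield one more pair from
  \<open>f R e\<close> and \<open>e R f\<close>. Sizes are bounded because the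
  \<open>y i \<star> x i\<close> are independent.\<close>

lemma graded_matrix_exists:
  obtains n E d where "graded_matrix mult hq k m B G S V n E d"
proof -
  obtain e where e: "e \<in> V \<one>" "e \<noteq> 0" "e \<star> e = e"
    and inv_e: "\<And>g y. g \<in> carrier G \<Longrightarrow> y \<in> V g \<Longrightarrow> y \<noteq> 0 \<Longrightarrow> y \<star> e = y \<Longrightarrow> \<exists>r\<in>V (inv g). r \<star> y = e"
    using minimal_idempotent by blast
  have eR: "e \<in> R" using e V_R by blast
  define fam where "fam = (\<lambda>(n::nat) x y d. \<forall>i<n. d i \<in> carrier G \<and> x i \<in> V (inv (d i)) \<and> y i \<in> V (d i) \<and>
     e \<star> x i = x i \<and> y i \<star> e = y i \<and> (\<forall>j<n. x i \<star> y j = (if i = j then e else 0)))"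
  define Q where "Q = (\<lambda>n. \<exists>x y d. fam n x y d)"
  have bound: "n \<le> card (b ` idx)" if fam: "fam n x y d" for n x y d
  proof -
    let ?v = "\<lambda>i. y i \<star> x i"
    have *: "\<forall>i\<in>{..<n}. c i = 0" if c: "(\<Sum>i<n. c i *\<^sub>R ?v i) = 0" for c
    proof
      fix j assume j: "j \<in> {..<n}"
      have "x j \<star> (\<Sum>i<n. c i *\<^sub>R ?v i) \<star> y j = (\<Sum>i<n. c i *\<^sub>R ((x j \<star> y i) \<star> (x i \<star> y j)))"
        by (simp add: mult_sum_left mult_sum_right mult_assoc)
      also have "\<dots> = (\<Sum>i<n. if i = j then c j *\<^sub>R e else 0)"
        using fam j e(3) unfolding fam_def by (intro sum.cong) auto
      also have "\<dots> = c j *\<^sub>R e" using j by simp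
      finally show "c j = 0" using c e(2) by simp
    qed
    have "?v i \<in> R" if "i < n" for i
      using fam that V_R unfolding fam_def by (meson R_mult inv_closed)
    then have "?v ` {..<n} \<subseteq> span (b ` idx)" unfolding R_def by auto
    moreover have "inj_on ?v {..<n}" "independent (?v ` {..<n})"
      using family_independent[of "{..<n}" ?v] * by auto
    ultimately have "card (?v ` {..<n}) \<le> card (b ` idx)"
      using real_vector.independent_span_bound[OF finite_imageI[OF finite_idx]] by blast
    then show ?thesis using card_image[OF \<open>inj_on ?v {..<n}\<close>] by simp
  qed
  have "Q 0" unfolding Q_def fam_def by simp
  moreover have "\<forall>n. Q n \<longrightarrow> n \<le> card (b ` idx)" using bound unfolding Q_def by blast
  ultimately obtain n where n: "Q n" "\<And>n'. Q n' \<Longrightarrow> n' \<le> n"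
    using GreatestI_nat[of Q 0 "card (b ` idx)"] Greatest_le_nat[of Q _ "card (b ` idx)"] by blast
  obtain x y d where fam: "fam n x y d" using n(1) unfolding Q_def by blast
  then have D: "\<And>i. i < n \<Longrightarrow> d i \<in> carrier G" "\<And>i. i < n \<Longrightarrow> x i \<in> V (inv (d i))" "\<And>i. i < n \<Longrightarrow> y i \<in> V (d i)"
    "\<And>i. i < n \<Longrightarrow> e \<star> x i = x i" "\<And>i. i < n \<Longrightarrow> y i \<star> e = y i"
    "\<And>i j. i < n \<Longrightarrow> j < n \<Longrightarrow> x i \<star> y j = (if i = j then e else 0)" unfolding fam_def by blast+
  have xyR: "x i \<in> R" "y i \<in> R" if "i < n" for i using D(1-3)[OF that] V_R by (meson inv_closed)+
  have ey: "x i \<star> (y j \<star> w) = (if i = j then e \<star> w else 0)" if "i < n" "j < n" for i j w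
    using D(6)[OF that] by (simp add: mult_assoc[symmetric])
  define f where "f = u - (\<Sum>i<n. y i \<star> x i)"
  have yxV: "y i \<star> x i \<in> V \<one>" if "i < n" for i
    using V_mult[OF _ _ D(3)[OF that] D(2)[OF that]] D(1)[OF that] by simp
  have fV: "f \<in> V \<one>" unfolding f_def
    using u_V yxV by (intro subspace_diff[OF subspace_V] subspace_sum[OF subspace_V]) auto
  have fR: "f \<in> R" using fV V_R by blast
  have xf: "x i \<star> f = 0" if "i < n" for i
  proof -
    have "x i \<star> (\<Sum>j<n. y j \<star> x j) = (\<Sum>j<n. if i = j then x i else 0)"
      unfolding mult_sum_right using that D(4) by (intro sum.cong) (auto simp: ey)
    then show ?thesis unfolding f_def using that xyR by (simp add: distribs)
  qed
  have fy: "f \<star> y i = 0" if "i < n" for i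
  proof -
    have "(\<Sum>j<n. y j \<star> x j) \<star> y i = (\<Sum>j<n. if i = j then y i else 0)"
      unfolding mult_sum_left mult_assoc using that D(5,6) by (intro sum.cong) auto
    then show ?thesis unfolding f_def using that xyR by (simp add: distribs)
  qed
  have ff: "f \<star> f = f"
  proof -
    have "(\<Sum>j<n. y j \<star> x j) \<star> f = 0" unfolding mult_sum_left mult_assoc using xf by simp
    then show ?thesis using fR by (subst (1) f_def) (simp add: distribs)
  qed
  have "f = 0"
  proof (rule ccontr)
    assume "f \<noteq> 0"
    then obtain r0 where r0: "r0 \<in> R" "f \<star> r0 \<star> e \<noteq> 0" using R_prime[OF fR eR] e(2) by blast
    have lin: "linear (\<lambda>r. f \<star> r \<star> e)" by (rule linearI) (simp_all add: distribs)
    obtain s r where r: "s \<in> carrier G" "r \<in> V s" "f \<star> r \<star> e \<noteq> 0" using hom_nonzero[OF lin r0] by blast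
    define yn where "yn = f \<star> r \<star> e"
    have yn: "yn \<in> V s" unfolding yn_def using V_mult[OF _ _ V_mult[OF _ _ fV r(2)] e(1)] r(1) by simp
    have yne: "yn \<star> e = yn" unfolding yn_def by (simp add: mult_assoc e)
    have fyn: "f \<star> yn = yn" unfolding yn_def by (simp add: mult_assoc[symmetric] ff)
    obtain x0 where x0: "x0 \<in> V (inv s)" "x0 \<star> yn = e" using inv_e[OF r(1) yn _ yne] r(3) unfolding yn_def by blast
    define xn where "xn = e \<star> x0 \<star> f"
    have xn: "xn \<in> V (inv s)" unfolding xn_def using V_mult[OF _ _ V_mult[OF _ _ e(1) x0(1)] fV] r(1) by simp
    have exn: "e \<star> xn = xn" unfolding xn_def by (simp add: mult_assoc[symmetric] e)
    have xyn: "xn \<star> yn = e" unfolding xn_def by (simp add: mult_assoc fyn x0 e)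
    have xny: "xn \<star> y j = 0" if "j < n" for j unfolding xn_def using that by (simp add: mult_assoc fy)
    have xyn': "x i \<star> yn = 0" if "i < n" for i unfolding yn_def using xf[OF that] by (simp add: mult_assoc[symmetric])
    have "fam (Suc n) (x(n := xn)) (y(n := yn)) (d(n := s))"
      unfolding fam_def using D xn yn r(1) exn yne xyn xny xyn' by (auto simp: less_Suc_eq)
    then have "Suc n \<le> n" using n(2) unfolding Q_def by blast
    then show False by simp
  qed
  then have sum: "(\<Sum>i<n. y i \<star> x i) = u" unfolding f_def by simp
  have npos: "0 < n" using sum u_nz by (cases n) auto
  show thesis
  proof (rule that[of n "\<lambda>i j. y i \<star> x j" d], unfold_locales)
    show "0 < n" by (rule npos)
    show "(\<Sum>i<n. y i \<star> x i) = u" by (rule sum)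
    show Em: "y i \<star> x j \<star> (y p \<star> x q) = (if j = p then y i \<star> x q else 0)"
      if "i < n" "j < n" "p < n" "q < n" for i j p q
      using that D(4) by (auto simp: mult_assoc ey)
    fix g c assume c: "g \<in> carrier G" "c \<in> V g" "c \<noteq> 0"
      "\<And>i j. i < n \<Longrightarrow> j < n \<Longrightarrow> c \<star> (y i \<star> x j) = y i \<star> x j \<star> c"
    have key: "\<exists>c'\<in>V (inv g). (\<forall>i<n. \<forall>j<n. c' \<star> (y i \<star> x j) = y i \<star> x j \<star> c') \<and> c' \<star> c = u"
      if c: "g \<in> carrier G" "c \<in> V g" "c \<noteq> 0"
      "\<And>i j. i < n \<Longrightarrow> j < n \<Longrightarrow> c \<star> (y i \<star> x j) = y i \<star> x j \<star> c" for g c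
    proof -
      have cR: "c \<in> R" using c V_R by blast
      \<comment> \<open>The image of \<open>c\<close> in \<open>e R e\<close>, where nonzero
        homogeneous elements have left inverses; \<open>c'\<close> spreads such an inverse along the
        diagonal.\<close>
      define z where "z = x 0 \<star> c \<star> y 0"
      have xc: "x i \<star> c = z \<star> x i" if "i < n" for i
      proof -
        have "x i \<star> c = x 0 \<star> (y 0 \<star> x i \<star> c)" using that npos D(4) by (simp add: mult_assoc ey mult_assoc[symmetric, of e])
        also have "\<dots> = x 0 \<star> (c \<star> (y 0 \<star> x i))" using c(4)[OF npos that] by simp
        finally show ?thesis unfolding z_def by (simp add: mult_assoc)
      qed
      have zV: "z \<in> V g"
      proof -
        have "z \<in> V (inv (d 0) \<otimes> g \<otimes> d 0)" unfolding z_def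
          using V_mult[OF _ _ V_mult[OF _ _ D(2)[OF npos] c(2)] D(3)[OF npos]] D(1)[OF npos] c(1) by simp
        also have "inv (d 0) \<otimes> g \<otimes> d 0 = g" using D(1)[OF npos] c(1)
          by (metis inv_closed inv_solve_left m_assoc m_closed m_comm)
        finally show ?thesis .
      qed
      have ze: "z \<star> e = z" unfolding z_def using D(5)[OF npos] by (simp add: mult_assoc)
      have z0: "z \<noteq> 0"
      proof
        assume "z = 0"
        then have "y i \<star> x i \<star> c = 0" if "i < n" for i using xc[OF that] by (simp add: mult_assoc)
        then have "(\<Sum>i<n. y i \<star> x i) \<star> c = 0" unfolding mult_sum_left by simp
        then show False using sum cR c(3) by simp
      qed
      obtain r where r: "r \<in> V (inv g)" "r \<star> z = e" using inv_e[OF c(1) zV z0 ze] by blast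
      define r' where "r' = e \<star> r \<star> e"
      have r'V: "r' \<in> V (inv g)" unfolding r'_def
        using V_mult[OF _ _ V_mult[OF _ _ e(1) r(1)] e(1)] c(1) by simp
      have ez: "e \<star> z = z" unfolding z_def using D(4)[OF npos] by (simp add: mult_assoc[symmetric])
      have r': "r' \<star> z = e" "e \<star> r' = r'" "r' \<star> e = r'" unfolding r'_def
        by (simp_all add: mult_assoc ez r e) (simp_all add: mult_assoc[symmetric] e)
      define c' where "c' = (\<Sum>i<n. y i \<star> r' \<star> x i)"
      have c'V: "c' \<in> V (inv g)" unfolding c'_def
      proof (rule subspace_sum[OF subspace_V])
        fix i assume "i \<in> {..<n}"
        then have i: "i < n" by simp
        have "y i \<star> r' \<star> x i \<in> V (d i \<otimes> inv g \<otimes> inv (d i))"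
          using V_mult[OF _ _ V_mult[OF _ _ D(3)[OF i] r'V] D(2)[OF i]] D(1)[OF i] c(1) by simp
        also have "d i \<otimes> inv g \<otimes> inv (d i) = inv g" using D(1)[OF i] c(1)
          by (metis inv_closed inv_solve_right m_closed m_comm)
        finally show "y i \<star> r' \<star> x i \<in> V (inv g)" .
      qed (use c in simp)
      have "c' \<star> c = (\<Sum>i<n. y i \<star> (r' \<star> z) \<star> x i)"
        unfolding c'_def mult_sum_left using xc by (intro sum.cong) (auto simp: mult_assoc)
      also have "\<dots> = u" using r' D(4) sum by (simp add: mult_assoc)
      finally have "c' \<star> c = u" .
      moreover have "c' \<star> (y p \<star> x q) = y p \<star> x q \<star> c'" if "p < n" "q < n" for p q
      proof -
        have "c' \<star> (y p \<star> x q) = (\<Sum>i<n. if i = p then y p \<star> r' \<star> x q else 0)"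
          unfolding c'_def mult_sum_left using that r' D(4)
          by (intro sum.cong) (auto simp: mult_assoc ey)
        moreover have "y p \<star> x q \<star> c' = (\<Sum>i<n. if i = q then y p \<star> r' \<star> x q else 0)"
          unfolding c'_def mult_sum_right using that r'
          by (intro sum.cong) (auto simp: mult_assoc ey mult_assoc[symmetric, of e])
        ultimately show ?thesis using that by simp
      qed
      ultimately show ?thesis using c'V by blast
    qed
    obtain c' where c': "c' \<in> V (inv g)" "\<And>i j. i < n \<Longrightarrow> j < n \<Longrightarrow> c' \<star> (y i \<star> x j) = y i \<star> x j \<star> c'" "c' \<star> c = u"
      using key[OF c] by blast
    \<comment> \<open>\<open>c'\<close> itself has a left inverse, which must then be
      \<open>c\<close>; so the inverse is two-sided.\<close>
    have "c' \<noteq> 0" using c'(3) u_nz by auto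
    then obtain c'' where c'': "c'' \<star> c' = u" "c'' \<in> V (inv (inv g))" using key[OF _ c'(1) _ c'(2)] c(1) by blast
    have cR: "c \<in> R" "c'' \<in> R" using c V_R c'' by auto
    have "c'' = c'' \<star> (c' \<star> c)" using c'(3) cR by simp
    also have "\<dots> = c" using c''(1) cR by (simp add: mult_assoc[symmetric])
    finally have "c \<star> c' = u" using c''(1) by simp
    then show "\<exists>c'\<in>V (inv g). (\<forall>i<n. \<forall>j<n. c' \<star> (y i \<star> x j) = y i \<star> x j \<star> c') \<and> c \<star> c' = u \<and> c' \<star> c = u"
      using c' by blast
  next
    fix i j assume "i < n" "j < n"
    then show "y i \<star> x j \<in> V (d i \<otimes> inv (d j))"
      using V_mult[OF _ _ D(3) D(2)] D(1) by simp
  qed (use D in auto)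
qed

end

section \<open>Refining a grading by a diagonalizable automorphism\<close>

text \<open>Replaces the unique finitely supported family by sums over one finite set that contains
  the support, together with independence of the components.\<close>

lemma lie_gradingI:
  assumes "comm_group G" and sub: "\<And>g. g \<in> carrier G \<Longrightarrow> subspace (\<Gamma> g)" "\<And>g. g \<in> carrier G \<Longrightarrow> \<Gamma> g \<subseteq> L"
    and S: "finite S" "S \<subseteq> carrier G" "\<And>g x. g \<in> carrier G \<Longrightarrow> g \<notin> S \<Longrightarrow> x \<in> \<Gamma> g \<Longrightarrow> x = 0"
    and sum: "\<And>x. x \<in> L \<Longrightarrow> \<exists>f. (\<forall>g\<in>S. f g \<in> \<Gamma> g) \<and> x = (\<Sum>g\<in>S. f g)"
    and indep: "\<And>f g. (\<And>g. g \<in> S \<Longrightarrow> f g \<in> \<Gamma> g) \<Longrightarrow> (\<Sum>g\<in>S. f g) = 0 \<Longrightarrow> g \<in> S \<Longrightarrow> f g = 0"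
    and br: "\<And>g h x y. g \<in> carrier G \<Longrightarrow> h \<in> carrier G \<Longrightarrow> x \<in> \<Gamma> g \<Longrightarrow> y \<in> \<Gamma> h \<Longrightarrow> br x y \<in> \<Gamma> (g \<otimes>\<^bsub>G\<^esub> h)"
  shows "lie_grading L br G \<Gamma>"
proof -
  have "\<exists>!f. (\<forall>g\<in>carrier G. f g \<in> \<Gamma> g) \<and> (\<forall>g. g \<notin> carrier G \<longrightarrow> f g = 0) \<and>
        finite {g. f g \<noteq> 0} \<and> x = (\<Sum>g | f g \<noteq> 0. f g)" (is "\<exists>!f. ?P f") if x: "x \<in> L" for x
  proof (rule ex_ex1I)
    obtain f where f: "\<forall>g\<in>S. f g \<in> \<Gamma> g" "x = (\<Sum>g\<in>S. f g)" using sum x by blast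
    define f' where "f' = (\<lambda>g. if g \<in> S then f g else 0)"
    have "?P f'"
    proof (intro conjI ballI allI impI)
      show "f' g \<in> \<Gamma> g" if "g \<in> carrier G" for g
        using f(1) subspace_0[OF sub(1)[OF that]] unfolding f'_def by auto
      show "f' g = 0" if "g \<notin> carrier G" for g using that S(2) unfolding f'_def by auto
      have "{g. f' g \<noteq> 0} \<subseteq> S" unfolding f'_def by auto
      then show "finite {g. f' g \<noteq> 0}" using S(1) finite_subset by blast
      show "x = (\<Sum>g | f' g \<noteq> 0. f' g)" unfolding f(2)
        using S(1) by (intro sum.mono_neutral_cong_right) (auto simp: f'_def)
    qed
    then show "\<exists>f. ?P f" by (rule exI[where P = "?P"])
  next
    fix f1 f2 assume f1: "?P f1" and f2: "?P f2"
    have zero: "f g = 0" if "?P f" "g \<notin> S" for f g using that S(3)[of g "f g"] by (cases "g \<in> carrier G") auto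
    have eq: "x = (\<Sum>g\<in>S. f g)" if "?P f" for f
    proof -
      have "x = (\<Sum>g | f g \<noteq> 0. f g)" using that by simp
      also have "\<dots> = (\<Sum>g\<in>S. f g)" using S(1) zero[OF that] by (intro sum.mono_neutral_left) auto
      finally show ?thesis .
    qed
    have "(\<Sum>g\<in>S. f1 g - f2 g) = 0" using eq[OF f1] eq[OF f2] by (simp add: sum_subtractf)
    moreover have "f1 g - f2 g \<in> \<Gamma> g" if "g \<in> S" for g
      using f1 f2 that S(2) sub(1) by (intro subspace_diff) auto
    ultimately have *: "f1 g - f2 g = 0" if "g \<in> S" for g using indep[of "\<lambda>g. f1 g - f2 g"] that by blast
    show "f1 = f2"
    proof
      fix g show "f1 g = f2 g" using *[of g] zero[OF f1, of g] zero[OF f2, of g] by (cases "g \<in> S") auto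
    qed
  qed
  note ex = this
  show ?thesis unfolding lie_grading_def
    by (intro conjI ballI, rule assms(1), erule sub(1), erule sub(2), erule ex, erule br, assumption+)
qed

text \<open>Every element of the generated subgroup is the value of a finite word in generators and
  their inverses; the flag in a letter marks an inverse.\<close>

lemma countable_generate:
  assumes "group G" "finite A" "A \<subseteq> carrier G"
  shows "countable (generate G A)"
proof -
  interpret group G by fact
  define f where "f = rec_list \<one>\<^bsub>G\<^esub> (\<lambda>p _ r. (if snd p then inv\<^bsub>G\<^esub> (fst p) else fst p) \<otimes>\<^bsub>G\<^esub> r)"
  have f: "f [] = \<one>\<^bsub>G\<^esub>" "f (p # ps) = (if snd p then inv\<^bsub>G\<^esub> (fst p) else fst p) \<otimes>\<^bsub>G\<^esub> f ps" for p ps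
    unfolding f_def by simp_all
  let ?W = "lists (A \<times> (UNIV :: bool set))"
  have c: "f ps \<in> carrier G" if "ps \<in> ?W" for ps
    using that by (induction ps) (use assms(3) in \<open>auto simp: f\<close>)
  have app: "f (ps @ qs) = f ps \<otimes>\<^bsub>G\<^esub> f qs" if "ps \<in> ?W" "qs \<in> ?W" for ps qs
    using that(1)
  proof (induction ps)
    case Nil
    then show ?case using c[OF that(2)] by (simp add: f)
  next
    case (Cons p ps)
    then have "(if snd p then inv\<^bsub>G\<^esub> (fst p) else fst p) \<in> carrier G" "ps \<in> ?W" using assms(3) by auto
    then show ?case using Cons.IH c that(2) by (simp only: append_Cons f m_assoc)
  qed
  have "generate G A \<subseteq> f ` ?W"
  proof
    fix x assume "x \<in> generate G A"
    then show "x \<in> f ` ?W"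
    proof (induction rule: generate.induct)
      case one
      then show ?case using f(1) by (intro image_eqI[of _ _ "[]"]) auto
    next
      case (incl h)
      then show ?case using assms(3) by (intro image_eqI[of _ _ "[(h, False)]"]) (auto simp: f)
    next
      case (inv h)
      then show ?case using assms(3) by (intro image_eqI[of _ _ "[(h, True)]"]) (auto simp: f)
    next
      case (eng h1 h2)
      then obtain p q where "p \<in> ?W" "q \<in> ?W" "h1 = f p" "h2 = f q" by blast
      then show ?case using app by (intro image_eqI[of _ _ "p @ q"]) auto
    qed
  qed
  moreover have "countable ?W"
    using assms(2) by (intro countable_lists) (auto intro: countable_finite)
  ultimately show ?thesis by (meson countable_image countable_subset)
qed

text \<open>\<open>fine_grading\<close> tests refinements over groups carried by natural numbers,
  whereas refinements arise over other groups. The finite support generates a countable subgroup,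
  which is transported along an enumeration and still indexes all nonzero components.\<close>

lemma lie_grading_over_nat:
  assumes gr: "lie_grading L br K \<Gamma>" and L: "0 \<in> L" and fin: "finite (grading_support K \<Gamma>)"
  obtains H :: "nat monoid" and \<Gamma>' where "lie_grading L br H \<Gamma>'"
    "\<And>h. h \<in> carrier H \<Longrightarrow> \<exists>s\<in>carrier K. \<Gamma>' h = \<Gamma> s"
    "\<And>s. s \<in> grading_support K \<Gamma> \<Longrightarrow> \<exists>h\<in>carrier H. \<Gamma>' h = \<Gamma> s"
proof -
  interpret K: comm_group K using gr unfolding lie_grading_def by simp
  let ?S = "grading_support K \<Gamma>"
  have Sc: "?S \<subseteq> carrier K" unfolding grading_support_def by auto
  define M where "M = generate K ?S"
  have SM: "?S \<subseteq> M" unfolding M_def by (auto intro: generate.incl)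
  have Msub: "subgroup M K" unfolding M_def by (rule K.generate_is_subgroup[OF Sc])
  have Mc: "x \<in> carrier K" if "x \<in> M" for x using subgroup.mem_carrier[OF Msub that] .
  have cM: "countable M" unfolding M_def by (rule countable_generate[OF K.group_axioms fin Sc])
  define e where "e = to_nat_on M"
  define r where "r = from_nat_into M"
  have inj: "inj_on e M" unfolding e_def by (rule inj_on_to_nat_on[OF cM])
  have re: "r (e x) = x" if "x \<in> M" for x unfolding r_def e_def using from_nat_into_to_nat_on[OF cM that] .
  define H :: "nat monoid" where
    "H = \<lparr>carrier = e ` M, monoid.mult = (\<lambda>a b. e (r a \<otimes>\<^bsub>K\<^esub> r b)), one = e \<one>\<^bsub>K\<^esub>\<rparr>"
  have Mcl: "x \<otimes>\<^bsub>K\<^esub> y \<in> M" "\<one>\<^bsub>K\<^esub> \<in> M" "inv\<^bsub>K\<^esub> x \<in> M" if "x \<in> M" "y \<in> M" for x y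
    using Msub that by (auto simp: subgroup.m_closed subgroup.one_closed subgroup.m_inv_closed)
  have one: "\<one>\<^bsub>K\<^esub> \<in> M" using Msub by (simp add: subgroup.one_closed)
  have H: "comm_group H"
  proof (rule comm_groupI)
    fix a assume "a \<in> carrier H"
    then obtain x where x: "x \<in> M" "a = e x" unfolding H_def by auto
    show "\<exists>y\<in>carrier H. y \<otimes>\<^bsub>H\<^esub> a = \<one>\<^bsub>H\<^esub>"
      using x Mcl(3)[OF x(1) x(1)] Mc re by (intro bexI[of _ "e (inv\<^bsub>K\<^esub> x)"]) (auto simp: H_def)
  qed (auto simp: H_def re Mcl one Mc K.m_ac)
  define \<Gamma>' where "\<Gamma>' = (\<lambda>h. \<Gamma> (r h))"
  have sub: "subspace (\<Gamma> s)" "\<Gamma> s \<subseteq> L" if "s \<in> carrier K" for s using gr that unfolding lie_grading_def by auto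
  have inje: "inj_on e ?S" using inj SM inj_on_subset by blast
  show thesis
  proof (rule that[of H \<Gamma>'])
    show "\<exists>s\<in>carrier K. \<Gamma>' h = \<Gamma> s" if "h \<in> carrier H" for h
      using that Mc re unfolding H_def \<Gamma>'_def by auto
    show "\<exists>h\<in>carrier H. \<Gamma>' h = \<Gamma> s" if "s \<in> ?S" for s
    proof -
      have "s \<in> M" using that SM by blast
      then show ?thesis using re unfolding H_def \<Gamma>'_def by auto
    qed
    show "lie_grading L br H \<Gamma>'"
    proof (rule lie_gradingI[OF H, where S = "e ` ?S"])
      show "subspace (\<Gamma>' h)" "\<Gamma>' h \<subseteq> L" if h: "h \<in> carrier H" for h
      proof -
        obtain x where x: "x \<in> M" "h = e x" using h unfolding H_def by auto
        show "subspace (\<Gamma>' h)" "\<Gamma>' h \<subseteq> L"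
          using sub[OF Mc[OF x(1)]] re[OF x(1)] unfolding \<Gamma>'_def x(2) by simp_all
      qed
      show "finite (e ` ?S)" using fin by simp
      show "e ` ?S \<subseteq> carrier H" using SM unfolding H_def by auto
      show "x = 0" if h: "h \<in> carrier H" "h \<notin> e ` ?S" "x \<in> \<Gamma>' h" for h x
      proof -
        obtain y where y: "y \<in> M" "h = e y" using h unfolding H_def by auto
        then have "y \<notin> ?S" using h by auto
        then show ?thesis using h(3) y re Mc unfolding \<Gamma>'_def grading_support_def by auto
      qed
    next
      fix x assume "x \<in> L"
      then obtain f where f: "\<And>g. g \<in> ?S \<Longrightarrow> f g \<in> \<Gamma> g" "x = (\<Sum>g\<in>?S. f g)"
        using lie_grading_sum[OF gr fin] by blast
      show "\<exists>f. (\<forall>h\<in>e ` ?S. f h \<in> \<Gamma>' h) \<and> x = (\<Sum>h\<in>e ` ?S. f h)"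
        using f SM re by (intro exI[of _ "\<lambda>h. f (r h)"])
          (auto simp: sum.reindex[OF inje] \<Gamma>'_def subset_iff intro!: sum.cong)
    next
      fix f h assume f: "\<And>h. h \<in> e ` ?S \<Longrightarrow> f h \<in> \<Gamma>' h" "(\<Sum>h\<in>e ` ?S. f h) = 0" "h \<in> e ` ?S"
      have rS: "r (e s) = s" if "s \<in> ?S" for s using re SM that by blast
      have m: "f (e s) \<in> \<Gamma> s" if "s \<in> ?S" for s using f(1)[of "e s"] rS[OF that] that unfolding \<Gamma>'_def by auto
      have z: "(\<Sum>s\<in>?S. f (e s)) = 0" using f(2) by (simp add: sum.reindex[OF inje])
      obtain s where s: "s \<in> ?S" "h = e s" using f(3) by auto
      show "f h = 0" unfolding s(2)
        by (rule lie_grading_indep[where f = "\<lambda>s. f (e s)", OF gr L fin Sc m z s(1)])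
    next
      fix g h x y assume *: "g \<in> carrier H" "h \<in> carrier H" "x \<in> \<Gamma>' g" "y \<in> \<Gamma>' h"
      then obtain a c where ac: "a \<in> M" "c \<in> M" "g = e a" "h = e c" unfolding H_def by auto
      have "br x y \<in> \<Gamma> (a \<otimes>\<^bsub>K\<^esub> c)"
        using gr * ac Mc re unfolding lie_grading_def \<Gamma>'_def by simp
      then show "br x y \<in> \<Gamma>' (g \<otimes>\<^bsub>H\<^esub> h)"
        using ac re Mcl unfolding \<Gamma>'_def H_def by simp
    qed
  qed
qed

lemma eigenvectors_independent:
  assumes "linear \<theta>" "finite \<Lambda>" "\<And>l. l \<in> \<Lambda> \<Longrightarrow> \<theta> (f l) = l *\<^sub>R f l" "(\<Sum>l\<in>\<Lambda>. f l) = 0" "l \<in> \<Lambda>"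
  shows "f l = 0"
proof -
  have "\<forall>l\<in>\<Lambda>. f l = 0"
    using assms(2,3,4)
  proof (induction \<Lambda> arbitrary: f rule: finite_induct)
    case (insert p \<Lambda>)
    have s: "f p + (\<Sum>l\<in>\<Lambda>. f l) = 0" using insert.prems insert.hyps by simp
    then have "\<theta> (f p + (\<Sum>l\<in>\<Lambda>. f l)) - p *\<^sub>R (f p + (\<Sum>l\<in>\<Lambda>. f l)) = 0"
      using linear_0[OF assms(1)] by simp
    then have z: "(\<Sum>l\<in>\<Lambda>. (l - p) *\<^sub>R f l) = 0"
      using insert.prems by (simp add: linear_add[OF assms(1)] linear_sum[OF assms(1)] scaleR_add_right
          scaleR_sum_right scaleR_diff_left sum_subtractf)
    have e: "\<theta> ((l - p) *\<^sub>R f l) = l *\<^sub>R ((l - p) *\<^sub>R f l)" if "l \<in> \<Lambda>" for l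
      using insert.prems that by (simp add: linear_cmul[OF assms(1)])
    have "\<forall>l\<in>\<Lambda>. (l - p) *\<^sub>R f l = 0"
      by (rule insert.IH[where f = "\<lambda>l. (l - p) *\<^sub>R f l", OF e z])
    then have "\<forall>l\<in>\<Lambda>. f l = 0" using insert.hyps by auto
    then show ?case using s by simp
  qed simp
  then show ?thesis using assms(5) by blast
qed

lemma finite_eigenvalues:
  assumes "linear \<theta>" "L \<subseteq> span T" "finite T"
  shows "finite {l. \<exists>v\<in>L. v \<noteq> 0 \<and> \<theta> v = l *\<^sub>R v}" (is "finite ?\<Lambda>")
proof -
  have "\<forall>l\<in>?\<Lambda>. \<exists>v. v \<in> L \<and> v \<noteq> 0 \<and> \<theta> v = l *\<^sub>R v" by blast
  from bchoice[OF this] obtain v where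
    v': "\<forall>l\<in>?\<Lambda>. v l \<in> L \<and> v l \<noteq> 0 \<and> \<theta> (v l) = l *\<^sub>R v l" by blast
  have v: "v l \<in> L \<and> v l \<noteq> 0 \<and> \<theta> (v l) = l *\<^sub>R v l" if "l \<in> ?\<Lambda>" for l
    using bspec[OF v' that] .
  have "card I \<le> card T" if I: "I \<subseteq> ?\<Lambda>" "finite I" for I
  proof -
    have *: "\<forall>l\<in>I. c l = 0" if c: "(\<Sum>l\<in>I. c l *\<^sub>R v l) = 0" for c
    proof
      fix l assume l: "l \<in> I"
      have e: "\<theta> (c l *\<^sub>R v l) = l *\<^sub>R (c l *\<^sub>R v l)" if "l \<in> I" for l
        using v[OF subsetD[OF I(1) that]] by (simp add: linear_cmul[OF assms(1)] mult.commute)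
      have "c l *\<^sub>R v l = 0"
        by (rule eigenvectors_independent[where f = "\<lambda>l. c l *\<^sub>R v l", OF assms(1) I(2) e c l])
      then show "c l = 0" using v[OF subsetD[OF I(1) l]] by simp
    qed
    have "inj_on v I" "independent (v ` I)" using family_independent[OF I(2), of v] * by auto
    moreover have "v ` I \<subseteq> span T"
    proof (rule image_subsetI)
      fix l assume "l \<in> I"
      then show "v l \<in> span T" using v[OF subsetD[OF I(1)]] assms(2) by (meson subsetD)
    qed
    ultimately show ?thesis using real_vector.independent_span_bound[OF assms(3)] card_image by metis
  qed
  then show ?thesis using finite_if_finite_subsets_card_bdd[of ?\<Lambda> "card T"] by simp
qed

definition real_units :: "real monoid" where
  "real_units = \<lparr>carrier = UNIV - {0}, monoid.mult = (*), one = 1\<rparr>"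

lemma comm_group_real_units: "comm_group real_units"
proof (rule comm_groupI)
  fix x assume "x \<in> carrier real_units"
  then show "\<exists>y\<in>carrier real_units. y \<otimes>\<^bsub>real_units\<^esub> x = \<one>\<^bsub>real_units\<^esub>"
    by (intro bexI[of _ "inverse x"]) (auto simp: real_units_def)
qed (auto simp: real_units_def mult.assoc mult.commute)

text \<open>The refinement is graded by \<open>G \<times>\<times> real_units\<close>: an eigenvalue
  becomes the second coordinate of the degree, since eigenvalues multiply under a map that preserves
  brackets. This is why \<open>eig\<close> asks for real and nonzero eigenvalues.\<close>

theorem fine_grading_scalar:
  assumes fine: "fine_grading L br G \<Gamma>" and L: "subspace L" "L \<subseteq> span T" "finite T"
    and th: "linear \<theta>" "\<And>x y. x \<in> L \<Longrightarrow> y \<in> L \<Longrightarrow> \<theta> (br x y) = br (\<theta> x) (\<theta> y)"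
    and br: "\<And>x y c c'. br (c *\<^sub>R x) (c' *\<^sub>R y) = (c * c') *\<^sub>R br x y"
    and eig: "\<And>g x. g \<in> carrier G \<Longrightarrow> x \<in> \<Gamma> g \<Longrightarrow> x \<in> span {v \<in> \<Gamma> g. \<exists>l. l \<noteq> 0 \<and> \<theta> v = l *\<^sub>R v}"
    and g0: "g0 \<in> carrier G"
  obtains l where "\<And>x. x \<in> \<Gamma> g0 \<Longrightarrow> \<theta> x = l *\<^sub>R x"
proof (rule ccontr)
  assume nt: "\<not> thesis"
  have gr: "lie_grading L br G \<Gamma>" using fine unfolding fine_grading_def by simp
  interpret G: comm_group G using gr unfolding lie_grading_def by simp
  interpret R: comm_group real_units by (rule comm_group_real_units)
  let ?S = "grading_support G \<Gamma>"
  have Sc: "?S \<subseteq> carrier G" unfolding grading_support_def by auto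
  have fin: "finite ?S" by (rule lie_grading_finite_support[OF gr L])
  have sub: "subspace (\<Gamma> g)" "\<Gamma> g \<subseteq> L" if "g \<in> carrier G" for g using gr that unfolding lie_grading_def by auto
  define \<Lambda> where "\<Lambda> = {l. \<exists>v\<in>L. v \<noteq> 0 \<and> \<theta> v = l *\<^sub>R v} - {0}"
  have finL: "finite \<Lambda>" unfolding \<Lambda>_def using finite_eigenvalues[OF th(1) L(2,3)] by simp
  define K where "K = G \<times>\<times> real_units"
  have K: "comm_group K" unfolding K_def
    by (rule group.group_comm_groupI[OF DirProd_group[OF G.group_axioms R.group_axioms]])
      (auto simp: G.m_comm R.m_comm)
  define \<Gamma>2 where "\<Gamma>2 = (\<lambda>(g, l). {x \<in> \<Gamma> g. \<theta> x = l *\<^sub>R x})"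
  have eigsum: "\<exists>f. (\<forall>l\<in>\<Lambda>. f l \<in> \<Gamma>2 (g, l)) \<and> x = (\<Sum>l\<in>\<Lambda>. f l)" if g: "g \<in> carrier G" "x \<in> \<Gamma> g" for g x
    using eig[OF g]
  proof (induction rule: span_induct_alt)
    case base
    show ?case using subspace_0[OF sub(1)[OF g(1)]] linear_0[OF th(1)]
      by (intro exI[of _ "\<lambda>_. 0"]) (auto simp: \<Gamma>2_def)
  next
    case (step c v y)
    then obtain f l where f: "\<forall>l\<in>\<Lambda>. f l \<in> \<Gamma>2 (g, l)" "y = (\<Sum>l\<in>\<Lambda>. f l)"
      and v: "v \<in> \<Gamma> g" "l \<noteq> 0" "\<theta> v = l *\<^sub>R v" by blast
    show ?case
    proof (cases "v = 0")
      case True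
      then show ?thesis using f by auto
    next
      case False
      then have l: "l \<in> \<Lambda>" using v sub(2)[OF g(1)] unfolding \<Lambda>_def by auto
      have "f l + c *\<^sub>R v \<in> \<Gamma>2 (g, l)"
        using f(1) l v sub(1)[OF g(1)] unfolding \<Gamma>2_def
        by (auto simp: linear_add[OF th(1)] linear_cmul[OF th(1)] scaleR_add_right intro!: subspace_add subspace_scale)
      moreover have "c *\<^sub>R v + y = (\<Sum>l'\<in>\<Lambda>. (f(l := f l + c *\<^sub>R v)) l')"
        unfolding f(2) using finL l by (simp add: sum.remove[of _ l])
      ultimately show ?thesis using f(1) by (intro exI[of _ "f(l := f l + c *\<^sub>R v)"]) auto
    qed
  qed
  have gr2: "lie_grading L br K \<Gamma>2"
  proof (rule lie_gradingI[OF K, where S = "?S \<times> \<Lambda>"])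
    show "subspace (\<Gamma>2 p)" "\<Gamma>2 p \<subseteq> L" if "p \<in> carrier K" for p
      using that sub[of "fst p"] unfolding K_def \<Gamma>2_def subspace_def
      by (auto simp: linear_0[OF th(1)] linear_add[OF th(1)] linear_cmul[OF th(1)] scaleR_add_right)
    show "finite (?S \<times> \<Lambda>)" using fin finL by simp
    show "?S \<times> \<Lambda> \<subseteq> carrier K" using Sc unfolding K_def \<Lambda>_def real_units_def by auto
    show "x = 0" if p0: "p \<in> carrier K" "p \<notin> ?S \<times> \<Lambda>" "x \<in> \<Gamma>2 p" for p x
    proof (rule ccontr)
      assume x: "x \<noteq> 0"
      obtain g l where p: "p = (g, l)" "g \<in> carrier G" "l \<noteq> 0" using p0(1) unfolding K_def real_units_def by auto
      then have xg: "x \<in> \<Gamma> g" "\<theta> x = l *\<^sub>R x" using p0(3) unfolding \<Gamma>2_def by auto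
      then have "g \<in> ?S" using x p unfolding grading_support_def by auto
      moreover have "l \<in> \<Lambda>" using xg x p sub unfolding \<Lambda>_def by blast
      ultimately show False using p0(2) p by simp
    qed
  next
    fix x assume "x \<in> L"
    then obtain f where f: "\<And>g. g \<in> ?S \<Longrightarrow> f g \<in> \<Gamma> g" "x = (\<Sum>g\<in>?S. f g)"
      using lie_grading_sum[OF gr fin] by blast
    have "\<forall>g\<in>?S. \<exists>F. (\<forall>l\<in>\<Lambda>. F l \<in> \<Gamma>2 (g, l)) \<and> f g = (\<Sum>l\<in>\<Lambda>. F l)" using eigsum f(1) Sc by blast
    then obtain F where F: "\<And>g. g \<in> ?S \<Longrightarrow> (\<forall>l\<in>\<Lambda>. F g l \<in> \<Gamma>2 (g, l)) \<and> f g = (\<Sum>l\<in>\<Lambda>. F g l)" by metis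
    have "x = (\<Sum>g\<in>?S. \<Sum>l\<in>\<Lambda>. F g l)" unfolding f(2) using F by (intro sum.cong) auto
    also have "\<dots> = (\<Sum>p\<in>?S \<times> \<Lambda>. F (fst p) (snd p))" by (simp add: sum.cartesian_product case_prod_unfold)
    finally show "\<exists>f. (\<forall>p\<in>?S \<times> \<Lambda>. f p \<in> \<Gamma>2 p) \<and> x = (\<Sum>p\<in>?S \<times> \<Lambda>. f p)"
      using F by (intro exI[of _ "\<lambda>p. F (fst p) (snd p)"]) auto
  next
    fix f p assume f: "\<And>p. p \<in> ?S \<times> \<Lambda> \<Longrightarrow> f p \<in> \<Gamma>2 p" "(\<Sum>p\<in>?S \<times> \<Lambda>. f p) = 0" "p \<in> ?S \<times> \<Lambda>"
    obtain g l where p: "p = (g, l)" "g \<in> ?S" "l \<in> \<Lambda>" using f(3) by auto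
    have m: "f (g, l) \<in> \<Gamma> g" "\<theta> (f (g, l)) = l *\<^sub>R f (g, l)" if "g \<in> ?S" "l \<in> \<Lambda>" for g l
      using f(1)[of "(g, l)"] that unfolding \<Gamma>2_def by auto
    have z: "(\<Sum>g\<in>?S. \<Sum>l\<in>\<Lambda>. f (g, l)) = 0" using f(2) by (simp add: sum.cartesian_product case_prod_unfold)
    have m': "(\<Sum>l\<in>\<Lambda>. f (g, l)) \<in> \<Gamma> g" if "g \<in> ?S" for g
      using m(1)[OF that] sub(1) Sc that by (intro subspace_sum) auto
    have z': "(\<Sum>l\<in>\<Lambda>. f (g, l)) = 0"
      by (rule lie_grading_indep[where f = "\<lambda>g. \<Sum>l\<in>\<Lambda>. f (g, l)", OF gr subspace_0[OF L(1)] fin Sc m' z p(2)])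
    show "f p = 0" unfolding p(1)
      by (rule eigenvectors_independent[where f = "\<lambda>l. f (g, l)", OF th(1) finL m(2)[OF p(2)] z' p(3)])
  next
    fix p q x y assume *: "p \<in> carrier K" "q \<in> carrier K" "x \<in> \<Gamma>2 p" "y \<in> \<Gamma>2 q"
    obtain g l where p: "p = (g, l)" "g \<in> carrier G" using *(1) unfolding K_def by auto
    obtain h l' where q: "q = (h, l')" "h \<in> carrier G" using *(2) unfolding K_def by auto
    have x: "x \<in> \<Gamma> g" "\<theta> x = l *\<^sub>R x" and y: "y \<in> \<Gamma> h" "\<theta> y = l' *\<^sub>R y" using *(3,4) unfolding p q \<Gamma>2_def by auto
    have "br x y \<in> \<Gamma> (g \<otimes>\<^bsub>G\<^esub> h)" using gr x y p q unfolding lie_grading_def by blast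
    moreover have "x \<in> L" "y \<in> L" using x y sub p q by auto
    then have "\<theta> (br x y) = (l * l') *\<^sub>R br x y" using th(2) x y br by simp
    ultimately show "br x y \<in> \<Gamma>2 (p \<otimes>\<^bsub>K\<^esub> q)" unfolding p q K_def \<Gamma>2_def by (simp add: real_units_def)
  qed
  have fin2: "finite (grading_support K \<Gamma>2)" by (rule lie_grading_finite_support[OF gr2 L])
  obtain H :: "nat monoid" and \<Gamma>' where H: "lie_grading L br H \<Gamma>'"
    "\<And>h. h \<in> carrier H \<Longrightarrow> \<exists>s\<in>carrier K. \<Gamma>' h = \<Gamma>2 s"
    "\<And>s. s \<in> grading_support K \<Gamma>2 \<Longrightarrow> \<exists>h\<in>carrier H. \<Gamma>' h = \<Gamma>2 s"
    using lie_grading_over_nat[OF gr2 subspace_0[OF L(1)] fin2] by metis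
  have "refines H \<Gamma>' G \<Gamma>"
    unfolding refines_def
  proof
    fix h assume "h \<in> carrier H"
    then obtain g l where "(g, l) \<in> carrier K" "\<Gamma>' h = \<Gamma>2 (g, l)" using H(2) by (metis surj_pair)
    then show "\<exists>g\<in>carrier G. \<Gamma>' h \<subseteq> \<Gamma> g" unfolding K_def \<Gamma>2_def by auto
  qed
  moreover have "\<exists>h\<in>grading_support H \<Gamma>'. \<exists>g\<in>carrier G. \<Gamma>' h \<subset> \<Gamma> g"
  proof -
    \<comment> \<open>Failure for the scalar 0 shows that \<open>\<theta>\<close> does not vanish on
      \<open>\<Gamma> g0\<close>. Hence there is a nonzero eigenvector, and its eigenspace is a
      nonzero component; failure for its eigenvalue makes the inclusion strict.\<close>
    have "\<not> (\<forall>x\<in>\<Gamma> g0. \<theta> x = 0 *\<^sub>R x)" using that nt by blast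
    then obtain x where x: "x \<in> \<Gamma> g0" "\<theta> x \<noteq> 0" by auto
    have "\<exists>v\<in>\<Gamma> g0. v \<noteq> 0 \<and> (\<exists>l. l \<noteq> 0 \<and> \<theta> v = l *\<^sub>R v)"
    proof (rule ccontr)
      assume "\<not> ?thesis"
      then have "{v \<in> \<Gamma> g0. \<exists>l. l \<noteq> 0 \<and> \<theta> v = l *\<^sub>R v} \<subseteq> {0}" by auto
      then have "x \<in> span {0}" using eig[OF g0 x(1)] span_mono by blast
      then show False using x(2) linear_0[OF th(1)] by (simp add: span_0)
    qed
    then obtain v l where v: "v \<in> \<Gamma> g0" "v \<noteq> 0" "l \<noteq> 0" "\<theta> v = l *\<^sub>R v" by blast
    have "(g0, l) \<in> grading_support K \<Gamma>2"
      using v g0 unfolding grading_support_def K_def \<Gamma>2_def real_units_def by auto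
    then obtain h where h: "h \<in> carrier H" "\<Gamma>' h = \<Gamma>2 (g0, l)" using H(3) by blast
    then have "h \<in> grading_support H \<Gamma>'" using v unfolding grading_support_def \<Gamma>2_def by auto
    moreover have "\<not> (\<forall>w\<in>\<Gamma> g0. \<theta> w = l *\<^sub>R w)" using that nt by blast
    then have "\<Gamma>' h \<subset> \<Gamma> g0" unfolding h(2) \<Gamma>2_def by auto
    ultimately show ?thesis using g0 by blast
  qed
  ultimately have "properly_refines H \<Gamma>' G \<Gamma>" unfolding properly_refines_def by blast
  then show False using fine H(1) unfolding fine_grading_def by blast
qed

section \<open>The components of a fine grading\<close>

context ralg
begin

text \<open>Horner evaluation at \<open>a\<close> with \<open>e\<close> in the role of 1, as the
  ambient algebra has no distinguished unit. Over the complex numbers with \<open>e = 1\<close> it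
  is ordinary evaluation of a real polynomial (\<open>poly_complex_evp\<close>), so one recursion
  serves both purposes.\<close>

definition evp :: "'a \<Rightarrow> 'a \<Rightarrow> real poly \<Rightarrow> 'a" where
  "evp e a p = fold_coeffs (\<lambda>c v. c *\<^sub>R e + a \<star> v) p 0"

lemma evp_0 [simp]: "evp e a 0 = 0"
  by (simp add: evp_def)

lemma evp_pCons [simp]: "evp e a (pCons c p) = c *\<^sub>R e + a \<star> evp e a p"
  by (cases "c = 0 \<and> p = 0") (auto simp: evp_def)

lemma evp_add: "evp e a (p + q) = evp e a p + evp e a q"
  by (induction p q rule: poly_induct2) (auto simp: distribs scaleR_add_left)

lemma evp_smult: "evp e a (smult c p) = c *\<^sub>R evp e a p"
  by (induction p) (auto simp: scaleR_add_right)

lemma evp_mult: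
  assumes "e \<star> e = e" "e \<star> a = a"
  shows "evp e a (p * q) = evp e a p \<star> evp e a q"
proof -
  have e: "e \<star> evp e a q = evp e a q" for q
    by (induction q) (auto simp: distribs assms mult_assoc[symmetric])
  show ?thesis
    by (induction p) (auto simp: evp_add evp_smult distribs mult_assoc e)
qed

lemma evp_in:
  assumes "subspace W" "e \<in> W" "\<And>v. v \<in> W \<Longrightarrow> a \<star> v \<in> W" shows "evp e a p \<in> W"
  by (induction p) (auto intro!: subspace_add[OF assms(1)] subspace_scale[OF assms(1)] simp: assms subspace_0)

end

lemma ralg_complex: "ralg ((*) :: complex \<Rightarrow> complex \<Rightarrow> complex)"
  by unfold_locales (auto simp: algebra_simps)

lemma poly_complex_evp: "poly (map_poly complex_of_real p) z = ralg.evp (*) 1 z p"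
proof -
  interpret c: ralg "(*) :: complex \<Rightarrow> complex \<Rightarrow> complex" by (rule ralg_complex)
  show ?thesis by (induction p) (auto simp: map_poly_pCons scaleR_conv_of_real)
qed

text \<open>The first step of Frobenius' theorem. A polynomial of least degree that kills
  \<open>a\<close> has a complex root z. Without zero divisors each of its nonconstant real factors
  already kills \<open>a\<close>, so \<open>a\<close> satisfies the irreducible real polynomial of
  z. A linear one is excluded by \<open>ns\<close>; completing the square in a quadratic one gives s
  = Re z and t = Im z.\<close>

lemma (in ralg) quadratic_relation:
  assumes e: "e \<star> e = e" "e \<star> a = a" "a \<star> e = a" "e \<noteq> 0"
    and W: "subspace W" "e \<in> W" "\<And>v. v \<in> W \<Longrightarrow> a \<star> v \<in> W" "W \<subseteq> span T" "finite T"
    and nozero: "\<And>v w. v \<in> W \<Longrightarrow> w \<in> W \<Longrightarrow> v \<star> w = 0 \<Longrightarrow> v = 0 \<or> w = 0"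
    and ns: "\<And>c. a \<noteq> c *\<^sub>R e"
  obtains s t :: real where "t \<noteq> 0" "(a - s *\<^sub>R e) \<star> (a - s *\<^sub>R e) = - (t\<^sup>2 *\<^sub>R e)"
proof -
  note evW = evp_in[OF W(1-3)]
  note evm = evp_mult[OF e(1,2)]
  have "\<exists>p. p \<noteq> 0 \<and> evp e a p = 0"
  proof (rule ccontr)
    assume no: "\<not> ?thesis"
    let ?N = "card T" and ?v = "\<lambda>i. evp e a (monom 1 i)"
    have *: "\<forall>i\<in>{..?N}. c i = 0" if c: "(\<Sum>i\<in>{..?N}. c i *\<^sub>R ?v i) = 0" for c
    proof -
      define p where "p = (\<Sum>i\<le>?N. monom (c i) i)"
      have lin: "evp e a (\<Sum>i\<in>I. f i) = (\<Sum>i\<in>I. evp e a (f i))" for f and I :: "nat set"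
        by (induction I rule: infinite_finite_induct) (auto simp: evp_add)
      have "evp e a p = (\<Sum>i\<le>?N. c i *\<^sub>R ?v i)"
        unfolding p_def lin evp_smult[symmetric] by (simp add: smult_monom)
      then have p: "p = 0" using no c by metis
      show ?thesis
      proof
        fix i assume i: "i \<in> {..?N}"
        have "coeff p i = c i" unfolding p_def using i by (simp add: coeff_sum)
        then show "c i = 0" using p by simp
      qed
    qed
    have "inj_on ?v {..?N}" "independent (?v ` {..?N})" using family_independent[of "{..?N}" ?v] * by auto
    moreover have "?v ` {..?N} \<subseteq> span T" using evW W(4) by blast
    ultimately have "card {..?N} \<le> card T"
      using real_vector.independent_span_bound[OF W(5)] card_image by metis
    then show False by simp
  qed
  then obtain p where p: "p \<noteq> 0 \<and> evp e a p = 0"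
    "\<And>q. q \<noteq> 0 \<and> evp e a q = 0 \<Longrightarrow> degree p \<le> degree q"
    using ex_has_least_nat[of "\<lambda>p. p \<noteq> 0 \<and> evp e a p = 0" _ degree] by blast
  have split: "evp e a q = 0" if "q * s = p" "degree q > 0" for q s
  proof -
    have qs: "q \<noteq> 0" "s \<noteq> 0" using that p by auto
    have "evp e a q \<star> evp e a s = 0" using evm[of q s] that p by simp
    then have "evp e a q = 0 \<or> evp e a s = 0" using nozero evW by blast
    moreover have "degree s < degree p" using that qs by (metis degree_mult_eq less_add_same_cancel2)
    then have "evp e a s \<noteq> 0" using p(2)[of s] qs by auto
    ultimately show ?thesis by simp
  qed
  have "degree p > 0"
  proof (rule ccontr)
    assume "\<not> ?thesis"
    then obtain c where c: "p = [:c:]" using degree_eq_zeroE by blast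
    have "evp e a p = 0" "c \<noteq> 0" using p(1) c by auto
    then show False unfolding c using e(4) by simp
  qed
  then have "\<not> constant (poly (map_poly complex_of_real p))"
    by (metis constant_degree degree_map_poly of_real_eq_0_iff of_real_0 not_gr_zero)
  then obtain z where z: "poly (map_poly complex_of_real p) z = 0" using fundamental_theorem_of_algebra by blast
  interpret c: ralg "(*) :: complex \<Rightarrow> complex \<Rightarrow> complex" by (rule ralg_complex)
  have z0: "c.evp 1 z p = 0" using z poly_complex_evp by simp
  show thesis
  proof (cases "Im z = 0")
    case True
    then have "z = of_real (Re z)" by (simp add: complex_eq_iff)
    moreover have "c.evp 1 (of_real x) q = of_real (poly q x)" for x q
      by (induction q) (auto simp: scaleR_conv_of_real)
    ultimately have "poly p (Re z) = 0" using z0 by (metis of_real_eq_0_iff)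
    then obtain s where "p = [:- Re z, 1:] * s" by (metis dvd_def poly_eq_0_iff_dvd)
    then have "evp e a [:- Re z, 1:] = 0" using split[of "[:- Re z, 1:]" s] by simp
    then have "a = Re z *\<^sub>R e" using e(3) by (simp add: algebra_simps)
    then show thesis using ns by blast
  next
    case False
    \<comment> \<open>The minimal polynomial of \<open>z\<close> over the reals. The remainder of
      \<open>p\<close> modulo \<open>Q\<close> has degree at most 1 and vanishes at the nonreal
      \<open>z\<close>, so \<open>Q\<close> divides \<open>p\<close>.\<close>
    define Q where "Q = [:(cmod z)\<^sup>2, - 2 * Re z, 1:]"
    have cz: "c.evp 1 z Q = 0"
      unfolding Q_def by (simp add: complex_eq_iff scaleR_conv_of_real cmod_power2) (simp add: algebra_simps power2_eq_square)
    have pQ: "p = Q * (p div Q) + p mod Q" by simp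
    have "c.evp 1 z (p mod Q) = 0"
    proof -
      have "c.evp 1 z p = c.evp 1 z Q * c.evp 1 z (p div Q) + c.evp 1 z (p mod Q)"
        by (subst pQ) (simp only: c.evp_add c.evp_mult[of 1 z] mult_1_left)
      then show ?thesis using z0 cz by simp
    qed
    moreover have Q0: "Q \<noteq> 0" "degree Q = 2" unfolding Q_def by auto
    then have "degree (p mod Q) < 2" using degree_mod_less[of Q p] by auto
    then obtain x y where xy: "p mod Q = [:x, y:]"
    proof -
      assume a: "\<And>x y. p mod Q = [:x, y:] \<Longrightarrow> thesis"
      obtain x r where r: "p mod Q = pCons x r" by (cases "p mod Q")
      then have "degree r = 0" using \<open>degree (p mod Q) < 2\<close> by (cases "r = 0") auto
      then obtain y where "r = [:y:]" by (rule degree_eq_zeroE)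
      then show thesis using a r by blast
    qed
    ultimately have "of_real x + z * of_real y = 0" by (simp add: scaleR_conv_of_real)
    then have "y = 0" "x = 0" using False by (auto simp: complex_eq_iff)
    then have "p = Q * (p div Q)" using pQ xy by simp
    then have "evp e a Q = 0" using split[of Q "p div Q"] Q0 by simp
    then have aa: "a \<star> a = (2 * Re z) *\<^sub>R a - (cmod z)\<^sup>2 *\<^sub>R e"
      unfolding Q_def using e(3) by (simp add: distribs algebra_simps add_eq_0_iff)
    have "(a - Re z *\<^sub>R e) \<star> (a - Re z *\<^sub>R e) = ((Re z)\<^sup>2 - (cmod z)\<^sup>2) *\<^sub>R e"
      using e aa by (simp add: distribs algebra_simps power2_eq_square)
         (simp add: scaleR_add_left[symmetric] mult_2[symmetric])
    also have "\<dots> = - ((Im z)\<^sup>2 *\<^sub>R e)" by (simp add: cmod_power2 scaleR_minus_left[symmetric] del: scaleR_minus_left)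
    finally show thesis using that False by blast
  qed
qed

section \<open>Conjugations and the centralizer of the matrix units\<close>

locale fine_graded = graded_matrix +
  fixes \<Gamma>
  assumes fine: "fine_grading L br G \<Gamma>" and V_eq: "g \<in> carrier G \<Longrightarrow> V g = unital G \<Gamma> g"
begin

lemma gr: "lie_grading L br G \<Gamma>" using fine unfolding fine_grading_def by simp

lemma \<Gamma>_L: "g \<in> carrier G \<Longrightarrow> x \<in> \<Gamma> g \<Longrightarrow> x \<in> L"
  using gr unfolding lie_grading_def by blast

lemma \<Gamma>_eq: "g \<in> carrier G \<Longrightarrow> g \<noteq> \<one> \<Longrightarrow> \<Gamma> g = V g"
  using V_eq by (simp add: unital_def)

lemma \<Gamma>_one: "x \<in> \<Gamma> \<one> \<longleftrightarrow> x \<in> V \<one> \<and> x \<in> L"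
proof
  assume "x \<in> \<Gamma> \<one>"
  then have "\<exists>y c. x = y + c *\<^sub>R u \<and> y \<in> \<Gamma> \<one>" by (intro exI[of _ x] exI[of _ 0]) auto
  then show "x \<in> V \<one> \<and> x \<in> L" using V_eq \<Gamma>_L[OF one_closed \<open>x \<in> \<Gamma> \<one>\<close>] unfolding unital_def by auto
next
  assume x: "x \<in> V \<one> \<and> x \<in> L"
  then obtain y c where y: "x = y + c *\<^sub>R u" "y \<in> \<Gamma> \<one>" using V_eq unfolding unital_def by auto
  then have "c * k = 0" using x \<Gamma>_L[OF one_closed y(2)] tr_L[of x] tr_L[of y] by simp
  then show "x \<in> \<Gamma> \<one>" using y k_pos by simp
qed

lemma V_one_u: "c *\<^sub>R u \<in> V \<one>"
  by (rule subspace_scale[OF subspace_V[OF one_closed] u_V])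

text \<open>Conjugation preserves the trace and fixes \<open>u\<close>; so it acts on the Lie
  algebra, and removing scalar parts sends eigenvectors to eigenvectors. Diagonalizability may
  therefore be checked on the components \<open>V g\<close> of the associative grading, the identity
  component included.\<close>

lemma conj_scalar:
  assumes a: "h' \<in> carrier G" "a \<in> V h'" "a' \<in> V (inv h')" "a \<star> a' = u" "a' \<star> a = u"
    and eig: "\<And>g x. g \<in> carrier G \<Longrightarrow> x \<in> V g \<Longrightarrow> x \<in> span {v \<in> V g. \<exists>l. l \<noteq> 0 \<and> a \<star> v \<star> a' = l *\<^sub>R v}"
    and g: "g \<in> carrier G"
  obtains l where "\<And>x. x \<in> \<Gamma> g \<Longrightarrow> a \<star> x \<star> a' = l *\<^sub>R x"
proof -
  define \<theta> where "\<theta> = (\<lambda>x. a \<star> x \<star> a')"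
  have aR: "a \<in> R" "a' \<in> R" using a V_R by auto
  have lin: "linear \<theta>" unfolding \<theta>_def by (rule linearI) (simp_all add: distribs)
  have mul: "\<theta> (x \<star> y) = \<theta> x \<star> \<theta> y" if "x \<in> R" "y \<in> R" for x y
  proof -
    have "\<theta> x \<star> \<theta> y = a \<star> x \<star> (a' \<star> a) \<star> y \<star> a'" unfolding \<theta>_def by (simp add: mult_assoc)
    then show ?thesis using that a aR unfolding \<theta>_def by (simp add: mult_assoc)
  qed
  have trt: "tr (\<theta> x) = tr x" if "x \<in> R" for x
  proof -
    have "tr (\<theta> x) = tr (a' \<star> (a \<star> x))" unfolding \<theta>_def using that aR R_mult by (intro tr_commute) auto
    then show ?thesis using that a by (simp add: mult_assoc[symmetric])
  qed
  have thu: "\<theta> u = u" unfolding \<theta>_def using aR a by simp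
  have eigL: "x \<in> span {v \<in> \<Gamma> g. \<exists>l. l \<noteq> 0 \<and> \<theta> v = l *\<^sub>R v}" if g: "g \<in> carrier G" "x \<in> \<Gamma> g" for g x
  proof (cases "g = \<one>")
    case False
    then show ?thesis using eig[of g x] g \<Gamma>_eq unfolding \<theta>_def by simp
  next
    case True
    define P where "P = (\<lambda>v. v - (tr v / k) *\<^sub>R u)"
    have P: "linear P" unfolding P_def by (rule linearI) (simp_all add: algebra_simps add_divide_distrib)
    have x: "x \<in> V \<one>" "x \<in> L" using g True \<Gamma>_one by auto
    let ?W = "{v \<in> V \<one>. \<exists>l. l \<noteq> 0 \<and> \<theta> v = l *\<^sub>R v}"
    have "x = P x" using x unfolding P_def by simp
    also have "\<dots> \<in> span (P ` ?W)"
      using eig[OF one_closed x(1)] linear_span_image[OF P, of ?W] unfolding \<theta>_def by auto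
    also have "\<dots> \<subseteq> span {v \<in> \<Gamma> \<one>. \<exists>l. l \<noteq> 0 \<and> \<theta> v = l *\<^sub>R v}"
    proof (rule span_mono, safe)
      fix v l assume v: "v \<in> V \<one>" "l \<noteq> 0" "\<theta> v = l *\<^sub>R v"
      have vR: "v \<in> R" using v V_R by blast
      have "P v \<in> L" unfolding P_def by (rule traceless_in_L[OF vR])
      moreover have "P v \<in> V \<one>" unfolding P_def using v V_one_u by (intro subspace_diff[OF subspace_V]) auto
      ultimately show "P v \<in> \<Gamma> \<one>" using \<Gamma>_one by simp
      have "tr v = l * tr v" using trt[OF vR] v by simp
      then have "\<theta> (P v) = l *\<^sub>R P v"
        unfolding P_def using v thu by (simp add: linear_diff[OF lin] linear_cmul[OF lin] scaleR_diff_right)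
      then show "\<exists>l. l \<noteq> 0 \<and> \<theta> (P v) = l *\<^sub>R P v" using v by blast
    qed
    finally show ?thesis unfolding True .
  qed
  have Lsp: "L \<subseteq> span (b ` idx)" using L_subset unfolding R_def .
  have th: "\<theta> (br x y) = br (\<theta> x) (\<theta> y)" if "x \<in> L" "y \<in> L" for x y
    using that mul by (simp add: br_def linear_diff[OF lin])
  have bil: "br (c *\<^sub>R x) (c' *\<^sub>R y) = (c * c') *\<^sub>R br x y" for x y c c'
    by (simp add: br_def scaleR_diff_right mult.commute)
  note goal = that
  have fin: thesis if l: "\<And>x. x \<in> \<Gamma> g \<Longrightarrow> \<theta> x = l *\<^sub>R x" for l
  proof (rule goal[of l])
    show "a \<star> x \<star> a' = l *\<^sub>R x" if "x \<in> \<Gamma> g" for x using l[OF that] unfolding \<theta>_def .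
  qed
  show thesis
    by (rule fine_grading_scalar[OF fine subspace_L Lsp finite_imageI[OF finite_idx] lin th bil eigL g])
      (assumption+, rule fin)
qed

definition C :: "'a set" where "C = {c. \<forall>i<n. \<forall>j<n. c \<star> E i j = E i j \<star> c}"

lemma E_R: "i < n \<Longrightarrow> j < n \<Longrightarrow> E i j \<in> R"
  using E_V d_carrier V_R by (meson inv_closed m_closed)

lemma subspace_C: "subspace C"
  unfolding subspace_def C_def by (auto simp: distribs)

lemma C_mult: "x \<in> C \<Longrightarrow> y \<in> C \<Longrightarrow> x \<star> y \<in> C"
  unfolding C_def by (auto simp: mult_assoc) (metis mult_assoc)

lemma u_C: "u \<in> C" unfolding C_def using E_R by auto

text \<open>The entry of \<open>r\<close> at (i, j) when \<open>R\<close> is viewed as matrices over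
  \<open>C\<close>: \<open>E i j \<star> cc i j r\<close> is
  \<open>E i i \<star> r \<star> E j j\<close>, and \<open>r\<close> is the sum of these
  (\<open>decompose\<close>).\<close>

definition cc :: "nat \<Rightarrow> nat \<Rightarrow> 'a \<Rightarrow> 'a" where
  "cc i j r = (\<Sum>l<n. E l i \<star> r \<star> E j l)"

lemma cc_C: assumes "i < n" "j < n" shows "cc i j r \<in> C"
proof -
  have "cc i j r \<star> E p q = E p i \<star> r \<star> E j q \<and> E p q \<star> cc i j r = E p i \<star> r \<star> E j q" if pq: "p < n" "q < n" for p q
  proof
    have "cc i j r \<star> E p q = (\<Sum>l<n. if l = p then E p i \<star> r \<star> E j q else 0)"
      unfolding cc_def mult_sum_left using assms pq E_mult by (intro sum.cong) (auto simp: mult_assoc)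
    then show "cc i j r \<star> E p q = E p i \<star> r \<star> E j q" using pq by simp
    have "E p q \<star> cc i j r = (\<Sum>l<n. if l = q then E p i \<star> r \<star> E j q else 0)"
      unfolding cc_def mult_sum_right using assms pq E_mult by (intro sum.cong) (auto simp: mult_assoc[symmetric])
    then show "E p q \<star> cc i j r = E p i \<star> r \<star> E j q" using pq by simp
  qed
  then show ?thesis unfolding C_def by simp
qed

lemma cc_V:
  assumes "i < n" "j < n" "g \<in> carrier G" "r \<in> V g" shows "cc i j r \<in> V (g \<otimes> d j \<otimes> inv (d i))"
  unfolding cc_def
proof (rule subspace_sum[OF subspace_V])
  show "g \<otimes> d j \<otimes> inv (d i) \<in> carrier G" using assms d_carrier by simp
  fix l assume "l \<in> {..<n}"
  then have l: "l < n" "d l \<in> carrier G" "d i \<in> carrier G" "d j \<in> carrier G" using assms d_carrier by auto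
  have "E l i \<star> r \<star> E j l \<in> V (d l \<otimes> inv (d i) \<otimes> g \<otimes> (d j \<otimes> inv (d l)))"
    using V_mult[OF _ _ V_mult[OF _ _ E_V[OF l(1) assms(1)] assms(4)] E_V[OF assms(2) l(1)]] l assms(3) by simp
  also have "d l \<otimes> inv (d i) \<otimes> g \<otimes> (d j \<otimes> inv (d l)) = (d l \<otimes> inv (d l)) \<otimes> (g \<otimes> d j \<otimes> inv (d i))"
    using l assms(3) by (simp only: m_ac m_closed inv_closed)
  also have "\<dots> = g \<otimes> d j \<otimes> inv (d i)" using l assms(3) by simp
  finally show "E l i \<star> r \<star> E j l \<in> V (g \<otimes> d j \<otimes> inv (d i))" .
qed

lemma E_cc: assumes "i < n" "j < n" shows "E i j \<star> cc i j r = E i i \<star> r \<star> E j j"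
proof -
  have "E i j \<star> cc i j r = (\<Sum>l<n. if l = j then E i i \<star> r \<star> E j j else 0)"
    unfolding cc_def mult_sum_right using assms E_mult by (intro sum.cong) (auto simp: mult_assoc[symmetric])
  then show ?thesis using assms by simp
qed

lemma decompose: assumes "r \<in> R" shows "r = (\<Sum>i<n. \<Sum>j<n. E i j \<star> cc i j r)"
proof -
  have "r = u \<star> r \<star> u" using assms by simp
  also have "\<dots> = (\<Sum>i<n. \<Sum>j<n. E i i \<star> r \<star> E j j)"
    unfolding E_sum[symmetric] mult_sum_left mult_sum_right by (rule sum.swap)
  finally show ?thesis using E_cc by simp
qed

lemma E_diag_V: assumes "i < n" "g \<in> carrier G" "r \<in> V g" shows "E i i \<star> r \<in> V g" "r \<star> E i i \<in> V g"
proof -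
  have "E i i \<in> V \<one>" using E_V[OF assms(1,1)] d_carrier[OF assms(1)] by simp
  then show "E i i \<star> r \<in> V g" "r \<star> E i i \<in> V g" using V_mult[OF one_closed assms(2)] V_mult[OF assms(2) one_closed] assms by fastforce+
qed

text \<open>The idempotents \<open>E i i\<close> have identity degree, so compressing by them stays
  inside \<open>V g\<close>. Diagonalizability of a conjugation thereby reduces to homogeneous
  products \<open>E i j \<star> c\<close>.\<close>

lemma span_E_C:
  assumes "g \<in> carrier G" "x \<in> V g"
    and "\<And>i j g' c. i < n \<Longrightarrow> j < n \<Longrightarrow> g' \<in> carrier G \<Longrightarrow> c \<in> C \<Longrightarrow> c \<in> V g' \<Longrightarrow> E i j \<star> c \<in> V g \<Longrightarrow> E i j \<star> c \<in> span W"
  shows "x \<in> span W"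
proof -
  have "x = (\<Sum>i<n. \<Sum>j<n. E i j \<star> cc i j x)" using decompose assms V_R by blast
  also have "\<dots> \<in> span W"
  proof (intro span_sum)
    fix i j assume ij: "i \<in> {..<n}" "j \<in> {..<n}"
    then show "E i j \<star> cc i j x \<in> span W"
      using cc_C cc_V[OF _ _ assms(1,2)] E_cc[of i j x] E_diag_V(1)[OF _ assms(1,2), of i] E_diag_V(2)[OF _ assms(1), of j "E i i \<star> x"] d_carrier assms(1)
      by (intro assms(3)[of i j "g \<otimes> d j \<otimes> inv (d i)"]) auto
  qed
  finally show ?thesis .
qed

lemma C_inverse:
  assumes "c \<in> C" "g \<in> carrier G" "c \<in> V g" "c \<noteq> 0"
  obtains c' where "c' \<in> C" "c' \<in> V (inv g)" "c \<star> c' = u" "c' \<star> c = u"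
  using E_division[OF assms(2,3,4)] assms(1) unfolding C_def by blast

lemma C_center:
  assumes "c \<in> C" "c \<in> R" "\<And>g y. g \<in> carrier G \<Longrightarrow> y \<in> C \<Longrightarrow> y \<in> V g \<Longrightarrow> c \<star> y = y \<star> c"
  shows "c = (tr c / k) *\<^sub>R u"
proof (rule center[OF assms(2)])
  fix r assume r: "r \<in> R"
  have hom: "c \<star> r = r \<star> c" if g: "g \<in> carrier G" "r \<in> V g" for g r
  proof -
    have t: "c \<star> (E i j \<star> cc i j r) = (E i j \<star> cc i j r) \<star> c" if "i < n" "j < n" for i j
    proof -
      have 1: "c \<star> cc i j r = cc i j r \<star> c" using assms(3) cc_C[OF that] cc_V[OF that g] that d_carrier g by (meson inv_closed m_closed)
      have 2: "c \<star> E i j = E i j \<star> c" using assms(1) that unfolding C_def by blast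
      show ?thesis by (metis 1 2 mult_assoc)
    qed
    have "r = (\<Sum>i<n. \<Sum>j<n. E i j \<star> cc i j r)" using decompose g V_R by blast
    moreover have "c \<star> (\<Sum>i<n. \<Sum>j<n. E i j \<star> cc i j r) = (\<Sum>i<n. \<Sum>j<n. E i j \<star> cc i j r) \<star> c"
      unfolding mult_sum_left mult_sum_right using t by (intro sum.cong) auto
    ultimately show ?thesis by simp
  qed
  obtain w where w: "\<And>s. s \<in> S \<Longrightarrow> w s \<in> V s" "r = (\<Sum>s\<in>S. w s)" using V_sum[OF r] by blast
  show "c \<star> r = r \<star> c" unfolding w(2) mult_sum_left mult_sum_right
    using hom w(1) S_carrier by (intro sum.cong) auto
qed

text \<open>\<open>v\<close> is half the sum of \<open>v + (1 / sqrt p) *\<^sub>R \<theta> v\<close>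
  and \<open>v - (1 / sqrt p) *\<^sub>R \<theta> v\<close>, which belong to the eigenvalues
  \<open>sqrt p\<close> and \<open>- sqrt p\<close>; \<open>0 < p\<close> keeps these real and
  nonzero.\<close>

lemma eigen_split:
  assumes th: "linear \<theta>" and v: "subspace X" "v \<in> X" "\<theta> v \<in> X" "\<theta> (\<theta> v) = p *\<^sub>R v" "0 < p"
  shows "v \<in> span {v \<in> X. \<exists>l. l \<noteq> 0 \<and> \<theta> v = l *\<^sub>R v}"
proof -
  let ?s = "sqrt p"
  have s: "?s \<noteq> 0" "?s * ?s = p" using v(5) by auto
  have p: "\<theta> (v + (e / ?s) *\<^sub>R \<theta> v) = (e * ?s) *\<^sub>R (v + (e / ?s) *\<^sub>R \<theta> v)" if "e * e = 1" for e
  proof -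
    have "e / ?s * p = e * ?s" using s by (simp add: field_simps)
    then show ?thesis using that s v(4)
      by (simp add: linear_add[OF th] linear_cmul[OF th] scaleR_add_right)
  qed
  have in1: "v + (e / ?s) *\<^sub>R \<theta> v \<in> {v \<in> X. \<exists>l. l \<noteq> 0 \<and> \<theta> v = l *\<^sub>R v}" if e: "e * e = 1" for e
  proof -
    have "e * ?s \<noteq> 0" using e s by auto
    moreover have "v + (e / ?s) *\<^sub>R \<theta> v \<in> X"
      by (rule subspace_add[OF v(1,2) subspace_scale[OF v(1,3)]])
    ultimately show ?thesis using p[OF e] by blast
  qed
  have "v = (1 / 2) *\<^sub>R (v + (1 / ?s) *\<^sub>R \<theta> v) + (1 / 2) *\<^sub>R (v + ((- 1) / ?s) *\<^sub>R \<theta> v)"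
  proof -
    define w where "w = (1 / ?s) *\<^sub>R \<theta> v"
    have "v = (1 / 2) *\<^sub>R (v + w) + (1 / 2) *\<^sub>R (v - w)"
      unfolding scaleR_add_right[symmetric] by (simp add: scaleR_2[symmetric])
    then show ?thesis unfolding w_def by simp
  qed
  also have "\<dots> \<in> span {v \<in> X. \<exists>l. l \<noteq> 0 \<and> \<theta> v = l *\<^sub>R v}"
    by (intro span_add span_scale span_base in1) auto
  finally show ?thesis .
qed

text \<open>
  A square root \<open>q\<close> of $-1$ in the identity component would be inverted by conjugation with a homogeneous
  element \<open>y\<close>; this conjugation is diagonalizable and splits the component of \<open>y\<close>.
\<close>

lemma no_imaginary_unit:
  assumes q: "q \<in> C" "q \<in> V \<one>" "q \<star> q = - u"
    and quad: "\<And>a. a \<in> C \<Longrightarrow> a \<in> V \<one> \<Longrightarrow> \<exists>s t. a = s *\<^sub>R u \<or> t \<noteq> 0 \<and> (a - s *\<^sub>R u) \<star> (a - s *\<^sub>R u) = - (t\<^sup>2 *\<^sub>R u)"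
  shows False
proof -
  have qR: "q \<in> R" using q V_R by blast
  have qinv: "q \<star> (- q) = u" "(- q) \<star> q = u" using q by simp_all
  have mq: "- q \<in> V (inv \<one>)" using subspace_neg[OF subspace_V[OF one_closed] q(2)] by simp
  have linq: "linear (\<lambda>v. q \<star> v \<star> (- q))" by (rule linearI) (simp_all add: distribs)
  \<comment> \<open>Conjugation by \<open>q\<close> is an involution: applied twice it is
    multiplication by \<open>q \<star> q = - u\<close> on both sides.\<close>
  have eq: "x \<in> span {v \<in> V g. \<exists>l. l \<noteq> 0 \<and> q \<star> v \<star> (- q) = l *\<^sub>R v}" if g: "g \<in> carrier G" "x \<in> V g" for g x
  proof (rule eigen_split[OF linq subspace_V[OF g(1)] g(2), of 1])
    have xR: "x \<in> R" using g V_R by blast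
    have "q \<star> x \<star> (- q) \<in> V (\<one> \<otimes> g \<otimes> \<one>)" using V_mult[OF _ _ V_mult[OF _ _ q(2) g(2)] mq] g by simp
    then show "q \<star> x \<star> (- q) \<in> V g" using g by simp
    have "q \<star> (q \<star> x \<star> (- q)) \<star> (- q) = (q \<star> q) \<star> x \<star> (q \<star> q)" by (simp add: mult_assoc)
    then show "q \<star> (q \<star> x \<star> - q) \<star> - q = 1 *\<^sub>R x" using q xR by simp
  qed simp
  obtain l0 where l0: "\<And>x. x \<in> \<Gamma> \<one> \<Longrightarrow> q \<star> x \<star> (- q) = l0 *\<^sub>R x"
    using conj_scalar[OF one_closed q(2) mq qinv eq one_closed] by blast
  define q0 where "q0 = q - (tr q / k) *\<^sub>R u"
  have q0: "q0 \<in> \<Gamma> \<one>" unfolding \<Gamma>_one q0_def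
    using traceless_in_L[OF qR] q(2) V_one_u by (auto intro: subspace_diff[OF subspace_V])
  have nonscalar: "q \<noteq> c *\<^sub>R u" for c
  proof
    assume "q = c *\<^sub>R u"
    then have "(c * c + 1) *\<^sub>R u = 0" using q(3) by (simp add: scaleR_add_left)
    moreover have "c * c + 1 \<noteq> 0" by (metis add_pos_nonneg less_irrefl zero_le_square zero_less_one add.commute)
    ultimately show False using u_nz by simp
  qed
  \<comment> \<open>The traceless part of \<open>q\<close> is nonzero and fixed, so the scalar on
    the identity component is 1, and \<open>q\<close> commutes with \<open>V \<one>\<close>.\<close>
  have "q \<star> q0 \<star> (- q) = q0"
    unfolding q0_def using qR q by (simp add: distribs mult_assoc)
  then have "l0 *\<^sub>R q0 = 1 *\<^sub>R q0" using l0[OF q0] by simp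
  moreover have "q0 \<noteq> 0" unfolding q0_def right_minus_eq by (rule nonscalar)
  ultimately have "l0 = 1" unfolding scaleR_cancel_right by blast
  then have l1: "q \<star> x \<star> (- q) = x" if "x \<in> \<Gamma> \<one>" for x using l0[OF that] by simp
  have comm1: "q \<star> x = x \<star> q" if "x \<in> V \<one>" for x
  proof -
    define x0 where "x0 = x - (tr x / k) *\<^sub>R u"
    have xR: "x \<in> R" using that V_R by blast
    have x0: "x0 \<in> \<Gamma> \<one>" unfolding \<Gamma>_one x0_def
      using traceless_in_L[OF xR] that V_one_u by (auto intro: subspace_diff[OF subspace_V])
    have x0R: "x0 \<in> R" using x0 \<Gamma>_one L_R by blast
    have "q \<star> x0 = q \<star> x0 \<star> ((- q) \<star> q)" using qinv qR x0R R_mult by simp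
    also have "\<dots> = (q \<star> x0 \<star> (- q)) \<star> q" by (simp only: mult_assoc)
    also have "\<dots> = x0 \<star> q" by (simp only: l1[OF x0])
    finally show ?thesis unfolding x0_def using qR by (simp add: distribs)
  qed
  \<comment> \<open>\<open>C \<inter> V \<one>\<close> is a copy of the complex numbers: if f^2 =
    -t^2 and f commutes with q, then (f - tq)(f + tq) = 0, and a nonzero first factor is
    invertible.\<close>
  have Ce: "\<exists>x y. a = x *\<^sub>R u + y *\<^sub>R q" if a: "a \<in> C" "a \<in> V \<one>" for a
  proof -
    obtain s t where st: "a = s *\<^sub>R u \<or> t \<noteq> 0 \<and> (a - s *\<^sub>R u) \<star> (a - s *\<^sub>R u) = - (t\<^sup>2 *\<^sub>R u)" using quad[OF a] by blast
    show ?thesis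
    proof (cases "a = s *\<^sub>R u")
      case True
      then show ?thesis by (intro exI[of _ s] exI[of _ 0]) simp
    next
      case False
      define f where "f = a - s *\<^sub>R u"
      have f: "f \<star> f = - (t\<^sup>2 *\<^sub>R u)" "t \<noteq> 0" using st False unfolding f_def by auto
      have fV: "f \<in> V \<one>" "f \<in> C" unfolding f_def using a V_one_u subspace_C u_C
        by (auto intro!: subspace_diff[OF subspace_V] subspace_diff[OF subspace_C] subspace_scale[OF subspace_C])
      have "(f - t *\<^sub>R q) \<star> (f + t *\<^sub>R q) = 0"
        using f(1) q(3) comm1[OF fV(1)] by (simp add: distribs power2_eq_square scaleR_add_right)
      moreover have mem: "f - t *\<^sub>R q \<in> V \<one>" "f - t *\<^sub>R q \<in> C" "f + t *\<^sub>R q \<in> V \<one>"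
        using fV q by (auto intro!: subspace_diff[OF subspace_V] subspace_add[OF subspace_V]
            subspace_scale[OF subspace_V] subspace_diff[OF subspace_C] subspace_scale[OF subspace_C])
      ultimately have "f - t *\<^sub>R q = 0 \<or> f + t *\<^sub>R q = 0"
      proof (cases "f - t *\<^sub>R q = 0")
        case False
        obtain c' where "c' \<star> (f - t *\<^sub>R q) = u" using C_inverse[OF mem(2) one_closed mem(1) False] by blast
        then have "u \<star> (f + t *\<^sub>R q) = c' \<star> ((f - t *\<^sub>R q) \<star> (f + t *\<^sub>R q))" by (simp add: mult_assoc[symmetric])
        then show ?thesis using \<open>(f - t *\<^sub>R q) \<star> (f + t *\<^sub>R q) = 0\<close> mem V_R[OF one_closed mem(3)] by simp
      qed simp
      then have "a = s *\<^sub>R u + t *\<^sub>R q \<or> a = s *\<^sub>R u + (- t) *\<^sub>R q" unfolding f_def by (auto simp: algebra_simps)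
      then show ?thesis by blast
    qed
  qed
  have "\<exists>g y. g \<in> carrier G \<and> y \<in> C \<and> y \<in> V g \<and> q \<star> y \<noteq> y \<star> q"
    using C_center[OF q(1) qR] nonscalar by blast
  then obtain g y where y: "g \<in> carrier G" "y \<in> C" "y \<in> V g" "q \<star> y \<noteq> y \<star> q" by blast
  have g1: "g \<noteq> \<one>" using y comm1 by auto
  have yR: "y \<in> R" using y V_R by blast
  have y0: "y \<noteq> 0" using y by auto
  have Gg: "\<Gamma> g = V g" using \<Gamma>_eq y(1) g1 by blast
  obtain lg where lg: "\<And>x. x \<in> \<Gamma> g \<Longrightarrow> q \<star> x \<star> (- q) = lg *\<^sub>R x"
    using conj_scalar[OF one_closed q(2) mq qinv eq y(1)] by blast
  have qy: "q \<star> y = lg *\<^sub>R (y \<star> q)"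
  proof -
    have "q \<star> y = q \<star> y \<star> ((- q) \<star> q)" using qinv qR yR R_mult by simp
    also have "\<dots> = (q \<star> y \<star> (- q)) \<star> q" by (simp only: mult_assoc)
    also have "\<dots> = lg *\<^sub>R (y \<star> q)" using lg[of y] y Gg by simp
    finally show ?thesis .
  qed
  \<comment> \<open>Passing \<open>q\<close> through \<open>y\<close> twice shows that the scalar
    squares to 1; it is not 1 because \<open>y\<close> was chosen not to commute with
    \<open>q\<close>.\<close>
  have "- y = lg *\<^sub>R (lg *\<^sub>R - y)"
  proof -
    have "- y = q \<star> (q \<star> y)" using q yR by (simp add: mult_assoc[symmetric])
    also have "\<dots> = lg *\<^sub>R ((q \<star> y) \<star> q)" unfolding qy by (simp add: mult_assoc[symmetric] qy)
    also have "\<dots> = lg *\<^sub>R (lg *\<^sub>R (y \<star> (q \<star> q)))" unfolding qy by (simp add: mult_assoc)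
    finally show ?thesis using q yR by simp
  qed
  then have "(lg * lg - 1) *\<^sub>R y = 0" by (simp add: scaleR_diff_left)
  then have "lg * lg = 1" using y0 by simp
  moreover have "lg \<noteq> 1" using qy y(4) by auto
  ultimately have "lg = -1" using square_eq_1_iff by blast
  then have anti: "q \<star> y = - (y \<star> q)" using qy by simp
  obtain y' where y': "y' \<in> C" "y' \<in> V (inv g)" "y \<star> y' = u" "y' \<star> y = u" using C_inverse[OF y(2,1,3) y0] by blast
  have y'R: "y' \<in> R" using y' V_R y(1) by blast
  define \<theta> where "\<theta> = (\<lambda>v. y \<star> v \<star> y')"
  have lin: "linear \<theta>" unfolding \<theta>_def by (rule linearI) (simp_all add: distribs)
  have mul: "\<theta> (x \<star> z) = \<theta> x \<star> \<theta> z" if "x \<in> R" "z \<in> R" for x z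
  proof -
    have "\<theta> x \<star> \<theta> z = y \<star> x \<star> (y' \<star> y) \<star> z \<star> y'" unfolding \<theta>_def by (simp add: mult_assoc)
    then show ?thesis using that y' yR unfolding \<theta>_def by (simp add: mult_assoc)
  qed
  have thq: "\<theta> q = - q"
  proof -
    have "y \<star> q = - (q \<star> y)" using anti by simp
    then have "\<theta> q = - (q \<star> (y \<star> y'))" unfolding \<theta>_def by (simp add: mult_assoc)
    then show ?thesis using y' qR by simp
  qed
  have thu: "\<theta> u = u" unfolding \<theta>_def using y' yR by simp
  have thV: "\<theta> x \<in> V s" if "s \<in> carrier G" "x \<in> V s" for s x
  proof -
    have "\<theta> x \<in> V (g \<otimes> s \<otimes> inv g)" unfolding \<theta>_def
      using V_mult[OF _ _ V_mult[OF _ _ y(3) that(2)] y'(2)] that y(1) by simp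
    also have "g \<otimes> s \<otimes> inv g = s" using that y(1) by (metis inv_closed m_comm m_closed inv_solve_right)
    finally show ?thesis .
  qed
  have thC: "\<theta> c \<in> C" if "c \<in> C" for c unfolding \<theta>_def using C_mult that y y' by blast
  have thE: "\<theta> (E i j) = E i j" if "i < n" "j < n" for i j
  proof -
    have "\<theta> (E i j) = E i j \<star> (y \<star> y')" unfolding \<theta>_def using y(2) that by (simp add: C_def mult_assoc)
    then show ?thesis using y' E_R[OF that] by simp
  qed
  \<comment> \<open>Conjugation by \<open>y\<close> maps \<open>c\<close> to (x1 + y1 q) c, since
    the quotient of the two lies in \<open>C \<inter> V \<one>\<close>. As it sends q to -q,
    applying it twice multiplies \<open>c\<close> by the norm x1^2 + y1^2 > 0, so
    \<open>eigen_split\<close> applies.\<close>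
  have eigy: "x \<in> span {v \<in> V s. \<exists>l. l \<noteq> 0 \<and> y \<star> v \<star> y' = l *\<^sub>R v}" if s: "s \<in> carrier G" "x \<in> V s" for s x
  proof (rule span_E_C[OF s])
    fix i j g' c assume c: "i < n" "j < n" "g' \<in> carrier G" "c \<in> C" "c \<in> V g'" "E i j \<star> c \<in> V s"
    have cR: "c \<in> R" using c V_R by blast
    show "E i j \<star> c \<in> span {v \<in> V s. \<exists>l. l \<noteq> 0 \<and> y \<star> v \<star> y' = l *\<^sub>R v}"
    proof (cases "c = 0")
      case False
      obtain c' where c': "c' \<in> C" "c' \<in> V (inv g')" "c \<star> c' = u" "c' \<star> c = u" using C_inverse[OF c(4,3,5) False] by blast
      have "\<theta> c \<star> c' \<in> V (g' \<otimes> inv g')" using V_mult[OF c(3) _ thV[OF c(3,5)] c'(2)] c(3) by simp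
      then have "\<theta> c \<star> c' \<in> V \<one>" using c(3) by simp
      moreover have "\<theta> c \<star> c' \<in> C" using thC c c' C_mult by blast
      ultimately obtain x1 y1 where w: "\<theta> c \<star> c' = x1 *\<^sub>R u + y1 *\<^sub>R q" using Ce by blast
      have thcR: "\<theta> c \<in> R" using thV[OF c(3,5)] V_R c(3) by blast
      have th1: "\<theta> c = (x1 *\<^sub>R u + y1 *\<^sub>R q) \<star> c"
      proof -
        have "\<theta> c = \<theta> c \<star> (c' \<star> c)" using c' thcR by simp
        then show ?thesis using w by (simp add: mult_assoc[symmetric])
      qed
      have wR: "x1 *\<^sub>R u + y1 *\<^sub>R q \<in> R" using qR by (intro subspace_add subspace_scale) auto
      have "\<theta> (\<theta> c) = \<theta> ((x1 *\<^sub>R u + y1 *\<^sub>R q) \<star> c)" by (rule arg_cong[OF th1])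
      also have "\<dots> = \<theta> (x1 *\<^sub>R u + y1 *\<^sub>R q) \<star> \<theta> c" by (rule mul[OF wR cR])
      also have "\<theta> (x1 *\<^sub>R u + y1 *\<^sub>R q) = x1 *\<^sub>R u - y1 *\<^sub>R q"
        using thq thu by (simp add: linear_add[OF lin] linear_cmul[OF lin])
      also have "(x1 *\<^sub>R u - y1 *\<^sub>R q) \<star> \<theta> c = ((x1 *\<^sub>R u - y1 *\<^sub>R q) \<star> (x1 *\<^sub>R u + y1 *\<^sub>R q)) \<star> c"
        unfolding th1 by (simp only: mult_assoc)
      also have "(x1 *\<^sub>R u - y1 *\<^sub>R q) \<star> (x1 *\<^sub>R u + y1 *\<^sub>R q) = (x1 * x1 + y1 * y1) *\<^sub>R u"
        using q qR by (simp add: distribs scaleR_add_left algebra_simps)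
      finally have th2: "\<theta> (\<theta> c) = (x1 * x1 + y1 * y1) *\<^sub>R c" using cR by simp
      have "x1 * x1 + y1 * y1 > 0"
      proof -
        have "x1 \<noteq> 0 \<or> y1 \<noteq> 0"
        proof (rule ccontr)
          assume "\<not> ?thesis"
          then have "\<theta> c = 0" using th1 by simp
          then have "y' \<star> (y \<star> c \<star> y') \<star> y = 0" unfolding \<theta>_def by simp
          then have "(y' \<star> y) \<star> c \<star> (y' \<star> y) = 0" by (simp only: mult_assoc)
          then show False using y' cR False by simp
        qed
        then show ?thesis by (metis not_sum_squares_lt_zero sum_squares_gt_zero_iff)
      qed
      moreover have tE: "\<theta> (E i j \<star> z) = E i j \<star> \<theta> z" if "z \<in> R" for z
        using mul[OF E_R[OF c(1,2)] that] thE[OF c(1,2)] by simp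
      moreover have "\<theta> (\<theta> (E i j \<star> c)) = (x1 * x1 + y1 * y1) *\<^sub>R (E i j \<star> c)"
        using tE[OF cR] tE[OF thcR] th2 by simp
      ultimately show ?thesis
        using eigen_split[OF lin subspace_V[OF s(1)] c(6) thV[OF s(1) c(6)]] unfolding \<theta>_def by blast
    qed (simp add: span_0)
  qed
  obtain l where l: "\<And>x. x \<in> \<Gamma> g \<Longrightarrow> y \<star> x \<star> y' = l *\<^sub>R x"
    using conj_scalar[OF y(1,3) y'(2,3,4) eigy y(1)] by blast
  \<comment> \<open>The component \<open>\<Gamma> g\<close> contains \<open>y\<close>, which is
    fixed, and \<open>q \<star> y\<close>, which is negated; no single scalar does both.\<close>
  have "y \<star> y \<star> y' = y" using y' yR by (simp add: mult_assoc)
  then have "(l - 1) *\<^sub>R y = 0" using l[of y] y Gg by (simp add: scaleR_diff_left)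
  then have l1: "l = 1" using y0 by simp
  have qyV: "q \<star> y \<in> V g" using V_mult[OF one_closed y(1) q(2) y(3)] y(1) by simp
  have "y \<star> (q \<star> y) \<star> y' = \<theta> q \<star> \<theta> y" using mul[OF qR yR] unfolding \<theta>_def by simp
  also have "\<dots> = - (q \<star> y)" using thq \<open>y \<star> y \<star> y' = y\<close> unfolding \<theta>_def by simp
  finally have "- (q \<star> y) = q \<star> y" using l[of "q \<star> y"] qyV Gg l1 by simp
  then have "2 *\<^sub>R (q \<star> y) = 0" unfolding scaleR_2 by (metis add.right_inverse)
  then have "q \<star> y = 0" by simp
  then have "q \<star> (q \<star> y) = 0" by simp
  then show False using q yR y0 by (simp add: mult_assoc[symmetric])
qed

text \<open>\<open>C \<inter> V \<one>\<close> is a real division algebra of finite dimension. A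
  nonscalar element satisfies a quadratic relation, and rescaling it gives a square root of -1,
  which \<open>no_imaginary_unit\<close> excludes.\<close>

theorem C_identity:
  assumes "c \<in> C" "c \<in> V \<one>"
  shows "\<exists>l. c = l *\<^sub>R u"
proof -
  define W where "W = C \<inter> V \<one>"
  have W: "subspace W" unfolding W_def by (rule subspace_inter[OF subspace_C subspace_V[OF one_closed]])
  have WR: "W \<subseteq> R" unfolding W_def using V_R by blast
  have quad: "\<exists>s t. t \<noteq> 0 \<and> (a - s *\<^sub>R u) \<star> (a - s *\<^sub>R u) = - (t\<^sup>2 *\<^sub>R u)"
    if a: "a \<in> W" and ns: "\<And>c. a \<noteq> c *\<^sub>R u" for a
  proof -
    have aR: "a \<in> R" using a WR by blast
    show ?thesis
    proof (rule quadratic_relation[where e = u and a = a and W = W and T = "b ` idx"])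
      show "u \<star> u = u" "u \<star> a = a" "a \<star> u = a" "u \<noteq> 0" using aR u_nz by auto
      show "u \<in> W" unfolding W_def using u_C u_V by simp
      show "W \<subseteq> span (b ` idx)" using WR unfolding R_def .
      show "a \<star> v \<in> W" if "v \<in> W" for v
        using that a V_mult[OF one_closed one_closed, of a v] C_mult unfolding W_def by auto
      show "v = 0 \<or> w = 0" if vw: "v \<in> W" "w \<in> W" "v \<star> w = 0" for v w
      proof (rule disjCI)
        assume "w \<noteq> 0"
        then obtain w' where "w \<star> w' = u" using C_inverse[of w \<one>] vw(2) unfolding W_def by auto
        then have "v \<star> u = (v \<star> w) \<star> w'" by (simp add: mult_assoc)
        then show "v = 0" using vw WR by auto
      qed
    qed (use W ns in auto)
  qed
  show ?thesis
  proof (rule ccontr)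
    assume "\<not> ?thesis"
    then have ns: "c \<noteq> l *\<^sub>R u" for l by blast
    obtain s t where st: "t \<noteq> 0" "(c - s *\<^sub>R u) \<star> (c - s *\<^sub>R u) = - (t\<^sup>2 *\<^sub>R u)"
      using quad[of c] ns assms unfolding W_def by blast
    define q where "q = (1 / t) *\<^sub>R (c - s *\<^sub>R u)"
    have "q \<in> W" unfolding q_def using W assms u_C u_V
      by (intro subspace_scale subspace_diff) (auto simp: W_def)
    moreover have "q \<star> q = - u" unfolding q_def using st by (simp add: power2_eq_square)
    ultimately show False
      using no_imaginary_unit[of q] quad unfolding W_def by (metis Int_iff)
  qed
qed

text \<open>Conjugation by the diagonal matrix with 2 in place \<open>i\<close> and 1 elsewhere
  multiplies \<open>E p q \<star> c\<close> by 2, 1/2 or 1. Any number different from its inverse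
  would serve in place of 2: it tells row \<open>i\<close> from column \<open>i\<close> and both
  from the other places.\<close>

lemma block_scalar:
  assumes g: "g \<in> carrier G" and i: "i < n"
  obtains l where "\<And>x. x \<in> \<Gamma> g \<Longrightarrow> (u + E i i) \<star> x \<star> (u - (1 / 2) *\<^sub>R E i i) = l *\<^sub>R x"
proof -
  have EV: "E i i \<in> V \<one>" using E_V[OF i i] d_carrier[OF i] by simp
  have ER: "E i i \<in> R" using E_R i by blast
  have EE: "E i i \<star> E i i = E i i" using E_mult i by simp
  let ?a = "u + E i i" and ?a' = "u - (1 / 2) *\<^sub>R E i i"
  have a: "?a \<in> V \<one>" "?a' \<in> V (inv \<one>)"
    using EV u_V by (auto intro!: subspace_add[OF subspace_V] subspace_diff[OF subspace_V] subspace_scale[OF subspace_V])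
  have h: "x = (1 / 2) *\<^sub>R x + (1 / 2) *\<^sub>R x" for x :: 'a by (simp add: scaleR_add_left[symmetric])
  have aa: "?a \<star> ?a' = u" "?a' \<star> ?a = u"
    using ER EE h[of "E i i"] by (simp_all add: distribs algebra_simps) 
  have eig: "x \<in> span {v \<in> V s. \<exists>l. l \<noteq> 0 \<and> ?a \<star> v \<star> ?a' = l *\<^sub>R v}" if s: "s \<in> carrier G" "x \<in> V s" for s x
  proof (rule span_E_C[OF s])
    fix p q g' c assume c: "p < n" "q < n" "g' \<in> carrier G" "c \<in> C" "c \<in> V g'" "E p q \<star> c \<in> V s"
    have cR: "c \<in> R" using c V_R by blast
    have cE: "c \<star> E i i = E i i \<star> c" using c(4) i unfolding C_def by blast
    have "?a \<star> (E p q \<star> c) \<star> ?a' = (?a \<star> E p q \<star> ?a') \<star> c"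
      using cR E_R[OF c(1,2)] ER by (simp add: distribs mult_assoc cE R_mult)
    also have "?a \<star> E p q \<star> ?a' = ((if p = i then 2 else 1) * (if q = i then 1 / 2 else 1)) *\<^sub>R E p q"
      using c(1,2) i E_mult E_R ER h[of "E p q"] by (auto simp: distribs scaleR_2 algebra_simps)
    finally have "?a \<star> (E p q \<star> c) \<star> ?a' = ((if p = i then 2 else 1) * (if q = i then 1 / 2 else 1)) *\<^sub>R (E p q \<star> c)"
      by simp
    moreover have "(if p = i then 2 else 1) * (if q = i then 1 / 2 else 1) \<noteq> (0::real)" by simp
    ultimately show "E p q \<star> c \<in> span {v \<in> V s. \<exists>l. l \<noteq> 0 \<and> ?a \<star> v \<star> ?a' = l *\<^sub>R v}"
      using c(6) by (intro span_base) blast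
  qed
  show thesis using conj_scalar[OF one_closed a aa eig g] that by blast
qed

end

section \<open>Symplectic bases of Pauli groups\<close>

text \<open>Modulo signs, \<open>P\<close> is an elementary abelian 2-group. Commutation is an
  alternating form on it, nondegenerate by \<open>P_center\<close>, and the sign of the square is a
  quadratic form with this polarization. Sought is a symplectic basis adapted to the quadratic
  form.\<close>

locale pauli_set = ralg mult for mult :: "'a::real_vector \<Rightarrow> 'a \<Rightarrow> 'a" (infixl "\<star>" 70) +
  fixes P :: "'a set" and e :: 'a and T :: "'a set"
  assumes e_P [simp]: "e \<in> P" and e_nz: "e \<noteq> 0"
    and P_mult [simp]: "x \<in> P \<Longrightarrow> y \<in> P \<Longrightarrow> x \<star> y \<in> P"
    and P_comm: "x \<in> P \<Longrightarrow> y \<in> P \<Longrightarrow> x \<star> y = y \<star> x \<or> x \<star> y = - (y \<star> x)"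
    and P_sq: "x \<in> P \<Longrightarrow> x \<star> x = e \<or> x \<star> x = - e"
    and e_left [simp]: "x \<in> P \<Longrightarrow> e \<star> x = x" and e_right [simp]: "x \<in> P \<Longrightarrow> x \<star> e = x"
    and P_center: "x \<in> P \<Longrightarrow> (\<And>y. y \<in> P \<Longrightarrow> x \<star> y = y \<star> x) \<Longrightarrow> x = e \<or> x = - e"
    and P_span: "P \<subseteq> span T" and finite_T: "finite T"
begin

definition commutes :: "'a \<Rightarrow> 'a \<Rightarrow> bool" where "commutes x y \<longleftrightarrow> x \<star> y = y \<star> x"
definition anti :: "'a \<Rightarrow> 'a \<Rightarrow> bool" where "anti x y \<longleftrightarrow> x \<star> y = - (y \<star> x)"

lemma P_nz: assumes "x \<in> P" shows "x \<noteq> 0"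
  using P_sq[OF assms] e_nz by auto

lemma commutes_sym: "commutes x y \<Longrightarrow> commutes y x" unfolding commutes_def by simp
lemma anti_sym: "anti x y \<Longrightarrow> anti y x" unfolding anti_def by simp

lemma commutes_or_anti: "x \<in> P \<Longrightarrow> y \<in> P \<Longrightarrow> commutes x y \<or> anti x y"
  using P_comm unfolding commutes_def anti_def by blast

lemma commutes_mult: "commutes x z \<Longrightarrow> commutes y z \<Longrightarrow> commutes (x \<star> y) z"
  unfolding commutes_def by (metis mult_assoc)

lemma anti_mult: "anti x z \<Longrightarrow> anti y z \<Longrightarrow> commutes (x \<star> y) z"
  unfolding commutes_def anti_def by (metis mult_assoc mult_minus_left mult_minus_right minus_minus)

lemma commutes_anti_mult: "commutes x z \<Longrightarrow> anti y z \<Longrightarrow> anti (x \<star> y) z"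
  unfolding commutes_def anti_def by (metis mult_assoc mult_minus_left mult_minus_right)

lemma anti_commutes_mult: "anti x z \<Longrightarrow> commutes y z \<Longrightarrow> anti (x \<star> y) z"
  unfolding commutes_def anti_def by (metis mult_assoc mult_minus_left mult_minus_right)

lemma commutes_refl [simp]: "commutes x x" unfolding commutes_def by simp

lemma commutes_e [simp]: "x \<in> P \<Longrightarrow> commutes e x" unfolding commutes_def by simp

lemma square_mult: "commutes x y \<Longrightarrow> (x \<star> y) \<star> (x \<star> y) = (x \<star> x) \<star> (y \<star> y)"
  unfolding commutes_def by (metis mult_assoc)

lemma square_mult_anti: "anti x y \<Longrightarrow> (x \<star> y) \<star> (x \<star> y) = - ((x \<star> x) \<star> (y \<star> y))"
  unfolding anti_def by (metis mult_assoc mult_minus_left mult_minus_right minus_minus)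

definition sq :: "bool \<Rightarrow> 'a" where "sq q = (if q then - e else e)"

text \<open>Mutually orthogonal hyperbolic pairs. With \<open>\<eta> i\<close> the pair behaves like
  i, j in the quaternions, otherwise like X, Y in M_2(R). Pairs whose squares have different signs
  are avoided by replacing one member by the product.\<close>

definition fam :: "(nat \<Rightarrow> bool) \<Rightarrow> nat \<Rightarrow> (nat \<Rightarrow> 'a) \<Rightarrow> (nat \<Rightarrow> 'a) \<Rightarrow> bool" where
  "fam \<eta> m a b \<longleftrightarrow> (\<forall>i<m. a i \<in> P \<and> b i \<in> P \<and> anti (a i) (b i) \<and> a i \<star> a i = sq (\<eta> i) \<and> b i \<star> b i = sq (\<eta> i) \<and>
     (\<forall>j<m. j \<noteq> i \<longrightarrow> commutes (a i) (a j) \<and> commutes (a i) (b j) \<and> commutes (b i) (a j) \<and> commutes (b i) (b j)))"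

definition commutant :: "nat \<Rightarrow> (nat \<Rightarrow> 'a) \<Rightarrow> (nat \<Rightarrow> 'a) \<Rightarrow> 'a set" where
  "commutant m a b = {x \<in> P. \<forall>i<m. commutes x (a i) \<and> commutes x (b i)}"

definition pw :: "'a \<Rightarrow> int \<Rightarrow> 'a" where "pw x i = (if i = 1 then x else e)"

text \<open>The analogue of \<open>X_t\<close>, one factor for each pair.\<close>

primrec prodY :: "(nat \<Rightarrow> 'a) \<Rightarrow> (nat \<Rightarrow> 'a) \<Rightarrow> nat \<Rightarrow> (nat \<Rightarrow> int) \<Rightarrow> 'a" where
  "prodY a b 0 t = e"
| "prodY a b (Suc s) t = prodY a b s t \<star> (pw (a s) (t (2 * s)) \<star> pw (b s) (t (2 * s + 1)))"

lemma famD: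
  assumes "fam \<eta> m a b" "i < m"
  shows "a i \<in> P" "b i \<in> P" "anti (a i) (b i)" "a i \<star> a i = sq (\<eta> i)" "b i \<star> b i = sq (\<eta> i)"
    "\<And>j. j < m \<Longrightarrow> j \<noteq> i \<Longrightarrow> commutes (a i) (a j) \<and> commutes (a i) (b j) \<and> commutes (b i) (a j) \<and> commutes (b i) (b j)"
  using assms unfolding fam_def by blast+

lemma fam_less: "fam \<eta> (Suc m) a b \<Longrightarrow> fam \<eta> m a b" unfolding fam_def by auto

lemma pw_P [simp]: "x \<in> P \<Longrightarrow> pw x i \<in> P" unfolding pw_def by simp

lemma prodY_cong: "(\<And>i. i < 2 * s \<Longrightarrow> t i = t' i) \<Longrightarrow> prodY a b s t = prodY a b s t'"
  by (induction s) auto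

lemma prodY_P: "fam \<eta> m a b \<Longrightarrow> prodY a b m t \<in> P"
proof (induction m)
  case (Suc m)
  then show ?case using famD(1,2)[OF Suc.prems, of m] fam_less by simp
qed simp

lemma commutes_pw: "x \<in> P \<Longrightarrow> z \<in> P \<Longrightarrow> commutes x z \<Longrightarrow> commutes (pw x i) z"
  unfolding pw_def by simp

lemma prodY_commutes:
  assumes "fam \<eta> m a b" "x \<in> P" "\<And>i. i < m \<Longrightarrow> commutes (a i) x \<and> commutes (b i) x"
  shows "commutes (prodY a b m t) x"
  using assms
proof (induction m)
  case (Suc m)
  have "a m \<in> P" "b m \<in> P" using famD(1,2)[OF Suc.prems(1), of m] by auto
  moreover have "commutes (prodY a b m t) x" using Suc fam_less by (meson less_SucI)
  ultimately show ?case using Suc.prems(2,3) by (auto intro!: commutes_mult commutes_pw)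
qed simp

lemma pair_mult:
  assumes "a \<in> P" "b \<in> P" "anti a b" "a \<star> a = sq q" "b \<star> b = sq q"
    "i \<in> {0, 1}" "j \<in> {0, 1}" "i' \<in> {0, 1}" "j' \<in> {0, 1}"
  shows "(pw a i \<star> pw b j) \<star> (pw a i' \<star> pw b j') =
    pair_sign q i j i' j' *\<^sub>R (pw a ((i + i') mod 2) \<star> pw b ((j + j') mod 2))"
proof -
  have ba: "b \<star> a = - (a \<star> b)" using assms(3) unfolding anti_def by simp
  have ba': "b \<star> (a \<star> x) = - (a \<star> (b \<star> x))" for x
    using ba by (metis mult_assoc mult_minus_left)
  have aa: "a \<star> (a \<star> x) = sq q \<star> x" "b \<star> (b \<star> x) = sq q \<star> x" for x
    using assms(4,5) by (simp_all add: mult_assoc[symmetric])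
  show ?thesis
    using assms(1,2,6-9) by (auto simp: pw_def pair_sign_def mult_assoc ba ba' aa assms(4,5) sq_def)
qed

lemma prodY_mult:
  assumes "fam \<eta> m a b" "\<And>i. i < 2 * m \<Longrightarrow> t i \<in> {0, 1}" "\<And>i. i < 2 * m \<Longrightarrow> t' i \<in> {0, 1}"
  shows "prodY a b m t \<star> prodY a b m t' =
    (\<Prod>i<m. pair_sign (\<eta> i) (t (2 * i)) (t (2 * i + 1)) (t' (2 * i)) (t' (2 * i + 1))) *\<^sub>R
      prodY a b m (\<lambda>i. (t i + t' i) mod 2)"
  using assms
proof (induction m)
  case (Suc m)
  let ?q = "\<lambda>t. pw (a m) (t (2 * m)) \<star> pw (b m) (t (2 * m + 1))"
  note D = famD[OF Suc.prems(1), of m, simplified]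
  have fm: "fam \<eta> m a b" using Suc.prems(1) by (rule fam_less)
  have qP: "?q t \<in> P" for t using D(1,2) by simp
  have "commutes (prodY a b m t') (?q t)"
  proof (rule prodY_commutes[OF fm qP])
    fix i assume i: "i < m"
    then have "commutes (a m) (a i)" "commutes (b m) (a i)" "commutes (a m) (b i)" "commutes (b m) (b i)"
      using D(6)[of i] by auto
    moreover have "a i \<in> P" "b i \<in> P" using famD(1,2)[OF fm i] by auto
    ultimately have "commutes (?q t) (a i)" "commutes (?q t) (b i)"
      using D(1,2) by (auto intro!: commutes_mult commutes_pw)
    then show "commutes (a i) (?q t) \<and> commutes (b i) (?q t)" using commutes_sym by blast
  qed
  then have c: "?q t \<star> prodY a b m t' = prodY a b m t' \<star> ?q t" unfolding commutes_def by simp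
  have "prodY a b (Suc m) t \<star> prodY a b (Suc m) t' = prodY a b m t \<star> (?q t \<star> prodY a b m t') \<star> ?q t'"
    by (simp add: mult_assoc)
  also have "\<dots> = (prodY a b m t \<star> prodY a b m t') \<star> (?q t \<star> ?q t')"
    unfolding c by (simp only: mult_assoc)
  also have "?q t \<star> ?q t' = pair_sign (\<eta> m) (t (2 * m)) (t (2 * m + 1)) (t' (2 * m)) (t' (2 * m + 1)) *\<^sub>R
      ?q (\<lambda>i. (t i + t' i) mod 2)"
    using Suc.prems(2,3) by (intro pair_mult D(1-5)) auto
  finally show ?case using Suc.IH[OF fm] Suc.prems(2,3) by (simp add: mult.commute)
qed simp

text \<open>Orthogonal projection away from the pairs: among all their members, multiplication by
  \<open>a i\<close> changes only the commutation with \<open>b i\<close>, and vice versa, so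
  failures to commute are corrected pair by pair.\<close>

lemma adjust:
  assumes "fam \<eta> m a b" "x \<in> P"
  obtains t where "t \<in> pidx m" "x \<star> prodY a b m t \<in> commutant m a b"
proof -
  have "\<exists>t. (\<forall>i. t i = 0 \<or> t i = 1) \<and> x \<star> prodY a b m t \<in> commutant m a b"
    using assms
  proof (induction m)
    case 0
    then show ?case by (intro exI[of _ "\<lambda>_. 0"]) (auto simp: commutant_def)
  next
    case (Suc m)
    note D = famD[OF Suc.prems(1), of m, simplified]
    have fm: "fam \<eta> m a b" using Suc.prems(1) by (rule fam_less)
    obtain t where t: "\<forall>i. t i = 0 \<or> t i = 1" "x \<star> prodY a b m t \<in> commutant m a b"
      using Suc.IH[OF fm Suc.prems(2)] by blast
    define y where "y = x \<star> prodY a b m t"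
    have y: "y \<in> P" "\<And>i. i < m \<Longrightarrow> commutes y (a i) \<and> commutes y (b i)"
      using t(2) unfolding y_def commutant_def by auto
    define i j :: int where "i = (if commutes y (b m) then 0 else 1)" and "j = (if commutes y (a m) then 0 else 1)"
    define w where "w = pw (a m) i \<star> pw (b m) j"
    have wP: "w \<in> P" unfolding w_def using D(1,2) by simp
    have an: "anti y (a m)" if "\<not> commutes y (a m)" using commutes_or_anti[OF y(1) D(1)] that by blast
    have bn: "anti y (b m)" if "\<not> commutes y (b m)" using commutes_or_anti[OF y(1) D(2)] that by blast
    have ba: "anti (b m) (a m)" using D(3) anti_sym by blast
    have "commutes (y \<star> w) (a m)"
    proof (cases "commutes y (a m)")
      case True
      then have "commutes w (a m)" using D(1,2) unfolding w_def j_def by (auto simp: pw_def intro!: commutes_mult)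
      then show ?thesis using True commutes_mult by blast
    next
      case False
      then have "anti w (a m)" using D(1,2) ba unfolding w_def j_def by (auto simp: pw_def intro!: commutes_anti_mult)
      then show ?thesis using an[OF False] anti_mult by blast
    qed
    moreover have "commutes (y \<star> w) (b m)"
    proof (cases "commutes y (b m)")
      case True
      then have "commutes w (b m)" using D(1,2) unfolding w_def i_def by (auto simp: pw_def intro!: commutes_mult)
      then show ?thesis using True commutes_mult by blast
    next
      case False
      then have "anti w (b m)" using D(1-3) unfolding w_def i_def by (auto simp: pw_def intro!: anti_commutes_mult)
      then show ?thesis using bn[OF False] anti_mult by blast
    qed
    moreover have "commutes (y \<star> w) (a l) \<and> commutes (y \<star> w) (b l)" if "l < m" for l
      using y(2)[OF that] D(6)[of l] D(1,2) famD(1,2)[OF fm that] that unfolding w_def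
      by (auto intro!: commutes_mult commutes_pw)
    ultimately have K: "y \<star> w \<in> commutant (Suc m) a b" using y(1) wP unfolding commutant_def by (auto simp: less_Suc_eq)
    define t' where "t' = t(2 * m := i, 2 * m + 1 := j)"
    have "prodY a b (Suc m) t' = prodY a b m t \<star> w"
      using prodY_cong[of m t' t a b] unfolding w_def by (simp add: t'_def)
    then have "x \<star> prodY a b (Suc m) t' \<in> commutant (Suc m) a b" using K unfolding y_def by (simp add: mult_assoc)
    moreover have "\<forall>l. t' l = 0 \<or> t' l = 1" using t(1) unfolding t'_def i_def j_def by auto
    ultimately show ?case by blast
  qed
  then obtain t where t: "\<forall>i. t i = 0 \<or> t i = 1" "x \<star> prodY a b m t \<in> commutant m a b" by blast
  have "restrict t {..<2 * m} \<in> pidx m" using t(1) unfolding pidx_def by auto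
  moreover have "prodY a b m (restrict t {..<2 * m}) = prodY a b m t" by (rule prodY_cong) simp
  ultimately show thesis using that t(2) by metis
qed

text \<open>Move \<open>x\<close> into the commutant by \<open>adjust\<close>. The result commutes
  with all pairs and with the adjusted form of every \<open>z\<close>, hence with \<open>z\<close>
  itself. So it is central and equals e or -e, which determines \<open>x\<close> up to sign because
  each \<open>prodY\<close> squares to e or -e.\<close>

lemma fam_generates:
  assumes f: "fam \<eta> m a b" and K: "\<And>y z. y \<in> commutant m a b \<Longrightarrow> z \<in> commutant m a b \<Longrightarrow> commutes y z"
    and x: "x \<in> P"
  obtains t where "t \<in> pidx m" "x = prodY a b m t \<or> x = - prodY a b m t"
proof -
  obtain t where t: "t \<in> pidx m" "x \<star> prodY a b m t \<in> commutant m a b" using adjust[OF f x] by blast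
  let ?Y = "prodY a b m t"
  have YP: "prodY a b m s \<in> P" for s by (rule prodY_P[OF f])
  have yP: "x \<star> ?Y \<in> P" using x YP by simp
  have "x \<star> ?Y = e \<or> x \<star> ?Y = - e"
  proof (rule P_center[OF yP])
    fix z assume z: "z \<in> P"
    obtain s where s: "z \<star> prodY a b m s \<in> commutant m a b" using adjust[OF f z] by blast
    have c1: "commutes (z \<star> prodY a b m s) (x \<star> ?Y)" using K s t(2) by blast
    have c2: "commutes (prodY a b m s) (x \<star> ?Y)"
      using t(2) unfolding commutant_def by (intro prodY_commutes[OF f yP]) (auto intro: commutes_sym)
    have "commutes (z \<star> prodY a b m s \<star> prodY a b m s) (x \<star> ?Y)" by (rule commutes_mult[OF c1 c2])
    moreover have "z \<star> prodY a b m s \<star> prodY a b m s = z \<or> z \<star> prodY a b m s \<star> prodY a b m s = - z"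
      using P_sq[OF YP, of s] z by (auto simp: mult_assoc)
    ultimately show "x \<star> ?Y \<star> z = z \<star> (x \<star> ?Y)" unfolding commutes_def by auto
  qed
  then have "x \<star> ?Y \<star> ?Y = ?Y \<or> x \<star> ?Y \<star> ?Y = - ?Y" using YP by auto
  moreover have "x \<star> ?Y \<star> ?Y = x \<or> x \<star> ?Y \<star> ?Y = - x" using P_sq[OF YP, of t] x by (auto simp: mult_assoc)
  ultimately have "x = ?Y \<or> x = - ?Y" by (metis minus_minus)
  then show thesis using that t(1) by blast
qed

text \<open>The \<open>a i\<close> are linearly independent: putting \<open>b j\<close> on both
  sides of a relation changes the sign of the j-th term relative to all others.\<close>

lemma fam_bound: assumes f: "fam \<eta> m a b" shows "m \<le> card T"
proof -
  have *: "\<forall>i\<in>{..<m}. c i = 0" if c: "(\<Sum>i<m. c i *\<^sub>R a i) = 0" for c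
  proof
    fix j assume j: "j \<in> {..<m}"
    have jm: "j < m" using j by simp
    note D = famD[OF f jm]
    have t: "b j \<star> a i \<star> b j = a i \<star> (b j \<star> b j) - (if i = j then 2 *\<^sub>R (a j \<star> (b j \<star> b j)) else 0)" if "i < m" for i
    proof (cases "i = j")
      case True
      have "b j \<star> a j = - (a j \<star> b j)" using D(3) unfolding anti_def by simp
      then show ?thesis using True by (simp add: mult_assoc scaleR_2)
    next
      case False
      then have "b j \<star> a i = a i \<star> b j" using D(6)[OF that] unfolding commutes_def by blast
      then show ?thesis using False by (simp add: mult_assoc)
    qed
    have "0 = b j \<star> (\<Sum>i<m. c i *\<^sub>R a i) \<star> b j" unfolding c by simp
    also have "\<dots> = (\<Sum>i<m. c i *\<^sub>R (b j \<star> a i \<star> b j))" by (simp add: mult_sum_left mult_sum_right)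
    also have "\<dots> = (\<Sum>i<m. c i *\<^sub>R (a i \<star> (b j \<star> b j)) - (if i = j then c j *\<^sub>R (2 *\<^sub>R (a j \<star> (b j \<star> b j))) else 0))"
      using t by (intro sum.cong) (auto simp: scaleR_diff_right)
    also have "\<dots> = (\<Sum>i<m. c i *\<^sub>R a i) \<star> (b j \<star> b j) - c j *\<^sub>R (2 *\<^sub>R (a j \<star> (b j \<star> b j)))"
      using jm by (simp add: sum_subtractf mult_sum_left)
    finally have "c j *\<^sub>R (a j \<star> (b j \<star> b j)) = 0" unfolding c by simp
    moreover have "a j \<star> (b j \<star> b j) \<noteq> 0" by (rule P_nz[OF P_mult[OF D(1) P_mult[OF D(2,2)]]])
    ultimately show "c j = 0" by simp
  qed
  have "inj_on a {..<m}" "independent (a ` {..<m})" using family_independent[of "{..<m}" a] * by auto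
  moreover have "a ` {..<m} \<subseteq> span T" using famD(1)[OF f] P_span by blast
  ultimately have "card {..<m} \<le> card T" using real_vector.independent_span_bound[OF finite_T] card_image by metis
  then show ?thesis by simp
qed

lemma fam_extend:
  assumes f: "fam \<eta> m a b" and y: "y \<in> commutant m a b" and z: "z \<in> commutant m a b"
    and "anti y z" "y \<star> y = sq q" "z \<star> z = sq q"
  shows "fam (\<eta>(m := q)) (Suc m) (a(m := y)) (b(m := z))"
proof -
  have "commutes y (a i)" "commutes y (b i)" "commutes z (a i)" "commutes z (b i)"
    "commutes (a i) y" "commutes (b i) y" "commutes (a i) z" "commutes (b i) z" if "i < m" for i
    using y z that commutes_sym unfolding commutant_def by auto
  moreover have "y \<in> P" "z \<in> P" using y z unfolding commutant_def by auto
  ultimately show ?thesis using f assms(4-6) unfolding fam_def by (auto simp: less_Suc_eq)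
qed

lemma commutant_mult: "x \<in> commutant m a b \<Longrightarrow> y \<in> commutant m a b \<Longrightarrow> x \<star> y \<in> commutant m a b"
  unfolding commutant_def by (auto intro: commutes_mult)

text \<open>Take a maximal family of split pairs. Its commutant has no anticommuting x, y with x^2 =
  y^2 = e; it has none with x^2 = e and y^2 = -e either, because x and xy would be a split pair. So
  anticommuting elements there have square -e. If there are any, one quaternion pair is added, and
  the remaining commutant is commutative, since two quaternion pairs contain a split pair.\<close>

theorem symplectic_basis:
  obtains h m Y where "h \<Longrightarrow> 0 < m" "\<And>t. t \<in> pidx m \<Longrightarrow> Y t \<in> P" "Y (pzero m) = e"
    "\<And>s t. s \<in> pidx m \<Longrightarrow> t \<in> pidx m \<Longrightarrow> Y s \<star> Y t = psign h m s t *\<^sub>R Y (padd m s t)"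
    "\<And>x. x \<in> P \<Longrightarrow> \<exists>t\<in>pidx m. x = Y t \<or> x = - Y t"
proof -
  note goal = that
  have fin: thesis if f: "fam (\<lambda>i. h \<and> Suc i = m) m a b" and h: "h \<Longrightarrow> 0 < m"
    and K: "\<And>y z. y \<in> commutant m a b \<Longrightarrow> z \<in> commutant m a b \<Longrightarrow> commutes y z" for h m a b
  proof (rule goal[of h m "prodY a b m"])
    have "prodY a b s (pzero m) = e" if "s \<le> m" for s
      using that by (induction s) (auto simp: pw_def pzero_def)
    then show "prodY a b m (pzero m) = e" by simp
    show "prodY a b m s \<star> prodY a b m t = psign h m s t *\<^sub>R prodY a b m (padd m s t)"
      if "s \<in> pidx m" "t \<in> pidx m" for s t
    proof -
      have "prodY a b m (padd m s t) = prodY a b m (\<lambda>i. (s i + t i) mod 2)"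
        by (rule prodY_cong) (simp add: padd_def)
      moreover have "s i \<in> {0, 1}" "t i \<in> {0, 1}" if "i < 2 * m" for i
        using pidx_cases that \<open>s \<in> pidx m\<close> \<open>t \<in> pidx m\<close> by auto
      ultimately show ?thesis using prodY_mult[OF f, of s t] unfolding psign_def by simp
    qed
    show "\<exists>t\<in>pidx m. x = prodY a b m t \<or> x = - prodY a b m t" if "x \<in> P" for x
      using fam_generates[OF f K that] by blast
  qed (use h prodY_P[OF f] in auto)
  define Q where "Q = (\<lambda>m. \<exists>a b. fam (\<lambda>_. False) m a b)"
  have "Q 0" unfolding Q_def fam_def by simp
  moreover have "\<forall>m. Q m \<longrightarrow> m \<le> card T" using fam_bound unfolding Q_def by blast
  ultimately obtain m where m: "Q m" "\<And>m'. Q m' \<Longrightarrow> m' \<le> m"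
    using GreatestI_nat[of Q 0 "card T"] Greatest_le_nat[of Q _ "card T"] by blast
  obtain a b where f: "fam (\<lambda>_. False) m a b" using m(1) unfolding Q_def by blast
  let ?K = "commutant m a b"
  have KP: "x \<in> P" if "x \<in> ?K" for x using that unfolding commutant_def by simp
  have noM: "\<not> (x \<star> x = e \<and> y \<star> y = e)" if "x \<in> ?K" "y \<in> ?K" "anti x y" for x y
  proof
    assume "x \<star> x = e \<and> y \<star> y = e"
    then have "fam ((\<lambda>_. False)(m := False)) (Suc m) (a(m := x)) (b(m := y))"
      using that by (intro fam_extend[OF f]) (auto simp: sq_def)
    then have "fam (\<lambda>_. False) (Suc m) (a(m := x)) (b(m := y))" by (simp add: fun_upd_idem)
    then have "Suc m \<le> m" using m(2) unfolding Q_def by blast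
    then show False by simp
  qed
  have minus: "x \<star> x = - e" if xy: "x \<in> ?K" "y \<in> ?K" "anti x y" for x y
  proof (rule ccontr)
    assume "x \<star> x \<noteq> - e"
    then have x: "x \<star> x = e" using P_sq KP xy by blast
    then have y: "y \<star> y = - e" using P_sq KP xy noM by blast
    have "anti x (x \<star> y)" using xy(3) commutes_anti_mult[of x x y] anti_sym by (metis commutes_refl)
    moreover have "(x \<star> y) \<star> (x \<star> y) = e" using square_mult_anti[OF xy(3)] x y by simp
    ultimately show False using noM[OF xy(1) commutant_mult[OF xy(1,2)]] x by blast
  qed
  show thesis
  proof (cases "\<forall>y\<in>?K. \<forall>z\<in>?K. commutes y z")
    case True
    have f': "fam (\<lambda>i. False \<and> Suc i = m) m a b" using f by simp
    show thesis by (rule fin[OF f']) (use True in auto)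
  next
    case False
    then obtain y z where yz: "y \<in> ?K" "z \<in> ?K" "\<not> commutes y z" by blast
    have an: "anti y z" using commutes_or_anti yz KP by blast
    have sqs: "y \<star> y = sq True" "z \<star> z = sq True"
      using minus[OF yz(1,2) an] minus[OF yz(2,1) anti_sym[OF an]] unfolding sq_def by auto
    let ?a = "a(m := y)" and ?b = "b(m := z)"
    have "fam ((\<lambda>_. False)(m := True)) (Suc m) ?a ?b" by (rule fam_extend[OF f yz(1,2) an sqs])
    moreover have "(\<lambda>_. False)(m := True) = (\<lambda>i. True \<and> Suc i = Suc m)" by (auto simp: fun_eq_iff)
    ultimately have f': "fam (\<lambda>i. True \<and> Suc i = Suc m) (Suc m) ?a ?b" by simp
    show thesis
    proof (rule fin[OF f'])
      fix x w assume xw: "x \<in> commutant (Suc m) ?a ?b" "w \<in> commutant (Suc m) ?a ?b"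
      have sub: "v \<in> ?K \<and> commutes v y \<and> commutes v z" if "v \<in> commutant (Suc m) ?a ?b" for v
        using that unfolding commutant_def by (auto simp: less_Suc_eq)
      show "commutes x w"
      proof (rule ccontr)
        assume "\<not> commutes x w"
        then have xa: "anti x w" using commutes_or_anti sub xw KP by blast
        have m1: "x \<star> x = - e" "w \<star> w = - e" using minus xa anti_sym sub xw by blast+
        \<comment> \<open>\<open>x \<star> y\<close> and \<open>w \<star> y\<close> would be a split
          pair in the commutant of the first \<open>m\<close> pairs, against maximality.\<close>
        have 1: "(x \<star> y) \<star> (x \<star> y) = e" "(w \<star> y) \<star> (w \<star> y) = e"
          using square_mult sub xw m1 sqs unfolding sq_def by simp_all
        have wy: "commutes (w \<star> y) y" "commutes y x" "commutes y w" using sub[OF xw(2)] sub[OF xw(1)] commutes_mult commutes_sym by auto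
        have "anti w x" using xa anti_sym by blast
        then have "anti (w \<star> y) x" using anti_commutes_mult wy by blast
        then have "anti x (w \<star> y)" by (rule anti_sym)
        moreover have "commutes y (w \<star> y)" using wy(1) commutes_sym by blast
        ultimately have "anti (x \<star> y) (w \<star> y)" by (rule anti_commutes_mult)
        then show False using noM[OF commutant_mult commutant_mult] 1 sub xw yz(1) by blast
      qed
    qed simp
  qed
qed

end

section \<open>The structure of a fine grading\<close>

context fine_graded
begin

text \<open>Homogeneous elements of \<open>C\<close> normalized to square u or -u; up to a scalar
  these are all homogeneous elements of \<open>C\<close> (\<open>normalize_P\<close>).\<close>

definition P :: "'a set" where
  "P = {x \<in> C. (\<exists>g\<in>carrier G. x \<in> V g) \<and> (x \<star> x = u \<or> x \<star> x = - u)}"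

text \<open>\<open>z\<close> times the inverse of \<open>y\<close> has identity degree in
  \<open>C\<close> and is a scalar by \<open>C_identity\<close>.\<close>

lemma C_one_dim:
  assumes "g \<in> carrier G" "y \<in> C" "y \<in> V g" "y \<noteq> 0" "z \<in> C" "z \<in> V g"
  shows "\<exists>c. z = c *\<^sub>R y"
proof -
  obtain y' where y': "y' \<in> C" "y' \<in> V (inv g)" "y' \<star> y = u" using C_inverse[OF assms(2,1,3,4)] by blast
  have "z \<star> y' \<in> V (g \<otimes> inv g)" using V_mult[OF assms(1) _ assms(6) y'(2)] assms(1) by simp
  then have "z \<star> y' \<in> V \<one>" using assms(1) by simp
  then obtain c where c: "z \<star> y' = c *\<^sub>R u" using C_identity[OF C_mult[OF assms(5) y'(1)]] by blast
  have R: "z \<in> R" "y \<in> R" using assms V_R by blast+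
  have "z = (z \<star> y') \<star> y" using y' R by (simp add: mult_assoc)
  then show ?thesis using c R by auto
qed

text \<open>Homogeneous components of \<open>C\<close> are lines, so yz = l zy for a real l. The
  support is finite, so the degree of \<open>y\<close> has finite order, and some power of
  \<open>y\<close> is a nonzero scalar. Hence a power of l is 1, and the only real roots of unity
  are 1 and -1.\<close>

lemma C_commute:
  assumes y: "g \<in> carrier G" "y \<in> C" "y \<in> V g" "y \<noteq> 0" and z: "s \<in> carrier G" "z \<in> C" "z \<in> V s"
  shows "y \<star> z = z \<star> y \<or> y \<star> z = - (z \<star> y)"
proof (cases "z = 0")
  case z0: False
  have R: "y \<in> R" "z \<in> R" using y z V_R by blast+
  obtain y' where y': "y' \<in> C" "y \<star> y' = u" "y' \<star> y = u" using C_inverse[OF y(2,1,3,4)] by blast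
  obtain z' where z': "z' \<in> C" "z \<star> z' = u" "z' \<star> z = u" using C_inverse[OF z(2,1,3) z0] by blast
  have zy0: "z \<star> y \<noteq> 0"
  proof
    assume "z \<star> y = 0"
    then have "z' \<star> z \<star> y = 0" by (simp add: mult_assoc)
    then show False using z' R y by simp
  qed
  have zyV: "z \<star> y \<in> V (g \<otimes> s)" using V_mult[OF z(1) y(1) z(3) y(3)] y z m_comm by simp
  obtain l where l: "y \<star> z = l *\<^sub>R (z \<star> y)"
    using C_one_dim[of "g \<otimes> s" "z \<star> y" "y \<star> z"] y z zyV zy0 C_mult V_mult[OF y(1) z(1) y(3) z(3)] by blast
  define p where "p = (\<lambda>N. ((\<star>) y ^^ N) u)"
  have pS: "p (Suc N) = y \<star> p N" for N unfolding p_def by simp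
  have pV: "p N \<in> V (g [^] N) \<and> p N \<in> C" for N
  proof (induction N)
    case 0
    then show ?case using u_V u_C unfolding p_def by simp
  next
    case (Suc N)
    then have "p (Suc N) \<in> V (g \<otimes> g [^] N)" unfolding pS using V_mult[OF y(1) _ y(3)] y(1) by simp
    then show ?case using Suc C_mult y unfolding pS by (simp add: m_comm)
  qed
  have pR: "p N \<in> R" for N using pV V_R y(1) by blast
  have p0: "p N \<noteq> 0" for N
  proof (induction N)
    case (Suc N)
    show ?case
    proof
      assume "p (Suc N) = 0"
      then have "y' \<star> y \<star> p N = 0" unfolding pS by (simp add: mult_assoc)
      then show False using Suc y' pR by simp
    qed
  qed (simp add: p_def u_nz)
  have "g [^] N \<in> S" for N :: nat using V_zero[of "g [^] N" "p N"] pV p0 y(1) by auto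
  then have "range (\<lambda>N::nat. g [^] N) \<subseteq> S" by auto
  then have "\<not> inj (\<lambda>N::nat. g [^] N)" using finite_S finite_subset range_inj_infinite by blast
  then obtain N1 N2 :: nat where N: "g [^] N1 = g [^] N2" "N1 < N2"
    unfolding inj_on_def by (metis linorder_neqE_nat)
  define N where "N = N2 - N1"
  have "N1 + N = N2" unfolding N_def using N by simp
  then have "g [^] N1 \<otimes> g [^] N = g [^] N1"
    unfolding nat_pow_mult[OF y(1)] by (simp only: N(1))
  then have eqN: "g [^] N1 \<otimes> g [^] N = g [^] N1 \<otimes> \<one>" using y(1) by simp
  have "inv (g [^] N1) \<otimes> (g [^] N1 \<otimes> x) = x" if "x \<in> carrier G" for x
    using that y(1) by (simp add: m_assoc[symmetric])
  from this[of "g [^] N"] this[of \<one>] have gN: "g [^] N = \<one>" unfolding eqN using y(1) by simp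
  have N0: "N > 0" unfolding N_def using N by simp
  have "p N \<in> V \<one>" using pV[of N] gN by simp
  then obtain c where c: "p N = c *\<^sub>R u" using C_identity pV by blast
  have c0: "c \<noteq> 0" using c p0[of N] by auto
  have pz: "p M \<star> z = l ^ M *\<^sub>R (z \<star> p M)" for M
  proof (induction M)
    case 0
    then show ?case using R by (simp add: p_def)
  next
    case (Suc M)
    have "p (Suc M) \<star> z = l ^ M *\<^sub>R ((y \<star> z) \<star> p M)" unfolding pS using Suc by (simp add: mult_assoc)
    then show ?case unfolding l pS by (simp add: mult_assoc mult.commute)
  qed
  have "c *\<^sub>R z = l ^ N *\<^sub>R (c *\<^sub>R z)" using pz[of N] R unfolding c by simp
  then have "l ^ N *\<^sub>R (c *\<^sub>R z) = 1 *\<^sub>R (c *\<^sub>R z)" by (simp only: scaleR_one)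
  then have "l ^ N = 1" unfolding scaleR_cancel_right using c0 z0 by simp
  then have "\<bar>l\<bar> ^ N = 1" by (simp add: power_abs[symmetric])
  then have "\<bar>l\<bar> = 1" using N0 by (metis abs_ge_zero power_eq_imp_eq_base power_one zero_le_one)
  then have "l = 1 \<or> l = -1" by linarith
  then show ?thesis using l by auto
qed simp

text \<open>The signs from \<open>C_commute\<close> cancel, so the square commutes with all
  homogeneous elements of \<open>C\<close> and is a scalar by \<open>C_center\<close>.\<close>

lemma C_square:
  assumes y: "g \<in> carrier G" "y \<in> C" "y \<in> V g" "y \<noteq> 0"
  shows "\<exists>c. c \<noteq> 0 \<and> y \<star> y = c *\<^sub>R u"
proof -
  have yyV: "y \<star> y \<in> V (g \<otimes> g)" using V_mult y by blast
  have yyR: "y \<star> y \<in> R" using yyV V_R y by blast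
  have "y \<star> y = (tr (y \<star> y) / k) *\<^sub>R u"
  proof (rule C_center[OF C_mult[OF y(2,2)] yyR])
    fix s z assume z: "s \<in> carrier G" "z \<in> C" "z \<in> V s"
    show "y \<star> y \<star> z = z \<star> (y \<star> y)"
      using C_commute[OF y z] by (metis mult_assoc mult_minus_left mult_minus_right minus_minus)
  qed
  then obtain c where c: "y \<star> y = c *\<^sub>R u" by blast
  have yR: "y \<in> R" using y V_R by blast
  obtain y' where y': "y' \<star> y = u" using C_inverse[OF y(2,1,3,4)] by blast
  have "c \<noteq> 0"
  proof
    assume "c = 0"
    then have "y' \<star> y \<star> y = 0" using c by (simp add: mult_assoc)
    then show False using y' yR y by simp
  qed
  then show ?thesis using c by blast
qed

lemma normalize_P:
  assumes y: "g \<in> carrier G" "y \<in> C" "y \<in> V g"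
  shows "\<exists>c x. x \<in> P \<and> y = c *\<^sub>R x"
proof (cases "y = 0")
  case True
  have "u \<in> P" unfolding P_def using u_C u_V u_in_R by auto
  then show ?thesis using True by (metis scaleR_zero_left)
next
  case False
  obtain c where c: "c \<noteq> 0" "y \<star> y = c *\<^sub>R u" using C_square[OF y False] by blast
  define s where "s = sqrt \<bar>c\<bar>"
  have s: "s \<noteq> 0" "s * s = \<bar>c\<bar>" using c unfolding s_def by auto
  define x where "x = (1 / s) *\<^sub>R y"
  have "x \<star> x = (c / \<bar>c\<bar>) *\<^sub>R u" unfolding x_def using c s by simp
  moreover have "c / \<bar>c\<bar> = 1 \<or> c / \<bar>c\<bar> = -1" using c by (cases "c > 0") auto
  ultimately have "x \<star> x = u \<or> x \<star> x = - u" by (metis scaleR_minus1_left scaleR_one)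
  moreover have "x \<in> C" "x \<in> V g" unfolding x_def using y subspace_C subspace_V by (auto intro: subspace_scale)
  ultimately have "x \<in> P" unfolding P_def using y by blast
  moreover have "y = s *\<^sub>R x" unfolding x_def using s by simp
  ultimately show ?thesis by blast
qed

lemma P_R: "x \<in> P \<Longrightarrow> x \<in> R" unfolding P_def using V_R by blast

lemma pauli_set_P: "pauli_set mult P u (b ` idx)"
proof
  have nz: "x \<noteq> 0" if "x \<in> P" for x using that u_nz unfolding P_def by auto
  have comm: "x \<star> y = y \<star> x \<or> x \<star> y = - (y \<star> x)" if "x \<in> P" "y \<in> P" for x y
    using that nz[of x] C_commute[of _ x _ y] unfolding P_def by blast
  show "u \<in> P" unfolding P_def using u_C u_V by auto
  show "u \<noteq> 0" by (rule u_nz)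
  show "P \<subseteq> span (b ` idx)" using P_R unfolding R_def by blast
  show "x \<star> y \<in> P" if xy: "x \<in> P" "y \<in> P" for x y
  proof -
    have "(x \<star> y) \<star> (x \<star> y) = (x \<star> x) \<star> (y \<star> y) \<or> (x \<star> y) \<star> (x \<star> y) = - ((x \<star> x) \<star> (y \<star> y))"
      using comm[OF xy(2,1)] by (metis mult_assoc mult_minus_left mult_minus_right)
    then have "(x \<star> y) \<star> (x \<star> y) = u \<or> (x \<star> y) \<star> (x \<star> y) = - u"
      using xy unfolding P_def by auto
    then show ?thesis using xy V_mult C_mult unfolding P_def by blast
  qed
  show "x \<star> y = y \<star> x \<or> x \<star> y = - (y \<star> x)" if "x \<in> P" "y \<in> P" for x y using comm that .
  show "x \<star> x = u \<or> x \<star> x = - u" if "x \<in> P" for x using that unfolding P_def by blast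
  show "u \<star> x = x" "x \<star> u = x" if "x \<in> P" for x using P_R[OF that] by auto
  show "finite (b ` idx)" by simp
  show "x = u \<or> x = - u" if x: "x \<in> P" "\<And>y. y \<in> P \<Longrightarrow> x \<star> y = y \<star> x" for x
  proof -
    have "x = (tr x / k) *\<^sub>R u"
    proof (rule C_center)
      show "x \<in> C" using x(1) unfolding P_def by simp
      show "x \<in> R" by (rule P_R[OF x(1)])
      fix g y assume y: "g \<in> carrier G" "y \<in> C" "y \<in> V g"
      obtain c z where z: "z \<in> P" "y = c *\<^sub>R z" using normalize_P[OF y] by blast
      show "x \<star> y = y \<star> x" unfolding z(2) using x(2)[OF z(1)] by simp
    qed
    then obtain c where c: "x = c *\<^sub>R u" by blast
    have "x \<star> x = (c * c) *\<^sub>R u" unfolding c by simp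
    moreover have "x \<star> x = u \<or> x \<star> x = - u" using x(1) unfolding P_def by blast
    ultimately have "(c * c) *\<^sub>R u = 1 *\<^sub>R u \<or> (c * c) *\<^sub>R u = (-1) *\<^sub>R u" by simp
    then have "c * c = 1 \<or> c * c = -1" unfolding scaleR_cancel_right using u_nz by blast
    moreover have "0 \<le> c * c" by simp
    then have "c * c \<noteq> -1" by linarith
    ultimately have "c = 1 \<or> c = -1" using square_eq_1_iff by blast
    then show ?thesis using c by auto
  qed
qed

end

lemma basis_diff_eq_iff:
  assumes "i < N" "j < N" "p < N" "q < N"
  shows "basis_diff N p q = basis_diff N i j \<longleftrightarrow> (p = i \<and> q = j) \<or> (p = q \<and> i = j)"
proof
  assume eq: "basis_diff N p q = basis_diff N i j"
  have "of_bool (a = p) - of_bool (a = q) = (of_bool (a = i) - of_bool (a = j) :: int)" if "a < N" for a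
    using fun_cong[OF eq, of a] that unfolding basis_diff_def by simp
  from this[OF assms(1)] this[OF assms(2)] this[OF assms(3)] this[OF assms(4)]
  show "(p = i \<and> q = j) \<or> (p = q \<and> i = j)" by (auto split: if_splits simp: of_bool_def)
qed (auto simp: basis_diff_def fun_eq_iff)

section \<open>The homogeneous basis of a fine grading\<close>

locale fine_structure = fine_graded +
  fixes hY :: bool and mY :: nat and Y :: "(nat \<Rightarrow> int) \<Rightarrow> 'a"
  assumes hY: "hY \<Longrightarrow> 0 < mY" and Y_P: "t \<in> pidx mY \<Longrightarrow> Y t \<in> P" and Y_zero: "Y (pzero mY) = u"
    and Y_mult: "s \<in> pidx mY \<Longrightarrow> t \<in> pidx mY \<Longrightarrow> Y s \<star> Y t = psign hY mY s t *\<^sub>R Y (padd mY s t)"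
    and Y_all: "x \<in> P \<Longrightarrow> \<exists>t\<in>pidx mY. x = Y t \<or> x = - Y t"

lemma (in fine_graded) fine_structure_exists:
  obtains hY mY Y where "fine_structure mult hq k m B G S V n E d \<Gamma> hY mY Y"
proof -
  interpret pauli_set mult P u "b ` idx" by (rule pauli_set_P)
  show thesis
  proof (rule symplectic_basis)
    fix h' m' Y'
    assume A: "h' \<Longrightarrow> 0 < m'" "\<And>t. t \<in> pidx m' \<Longrightarrow> Y' t \<in> P" "Y' (pzero m') = u"
      "\<And>s t. s \<in> pidx m' \<Longrightarrow> t \<in> pidx m' \<Longrightarrow> Y' s \<star> Y' t = psign h' m' s t *\<^sub>R Y' (padd m' s t)"
      "\<And>x. x \<in> P \<Longrightarrow> \<exists>t\<in>pidx m'. x = Y' t \<or> x = - Y' t"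
    show thesis
      by (rule that, rule fine_structure.intro[OF fine_graded_axioms], rule fine_structure_axioms.intro[OF A])
  qed
qed

context fine_structure
begin

text \<open>These products obey the table of \<open>E_ij \<otimes> X_t\<close> with size
  \<open>n\<close>, parameter \<open>mY\<close> and flag \<open>hY\<close>. The sublocale below
  gives \<open>R\<close> a second \<open>type_I\<close> structure, now adapted to the
  grading.\<close>

definition BY :: "nat \<Rightarrow> nat \<Rightarrow> (nat \<Rightarrow> int) \<Rightarrow> 'a" where "BY i j t = E i j \<star> Y t"

lemma Y_C: "t \<in> pidx mY \<Longrightarrow> Y t \<in> C" using Y_P unfolding P_def by blast
lemma Y_R: "t \<in> pidx mY \<Longrightarrow> Y t \<in> R" using Y_P P_R by blast
lemma Y_nz: assumes "t \<in> pidx mY" shows "Y t \<noteq> 0"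
  using Y_P[OF assms] u_nz unfolding P_def by auto

lemma E_nz: assumes "i < n" "j < n" shows "E i j \<noteq> 0"
proof
  assume z: "E i j = 0"
  have "E p p = 0" if "p < n" for p
  proof -
    have "E p i \<star> E i j \<star> E j p = E p p" using E_mult assms that by simp
    then show ?thesis using z by simp
  qed
  then show False using E_sum u_nz by simp
qed

lemma YE: "t \<in> pidx mY \<Longrightarrow> i < n \<Longrightarrow> j < n \<Longrightarrow> Y t \<star> E i j = E i j \<star> Y t"
  using Y_C unfolding C_def by blast

lemma type_I_BY: "type_I mult hY n mY BY"
proof
  show "0 < n" by (rule n_pos)
  show "BY 0 0 (pzero mY) \<noteq> 0" unfolding BY_def Y_zero using E_nz[of 0 0] E_R[of 0 0] n_pos by simp
  fix i j p q s t assume *: "i < n" "j < n" "p < n" "q < n" "s \<in> pidx mY" "t \<in> pidx mY"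
  have "BY i j s \<star> BY p q t = E i j \<star> (Y s \<star> E p q) \<star> Y t" unfolding BY_def by (simp add: mult_assoc)
  also have "\<dots> = (E i j \<star> E p q) \<star> (Y s \<star> Y t)" using YE * by (simp add: mult_assoc)
  finally show "BY i j s \<star> BY p q t = (if j = p then psign hY mY s t *\<^sub>R BY i q (padd mY s t) else 0)"
    using * by (simp add: E_mult Y_mult BY_def)
qed

sublocale BY: type_I mult hY n mY BY by (rule type_I_BY)

lemma BY_R: "i < n \<Longrightarrow> j < n \<Longrightarrow> t \<in> pidx mY \<Longrightarrow> BY i j t \<in> R"
  unfolding BY_def using E_R Y_R by auto

text \<open>By \<open>normalize_P\<close> and \<open>Y_all\<close> a homogeneous element of
  \<open>C\<close> is a multiple of some \<open>Y t\<close>, so the homogeneous products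
  \<open>E i j \<star> c\<close> are multiples of basis elements.\<close>

lemma V_span:
  assumes g: "g \<in> carrier G"
  shows "V g = span {BY i j t | i j t. i < n \<and> j < n \<and> t \<in> pidx mY \<and> BY i j t \<in> V g}" (is "_ = span ?W")
proof
  show "span ?W \<subseteq> V g" by (rule span_minimal[OF _ subspace_V[OF g]]) auto
  show "V g \<subseteq> span ?W"
  proof
    fix x assume "x \<in> V g"
    then show "x \<in> span ?W"
    proof (rule span_E_C[OF g])
      fix i j g' c assume c: "i < n" "j < n" "g' \<in> carrier G" "c \<in> C" "c \<in> V g'" "E i j \<star> c \<in> V g"
      obtain a x where x: "x \<in> P" "c = a *\<^sub>R x" using normalize_P[OF c(3-5)] by blast
      obtain t where t: "t \<in> pidx mY" "x = Y t \<or> x = - Y t" using Y_all[OF x(1)] by blast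
      then obtain a' where a': "c = a' *\<^sub>R Y t" using x(2) by (metis scaleR_minus_left scaleR_minus_right)
      show "E i j \<star> c \<in> span ?W"
      proof (cases "a' = 0")
        case False
        have "(1 / a') *\<^sub>R (E i j \<star> c) \<in> V g" by (rule subspace_scale[OF subspace_V[OF g] c(6)])
        then have "BY i j t \<in> V g" unfolding BY_def a' using False by simp
        then have "BY i j t \<in> ?W" using c t by blast
        then have "a' *\<^sub>R BY i j t \<in> span ?W" by (intro span_scale span_base)
        then show ?thesis unfolding a' BY_def by simp
      qed (simp add: a' span_0)
    qed
  qed
qed

lemma BY_R_eq: "BY.R = R"
proof
  show "BY.R \<subseteq> R" unfolding BY.R_def
    by (rule span_minimal) (auto simp: BY.b_def BY.idx_def BY_R)
  show "R \<subseteq> BY.R"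
  proof
    fix x assume "x \<in> R"
    then obtain w where w: "\<And>s. s \<in> S \<Longrightarrow> w s \<in> V s" "x = (\<Sum>s\<in>S. w s)" using V_sum by blast
    have "V s \<subseteq> BY.R" if "s \<in> S" for s
    proof -
      have sc: "s \<in> carrier G" using that S_carrier by blast
      show ?thesis by (subst V_span[OF sc], rule span_minimal) auto
    qed
    then show "x \<in> BY.R" unfolding w(2) using w(1) by (intro subspace_sum) auto
  qed
qed

lemma BY_L_eq: "BY.L = L" unfolding BY.L_def L_def BY_R_eq ..

lemma dim_eq: "n\<^sup>2 * 4 ^ mY = k\<^sup>2 * 4 ^ m"
proof -
  have "span (BY.b ` BY.idx) = span (b ` idx)" using BY_R_eq unfolding BY.R_def R_def .
  then have "card (BY.b ` BY.idx) = card (b ` idx)"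
    using real_vector.dim_eq_card[OF _ BY.b_independent] real_vector.dim_eq_card[OF _ b_independent]
    by (metis real_vector.dim_span)
  then show ?thesis unfolding BY.card_b card_b .
qed

lemma Y_degree: assumes "t \<in> pidx mY" obtains g where "g \<in> carrier G" "Y t \<in> V g"
  using Y_P[OF assms] unfolding P_def by blast

lemma Y_not_scalar: assumes t: "t \<in> pidx mY" "t \<noteq> pzero mY" shows "Y t \<noteq> c *\<^sub>R u"
proof
  assume c: "Y t = c *\<^sub>R u"
  obtain s where s: "s \<in> pidx mY" "psign hY mY s t = - psign hY mY t s" using psign_nondegenerate t by blast
  have "Y s \<star> Y t = - (Y t \<star> Y s)" using s t by (simp add: Y_mult padd_commute)
  then have "c *\<^sub>R Y s = - (c *\<^sub>R Y s)" using c Y_R[OF s(1)] by simp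
  then have "2 *\<^sub>R (c *\<^sub>R Y s) = 0" unfolding scaleR_2 by (metis add.right_inverse)
  then have "c = 0" using Y_nz[OF s(1)] by simp
  then show False using c Y_nz[OF t(1)] by simp
qed

text \<open>If \<open>Y s\<close> and \<open>Y t\<close> share a component they are proportional.
  Their product, which is \<open>Y (padd mY s t)\<close> up to sign, is then a scalar, and only the
  unit index allows that.\<close>

lemma Y_degree_unique:
  assumes "s \<in> pidx mY" "t \<in> pidx mY" "g \<in> carrier G" "Y s \<in> V g" "Y t \<in> V g" shows "s = t"
proof (rule ccontr)
  assume ne: "s \<noteq> t"
  obtain c where c: "Y t = c *\<^sub>R Y s" using C_one_dim[OF assms(3) Y_C[OF assms(1)] assms(4) Y_nz[OF assms(1)] Y_C[OF assms(2)] assms(5)] by blast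
  have "psign hY mY s t *\<^sub>R Y (padd mY s t) = Y s \<star> Y t" using assms by (simp add: Y_mult)
  also have "\<dots> = (c * psign hY mY s s) *\<^sub>R u" unfolding c using assms by (simp add: Y_mult Y_zero)
  finally have "(1 / psign hY mY s t) *\<^sub>R (psign hY mY s t *\<^sub>R Y (padd mY s t)) = (1 / psign hY mY s t) *\<^sub>R ((c * psign hY mY s s) *\<^sub>R u)" by simp
  then have "Y (padd mY s t) = (c * psign hY mY s s / psign hY mY s t) *\<^sub>R u" by simp
  then show False using Y_not_scalar[of "padd mY s t"] assms ne by auto
qed

lemma BY_degree:
  assumes "i < n" "j < n" "t \<in> pidx mY" "g \<in> carrier G" "BY i j t \<in> V g" "s \<in> carrier G" "Y t \<in> V s"
  shows "g = d i \<otimes> inv (d j) \<otimes> s"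
proof (rule ccontr)
  assume ne: "g \<noteq> d i \<otimes> inv (d j) \<otimes> s"
  have "BY i j t \<in> V (d i \<otimes> inv (d j) \<otimes> s)"
    unfolding BY_def using V_mult[OF _ assms(6) E_V[OF assms(1,2)] assms(7)] d_carrier assms by simp
  then show False
    using V_disjoint[OF assms(5) _ assms(4) _ ne] BY.B_neq_0[OF assms(1-3)] d_carrier assms by simp
qed

lemma BY_diag_V: assumes "i < n" "g \<in> carrier G" "Y t \<in> V g" shows "BY i i t \<in> V g"
  unfolding BY_def using E_diag_V(1)[OF assms] .

lemma block_conj:
  assumes "i < n" "j < n" "p < n" "t \<in> pidx mY"
  shows "(u + E p p) \<star> BY i j t \<star> (u - (1 / 2) *\<^sub>R E p p) =
    ((if i = p then 2 else 1) * (if j = p then 1 / 2 else 1)) *\<^sub>R BY i j t"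
proof -
  have ER: "E p p \<in> R" "E i j \<in> R" using E_R assms by auto
  have tR: "Y t \<in> R" using Y_R assms by blast
  have cE: "Y t \<star> E p p = E p p \<star> Y t" using YE assms by blast
  have h: "x = (1 / 2) *\<^sub>R x + (1 / 2) *\<^sub>R x" for x :: 'a by (simp add: scaleR_add_left[symmetric])
  have "(u + E p p) \<star> (E i j \<star> Y t) \<star> (u - (1 / 2) *\<^sub>R E p p) = ((u + E p p) \<star> E i j \<star> (u - (1 / 2) *\<^sub>R E p p)) \<star> Y t"
    using tR ER by (simp add: distribs mult_assoc cE R_mult)
  also have "(u + E p p) \<star> E i j \<star> (u - (1 / 2) *\<^sub>R E p p) = ((if i = p then 2 else 1) * (if j = p then 1 / 2 else 1)) *\<^sub>R E i j"
    using assms E_mult ER h[of "E i j"] by (auto simp: distribs scaleR_2 algebra_simps)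
  finally show ?thesis unfolding BY_def by simp
qed

text \<open>Both sides are the scalar by which the conjugation of \<open>block_scalar\<close> acts
  on \<open>\<Gamma> g\<close>.\<close>

lemma block_eq:
  assumes g: "g \<in> carrier G" and x: "i < n" "j < n" "t \<in> pidx mY" "BY i j t \<in> \<Gamma> g"
    and x': "i' < n" "j' < n" "t' \<in> pidx mY" "BY i' j' t' \<in> \<Gamma> g" and p: "p < n"
  shows "(if i = p then 2 else 1) * (if j = p then 1 / 2 else 1) =
    (if i' = p then 2 else 1) * (if j' = p then 1 / 2 else (1::real))"
proof -
  obtain l where l: "\<And>x. x \<in> \<Gamma> g \<Longrightarrow> (u + E p p) \<star> x \<star> (u - (1 / 2) *\<^sub>R E p p) = l *\<^sub>R x"
    using block_scalar[OF g p] by blast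
  have "((if i = p then 2 else 1) * (if j = p then 1 / 2 else 1)) *\<^sub>R BY i j t = l *\<^sub>R BY i j t"
    using l[OF x(4)] block_conj[OF x(1,2) p x(3)] by simp
  moreover have "((if i' = p then 2 else 1) * (if j' = p then 1 / 2 else 1)) *\<^sub>R BY i' j' t' = l *\<^sub>R BY i' j' t'"
    using l[OF x'(4)] block_conj[OF x'(1,2) p x'(3)] by simp
  ultimately show ?thesis unfolding scaleR_cancel_right using BY.B_neq_0 x x' by metis
qed

text \<open>An off-diagonal element of identity degree would share \<open>\<Gamma> \<one>\<close>
  with \<open>E_ii - E_jj\<close>, but the conjugation of \<open>block_scalar\<close> doubles the
  first and fixes the second. On the diagonal the degree is that of \<open>Y t\<close>, so
  \<open>t\<close> is the unit index.\<close>

lemma BY_V_one: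
  assumes "i < n" "j < n" "t \<in> pidx mY" "BY i j t \<in> V \<one>" shows "i = j \<and> t = pzero mY"
proof -
  have ij: "i = j"
  proof (rule ccontr)
    assume ne: "i \<noteq> j"
    have 1: "BY i j t \<in> \<Gamma> \<one>" unfolding \<Gamma>_one using assms ne BY.B_offdiag_L BY_L_eq by simp
    have "u \<in> V \<one>" by (rule u_V)
    then have "BY p p (pzero mY) \<in> V \<one>" if "p < n" for p
      using BY_diag_V[OF that one_closed, of "pzero mY"] Y_zero by simp
    then have "BY i i (pzero mY) - BY j j (pzero mY) \<in> V \<one>"
      using assms by (intro subspace_diff[OF subspace_V]) auto
    then have 2: "BY i i (pzero mY) - BY j j (pzero mY) \<in> \<Gamma> \<one>"
      unfolding \<Gamma>_one using BY.B_diff_L[of i j] BY_L_eq assms by simp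
    obtain l where l: "\<And>x. x \<in> \<Gamma> \<one> \<Longrightarrow> (u + E i i) \<star> x \<star> (u - (1 / 2) *\<^sub>R E i i) = l *\<^sub>R x"
      using block_scalar[OF one_closed assms(1)] by blast
    have "2 *\<^sub>R BY i j t = l *\<^sub>R BY i j t"
      using l[OF 1] block_conj[OF assms(1,2,1,3)] ne by simp
    then have l2: "2 = l" unfolding scaleR_cancel_right using BY.B_neq_0[OF assms(1-3)] by blast
    let ?D = "BY i i (pzero mY) - BY j j (pzero mY)"
    have "(u + E i i) \<star> ?D \<star> (u - (1 / 2) *\<^sub>R E i i) = ?D"
      using block_conj[OF assms(1,1,1) pzero_in] block_conj[OF assms(2,2,1) pzero_in] ne
      by (simp add: mult_diff_left[of "_ \<star> _"] mult_diff_right[of "u + E i i"])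
    then have "1 *\<^sub>R ?D = l *\<^sub>R ?D" using l[OF 2] by simp
    then have "?D = 0" using l2 unfolding scaleR_cancel_right by auto
    then have "BY.b (i, i, pzero mY) = BY.b (j, j, pzero mY)" unfolding BY.b_def by simp
    moreover have "(i, i, pzero mY) \<in> BY.idx" "(j, j, pzero mY) \<in> BY.idx" using assms unfolding BY.idx_def by auto
    ultimately show False using inj_onD[OF BY.b_inj] ne by blast
  qed
  obtain s where s: "s \<in> carrier G" "Y t \<in> V s" using Y_degree assms by blast
  have "\<one> = d i \<otimes> inv (d i) \<otimes> s" using BY_degree[OF assms(1-3) one_closed assms(4) s] ij by simp
  then have "s = \<one>" using d_carrier[OF assms(1)] s by simp
  then have "t = pzero mY" using Y_degree_unique[OF assms(3) pzero_in one_closed] s Y_zero u_V by simp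
  then show ?thesis using ij by simp
qed

definition comp :: "(nat \<Rightarrow> int) \<Rightarrow> (nat \<Rightarrow> int) \<Rightarrow> 'a set" where
  "comp t v = span {BY i j t | i j. i < n \<and> j < n \<and> basis_diff n i j = v} \<inter> L"

text \<open>The block factors at all places determine the difference \<open>e_i - e_j\<close>, and
  then the degree determines \<open>t\<close>. So the basis elements that share a component with
  \<open>BY i j t\<close> are exactly those with the same \<open>t\<close> and the same
  difference.\<close>

theorem component_form:
  assumes g: "g \<in> carrier G" and nz: "\<Gamma> g \<noteq> {0}"
  obtains t i j where "t \<in> pidx mY" "i < n" "j < n" "\<Gamma> g = comp t (basis_diff n i j)"
    "BY i j t \<in> V g"
proof -
  have Geq: "\<Gamma> g = V g \<inter> L"
  proof (cases "g = \<one>")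
    case False
    then show ?thesis using \<Gamma>_eq[OF g False] \<Gamma>_L[OF g] by blast
  qed (use \<Gamma>_one in blast)
  have sub: "subspace (\<Gamma> g)" using g gr unfolding lie_grading_def by blast
  have "\<exists>i j t. i < n \<and> j < n \<and> t \<in> pidx mY \<and> BY i j t \<in> V g"
  proof (rule ccontr)
    assume "\<not> ?thesis"
    then have e: "{BY i j t | i j t. i < n \<and> j < n \<and> t \<in> pidx mY \<and> BY i j t \<in> V g} = {}" by blast
    have "V g = span {}" by (rule trans[OF V_span[OF g] arg_cong[where f = span, OF e]])
    then have "V g = {0}" by simp
    then show False using Geq nz subspace_0[OF sub] by auto
  qed
  then obtain i j t where t: "i < n" "j < n" "t \<in> pidx mY" "BY i j t \<in> V g" by blast
  obtain s where s: "s \<in> carrier G" "Y t \<in> V s" using Y_degree t by blast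
  have gs: "g = d i \<otimes> inv (d j) \<otimes> s" using BY_degree[OF t(1,2,3) g t(4) s] .
  have "{BY p q t' | p q t'. p < n \<and> q < n \<and> t' \<in> pidx mY \<and> BY p q t' \<in> V g} =
     {BY p q t | p q. p < n \<and> q < n \<and> basis_diff n p q = basis_diff n i j}"
  proof (rule subset_antisym; rule subsetI)
    fix x assume "x \<in> {BY p q t | p q. p < n \<and> q < n \<and> basis_diff n p q = basis_diff n i j}"
    then obtain p q where pq: "x = BY p q t" "p < n" "q < n" "(p = i \<and> q = j) \<or> (p = q \<and> i = j)"
      using basis_diff_eq_iff[OF t(1,2)] by blast
    have "BY p q t \<in> V g"
    proof (cases "p = i \<and> q = j")
      case False
      then have "p = q" "i = j" using pq by auto
      moreover then have "g = s" using gs d_carrier[OF t(1)] s by simp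
      ultimately show ?thesis using BY_diag_V[OF pq(2) s] by simp
    qed (use t in simp)
    then show "x \<in> {BY p q t' | p q t'. p < n \<and> q < n \<and> t' \<in> pidx mY \<and> BY p q t' \<in> V g}" using pq t by blast
  next
    fix x assume "x \<in> {BY p q t' | p q t'. p < n \<and> q < n \<and> t' \<in> pidx mY \<and> BY p q t' \<in> V g}"
    then obtain p q t' where x: "x = BY p q t'" "p < n" "q < n" "t' \<in> pidx mY" "BY p q t' \<in> V g" by blast
    \<comment> \<open>\<open>block_eq\<close> speaks about \<open>\<Gamma> g\<close>, which for the
      identity lacks the single elements \<open>E_ii\<close>; that case is covered by
      \<open>BY_V_one\<close>.\<close>
    have pq: "(p = i \<and> q = j) \<or> (p = q \<and> i = j)"
    proof (cases "g = \<one>")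
      case True
      then show ?thesis using BY_V_one x t by blast
    next
      case False
      then have G: "\<Gamma> g = V g" by (rule \<Gamma>_eq[OF g])
      have "(if i = a then 2 else 1) * (if j = a then 1 / 2 else 1) =
        (if p = a then 2 else 1) * (if q = a then 1 / 2 else (1::real))" if "a < n" for a
        using block_eq[OF g t(1-3) _ x(2-4) _ that] t(4) x(5) G by blast
      \<comment> \<open>Tested at the places i, j, p and q, the three values 2, 1/2 and 1 tell the
        rows from the columns.\<close>
      from this[OF t(1)] this[OF t(2)] this[OF x(2)] this[OF x(3)]
      show ?thesis by (auto split: if_splits)
    qed
    obtain s' where s': "s' \<in> carrier G" "Y t' \<in> V s'" using Y_degree x by blast
    have gs': "g = d p \<otimes> inv (d q) \<otimes> s'" using BY_degree[OF x(2,3,4) g x(5) s'] .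
    have "d i \<otimes> inv (d j) = d p \<otimes> inv (d q)" using pq d_carrier t(1,2) x(2,3) by auto
    then have "d i \<otimes> inv (d j) \<otimes> s = d i \<otimes> inv (d j) \<otimes> s'" using gs gs' by simp
    then have "s = s'" using d_carrier t(1,2) s(1) s'(1) by simp
    then have "t' = t" using Y_degree_unique[OF x(4) t(3) s(1)] s s' by simp
    then show "x \<in> {BY p q t | p q. p < n \<and> q < n \<and> basis_diff n p q = basis_diff n i j}"
      using x pq basis_diff_eq_iff[OF t(1,2) x(2,3)] by blast
  qed
  then have "V g = span {BY p q t | p q. p < n \<and> q < n \<and> basis_diff n p q = basis_diff n i j}"
    by (rule trans[OF V_span[OF g] arg_cong[where f = span]])
  then have "\<Gamma> g = comp t (basis_diff n i j)" unfolding Geq comp_def by (rule arg_cong)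
  then show thesis using that t by blast
qed

end

section \<open>Matrix size at least three\<close>

text \<open>The sign of \<open>X_t^2\<close> is a quadratic form in t whose polarization is the
  commutation sign. This is what makes multiplying each \<open>X_t\<close> by the sign of its square
  an antiautomorphism.\<close>

lemma psign_square_add:
  assumes "s \<in> pidx m" "t \<in> pidx m"
  shows "psign q m (padd m s t) (padd m s t) = psign q m s t * psign q m t s * psign q m s s * psign q m t t"
  unfolding psign_def prod.distrib[symmetric]
proof (rule prod.cong[OF refl])
  fix i assume "i \<in> {..<m}"
  then have i: "2 * i < 2 * m" "2 * i + 1 < 2 * m" by auto
  have v: "s (2 * i) = 0 \<or> s (2 * i) = 1" "s (2 * i + 1) = 0 \<or> s (2 * i + 1) = 1"
    "t (2 * i) = 0 \<or> t (2 * i) = 1" "t (2 * i + 1) = 0 \<or> t (2 * i + 1) = 1"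
    using pidx_cases[OF assms(1)] pidx_cases[OF assms(2)] i by blast+
  have p: "padd m s t (2 * i) = (s (2 * i) + t (2 * i)) mod 2"
    "padd m s t (2 * i + 1) = (s (2 * i + 1) + t (2 * i + 1)) mod 2" using i by (simp_all add: padd_def)
  have "pair_sign w ((a + c) mod 2) ((b' + d') mod 2) ((a + c) mod 2) ((b' + d') mod 2) =
      pair_sign w a b' c d' * pair_sign w c d' a b' * pair_sign w a b' a b' * pair_sign w c d' c d'"
    if "a = 0 \<or> a = 1" "b' = 0 \<or> b' = 1" "c = 0 \<or> c = 1" "d' = 0 \<or> d' = 1" for w a b' c d'
    using that by (elim disjE) (simp_all add: pair_sign_def)
  from this[OF v] show "pair_sign (q \<and> Suc i = m) (padd m s t (2 * i)) (padd m s t (2 * i + 1)) (padd m s t (2 * i)) (padd m s t (2 * i + 1)) =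
    pair_sign (q \<and> Suc i = m) (s (2 * i)) (s (2 * i + 1)) (t (2 * i)) (t (2 * i + 1)) *
    pair_sign (q \<and> Suc i = m) (t (2 * i)) (t (2 * i + 1)) (s (2 * i)) (s (2 * i + 1)) *
    pair_sign (q \<and> Suc i = m) (s (2 * i)) (s (2 * i + 1)) (s (2 * i)) (s (2 * i + 1)) *
    pair_sign (q \<and> Suc i = m) (t (2 * i)) (t (2 * i + 1)) (t (2 * i)) (t (2 * i + 1))"
    unfolding p .
qed

lemma (in type_I) linear_on_basis:
  fixes F :: "nat \<Rightarrow> nat \<Rightarrow> (nat \<Rightarrow> int) \<Rightarrow> 'v::real_vector"
  obtains f where "linear f" "\<And>i j t. i < k \<Longrightarrow> j < k \<Longrightarrow> t \<in> pidx m \<Longrightarrow> f (B i j t) = F i j t"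
proof -
  define f0 where "f0 = (\<lambda>(i, j, t). F i j t)"
  obtain f where f: "linear f" "\<forall>x\<in>b ` idx. f x = f0 (inv_into idx b x)"
    using real_vector.linear_independent_extend[OF b_independent, where f = "\<lambda>x. f0 (inv_into idx b x)"]
    unfolding linear_def by auto
  have "f (B i j t) = F i j t" if "i < k" "j < k" "t \<in> pidx m" for i j t
  proof -
    have "(i, j, t) \<in> idx" using that unfolding idx_def by auto
    then have "f (b (i, j, t)) = f0 (i, j, t)" using f(2) b_inj by (simp add: inv_into_f_f)
    then show ?thesis by (simp add: b_def f0_def)
  qed
  then show thesis using that f(1) by blast
qed

context fine_structure
begin

abbreviation \<eta> :: "(nat \<Rightarrow> int) \<Rightarrow> real" where "\<eta> t \<equiv> psign hY mY t t"

lemma \<Gamma>_eq_V_L: assumes "g \<in> carrier G" shows "\<Gamma> g = V g \<inter> L"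
proof (cases "g = \<one>")
  case False
  then show ?thesis using \<Gamma>_eq[OF assms False] \<Gamma>_L[OF assms] by blast
qed (use \<Gamma>_one in blast)

text \<open>
  For \<open>n = 2\<close> the negative of the antiautomorphism given by
  \<open>E i j \<star> Y t \<mapsto> \<eta> t \<cdot> E (1 - j) (1 - i) \<star> Y t\<close> splits the components in the diagonal.
\<close>

lemma n_neq_2:
  assumes t0: "t0 \<in> pidx mY" "t0 \<noteq> pzero mY" shows "n \<noteq> 2"
proof
  assume n2: "n = 2"
  obtain \<theta> where lin: "linear \<theta>" and th: "\<And>i j t. i < n \<Longrightarrow> j < n \<Longrightarrow> t \<in> pidx mY \<Longrightarrow>
      \<theta> (BY i j t) = (- \<eta> t) *\<^sub>R BY (1 - j) (1 - i) t"
    using BY.linear_on_basis[where F = "\<lambda>i j t. (- \<eta> t) *\<^sub>R BY (1 - j) (1 - i) t"] by blast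
  have sw: "1 - i < n" "1 - (1 - i) = i" if "i < n" for i using that n2 by auto
  have sw_eq: "1 - i = 1 - j \<longleftrightarrow> i = j" if "i < n" "j < n" for i j using that n2 by auto
  have Rsp: "R = span (BY.b ` BY.idx)" using BY_R_eq unfolding BY.R_def by simp
  have th_R: "\<theta> x \<in> R" if "x \<in> R" for x
    using that unfolding Rsp
  proof (rule span_induct)
    show "subspace {x. \<theta> x \<in> span (BY.b ` BY.idx)}"
      using subspace_R unfolding Rsp subspace_def
      by (auto simp: linear_0[OF lin] linear_add[OF lin] linear_cmul[OF lin])
    fix x assume "x \<in> BY.b ` BY.idx"
    then obtain i j t where x: "x = BY i j t" "i < n" "j < n" "t \<in> pidx mY" unfolding BY.b_def BY.idx_def by auto
    have "BY (1 - j) (1 - i) t \<in> R" using BY_R x sw by simp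
    then have "\<theta> x \<in> R" unfolding x(1) th[OF x(2-4)] by (rule subspace_scale[OF subspace_R])
    then show "\<theta> x \<in> span (BY.b ` BY.idx)" unfolding Rsp .
  qed
  have mulB: "\<theta> (BY i j s \<star> BY p q t) = - (\<theta> (BY p q t) \<star> \<theta> (BY i j s))"
    if "i < n" "j < n" "p < n" "q < n" "s \<in> pidx mY" "t \<in> pidx mY" for i j p q s t
  proof -
    have 1: "psign hY mY s t * \<eta> (padd mY s t) = \<eta> t * (\<eta> s * psign hY mY t s)"
    proof -
      have "psign hY mY s t * \<eta> (padd mY s t) = (psign hY mY s t * psign hY mY s t) * psign hY mY t s * \<eta> s * \<eta> t"
        unfolding psign_square_add[OF that(5,6)] by (simp only: mult_ac)
      then show ?thesis unfolding psign_square by (simp only: mult_ac mult_1_left)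
    qed
    show ?thesis
    proof (cases "j = p")
      case True
      have "\<theta> (BY i j s \<star> BY p q t) = - (psign hY mY s t * \<eta> (padd mY s t)) *\<^sub>R BY (1 - q) (1 - i) (padd mY s t)"
        using that True by (simp add: BY.B_mult linear_cmul[OF lin] th linear_neg[OF lin])
      moreover have "\<theta> (BY p q t) \<star> \<theta> (BY i j s) = (\<eta> t * (\<eta> s * psign hY mY t s)) *\<^sub>R BY (1 - q) (1 - i) (padd mY t s)"
        using that sw True by (simp add: th BY.B_mult)
      ultimately show ?thesis unfolding 1 by (simp add: padd_commute)
    next
      case False
      then have "1 - p \<noteq> 1 - j" using sw_eq[OF that(2,3)] by simp
      then have "\<theta> (BY p q t) \<star> \<theta> (BY i j s) = 0" using that sw by (simp add: th BY.B_mult)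
      then show ?thesis using that False by (simp add: BY.B_mult linear_0[OF lin])
    qed
  qed
  have mul: "\<theta> (x \<star> y) = - (\<theta> y \<star> \<theta> x)" if x: "x \<in> R" and y: "y \<in> R" for x y
  proof -
    have 1: "\<theta> (BY i j s \<star> y) = - (\<theta> y \<star> \<theta> (BY i j s))" if ij: "i < n" "j < n" "s \<in> pidx mY" for i j s
    proof (rule linear_eqI_span[of "\<lambda>y. \<theta> (BY i j s \<star> y)" "\<lambda>y. - (\<theta> y \<star> \<theta> (BY i j s))" "BY.b ` BY.idx"])
      show "linear (\<lambda>y. \<theta> (BY i j s \<star> y))" "linear (\<lambda>y. - (\<theta> y \<star> \<theta> (BY i j s)))"
        by (auto intro!: linearI simp: distribs linear_add[OF lin] linear_cmul[OF lin])
      fix c assume "c \<in> BY.b ` BY.idx"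
      then obtain p q t where "c = BY p q t" "p < n" "q < n" "t \<in> pidx mY" unfolding BY.b_def BY.idx_def by auto
      then show "\<theta> (BY i j s \<star> c) = - (\<theta> c \<star> \<theta> (BY i j s))" using mulB ij by simp
    qed (use y Rsp in simp)
    show ?thesis
    proof (rule linear_eqI_span[of "\<lambda>x. \<theta> (x \<star> y)" "\<lambda>x. - (\<theta> y \<star> \<theta> x)" "BY.b ` BY.idx"])
      show "linear (\<lambda>x. \<theta> (x \<star> y))" "linear (\<lambda>x. - (\<theta> y \<star> \<theta> x))"
        by (auto intro!: linearI simp: distribs linear_add[OF lin] linear_cmul[OF lin])
      fix c assume "c \<in> BY.b ` BY.idx"
      then obtain p q t where "c = BY p q t" "p < n" "q < n" "t \<in> pidx mY" unfolding BY.b_def BY.idx_def by auto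
      then show "\<theta> (c \<star> y) = - (\<theta> y \<star> \<theta> c)" using 1 by simp
    qed (use x Rsp in simp)
  qed
  have th_br: "\<theta> (br x y) = br (\<theta> x) (\<theta> y)" if "x \<in> R" "y \<in> R" for x y
    using that mul by (simp add: br_def linear_diff[OF lin])
  have th_th: "\<theta> (\<theta> x) = x" if "x \<in> R" for x
  proof (rule linear_eqI_span[of "\<lambda>x. \<theta> (\<theta> x)" "\<lambda>x. x" "BY.b ` BY.idx"])
    show "linear (\<lambda>x. \<theta> (\<theta> x))" "linear (\<lambda>x::'a. x)"
      by (auto intro!: linearI simp: linear_add[OF lin] linear_cmul[OF lin])
    fix c assume "c \<in> BY.b ` BY.idx"
    then obtain p q t where c: "c = BY p q t" "p < n" "q < n" "t \<in> pidx mY" unfolding BY.b_def BY.idx_def by auto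
    have "\<theta> (\<theta> c) = (- \<eta> t) *\<^sub>R ((- \<eta> t) *\<^sub>R BY (1 - (1 - p)) (1 - (1 - q)) t)"
      unfolding c(1) th[OF c(2-4)] linear_cmul[OF lin] th[OF sw(1)[OF c(3)] sw(1)[OF c(2)] c(4)] ..
    then show "\<theta> (\<theta> c) = c" using c sw by simp
  qed (use that Rsp in simp)
  have th_L: "\<theta> x \<in> L" if "x \<in> L" for x
    using that unfolding L_def
  proof (rule span_induct)
    show "subspace {x. \<theta> x \<in> span {br x y |x y. x \<in> R \<and> y \<in> R}}"
      using subspace_span[of "{br x y |x y. x \<in> R \<and> y \<in> R}"] unfolding subspace_def
      by (auto simp: linear_0[OF lin] linear_add[OF lin] linear_cmul[OF lin])
    fix x assume "x \<in> {br x y |x y. x \<in> R \<and> y \<in> R}"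
    then obtain y z where x: "x = br y z" "y \<in> R" "z \<in> R" by blast
    show "\<theta> x \<in> span {br x y |x y. x \<in> R \<and> y \<in> R}"
      unfolding x(1) th_br[OF x(2,3)] using th_R x by (intro span_base) blast
  qed
  have th_G: "\<theta> x \<in> \<Gamma> g" if g: "g \<in> carrier G" "x \<in> \<Gamma> g" for g x
  proof (cases "\<Gamma> g = {0}")
    case True
    then show ?thesis using g linear_0[OF lin] by simp
  next
    case False
    obtain t i j where t: "t \<in> pidx mY" "i < n" "j < n" "\<Gamma> g = comp t (basis_diff n i j)"
      by (rule component_form[OF g(1) False])
    let ?W = "{BY p q t | p q. p < n \<and> q < n \<and> basis_diff n p q = basis_diff n i j}"
    have "x \<in> span ?W" "x \<in> L" using g t(4) unfolding comp_def by auto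
    then have "\<theta> x \<in> \<theta> ` span ?W" by blast
    also have "\<dots> = span (\<theta> ` ?W)" by (rule linear_span_image[OF lin, symmetric])
    also have "\<dots> \<subseteq> span ?W"
    proof (rule span_minimal)
      show "\<theta> ` ?W \<subseteq> span ?W"
      proof
        fix y assume "y \<in> \<theta> ` ?W"
        then obtain p q where pq: "y = \<theta> (BY p q t)" "p < n" "q < n" "basis_diff n p q = basis_diff n i j" by blast
        \<comment> \<open>Reflection in the antidiagonal fixes the two off-diagonal places of a 2 by
          2 matrix and swaps the diagonal ones, so it preserves the differences
          \<open>e_p - e_q\<close>.\<close>
        have "basis_diff n (1 - q) (1 - p) = basis_diff n p q"
          unfolding basis_diff_eq_iff[OF pq(2,3) sw(1)[OF pq(3)] sw(1)[OF pq(2)]] using pq n2 by auto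
        then have "BY (1 - q) (1 - p) t \<in> ?W" using pq sw by auto
        then show "y \<in> span ?W" unfolding pq(1) th[OF pq(2,3) t(1)] by (intro span_scale span_base)
      qed
    qed simp
    finally show ?thesis using th_L[OF \<open>x \<in> L\<close>] unfolding t(4) comp_def by simp
  qed
  have eig: "x \<in> span {v \<in> \<Gamma> g. \<exists>l. l \<noteq> 0 \<and> \<theta> v = l *\<^sub>R v}" if g: "g \<in> carrier G" "x \<in> \<Gamma> g" for g x
  proof -
    have "subspace (\<Gamma> g)" using gr g unfolding lie_grading_def by blast
    moreover have "\<theta> (\<theta> x) = 1 *\<^sub>R x" using th_th \<Gamma>_L[OF g] by simp
    ultimately show ?thesis using eigen_split[OF lin _ g(2) th_G[OF g], of 1] by simp
  qed
  obtain s where s: "s \<in> carrier G" "Y t0 \<in> V s" using Y_degree t0 by blast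
  have n01: "0 < n" "1 < n" using n2 by auto
  \<comment> \<open>\<open>t0\<close> is not the unit index, so this single diagonal element lies in
    the Lie algebra. Its image stands at the other diagonal place and is no multiple of it.\<close>
  have mem: "BY 0 0 t0 \<in> \<Gamma> s"
    unfolding \<Gamma>_eq_V_L[OF s(1)] using BY_diag_V[OF n01(1) s] BY.B_diag_L[OF n01(1) t0] BY_L_eq by simp
  have Lsp: "L \<subseteq> span (b ` idx)" using L_subset unfolding R_def .
  have th_br': "\<theta> (br x y) = br (\<theta> x) (\<theta> y)" if "x \<in> L" "y \<in> L" for x y using th_br that by simp
  have bil: "br (c *\<^sub>R x) (c' *\<^sub>R y) = (c * c') *\<^sub>R br x y" for x y c c'
    by (simp add: br_def scaleR_diff_right mult.commute)
  show False
  proof (rule fine_grading_scalar[OF fine subspace_L Lsp finite_imageI[OF finite_idx] lin th_br' bil eig s(1)])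
    fix l assume l: "\<And>x. x \<in> \<Gamma> s \<Longrightarrow> \<theta> x = l *\<^sub>R x"
    have eq: "(- \<eta> t0) *\<^sub>R BY 1 1 t0 = l *\<^sub>R BY 0 0 t0" using l[OF mem] th[OF n01(1,1) t0(1)] by simp
    have "BY 1 1 (pzero mY) \<star> ((- \<eta> t0) *\<^sub>R BY 1 1 t0) = (- \<eta> t0) *\<^sub>R BY 1 1 t0"
      using n01 t0 by (simp add: BY.B_mult)
    moreover have "BY 1 1 (pzero mY) \<star> (l *\<^sub>R BY 0 0 t0) = 0" using n01 t0 by (simp add: BY.B_mult)
    ultimately have "(- \<eta> t0) *\<^sub>R BY 1 1 t0 = 0" using eq by metis
    then show False using BY.B_neq_0[OF n01(2,2) t0(1)] by simp
  qed
qed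

text \<open>
  For \<open>n = 1\<close> the negative of the antiautomorphism \<open>Y t \<mapsto> \<eta> t \<cdot> Y t\<close> comes from a character of the
  universal group but is not inner, since it does not extend to an automorphism of the associative algebra.
\<close>

lemma n_neq_1:
  assumes inner: "inner_grading L br (universal_group br G \<Gamma>) (universal_grading br G \<Gamma>)" and m2: "2 \<le> mY"
  shows "n \<noteq> 1"
proof
  assume n1: "n = 1"
  let ?S = "grading_support G \<Gamma>"
  have E0: "E 0 0 = u" using E_sum n1 by simp
  have RC: "x \<in> C" if "x \<in> R" for x using that n1 E0 unfolding C_def by simp
  have line: "\<exists>c. x = c *\<^sub>R Y t" if "g \<in> carrier G" "t \<in> pidx mY" "Y t \<in> V g" "x \<in> \<Gamma> g" for x t g
  proof -
    have "x \<in> V g" using that \<Gamma>_eq_V_L by blast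
    then show ?thesis using C_one_dim[OF that(1) Y_C[OF that(2)] that(3) Y_nz[OF that(2)]] RC V_R that(1) by blast
  qed
  have YL: "Y t \<in> \<Gamma> g" if "g \<in> carrier G" "t \<in> pidx mY" "t \<noteq> pzero mY" "Y t \<in> V g" for t g
  proof -
    have "BY 0 0 t \<in> L" using BY.B_diag_L[of 0 t] that n1 BY_L_eq by simp
    then have "Y t \<in> L" unfolding BY_def E0 using Y_R that by simp
    then show ?thesis using \<Gamma>_eq_V_L that by blast
  qed
  have supp: "\<exists>t. t \<in> pidx mY \<and> t \<noteq> pzero mY \<and> Y t \<in> V g" if g: "g \<in> ?S" for g
  proof -
    have gc: "g \<in> carrier G" "\<Gamma> g \<noteq> {0}" using g unfolding grading_support_def by auto
    obtain t i j where t: "t \<in> pidx mY" "i < n" "j < n" "BY i j t \<in> V g" by (rule component_form[OF gc])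
    have YV: "Y t \<in> V g" using t n1 E0 Y_R unfolding BY_def by simp
    have "t \<noteq> pzero mY"
    proof
      assume tz: "t = pzero mY"
      have "x = 0" if x: "x \<in> \<Gamma> g" for x
      proof -
        obtain c where c: "x = c *\<^sub>R u" using line[OF gc(1) t(1) YV x] tz Y_zero by auto
        have "tr x = 0" using \<Gamma>_L[OF gc(1) x] by (rule tr_L)
        then show ?thesis using c k_pos by simp
      qed
      moreover have "subspace (\<Gamma> g)" using gr gc unfolding lie_grading_def by blast
      then have "0 \<in> \<Gamma> g" by (rule subspace_0)
      ultimately show False using gc(2) by auto
    qed
    then show ?thesis using t YV by blast
  qed
  \<comment> \<open>Equal to -\<eta>(t) in the degree of \<open>Y t\<close>, but expressed through
    the component so that it is a function of the degree.\<close>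
  define \<kappa> where "\<kappa> = (\<lambda>g. if \<exists>x\<in>\<Gamma> g. x \<star> x = u then -1 else 1 :: complex)"
  have kap: "\<kappa> g = of_real (- \<eta> t)" if t: "g \<in> carrier G" "t \<in> pidx mY" "t \<noteq> pzero mY" "Y t \<in> V g" for g t
  proof -
    have sq: "Y t \<star> Y t = \<eta> t *\<^sub>R u" using t by (simp add: Y_mult Y_zero)
    show ?thesis
    proof (cases "\<eta> t = 1")
      case True
      then have "\<exists>x\<in>\<Gamma> g. x \<star> x = u" using YL[OF t] sq by (intro bexI[of _ "Y t"]) auto
      then show ?thesis unfolding \<kappa>_def True by simp
    next
      case False
      then have m1: "\<eta> t = -1" using psign_cases[of hY mY t t] by blast
      have "\<not> (\<exists>x\<in>\<Gamma> g. x \<star> x = u)"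
      proof
        assume "\<exists>x\<in>\<Gamma> g. x \<star> x = u"
        then obtain x where x: "x \<in> \<Gamma> g" "x \<star> x = u" by blast
        obtain c where c: "x = c *\<^sub>R Y t" using line[OF t(1,2,4) x(1)] by blast
        have "(- (c * c)) *\<^sub>R u = 1 *\<^sub>R u" using x(2) sq m1 unfolding c by simp
        then have "- (c * c) = 1" unfolding scaleR_cancel_right using u_nz by blast
        moreover have "0 \<le> c * c" by simp
        ultimately show False by linarith
      qed
      then show ?thesis unfolding \<kappa>_def m1 by simp
    qed
  qed
  have prod: "Y (padd mY s t) \<in> V (g \<otimes> g')" if "g \<in> carrier G" "g' \<in> carrier G" "s \<in> pidx mY" "t \<in> pidx mY" "Y s \<in> V g" "Y t \<in> V g'" for g g' s t
  proof -
    have "psign hY mY s t *\<^sub>R (Y s \<star> Y t) \<in> V (g \<otimes> g')"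
      using V_mult that by (intro subspace_scale[OF subspace_V]) auto
    then show ?thesis using that by (simp add: Y_mult)
  qed
  have mult: "\<kappa> (g \<otimes> g') = \<kappa> g * \<kappa> g'"
    if g: "g \<in> ?S" "g' \<in> ?S" "x \<in> \<Gamma> g" "y \<in> \<Gamma> g'" "br x y \<noteq> 0" for g g' x y
  proof -
    have gc: "g \<in> carrier G" "g' \<in> carrier G" using g unfolding grading_support_def by auto
    obtain s where s: "s \<in> pidx mY" "s \<noteq> pzero mY" "Y s \<in> V g" using supp g by blast
    obtain t where t: "t \<in> pidx mY" "t \<noteq> pzero mY" "Y t \<in> V g'" using supp g by blast
    obtain c where c: "x = c *\<^sub>R Y s" using line[OF gc(1) s(1,3) g(3)] by blast
    obtain c' where c': "y = c' *\<^sub>R Y t" using line[OF gc(2) t(1,3) g(4)] by blast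
    \<comment> \<open>Only noncommuting pairs matter; for them \<eta>(s + t) = -\<eta>(s) \<eta>(t),
      which is multiplicativity of -\<eta>.\<close>
    have ne: "psign hY mY s t \<noteq> psign hY mY t s"
    proof
      assume "psign hY mY s t = psign hY mY t s"
      then have "Y s \<star> Y t = Y t \<star> Y s" using s t by (simp add: Y_mult padd_commute)
      then show False using g(5) unfolding c c' br_def by simp
    qed
    then have ps: "psign hY mY s t * psign hY mY t s = -1"
      using psign_cases[of hY mY s t] psign_cases[of hY mY t s] by auto
    have st: "padd mY s t \<noteq> pzero mY" using ne s t by auto
    have "\<kappa> (g \<otimes> g') = of_real (- \<eta> (padd mY s t))"
      by (rule kap[OF _ padd_in st prod[OF gc s(1) t(1) s(3) t(3)]]) (use gc in simp)
    also have "- \<eta> (padd mY s t) = (- \<eta> s) * (- \<eta> t)" unfolding psign_square_add[OF s(1) t(1)] ps by simp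
    finally show ?thesis using kap[OF gc(1) s] kap[OF gc(2) t] by simp
  qed
  have nz: "\<kappa> g \<noteq> 0" for g unfolding \<kappa>_def by simp
  obtain \<phi> where phi: "inner_automorphism L br \<phi>"
    "\<And>g z. g \<in> ?S \<Longrightarrow> z \<in> \<Gamma> g \<times> \<Gamma> g \<Longrightarrow> \<phi> z = cscale (\<kappa> g) z"
    by (rule inner_grading_character[OF gr inner, where \<kappa> = \<kappa>]) (use nz mult in blast)+
  \<comment> \<open>The first generators of the first two tensor factors, available since
    \<open>2 \<le> mY\<close>. They commute, so \<eta> is multiplicative on this pair and -\<eta> is
    not; their associative product nevertheless lies in a nonzero component, where innerness demands
    multiplicativity.\<close>
  define s t :: "nat \<Rightarrow> int" where "s = (\<lambda>a\<in>{..<2 * mY}. if a = 0 then 1 else 0)"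
    and "t = (\<lambda>a\<in>{..<2 * mY}. if a = 2 then 1 else 0)"
  have st: "s \<in> pidx mY" "t \<in> pidx mY" unfolding s_def t_def pidx_def by auto
  have "s 0 = 1" "t 0 = 0" "t 2 = 1" "pzero mY 0 = 0" "pzero mY 2 = 0" using m2 unfolding s_def t_def pzero_def by auto
  then have ne: "s \<noteq> pzero mY" "t \<noteq> pzero mY" "s \<noteq> t" by fastforce+
  have one: "psign hY mY s t = 1" "psign hY mY t s = 1"
    unfolding psign_def by (rule prod.neutral, auto simp: pair_sign_def s_def t_def)+
  have eta: "\<eta> (padd mY s t) = \<eta> s * \<eta> t" unfolding psign_square_add[OF st] one by simp
  obtain g where g: "g \<in> carrier G" "Y s \<in> V g" using Y_degree st by blast
  obtain g' where g': "g' \<in> carrier G" "Y t \<in> V g'" using Y_degree st by blast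
  have pst: "padd mY s t \<noteq> pzero mY" using ne st by simp
  have gg: "g \<otimes> g' \<in> carrier G" using g g' by simp
  have pV: "Y (padd mY s t) \<in> V (g \<otimes> g')" by (rule prod[OF g(1) g'(1) st g(2) g'(2)])
  have pG: "Y (padd mY s t) \<in> \<Gamma> (g \<otimes> g')" by (rule YL[OF gg padd_in pst pV])
  have sub: "subspace (\<Gamma> x)" if "x \<in> carrier G" for x using gr that unfolding lie_grading_def by blast
  have inS: "x \<in> ?S" if "x \<in> carrier G" "Y a \<in> \<Gamma> x" "a \<in> pidx mY" for x a
    using that Y_nz unfolding grading_support_def by auto
  have S3: "g \<in> ?S" "g' \<in> ?S" "g \<otimes> g' \<in> ?S"
    using inS[OF g(1) YL[OF g(1) st(1) ne(1) g(2)] st(1)] inS[OF g'(1) YL[OF g'(1) st(2) ne(2) g'(2)] st(2)]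
      inS[OF gg pG padd_in] by auto
  define f where "f = (\<lambda>x. if x = g \<otimes> g' then Y (padd mY s t) else 0)"
  have f: "f x \<in> \<Gamma> x" if "x \<in> ?S" for x
    using that pG sub subspace_0 unfolding f_def grading_support_def by auto
  have fs: "Y s \<star> Y t = (\<Sum>x\<in>?S. f x) + 0 *\<^sub>R u"
    unfolding f_def using S3(3) finite_support[OF gr] st one by (simp add: Y_mult)
  have fne: "f (g \<otimes> g') \<noteq> 0" unfolding f_def using Y_nz by simp
  have "\<kappa> (g \<otimes> g') = \<kappa> g * \<kappa> g'"
    by (rule inner_multiplicative(1)[where \<kappa> = \<kappa> and f = f and c = 0, OF gr phi S3(1,2)
        YL[OF g(1) st(1) ne(1) g(2)] YL[OF g'(1) st(2) ne(2) g'(2)] f fs S3(3) fne])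
  then have "complex_of_real (- \<eta> (padd mY s t)) = of_real (\<eta> s * \<eta> t)"
    using kap[OF gg padd_in pst pV] kap[OF g(1) st(1) ne(1) g(2)] kap[OF g'(1) st(2) ne(2) g'(2)] by simp
  then have "- \<eta> (padd mY s t) = \<eta> s * \<eta> t" unfolding of_real_eq_iff .
  then have "2 * (\<eta> s * \<eta> t) = 0" unfolding eta by simp
  then show False by simp
qed

end

section \<open>Assembling the structure of an inner fine grading\<close>

context type_I
begin

text \<open>Splitting off scalar parts turns the decomposition of \<open>L\<close> into one of
  \<open>R\<close>; independence persists because the trace detects the coefficient of
  \<open>u\<close>. Closure under products is \<open>associative_grading\<close>.\<close>

lemma graded_unital:
  assumes gr: "lie_grading L br G \<Gamma>"
    and inner: "inner_grading L br (universal_group br G \<Gamma>) (universal_grading br G \<Gamma>)"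
  shows "graded_type_I mult hq k m B G (insert \<one>\<^bsub>G\<^esub> (grading_support G \<Gamma>)) (unital G \<Gamma>)"
proof -
  interpret G: comm_group G using gr unfolding lie_grading_def by simp
  let ?Sup = "grading_support G \<Gamma>" and ?V = "unital G \<Gamma>"
  let ?S = "insert \<one>\<^bsub>G\<^esub> ?Sup"
  have fin: "finite ?Sup" by (rule finite_support[OF gr])
  have Sc: "?Sup \<subseteq> carrier G" unfolding grading_support_def by auto
  have sub: "subspace (\<Gamma> s)" "\<Gamma> s \<subseteq> L" if "s \<in> carrier G" for s using gr that unfolding lie_grading_def by auto
  have zero: "x = 0" if "x \<in> \<Gamma> s" "s \<in> carrier G" "s \<notin> ?Sup" for x s using that unfolding grading_support_def by auto
  have one_eq: "?V \<one>\<^bsub>G\<^esub> = {x + y | x y. x \<in> \<Gamma> \<one>\<^bsub>G\<^esub> \<and> y \<in> span {u}}"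
    unfolding unital_def by (auto simp: span_singleton)
  have V_one: "\<exists>y c. x = y + c *\<^sub>R u \<and> y \<in> \<Gamma> \<one>\<^bsub>G\<^esub>" if "x \<in> ?V \<one>\<^bsub>G\<^esub>" for x
    using that unfolding unital_def by auto
  have V_oneI: "y + c *\<^sub>R u \<in> ?V \<one>\<^bsub>G\<^esub>" if "y \<in> \<Gamma> \<one>\<^bsub>G\<^esub>" for y c
    using that unfolding unital_def by auto
  have V_ne: "?V s = \<Gamma> s" if "s \<noteq> \<one>\<^bsub>G\<^esub>" for s using that unfolding unital_def by simp
  have subV: "subspace (?V s)" if "s \<in> carrier G" for s
  proof (cases "s = \<one>\<^bsub>G\<^esub>")
    case True
    then show ?thesis using subspace_sums[OF sub(1)[OF that] subspace_span[of "{u}"]] one_eq by simp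
  qed (use sub that V_ne in simp)
  show ?thesis
  proof (intro graded_type_I.intro type_I_axioms G.comm_group_axioms graded_type_I_axioms.intro)
    show "finite ?S" using fin by (rule finite.insertI)
    show "?S \<subseteq> carrier G" using Sc by simp
    show "subspace (?V g)" if "g \<in> carrier G" for g by (rule subV[OF that])
    show "x \<in> R" if g: "g \<in> carrier G" "x \<in> ?V g" for g x
    proof (cases "g = \<one>\<^bsub>G\<^esub>")
      case True
      then obtain y c where y: "x = y + c *\<^sub>R u" "y \<in> \<Gamma> \<one>\<^bsub>G\<^esub>" using V_one g by blast
      then have "y \<in> R" using sub(2)[OF G.one_closed] L_R by blast
      then show ?thesis unfolding y(1) by (intro subspace_add subspace_scale) auto
    next
      case False
      then show ?thesis using g sub(2) V_ne L_R by blast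
    qed
    show "x = 0" if "g \<in> carrier G" "g \<notin> ?S" "x \<in> ?V g" for g x
      using that zero[of x g] V_ne[of g] by simp
    show "x \<star> y \<in> ?V (g \<otimes>\<^bsub>G\<^esub> g')" if "g \<in> carrier G" "g' \<in> carrier G" "x \<in> ?V g" "y \<in> ?V g'" for g g' x y
      by (rule associative_grading[OF gr inner that])
    show "u \<in> ?V \<one>\<^bsub>G\<^esub>" using V_oneI[of 0 1] subspace_0[OF sub(1)[OF G.one_closed]] by simp
    have split_sum: "(\<Sum>g\<in>?S. F g) = F \<one>\<^bsub>G\<^esub> + (\<Sum>g\<in>?Sup - {\<one>\<^bsub>G\<^esub>}. F g)" for F :: "_ \<Rightarrow> 'a"
      using fin by (simp add: sum.insert_remove)
    show "\<exists>f. (\<forall>g\<in>?S. f g \<in> ?V g) \<and> x = (\<Sum>g\<in>?S. f g)" if x: "x \<in> R" for x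
    proof -
      obtain f where f: "\<And>g. g \<in> ?Sup \<Longrightarrow> f g \<in> \<Gamma> g" "x - (tr x / k) *\<^sub>R u = (\<Sum>g\<in>?Sup. f g)"
        using lie_grading_sum[OF gr fin traceless_in_L[OF x]] by blast
      define f0 where "f0 = (\<lambda>g. if g \<in> ?Sup then f g else 0)"
      have f0: "f0 g \<in> \<Gamma> g" if "g \<in> carrier G" for g using f(1) subspace_0[OF sub(1)[OF that]] unfolding f0_def by simp
      define F where "F = (\<lambda>g. if g = \<one>\<^bsub>G\<^esub> then f0 g + (tr x / k) *\<^sub>R u else f0 g)"
      have "F g \<in> ?V g" if "g \<in> ?S" for g
        using that f0 Sc V_oneI V_ne unfolding F_def by auto
      moreover have "(\<Sum>g\<in>?S. F g) = x"
      proof -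
        have "(\<Sum>g\<in>?S. F g) = (tr x / k) *\<^sub>R u + (\<Sum>g\<in>?S. f0 g)"
          unfolding split_sum unfolding F_def by simp
        also have "(\<Sum>g\<in>?S. f0 g) = (\<Sum>g\<in>?Sup. f g)"
          using fin by (intro sum.mono_neutral_cong_right) (auto simp: f0_def)
        finally show ?thesis using f(2) by (metis add.commute diff_add_cancel)
      qed
      ultimately show ?thesis by metis
    qed
    show "f g = 0" if f: "\<And>g. g \<in> ?S \<Longrightarrow> f g \<in> ?V g" "(\<Sum>g\<in>?S. f g) = 0" "g \<in> ?S" for f g
    proof -
      obtain y c where y: "f \<one>\<^bsub>G\<^esub> = y + c *\<^sub>R u" "y \<in> \<Gamma> \<one>\<^bsub>G\<^esub>" using V_one f(1) by blast
      define F where "F = (\<lambda>g. if g = \<one>\<^bsub>G\<^esub> then y else f g)"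
      have FG: "F h \<in> \<Gamma> h" if "h \<in> ?S" for h using that f(1) y V_ne unfolding F_def by auto
      have S: "finite ?S" "?S \<subseteq> carrier G" using fin Sc by auto
      have "(\<Sum>g\<in>?S. F g) \<in> L" using FG sub(2) S by (intro subspace_sum) auto
      moreover have "(\<Sum>g\<in>?S. F g) = (- c) *\<^sub>R u"
      proof -
        have "(\<Sum>g\<in>?S. f g) = c *\<^sub>R u + (\<Sum>g\<in>?S. F g)" unfolding split_sum unfolding F_def using y by simp
        then show ?thesis using f(2) by (simp add: add_eq_0_iff)
      qed
      ultimately have "tr ((- c) *\<^sub>R u) = 0" using tr_L by metis
      then have c0: "c = 0" using k_pos by simp
      then have "(\<Sum>g\<in>?S. F g) = 0" using \<open>(\<Sum>g\<in>?S. F g) = (- c) *\<^sub>R u\<close> by simp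
      from lie_grading_indep[OF gr subspace_0[OF subspace_L] S FG this f(3)]
      show ?thesis using c0 y unfolding F_def by (cases "g = \<one>\<^bsub>G\<^esub>") auto
    qed
  qed
qed

text \<open>The bound 9 is the dimension of \<open>R\<close> in the smallest case r = 2. It excludes
  n = 1 with at most one Pauli factor and n = 2 with none, where the dimension is at most 4; the
  remaining cases of n \<le> 2 fall to \<open>n_neq_1\<close> and \<open>n_neq_2\<close>.\<close>

theorem fine_inner_structure:
  assumes fine: "fine_grading L br G \<Gamma>"
    and inner: "inner_grading L br (universal_group br G \<Gamma>) (universal_grading br G \<Gamma>)"
    and big: "9 \<le> k\<^sup>2 * 4 ^ m"
  obtains h' n' m' B' where "type_I mult h' n' m' B'" "h' \<Longrightarrow> 0 < m'" "3 \<le> n'"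
    "type_I.R n' m' B' = R" "n'\<^sup>2 * 4 ^ m' = k\<^sup>2 * 4 ^ m"
    "\<And>g. g \<in> carrier G \<Longrightarrow> \<Gamma> g \<noteq> {0} \<Longrightarrow> \<exists>t\<in>pidx m'. \<exists>i<n'. \<exists>j<n'.
       \<Gamma> g = span {B' p q t | p q. p < n' \<and> q < n' \<and> basis_diff n' p q = basis_diff n' i j} \<inter> L"
proof -
  have gr: "lie_grading L br G \<Gamma>" using fine unfolding fine_grading_def by simp
  interpret G1: graded_type_I mult hq k m B G "insert \<one>\<^bsub>G\<^esub> (grading_support G \<Gamma>)" "unital G \<Gamma>"
    by (rule graded_unital[OF gr inner])
  obtain n E d where "graded_matrix mult hq k m B G (insert \<one>\<^bsub>G\<^esub> (grading_support G \<Gamma>)) (unital G \<Gamma>) n E d"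
    by (rule G1.graded_matrix_exists)
  then have "fine_graded mult hq k m B G (insert \<one>\<^bsub>G\<^esub> (grading_support G \<Gamma>)) (unital G \<Gamma>) n E d \<Gamma>"
    by (rule fine_graded.intro) (rule fine_graded_axioms.intro[OF fine refl])
  then interpret G2: fine_graded mult hq k m B G "insert \<one>\<^bsub>G\<^esub> (grading_support G \<Gamma>)" "unital G \<Gamma>" n E d \<Gamma> .
  obtain hY mY Y where "fine_structure mult hq k m B G (insert \<one>\<^bsub>G\<^esub> (grading_support G \<Gamma>)) (unital G \<Gamma>) n E d \<Gamma> hY mY Y"
    by (rule G2.fine_structure_exists)
  then interpret G3: fine_structure mult hq k m B G "insert \<one>\<^bsub>G\<^esub> (grading_support G \<Gamma>)" "unital G \<Gamma>" n E d \<Gamma> hY mY Y .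
  have dim: "n\<^sup>2 * 4 ^ mY = k\<^sup>2 * 4 ^ m" by (rule G3.dim_eq)
  have "n \<noteq> 1"
  proof
    assume n1: "n = 1"
    have "\<not> 2 \<le> mY" using G3.n_neq_1[OF inner] n1 by blast
    then have "mY = 0 \<or> mY = 1" by auto
    then have "(4::nat) ^ mY \<le> 4" by auto
    then show False using dim big n1 by simp
  qed
  moreover have "n \<noteq> 2"
  proof
    assume n2: "n = 2"
    have "mY \<noteq> 0" using dim big n2 by (intro notI) simp
    define t0 :: "nat \<Rightarrow> int" where "t0 = (\<lambda>a\<in>{..<2 * mY}. 1)"
    have "t0 \<in> pidx mY" unfolding t0_def pidx_def by auto
    moreover have "t0 0 \<noteq> pzero mY 0" using \<open>mY \<noteq> 0\<close> unfolding t0_def pzero_def by simp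
    then have "t0 \<noteq> pzero mY" by auto
    ultimately show False using G3.n_neq_2 n2 by blast
  qed
  ultimately have n3: "3 \<le> n" using G2.n_pos by linarith
  show thesis
  proof (rule that[OF G3.type_I_BY G3.hY n3 G3.BY_R_eq dim])
    fix g assume g: "g \<in> carrier G" "\<Gamma> g \<noteq> {0}"
    obtain t i j where "t \<in> pidx mY" "i < n" "j < n" "\<Gamma> g = G3.comp t (basis_diff n i j)"
      by (rule G3.component_form[OF g])
    then show "\<exists>t\<in>pidx mY. \<exists>i<n. \<exists>j<n.
       \<Gamma> g = span {G3.BY p q t | p q. p < n \<and> q < n \<and> basis_diff n p q = basis_diff n i j} \<inter> L"
      unfolding G3.comp_def by blast
  qed
qed

end

section \<open>Counting the negative components\<close>

text \<open>
  Intended for the components \<open>X\<close> of a grading on \<open>L\<close>: for type I gradings this is the condition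
  $X_t^2 = -1$ on the component of degree \<open>(t, 0)\<close>, expressed by the Lie bracket alone.
\<close>

definition negative :: "'a::real_vector set \<Rightarrow> ('a \<Rightarrow> 'a \<Rightarrow> 'a) \<Rightarrow> 'a set \<Rightarrow> bool" where
  "negative L br X \<longleftrightarrow> (\<exists>a\<in>X. \<exists>z\<in>L. \<exists>c<0. z \<noteq> 0 \<and> br a (br a z) = c *\<^sub>R z)"

context type_I
begin

text \<open>The shape of the components of \<open>type_I_grading\<close>, for an abstract
  \<open>type_I\<close> algebra.\<close>

definition comp0 :: "(nat \<Rightarrow> int) \<Rightarrow> (nat \<Rightarrow> int) \<Rightarrow> 'a set" where
  "comp0 t v = span {B i j t | i j. i < k \<and> j < k \<and> basis_diff k i j = v} \<inter> L"

lemma br_br: "br a (br a z) = a \<star> (a \<star> z) - 2 *\<^sub>R (a \<star> z \<star> a) + z \<star> a \<star> a"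
  by (simp add: br_def distribs mult_assoc scaleR_2)

lemma B_in_comp0:
  assumes "t \<in> pidx m" "t \<noteq> pzero m" shows "B 0 0 t \<in> comp0 t (basis_diff k 0 0)"
proof -
  have "B 0 0 t \<in> {B i j t | i j. i < k \<and> j < k \<and> basis_diff k i j = basis_diff k 0 0}"
    using k_pos by blast
  then show ?thesis unfolding comp0_def using B_diag_L[OF k_pos assms] by (blast intro: span_base)
qed

lemma functional_span:
  assumes "linear f" "x \<in> span W" "f x \<noteq> (0::'v::real_vector)" obtains w where "w \<in> W" "f w \<noteq> 0"
proof -
  have "\<exists>w\<in>W. f w \<noteq> 0"
  proof (rule ccontr)
    assume "\<not> ?thesis"
    then have "f x = (\<lambda>_. 0) x"
      by (intro linear_eqI_span[OF assms(1) _ _ assms(2)]) (auto intro!: linearI)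
    then show False using assms(3) by simp
  qed
  then show thesis using that by blast
qed

text \<open>\<open>E_00 \<otimes> X_t\<close> acts on the off-diagonal unit \<open>E_01\<close> by
  left multiplication alone, so bracketing twice multiplies it by -1. The second column is the
  reason for \<open>2 \<le> k\<close>.\<close>

lemma negative_comp0:
  assumes k2: "2 \<le> k" and t: "t \<in> pidx m" "psign hq m t t = -1"
  shows "negative L br (comp0 t (basis_diff k 0 0))"
proof -
  have k01: "0 < k" "1 < k" using k2 by auto
  have tz: "t \<noteq> pzero m" using t by auto
  have "B 0 0 t \<in> comp0 t (basis_diff k 0 0)" by (rule B_in_comp0[OF t(1) tz])
  moreover have "B 0 1 (pzero m) \<in> L" using k01 by simp
  moreover have "br (B 0 0 t) (br (B 0 0 t) (B 0 1 (pzero m))) = (-1) *\<^sub>R B 0 1 (pzero m)"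
    using k01 t by (simp add: br_def B_mult)
  moreover have "B 0 1 (pzero m) \<noteq> 0" using B_neq_0 k01 by simp
  ultimately show ?thesis unfolding negative_def by (metis neg_less_0_iff_less zero_less_one)
qed

text \<open>In all other cases the adjoint map has real spectrum. For i \<noteq> j the element
  squares to 0 and its adjoint map is nilpotent. If X_t squares to 1, the element is a combination
  of diagonal \<open>y p\<close> with coefficients \<open>l p\<close>, where \<open>y p\<close>
  squares to \<open>e p\<close>; on the block (p, q) the squared adjoint map has the eigenvalues
  \<open>(l p - l q)^2\<close> and \<open>(l p + l q)^2\<close>, which are not negative.\<close>

lemma negative_comp0_imp:
  assumes t: "t \<in> pidx m" and neg: "negative L br (comp0 t v)"
  shows "v = basis_diff k 0 0 \<and> psign hq m t t = -1"
proof -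
  let ?W = "{B i j t | i j. i < k \<and> j < k \<and> basis_diff k i j = v}"
  obtain a z c where a: "a \<in> span ?W" and z: "z \<in> R" "z \<noteq> 0" and c: "c < 0" and eq: "br a (br a z) = c *\<^sub>R z"
    using neg L_R unfolding negative_def comp0_def by blast
  have "?W \<noteq> {}"
  proof
    assume "?W = {}"
    then have "span ?W = {0}" by (simp only: span_empty)
    then have "a = 0" using a by blast
    then have "c *\<^sub>R z = 0" using eq by (simp add: br_def)
    then show False using c z by simp
  qed
  then obtain i j where ij: "i < k" "j < k" "basis_diff k i j = v" by blast
  have ij_eq: "i = j"
  proof (rule ccontr)
    assume ne: "i \<noteq> j"
    have "?W \<subseteq> {B i j t}" using ne basis_diff_eq_iff[OF ij(1,2)] ij(3) by auto
    then have "a \<in> span {B i j t}" using a span_mono by blast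
    then obtain l where l: "a = l *\<^sub>R B i j t" by (auto simp: span_singleton)
    have aa: "a \<star> a = 0" unfolding l using ne ij t by (simp add: B_mult)
    have aax: "a \<star> (a \<star> x) = 0" for x using aa by (simp add: mult_assoc[symmetric])
    \<comment> \<open>Only the middle term of \<open>br_br\<close> survives, and multiplying it by
      \<open>a\<close> on both sides gives 0.\<close>
    have e1: "c *\<^sub>R z = - (2 *\<^sub>R (a \<star> z \<star> a))"
      using eq unfolding br_br by (simp add: aax mult_assoc aa)
    have "c *\<^sub>R (a \<star> z \<star> a) = a \<star> (c *\<^sub>R z) \<star> a" by simp
    also have "\<dots> = 0" unfolding e1 by (simp add: mult_assoc aax)
    finally have "a \<star> z \<star> a = 0" using c by simp
    then have "c *\<^sub>R z = 0" using e1 by simp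
    then show False using c z by simp
  qed
  have v: "v = basis_diff k 0 0"
    using basis_diff_eq_iff[OF k_pos k_pos ij(1,2)] ij ij_eq by simp
  have "psign hq m t t \<noteq> 1"
  proof
    assume p1: "psign hq m t t = 1"
    have tt: "B i i t \<star> B i i t = B i i (pzero m)" if "i < k" for i using that t p1 by (simp add: B_mult)
    define e where "e = (\<lambda>i. B i i (pzero m))"
    define y where "y = (\<lambda>i. B i i t)"
    have rel: "y p \<star> y p = e p" "e p \<star> y p = y p" "y p \<star> e p = y p" "e p \<star> e p = e p" if "p < k" for p
      using that t p1 unfolding e_def y_def by (simp_all add: B_mult)
    \<comment> \<open>A property closed under linear combinations which expresses that
      \<open>a\<close> has coefficients \<open>l p\<close> with respect to the
      \<open>y p\<close>.\<close>
    have Wsub: "?W \<subseteq> {x. \<forall>p<k. \<exists>l. e p \<star> x = l *\<^sub>R y p \<and> x \<star> e p = l *\<^sub>R y p}"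
    proof
      fix x assume "x \<in> ?W"
      then obtain i' j' where x: "x = B i' j' t" "i' < k" "j' < k" "basis_diff k i' j' = v" by blast
      then have ii: "i' = j'" using basis_diff_eq_iff[OF k_pos k_pos x(2,3)] v by auto
      have "e p \<star> x = (if p = i' then 1 else 0) *\<^sub>R y p \<and> x \<star> e p = (if p = i' then 1 else 0) *\<^sub>R y p" if "p < k" for p
        unfolding x(1) ii e_def y_def using that x t ii by (simp add: B_mult)
      then show "x \<in> {x. \<forall>p<k. \<exists>l. e p \<star> x = l *\<^sub>R y p \<and> x \<star> e p = l *\<^sub>R y p}" by blast
    qed
    have "subspace {x. \<forall>p<k. \<exists>l. e p \<star> x = l *\<^sub>R y p \<and> x \<star> e p = l *\<^sub>R y p}"
      unfolding subspace_def
    proof (intro conjI ballI allI)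
      show "0 \<in> {x. \<forall>p<k. \<exists>l. e p \<star> x = l *\<^sub>R y p \<and> x \<star> e p = l *\<^sub>R y p}" by (auto intro!: exI[of _ "0::real"])
    next
      fix x x' assume "x \<in> {x. \<forall>p<k. \<exists>l. e p \<star> x = l *\<^sub>R y p \<and> x \<star> e p = l *\<^sub>R y p}"
        "x' \<in> {x. \<forall>p<k. \<exists>l. e p \<star> x = l *\<^sub>R y p \<and> x \<star> e p = l *\<^sub>R y p}"
      then have H: "\<exists>l. e p \<star> x = l *\<^sub>R y p \<and> x \<star> e p = l *\<^sub>R y p" "\<exists>l. e p \<star> x' = l *\<^sub>R y p \<and> x' \<star> e p = l *\<^sub>R y p" if "p < k" for p
        using that by auto
      have "\<exists>l. e p \<star> (x + x') = l *\<^sub>R y p \<and> (x + x') \<star> e p = l *\<^sub>R y p" if "p < k" for p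
        using H[OF that] by (auto simp: distribs scaleR_add_left[symmetric])
      then show "x + x' \<in> {x. \<forall>p<k. \<exists>l. e p \<star> x = l *\<^sub>R y p \<and> x \<star> e p = l *\<^sub>R y p}" by blast
    next
      fix r x assume "x \<in> {x. \<forall>p<k. \<exists>l. e p \<star> x = l *\<^sub>R y p \<and> x \<star> e p = l *\<^sub>R y p}"
      then have H: "\<exists>l. e p \<star> x = l *\<^sub>R y p \<and> x \<star> e p = l *\<^sub>R y p" if "p < k" for p using that by auto
      have "\<exists>l. e p \<star> (r *\<^sub>R x) = l *\<^sub>R y p \<and> (r *\<^sub>R x) \<star> e p = l *\<^sub>R y p" if "p < k" for p
        using H[OF that] by auto
      then show "r *\<^sub>R x \<in> {x. \<forall>p<k. \<exists>l. e p \<star> x = l *\<^sub>R y p \<and> x \<star> e p = l *\<^sub>R y p}" by blast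
    qed
    then have "a \<in> {x. \<forall>p<k. \<exists>l. e p \<star> x = l *\<^sub>R y p \<and> x \<star> e p = l *\<^sub>R y p}"
      using span_minimal[OF Wsub] a by blast
    then have "\<forall>p. \<exists>l. p < k \<longrightarrow> e p \<star> a = l *\<^sub>R y p \<and> a \<star> e p = l *\<^sub>R y p" by blast
    then obtain l where l: "\<And>p. p < k \<Longrightarrow> e p \<star> a = l p *\<^sub>R y p \<and> a \<star> e p = l p *\<^sub>R y p" by metis
    have key: "e p \<star> z \<star> e q = 0" if pq: "p < k" "q < k" for p q
    proof -
      define zz where "zz = e p \<star> z \<star> e q"
      define w where "w = y p \<star> z \<star> y q"
      have ea: "e p \<star> a = l p *\<^sub>R y p" and ae: "a \<star> e q = l q *\<^sub>R y q" using l pq by auto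
      have ya: "y p \<star> a = l p *\<^sub>R e p"
      proof -
        have "y p \<star> a = y p \<star> (e p \<star> a)" using rel[OF pq(1)] by (simp add: mult_assoc[symmetric])
        then show ?thesis using ea rel[OF pq(1)] by simp
      qed
      have ay: "a \<star> y q = l q *\<^sub>R e q"
      proof -
        have "a \<star> y q = (a \<star> e q) \<star> y q" using rel[OF pq(2)] by (simp add: mult_assoc)
        then show ?thesis using ae rel[OF pq(2)] by simp
      qed
      have 1: "e p \<star> (a \<star> (a \<star> z)) \<star> e q = (l p * l p) *\<^sub>R zz"
      proof -
        have "e p \<star> (a \<star> (a \<star> z)) \<star> e q = ((e p \<star> a) \<star> a) \<star> z \<star> e q" by (simp add: mult_assoc)
        then show ?thesis unfolding ea mult_scaleR_left ya zz_def by simp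
      qed
      have 2: "e p \<star> (z \<star> a \<star> a) \<star> e q = (l q * l q) *\<^sub>R zz"
      proof -
        have "e p \<star> (z \<star> a \<star> a) \<star> e q = e p \<star> z \<star> (a \<star> (a \<star> e q))" by (simp add: mult_assoc)
        then show ?thesis unfolding ae mult_scaleR_right ay zz_def by simp
      qed
      have 3: "e p \<star> (a \<star> z \<star> a) \<star> e q = (l p * l q) *\<^sub>R w"
      proof -
        have "e p \<star> (a \<star> z \<star> a) \<star> e q = (e p \<star> a) \<star> z \<star> (a \<star> e q)" by (simp add: mult_assoc)
        then show ?thesis unfolding ea ae w_def by (simp add: mult.commute)
      qed
      have "e p \<star> (c *\<^sub>R z) \<star> e q = e p \<star> (a \<star> (a \<star> z)) \<star> e q - 2 *\<^sub>R (e p \<star> (a \<star> z \<star> a) \<star> e q) + e p \<star> (z \<star> a \<star> a) \<star> e q"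
        unfolding eq[symmetric] br_br by (simp add: distribs)
      then have E1: "c *\<^sub>R zz = (l p * l p) *\<^sub>R zz - (2 * (l p * l q)) *\<^sub>R w + (l q * l q) *\<^sub>R zz"
        unfolding 1 2 3 by (simp add: zz_def)
      have yz: "y p \<star> zz \<star> y q = w" unfolding zz_def w_def
        using rel[OF pq(1)] rel[OF pq(2)] by (metis mult_assoc)
      have yw: "y p \<star> w \<star> y q = zz" unfolding zz_def w_def
        using rel[OF pq(1)] rel[OF pq(2)] by (metis mult_assoc)
      have "y p \<star> (c *\<^sub>R zz) \<star> y q = (l p * l p) *\<^sub>R (y p \<star> zz \<star> y q) - (2 * (l p * l q)) *\<^sub>R (y p \<star> w \<star> y q) + (l q * l q) *\<^sub>R (y p \<star> zz \<star> y q)"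
        unfolding E1 by (simp add: distribs)
      then have E2: "c *\<^sub>R w = (l p * l p) *\<^sub>R w - (2 * (l p * l q)) *\<^sub>R zz + (l q * l q) *\<^sub>R w"
        unfolding yw by (simp add: yz)
      \<comment> \<open>The relations \<open>E1\<close> and \<open>E2\<close> are diagonalized by
        \<open>zz + w\<close> and \<open>zz - w\<close>.\<close>
      have "(c - (l p - l q) * (l p - l q)) *\<^sub>R (zz + w) = 0"
      proof -
        have "c *\<^sub>R (zz + w) = ((l p - l q) * (l p - l q)) *\<^sub>R (zz + w)"
          unfolding scaleR_add_right E1 E2 by (simp add: algebra_simps)
        then show ?thesis by (simp add: scaleR_diff_left)
      qed
      moreover have "0 \<le> (l p - l q) * (l p - l q)" by simp
      then have "c - (l p - l q) * (l p - l q) \<noteq> 0" using c by linarith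
      ultimately have s1: "zz + w = 0" by simp
      have "(c - (l p + l q) * (l p + l q)) *\<^sub>R (zz - w) = 0"
      proof -
        have "c *\<^sub>R (zz - w) = ((l p + l q) * (l p + l q)) *\<^sub>R (zz - w)"
          unfolding scaleR_diff_right E1 E2 by (simp add: algebra_simps)
        then show ?thesis by (simp add: scaleR_diff_left)
      qed
      moreover have "0 \<le> (l p + l q) * (l p + l q)" by simp
      then have "c - (l p + l q) * (l p + l q) \<noteq> 0" using c by linarith
      ultimately have s2: "zz - w = 0" by simp
      have "2 *\<^sub>R zz = (zz + w) + (zz - w)" by (simp add: scaleR_2)
      then show ?thesis using s1 s2 unfolding zz_def by simp
    qed
    have "z = u \<star> z \<star> u" using z by simp
    also have "\<dots> = (\<Sum>q<k. \<Sum>p<k. e p \<star> z \<star> e q)" unfolding u_def e_def by (simp add: mult_sum_left mult_sum_right)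
    also have "\<dots> = 0" using key by (intro sum.neutral ballI) auto
    finally show False using z by simp
  qed
  then show ?thesis using v psign_cases[of hq m t t] by blast
qed

lemma comp0_functional:
  assumes lin: "linear f" and x: "x \<in> comp0 t v" "f x \<noteq> (0::'v::real_vector)"
  obtains i j where "i < k" "j < k" "basis_diff k i j = v" "f (B i j t) \<noteq> 0"
proof -
  have "x \<in> span {B i j t | i j. i < k \<and> j < k \<and> basis_diff k i j = v}" using x unfolding comp0_def by blast
  then obtain w where "w \<in> {B i j t | i j. i < k \<and> j < k \<and> basis_diff k i j = v}" "f w \<noteq> 0"
    by (rule functional_span[OF lin _ x(2)])
  then show thesis using that by blast
qed

text \<open>The left side depends on the Lie grading alone, the right side on the target alone. By
  \<open>comps\<close> components go to components, but the count also requires that each negative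
  \<open>comp0\<close> is hit: expand a preimage of \<open>B 0 0 t\<close> into its parts and find
  one whose image has a nonzero coefficient at \<open>B 0 0 t\<close>.\<close>

theorem card_negative:
  fixes L0 :: "'v::real_vector set"
  assumes k2: "2 \<le> k" and gr: "lie_grading L0 br0 G \<Gamma>" and fin: "finite (grading_support G \<Gamma>)"
    and L0: "subspace L0" "\<And>x y. x \<in> L0 \<Longrightarrow> y \<in> L0 \<Longrightarrow> br0 x y \<in> L0"
    and iso: "lie_isomorphism L0 br0 L br \<phi>"
    and comps: "\<And>g. g \<in> grading_support G \<Gamma> \<Longrightarrow> \<exists>t\<in>pidx m. \<exists>v. \<phi> ` \<Gamma> g = comp0 t v"
  shows "card {X. \<exists>g\<in>grading_support G \<Gamma>. X = \<Gamma> g \<and> negative L0 br0 X} =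
    card {t \<in> pidx m. psign hq m t t = -1}"
proof -
  let ?S = "grading_support G \<Gamma>"
  let ?N = "{X. \<exists>g\<in>?S. X = \<Gamma> g \<and> negative L0 br0 X}" and ?T = "{t \<in> pidx m. psign hq m t t = -1}"
  let ?c = "\<lambda>t. comp0 t (basis_diff k 0 0)"
  have bij: "bij_betw \<phi> L0 L" and add: "\<And>x y. x \<in> L0 \<Longrightarrow> y \<in> L0 \<Longrightarrow> \<phi> (x + y) = \<phi> x + \<phi> y"
    and scale: "\<And>c x. x \<in> L0 \<Longrightarrow> \<phi> (c *\<^sub>R x) = c *\<^sub>R \<phi> x"
    and brk: "\<And>x y. x \<in> L0 \<Longrightarrow> y \<in> L0 \<Longrightarrow> \<phi> (br0 x y) = br (\<phi> x) (\<phi> y)"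
    using iso unfolding lie_isomorphism_def by blast+
  have inj: "inj_on \<phi> L0" and img: "\<phi> ` L0 = L" using bij unfolding bij_betw_def by blast+
  have zero: "\<phi> 0 = 0" using scale[OF subspace_0[OF L0(1)], of 0] by simp
  have GL: "\<Gamma> g \<subseteq> L0" if "g \<in> ?S" for g using gr that unfolding lie_grading_def grading_support_def by blast
  have sums: "\<phi> (\<Sum>g\<in>F. f g) = (\<Sum>g\<in>F. \<phi> (f g))" if "finite F" "\<And>g. g \<in> F \<Longrightarrow> f g \<in> L0" for F f
    using that
  proof (induction F rule: finite_induct)
    case (insert g F)
    have "(\<Sum>g\<in>F. f g) \<in> L0" using insert.prems by (intro subspace_sum[OF L0(1)]) auto
    then show ?case using insert add by simp
  qed (simp add: zero)
  have neg_iff: "negative L br (\<phi> ` X) \<longleftrightarrow> negative L0 br0 X" if X: "X \<subseteq> L0" for X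
  proof -
    have bb: "br (\<phi> a) (br (\<phi> a) (\<phi> z)) = \<phi> (br0 a (br0 a z))" if "a \<in> L0" "z \<in> L0" for a z
      using brk that L0(2) by simp
    have e: "br (\<phi> a) (br (\<phi> a) (\<phi> z)) = c *\<^sub>R \<phi> z \<longleftrightarrow> br0 a (br0 a z) = c *\<^sub>R z" if "a \<in> L0" "z \<in> L0" for a z c
      unfolding bb[OF that] scale[OF that(2), symmetric]
      using inj_on_eq_iff[OF inj] L0 that subspace_scale[OF L0(1)] by simp
    have z: "\<phi> z \<noteq> 0 \<longleftrightarrow> z \<noteq> 0" if "z \<in> L0" for z
      using inj_on_eq_iff[OF inj that subspace_0[OF L0(1)]] zero by simp
    show ?thesis unfolding negative_def img[symmetric] using e z X by (fastforce simp: subset_iff)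
  qed
  have mem: "B 0 0 t \<in> ?c t" if "t \<in> ?T" for t
    using that by (intro B_in_comp0) auto
  have inj_c: "inj_on ?c ?T"
  proof (rule inj_onI)
    fix s t assume st: "s \<in> ?T" "t \<in> ?T" "?c s = ?c t"
    obtain f :: "'a \<Rightarrow> real" where f: "linear f" "\<And>i j t. i < k \<Longrightarrow> j < k \<Longrightarrow> t \<in> pidx m \<Longrightarrow> f (B i j t) = of_bool (t = s)"
      using linear_on_basis[where F = "\<lambda>i j t. of_bool (t = s)"] by blast
    have "B 0 0 s \<in> ?c t" using mem st by blast
    moreover have "f (B 0 0 s) \<noteq> 0" using f(2) k_pos st by simp
    ultimately obtain i j where "i < k" "j < k" "f (B i j t) \<noteq> 0" by (rule comp0_functional[OF f(1)])
    then show "s = t" using f(2) st by auto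
  qed
  have "bij_betw ((`) \<phi>) ?N (?c ` ?T)"
    unfolding bij_betw_def
  proof
    show "inj_on ((`) \<phi>) ?N"
      using inj_on_image_eq_iff[OF inj] GL by (intro inj_onI) blast
    show "(`) \<phi> ` ?N = ?c ` ?T"
    proof (rule subset_antisym; rule subsetI)
      fix Z assume "Z \<in> (`) \<phi> ` ?N"
      then obtain g where g: "g \<in> ?S" "Z = \<phi> ` \<Gamma> g" "negative L0 br0 (\<Gamma> g)" by blast
      obtain t v where t: "t \<in> pidx m" "\<phi> ` \<Gamma> g = comp0 t v" using comps[OF g(1)] by blast
      have "negative L br (comp0 t v)" using neg_iff[OF GL[OF g(1)]] g(3) t(2) by simp
      from negative_comp0_imp[OF t(1) this] show "Z \<in> ?c ` ?T" using g(2) t by blast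
    next
      fix Z assume "Z \<in> ?c ` ?T"
      then obtain t where t: "t \<in> ?T" "Z = ?c t" by blast
      obtain f :: "'a \<Rightarrow> real" where f: "linear f" "\<And>i j s. i < k \<Longrightarrow> j < k \<Longrightarrow> s \<in> pidx m \<Longrightarrow> f (B i j s) = of_bool (i = 0 \<and> j = 0 \<and> s = t)"
        using linear_on_basis[where F = "\<lambda>i j s. of_bool (i = 0 \<and> j = 0 \<and> s = t)"] by blast
      have "B 0 0 t \<in> L" using mem[OF t(1)] unfolding comp0_def by blast
      then obtain x where x: "x \<in> L0" "\<phi> x = B 0 0 t" using img by (metis imageE)
      obtain w where w: "\<And>g. g \<in> ?S \<Longrightarrow> w g \<in> \<Gamma> g" "x = (\<Sum>g\<in>?S. w g)"
        using lie_grading_sum[OF gr fin x(1)] by blast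
      have wL: "w g \<in> L0" if "g \<in> ?S" for g using w(1)[OF that] GL[OF that] by blast
      have "B 0 0 t = (\<Sum>g\<in>?S. \<phi> (w g))" unfolding x(2)[symmetric] w(2) by (rule sums[OF fin wL])
      then have "f (B 0 0 t) = (\<Sum>g\<in>?S. f (\<phi> (w g)))" using linear_sum[OF f(1)] by simp
      moreover have "f (B 0 0 t) = 1" using f(2) k_pos t by simp
      ultimately have "(\<Sum>g\<in>?S. f (\<phi> (w g))) \<noteq> 0" by simp
      then obtain g where g: "g \<in> ?S" "f (\<phi> (w g)) \<noteq> 0" by (metis (mono_tags, lifting) sum.neutral)
      obtain s v where s: "s \<in> pidx m" "\<phi> ` \<Gamma> g = comp0 s v" using comps[OF g(1)] by blast
      have "\<phi> (w g) \<in> comp0 s v" using w(1)[OF g(1)] s(2) by blast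
      then obtain i j where ij: "i < k" "j < k" "basis_diff k i j = v" "f (B i j s) \<noteq> 0"
        using g(2) by (rule comp0_functional[OF f(1)])
      then have "i = 0" "j = 0" "s = t" using f(2)[OF ij(1,2) s(1)] by (auto split: if_splits simp: of_bool_def)
      then have eq: "\<phi> ` \<Gamma> g = Z" using s(2) ij(3) t(2) by simp
      have "negative L br Z" unfolding t(2) using negative_comp0[OF k2] t(1) by blast
      then have "negative L0 br0 (\<Gamma> g)" using neg_iff[OF GL[OF g(1)]] eq by simp
      then show "Z \<in> (`) \<phi> ` ?N" using g(1) eq by blast
    qed
  qed
  then have "card ?N = card (?c ` ?T)" by (rule bij_betw_same_card)
  then show ?thesis using card_image[OF inj_c] by simp
qed

end

section \<open>The number of indices with negative square\<close>

lemma sum_pidx_Suc: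
  fixes g :: "(nat \<Rightarrow> int) \<Rightarrow> real"
  shows "(\<Sum>t\<in>pidx (Suc m). g t) = (\<Sum>t\<in>pidx m. \<Sum>(a, c)\<in>{0, 1} \<times> {0, 1}. g (t(2 * m := a, 2 * m + 1 := c)))"
proof -
  have "(\<Sum>t\<in>pidx (Suc m). g t) = (\<Sum>(t, p)\<in>pidx m \<times> ({0, 1} \<times> {0, 1}). g (t(2 * m := fst p, 2 * m + 1 := snd p)))"
  proof (rule sum.reindex_bij_witness[of _ "\<lambda>(t, p). t(2 * m := fst p, 2 * m + 1 := snd p)"
        "\<lambda>t. (restrict t {..<2 * m}, (t (2 * m), t (2 * m + 1)))"])
    fix t assume t: "t \<in> pidx (Suc m)"
    have r: "(restrict t {..<2 * m})(2 * m := t (2 * m), 2 * m + 1 := t (2 * m + 1)) = t"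
    proof
      fix i
      show "((restrict t {..<2 * m})(2 * m := t (2 * m), 2 * m + 1 := t (2 * m + 1))) i = t i"
        using t unfolding pidx_def by (cases "i < 2 * m") (auto simp: PiE_iff extensional_def)
    qed
    then show "(case (restrict t {..<2 * m}, t (2 * m), t (2 * m + 1)) of (t, p) \<Rightarrow> t(2 * m := fst p, 2 * m + 1 := snd p)) = t"
      by simp
    show "(case (restrict t {..<2 * m}, t (2 * m), t (2 * m + 1)) of (t, p) \<Rightarrow> g (t(2 * m := fst p, 2 * m + 1 := snd p))) = g t"
      using r by simp
    have "restrict t {..<2 * m} \<in> pidx m"
      unfolding pidx_def
    proof (rule restrict_PiE_iff[THEN iffD2], rule ballI)
      fix i assume "i \<in> {..<2 * m}"
      then show "t i \<in> {0, 1}" using pidx_cases[OF t, of i] by simp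
    qed
    moreover have "t (2 * m) \<in> {0, 1}" "t (2 * m + 1) \<in> {0, 1}"
      using pidx_cases[OF t, of "2 * m"] pidx_cases[OF t, of "2 * m + 1"] by simp_all
    ultimately show "(restrict t {..<2 * m}, t (2 * m), t (2 * m + 1)) \<in> pidx m \<times> {0, 1} \<times> {0, 1}"
      by (simp only: mem_Times_iff fst_conv snd_conv)
  next
    fix x assume "x \<in> pidx m \<times> ({0, 1::int} \<times> {0, 1::int})"
    then obtain t a c where x: "x = (t, (a, c))" "t \<in> pidx m" "a \<in> {0, 1}" "c \<in> {0, 1}" by auto
    have "restrict (t(2 * m := a, 2 * m + 1 := c)) {..<2 * m} = t"
      using x(2) unfolding pidx_def by (auto simp: fun_eq_iff PiE_iff extensional_def)
    then show "(restrict (case x of (t, p) \<Rightarrow> t(2 * m := fst p, 2 * m + 1 := snd p)) {..<2 * m},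
        (case x of (t, p) \<Rightarrow> t(2 * m := fst p, 2 * m + 1 := snd p)) (2 * m),
        (case x of (t, p) \<Rightarrow> t(2 * m := fst p, 2 * m + 1 := snd p)) (2 * m + 1)) = x"
      using x(1) by simp
    show "(case x of (t, p) \<Rightarrow> t(2 * m := fst p, 2 * m + 1 := snd p)) \<in> pidx (Suc m)"
      using x unfolding pidx_def by (auto simp: PiE_iff extensional_def)
  qed
  then show ?thesis by (simp only: sum.cartesian_product case_prod_unfold fst_conv snd_conv)
qed

lemma psign_cong:
  "(\<And>i. i < 2 * m \<Longrightarrow> s i = s' i \<and> t i = t' i) \<Longrightarrow> psign q m s t = psign q m s' t'"
  unfolding psign_def by (intro prod.cong) auto

text \<open>The squares of the four basis elements of the last factor have signs 1, 1, 1, -1 for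
  M_2(R) and 1, -1, -1, -1 for H, with sums 2 and -2.\<close>

lemma sum_psign_Suc:
  "(\<Sum>t\<in>pidx (Suc m). psign q (Suc m) t t) = (\<Sum>t\<in>pidx m. psign False m t t) * (if q then -2 else 2)"
proof -
  have "(\<Sum>(a, c)\<in>{0, 1} \<times> {0, 1}. psign q (Suc m) (t(2 * m := a, 2 * m + 1 := c)) (t(2 * m := a, 2 * m + 1 := c))) =
    psign False m t t * (if q then -2 else 2)" for t
  proof -
    have 1: "psign q (Suc m) (t(2 * m := a, 2 * m + 1 := c)) (t(2 * m := a, 2 * m + 1 := c)) =
      psign False m t t * pair_sign q a c a c" for a c
    proof -
      have "psign False m (t(2 * m := a, 2 * m + 1 := c)) (t(2 * m := a, 2 * m + 1 := c)) = psign False m t t"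
        by (rule psign_cong) auto
      then show ?thesis unfolding psign_Suc by simp
    qed
    show ?thesis unfolding 1 sum.cartesian_product[symmetric] by (simp add: pair_sign_def)
  qed
  then show ?thesis unfolding sum_pidx_Suc by (simp add: sum_distrib_right)
qed

lemma sum_psign_False: "(\<Sum>t\<in>pidx m. psign False m t t) = 2 ^ m"
proof (induction m)
  case 0
  show ?case by (simp add: pidx_def psign_def)
next
  case (Suc m)
  then show ?case by (simp add: sum_psign_Suc)
qed

text \<open>Over the 4^m indices the signs of the squares sum to 2^m, or to -2^m with a quaternion
  factor. The equation is doubled to avoid a division.\<close>

lemma card_negative_indices:
  assumes "q \<Longrightarrow> 0 < m"
  shows "2 * int (card {t \<in> pidx m. psign q m t t = -1}) = 2 ^ m * (2 ^ m - (if q then -1 else 1))"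
proof -
  have "(\<Sum>t\<in>pidx m. psign q m t t) = (if q then -1 else 1) * 2 ^ m"
  proof (cases q)
    case True
    then obtain s where "m = Suc s" using assms by (cases m) auto
    then show ?thesis using True by (simp add: sum_psign_Suc sum_psign_False)
  qed (simp add: sum_psign_False)
  moreover have "(\<Sum>t\<in>pidx m. psign q m t t) = (\<Sum>t\<in>pidx m. 1 - 2 * of_bool (psign q m t t = -1))"
  proof (rule sum.cong[OF refl])
    fix t show "psign q m t t = 1 - 2 * of_bool (psign q m t t = -1)" using psign_cases[of q m t t] by auto
  qed
  moreover have "(\<Sum>t\<in>pidx m. 1 - 2 * of_bool (psign q m t t = -1)) = (4 ^ m - 2 * real (card {t \<in> pidx m. psign q m t t = -1}))"
  proof -
    have "(\<Sum>t\<in>pidx m. of_bool (psign q m t t = -1)) = real (card {t \<in> pidx m. psign q m t t = -1})"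
      by (simp add: of_bool_def sum.If_cases Int_def)
    then show ?thesis by (simp add: sum_subtractf sum_distrib_left[symmetric] card_pidx)
  qed
  ultimately have "2 * real (card {t \<in> pidx m. psign q m t t = -1}) = 4 ^ m - (if q then -1 else 1) * 2 ^ m" by linarith
  moreover have "(4::real) ^ m = 2 ^ m * 2 ^ m" by (simp add: power_mult_distrib[symmetric])
  ultimately have "real_of_int (2 * int (card {t \<in> pidx m. psign q m t t = -1})) = real_of_int (2 ^ m * (2 ^ m - (if q then -1 else 1)))"
    by (simp add: right_diff_distrib distrib_left)
  then show ?thesis unfolding of_int_eq_iff .
qed

text \<open>Put x = 2^m and y = 2^m'. With equal flags, x^2 - x or x^2 + x determines x. With
  different flags x and y differ by 1, the smaller one belonging to the quaternion side, where the
  exponent is positive; but then the larger one is an odd power of 2 greater than 1.\<close>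

lemma negative_indices_inject:
  assumes "q \<Longrightarrow> 0 < m" "q' \<Longrightarrow> 0 < m'"
    and eq: "card {t \<in> pidx m. psign q m t t = -1} = card {t \<in> pidx m'. psign q' m' t t = -1}"
  shows "q = q' \<and> m = m'"
proof -
  define x y :: int where "x = 2 ^ m" and "y = 2 ^ m'"
  have xy: "1 \<le> x" "1 \<le> y" unfolding x_def y_def by simp_all
  have e: "x * (x - (if q then -1 else 1)) = y * (y - (if q' then -1 else 1))"
  proof -
    have "2 * int (card {t \<in> pidx m. psign q m t t = -1}) = 2 ^ m * (2 ^ m - (if q then -1 else 1))"
      by (rule card_negative_indices) (use assms(1) in blast)
    moreover have "2 * int (card {t \<in> pidx m'. psign q' m' t t = -1}) = 2 ^ m' * (2 ^ m' - (if q' then -1 else 1))"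
      by (rule card_negative_indices) (use assms(2) in blast)
    ultimately show ?thesis using eq unfolding x_def y_def by simp
  qed
  have odd: False if "2 ^ i = (2 ^ j + 1 :: int)" "0 < j" for i j
  proof -
    have "odd (2 ^ j + 1 :: int)" using that(2) by simp
    then have "i = 0" using that(1) by (metis even_power even_numeral gr0I)
    then show False using that(1) by simp
  qed
  have inj: "m = m'" if "x = y" using that unfolding x_def y_def by simp
  show ?thesis
  proof (cases "q = q'")
    case True
    then have "(x - y) * (x + y - (if q then -1 else 1)) = 0" using e by (simp add: algebra_simps split: if_splits)
    moreover have "x + y - (if q then -1 else 1) \<noteq> 0" using xy by auto
    ultimately have "x = y" by simp
    then show ?thesis using inj True by simp
  next
    case False
    show ?thesis
    proof (cases q)
      case True
      then have "\<not> q'" using False by simp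
      then have "(x + y) * (y - x - 1) = 0" using e True by (simp add: algebra_simps)
      then have "y = x + 1" using xy by auto
      then show ?thesis using odd[of m' m] assms(1) True unfolding x_def y_def by blast
    next
      case nq: False
      then have "q'" using False by simp
      then have "(x + y) * (x - y - 1) = 0" using e nq by (simp add: algebra_simps)
      then have "x = y + 1" using xy by auto
      then show ?thesis using odd[of m m'] assms(2) \<open>q'\<close> unfolding x_def y_def by blast
    qed
  qed
qed

section \<open>The classification\<close>

text \<open>Both families are independent, so matching them extends linearly in both directions, and
  equality of the tables makes the extension multiplicative. Commutators then go to
  commutators.\<close>

lemma type_I_isomorphism:
  fixes mult1 :: "'a::real_vector \<Rightarrow> 'a \<Rightarrow> 'a" and mult2 :: "'b::real_vector \<Rightarrow> 'b \<Rightarrow> 'b"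
  assumes A1: "type_I mult1 q k m B1" and A2: "type_I mult2 q k m B2"
  obtains \<Phi> where "linear \<Phi>" "\<And>i j t. i < k \<Longrightarrow> j < k \<Longrightarrow> t \<in> pidx m \<Longrightarrow> \<Phi> (B1 i j t) = B2 i j t"
    "\<And>x y. x \<in> type_I.R k m B1 \<Longrightarrow> y \<in> type_I.R k m B1 \<Longrightarrow> \<Phi> (mult1 x y) = mult2 (\<Phi> x) (\<Phi> y)"
    "inj_on \<Phi> (type_I.R k m B1)" "\<Phi> ` type_I.R k m B1 = type_I.R k m B2"
    "\<Phi> ` type_I.L mult1 k m B1 = type_I.L mult2 k m B2"
proof -
  interpret X: type_I mult1 q k m B1 by (rule A1)
  interpret Z: type_I mult2 q k m B2 by (rule A2)
  obtain \<Phi> where lin: "linear \<Phi>" and Phi: "\<And>i j t. i < k \<Longrightarrow> j < k \<Longrightarrow> t \<in> pidx m \<Longrightarrow> \<Phi> (B1 i j t) = B2 i j t"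
    using X.linear_on_basis[where F = B2] by blast
  obtain \<Psi> where lin': "linear \<Psi>" and Psi: "\<And>i j t. i < k \<Longrightarrow> j < k \<Longrightarrow> t \<in> pidx m \<Longrightarrow> \<Psi> (B2 i j t) = B1 i j t"
    using Z.linear_on_basis[where F = B1] by blast
  have inv: "\<Psi> (\<Phi> x) = x" if "x \<in> X.R" for x
  proof (rule linear_eqI_span[of "\<lambda>x. \<Psi> (\<Phi> x)" "\<lambda>x. x" "X.b ` X.idx"])
    show "linear (\<lambda>x. \<Psi> (\<Phi> x))" "linear (\<lambda>x::'a. x)"
      by (auto intro!: linearI simp: linear_add[OF lin] linear_cmul[OF lin] linear_add[OF lin'] linear_cmul[OF lin'])
    fix c assume "c \<in> X.b ` X.idx"
    then show "\<Psi> (\<Phi> c) = c" using Phi Psi unfolding X.b_def X.idx_def by auto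
  qed (use that in \<open>simp add: X.R_def\<close>)
  have inj: "inj_on \<Phi> X.R" using inv by (rule inj_on_inverseI)
  have img: "\<Phi> ` X.R = Z.R"
  proof -
    have "\<Phi> ` (X.b ` X.idx) = Z.b ` Z.idx"
      unfolding image_image X.idx_def Z.idx_def by (rule image_cong[OF refl]) (auto simp: X.b_def Z.b_def Phi)
    then show ?thesis unfolding X.R_def Z.R_def linear_span_image[OF lin, symmetric] by simp
  qed
  have mulB: "\<Phi> (mult1 (B1 i j s) (B1 p r t)) = mult2 (\<Phi> (B1 i j s)) (\<Phi> (B1 p r t))"
    if "i < k" "j < k" "p < k" "r < k" "s \<in> pidx m" "t \<in> pidx m" for i j p r s t
    using that by (simp add: X.B_mult Z.B_mult Phi linear_cmul[OF lin] linear_0[OF lin])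
  have mul: "\<Phi> (mult1 x y) = mult2 (\<Phi> x) (\<Phi> y)" if x: "x \<in> X.R" and y: "y \<in> X.R" for x y
  proof -
    have 1: "\<Phi> (mult1 (B1 i j s) y) = mult2 (\<Phi> (B1 i j s)) (\<Phi> y)" if ij: "i < k" "j < k" "s \<in> pidx m" for i j s
    proof (rule linear_eqI_span[of "\<lambda>y. \<Phi> (mult1 (B1 i j s) y)" "\<lambda>y. mult2 (\<Phi> (B1 i j s)) (\<Phi> y)" "X.b ` X.idx"])
      show "linear (\<lambda>y. \<Phi> (mult1 (B1 i j s) y))" "linear (\<lambda>y. mult2 (\<Phi> (B1 i j s)) (\<Phi> y))"
        by (auto intro!: linearI simp: X.distribs Z.distribs linear_add[OF lin] linear_cmul[OF lin])
      fix c assume "c \<in> X.b ` X.idx"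
      then show "\<Phi> (mult1 (B1 i j s) c) = mult2 (\<Phi> (B1 i j s)) (\<Phi> c)"
        using mulB ij unfolding X.b_def X.idx_def by auto
    qed (use y in \<open>simp add: X.R_def\<close>)
    show ?thesis
    proof (rule linear_eqI_span[of "\<lambda>x. \<Phi> (mult1 x y)" "\<lambda>x. mult2 (\<Phi> x) (\<Phi> y)" "X.b ` X.idx"])
      show "linear (\<lambda>x. \<Phi> (mult1 x y))" "linear (\<lambda>x. mult2 (\<Phi> x) (\<Phi> y))"
        by (auto intro!: linearI simp: X.distribs Z.distribs linear_add[OF lin] linear_cmul[OF lin])
      fix c assume "c \<in> X.b ` X.idx"
      then show "\<Phi> (mult1 c y) = mult2 (\<Phi> c) (\<Phi> y)" using 1 unfolding X.b_def X.idx_def by auto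
    qed (use x in \<open>simp add: X.R_def\<close>)
  qed
  have imgL: "\<Phi> ` X.L = Z.L"
  proof -
    have "\<Phi> ` {X.br x y | x y. x \<in> X.R \<and> y \<in> X.R} = {Z.br x y | x y. x \<in> Z.R \<and> y \<in> Z.R}"
    proof (rule subset_antisym; rule subsetI)
      fix w assume "w \<in> \<Phi> ` {X.br x y | x y. x \<in> X.R \<and> y \<in> X.R}"
      then obtain x y where xy: "w = \<Phi> (X.br x y)" "x \<in> X.R" "y \<in> X.R" by blast
      then have "w = Z.br (\<Phi> x) (\<Phi> y)" using mul by (simp add: X.br_def Z.br_def linear_diff[OF lin])
      then show "w \<in> {Z.br x y | x y. x \<in> Z.R \<and> y \<in> Z.R}" using xy img by blast
    next
      fix w assume "w \<in> {Z.br x y | x y. x \<in> Z.R \<and> y \<in> Z.R}"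
      then obtain x y where xy: "w = Z.br (\<Phi> x) (\<Phi> y)" "x \<in> X.R" "y \<in> X.R" unfolding img[symmetric] by blast
      then have "w = \<Phi> (X.br x y)" using mul by (simp add: X.br_def Z.br_def linear_diff[OF lin])
      then show "w \<in> \<Phi> ` {X.br x y | x y. x \<in> X.R \<and> y \<in> X.R}" using xy by blast
    qed
    then show ?thesis unfolding X.L_def Z.L_def linear_span_image[OF lin, symmetric] by simp
  qed
  show thesis by (rule that[OF lin Phi mul inj img imgL])
qed

lemma sl_eq_L:
  assumes "is_quat \<Delta> \<Longrightarrow> 0 < m" "0 < k"
  shows "type_I.L (mat_mult (k * D_size \<Delta> m)) k m (gl_basis \<Delta> m) = sl \<Delta> (k * D_size \<Delta> m)"
proof -
  interpret X: type_I "mat_mult (k * D_size \<Delta> m)" "is_quat \<Delta>" k m "gl_basis \<Delta> m"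
    using assms by (intro type_I_gl) auto
  have "X.R = gl \<Delta> (k * D_size \<Delta> m)" by (rule gl_eq_R) (use assms in auto)
  then show ?thesis unfolding X.L_def sl_def mat_bracket_eq by simp
qed

lemma carrier_type_I_group:
  "carrier (type_I_group \<Delta> n m) = pidx m \<times> ({..<n div D_size \<Delta> m} \<rightarrow>\<^sub>E UNIV)"
proof -
  have "{0..<2} = {0, 1::int}" by auto
  then show ?thesis
    unfolding type_I_group_def by (simp add: pidx_def integer_group_def carrier_integer_mod_group)
qed

lemma type_I_grading_eq:
  assumes "is_quat \<Delta> \<Longrightarrow> 0 < m" "0 < k"
  shows "type_I_grading \<Delta> (k * D_size \<Delta> m) m (t, v) =
    span {gl_basis \<Delta> m i j t | i j. i < k \<and> j < k \<and> basis_diff k i j = v} \<inter> sl \<Delta> (k * D_size \<Delta> m)"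
  unfolding type_I_grading_def by (simp add: gl_basis_def Let_def)

text \<open>In both cases k = (r + 1) / 2^m: for the quaternions the size of D and the matrix size
  n' are both half of their real counterparts.\<close>

lemma admissible_triple:
  assumes "(\<Delta>' = Reals_alg \<and> n' = r + 1 \<and> m \<ge> 0 \<or> \<Delta>' = Quaternions_alg \<and> 2 * n' = r + 1 \<and> m \<ge> 1)"
    and "2 ^ m dvd r + 1" "(r + 1) div 2 ^ m \<ge> 3"
  obtains k where "k * D_size \<Delta>' m = n'" "3 \<le> k" "is_quat \<Delta>' \<Longrightarrow> 0 < m"
proof (cases \<Delta>')
  case Reals_alg
  then show thesis using that[of "(r + 1) div 2 ^ m"] assms by simp
next
  case Quaternions_alg
  then obtain s where s: "m = Suc s" "2 * n' = r + 1" using assms(1) by (cases m) auto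
  have "(r + 1) div 2 ^ m * 2 ^ m = r + 1" using assms(2) by simp
  then have "(r + 1) div 2 ^ m * 2 ^ s = n'" using s by simp
  then show thesis using that[of "(r + 1) div 2 ^ m"] assms(3) s Quaternions_alg by simp
qed

text \<open>The isomorphism of tables carries the spans to the model spans, and being injective it
  commutes with intersecting with the Lie algebra.\<close>

lemma type_I_basis_equivalence:
  fixes mult :: "'a::real_vector \<Rightarrow> 'a \<Rightarrow> 'a"
  assumes A: "type_I mult (is_quat \<Delta>) k m B" and m: "is_quat \<Delta> \<Longrightarrow> 0 < m"
    and comps: "\<And>g. g \<in> carrier G \<Longrightarrow> \<Gamma> g \<noteq> {0} \<Longrightarrow> \<exists>t\<in>pidx m. \<exists>i<k. \<exists>j<k.
       \<Gamma> g = span {B p q t | p q. p < k \<and> q < k \<and> basis_diff k p q = basis_diff k i j} \<inter> type_I.L mult k m B"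
  shows "equivalent_gradings (type_I.L mult k m B) (ralg.br mult) G \<Gamma>
    (sl \<Delta> (k * D_size \<Delta> m)) (mat_bracket (k * D_size \<Delta> m))
    (type_I_group \<Delta> (k * D_size \<Delta> m) m) (type_I_grading \<Delta> (k * D_size \<Delta> m) m)"
proof -
  let ?N = "k * D_size \<Delta> m"
  interpret X: type_I mult "is_quat \<Delta>" k m B by (rule A)
  have k: "0 < k" by (rule X.k_pos)
  interpret Z: type_I "mat_mult ?N" "is_quat \<Delta>" k m "gl_basis \<Delta> m"
    using m k by (intro type_I_gl) auto
  obtain \<Phi> where lin: "linear \<Phi>"
    and Phi: "\<And>i j t. i < k \<Longrightarrow> j < k \<Longrightarrow> t \<in> pidx m \<Longrightarrow> \<Phi> (B i j t) = gl_basis \<Delta> m i j t"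
    and mul: "\<And>x y. x \<in> X.R \<Longrightarrow> y \<in> X.R \<Longrightarrow> \<Phi> (mult x y) = mat_mult ?N (\<Phi> x) (\<Phi> y)"
    and inj: "inj_on \<Phi> X.R" and imgL: "\<Phi> ` X.L = Z.L"
    by (rule type_I_isomorphism[OF A Z.type_I_axioms]) blast
  have ZL: "Z.L = sl \<Delta> ?N" by (rule sl_eq_L) (use m k in auto)
  have "lie_isomorphism X.L X.br (sl \<Delta> ?N) (mat_bracket ?N) \<Phi>"
    unfolding lie_isomorphism_def mat_bracket_eq ZL[symmetric]
  proof (intro conjI ballI allI)
    show "bij_betw \<Phi> X.L Z.L" using inj_on_subset[OF inj X.L_subset] imgL unfolding bij_betw_def by blast
    fix x y assume "x \<in> X.L" "y \<in> X.L"
    then show "\<Phi> (X.br x y) = mat.br ?N (\<Phi> x) (\<Phi> y)" using mul by (simp add: X.br_def mat.br_def linear_diff[OF lin])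
  qed (simp_all add: linear_add[OF lin] linear_cmul[OF lin])
  moreover have "\<exists>g'\<in>carrier (type_I_group \<Delta> ?N m). \<Phi> ` \<Gamma> g = type_I_grading \<Delta> ?N m g'"
    if g: "g \<in> grading_support G \<Gamma>" for g
  proof -
    obtain t i j where t: "t \<in> pidx m" and ij: "i < k" "j < k"
      and G: "\<Gamma> g = span {B p q t | p q. p < k \<and> q < k \<and> basis_diff k p q = basis_diff k i j} \<inter> X.L"
      using comps g unfolding grading_support_def by blast
    let ?W = "{B p q t | p q. p < k \<and> q < k \<and> basis_diff k p q = basis_diff k i j}"
    have "?W \<subseteq> X.R" using t by auto
    then have WR: "span ?W \<subseteq> X.R" by (intro span_minimal) auto
    have "\<Phi> ` ?W = {gl_basis \<Delta> m p q t | p q. p < k \<and> q < k \<and> basis_diff k p q = basis_diff k i j}"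
    proof (rule subset_antisym; rule subsetI)
      fix w assume "w \<in> \<Phi> ` ?W"
      then obtain p q where "w = \<Phi> (B p q t)" "p < k" "q < k" "basis_diff k p q = basis_diff k i j" by blast
      then show "w \<in> {gl_basis \<Delta> m p q t | p q. p < k \<and> q < k \<and> basis_diff k p q = basis_diff k i j}"
        using Phi t by blast
    next
      fix w assume "w \<in> {gl_basis \<Delta> m p q t | p q. p < k \<and> q < k \<and> basis_diff k p q = basis_diff k i j}"
      then obtain p q where pq: "w = gl_basis \<Delta> m p q t" "p < k" "q < k" "basis_diff k p q = basis_diff k i j" by blast
      then have "w = \<Phi> (B p q t)" using Phi t by simp
      then show "w \<in> \<Phi> ` ?W" using pq by blast
    qed
    then have "\<Phi> ` span ?W = span {gl_basis \<Delta> m p q t | p q. p < k \<and> q < k \<and> basis_diff k p q = basis_diff k i j}"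
      using linear_span_image[OF lin, of ?W] by simp
    moreover have "\<Phi> ` (span ?W \<inter> X.L) = \<Phi> ` span ?W \<inter> \<Phi> ` X.L"
      by (rule inj_on_image_Int[OF inj WR X.L_subset])
    moreover have "type_I_grading \<Delta> ?N m (t, basis_diff k i j) =
      span {gl_basis \<Delta> m p q t | p q. p < k \<and> q < k \<and> basis_diff k p q = basis_diff k i j} \<inter> sl \<Delta> ?N"
      by (rule type_I_grading_eq) (use m k in auto)
    ultimately have "\<Phi> ` \<Gamma> g = type_I_grading \<Delta> ?N m (t, basis_diff k i j)"
      unfolding G imgL ZL by simp
    moreover have "0 < D_size \<Delta> m" by (cases \<Delta>) auto
    then have "?N div D_size \<Delta> m = k" by simp
    then have "(t, basis_diff k i j) \<in> carrier (type_I_group \<Delta> ?N m)"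
      unfolding carrier_type_I_group using t by (simp add: basis_diff_def)
    ultimately show ?thesis by blast
  qed
  ultimately show ?thesis unfolding equivalent_gradings_def by blast
qed

lemma card_negative_equivalent:
  fixes L0 :: "'v::real_vector set"
  assumes m: "is_quat \<Delta> \<Longrightarrow> 0 < m" and k: "2 \<le> k"
    and gr: "lie_grading L0 br0 G \<Gamma>" and fin: "finite (grading_support G \<Gamma>)"
    and L0: "subspace L0" "\<And>x y. x \<in> L0 \<Longrightarrow> y \<in> L0 \<Longrightarrow> br0 x y \<in> L0"
    and eqv: "equivalent_gradings L0 br0 G \<Gamma> (sl \<Delta> (k * D_size \<Delta> m)) (mat_bracket (k * D_size \<Delta> m))
      (type_I_group \<Delta> (k * D_size \<Delta> m) m) (type_I_grading \<Delta> (k * D_size \<Delta> m) m)"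
  shows "card {X. \<exists>g\<in>grading_support G \<Gamma>. X = \<Gamma> g \<and> negative L0 br0 X} =
    card {t \<in> pidx m. psign (is_quat \<Delta>) m t t = -1}"
proof -
  let ?N = "k * D_size \<Delta> m"
  have k0: "0 < k" using k by simp
  interpret Z: type_I "mat_mult ?N" "is_quat \<Delta>" k m "gl_basis \<Delta> m"
    using m k0 by (intro type_I_gl) auto
  have ZL: "Z.L = sl \<Delta> ?N" by (rule sl_eq_L) (use m k0 in auto)
  obtain \<phi> where iso: "lie_isomorphism L0 br0 Z.L (mat.br ?N) \<phi>"
    and img: "\<And>g. g \<in> grading_support G \<Gamma> \<Longrightarrow>
      \<exists>g'\<in>carrier (type_I_group \<Delta> ?N m). \<phi> ` \<Gamma> g = type_I_grading \<Delta> ?N m g'"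
    using eqv unfolding equivalent_gradings_def mat_bracket_eq ZL by blast
  have "\<exists>t\<in>pidx m. \<exists>v. \<phi> ` \<Gamma> g = Z.comp0 t v" if g: "g \<in> grading_support G \<Gamma>" for g
  proof -
    obtain t v where tv: "(t, v) \<in> carrier (type_I_group \<Delta> ?N m)" "\<phi> ` \<Gamma> g = type_I_grading \<Delta> ?N m (t, v)"
      using img[OF g] by (metis surj_pair)
    have "type_I_grading \<Delta> ?N m (t, v) = Z.comp0 t v"
      unfolding Z.comp0_def ZL by (rule type_I_grading_eq) (use m k0 in auto)
    then show ?thesis using tv unfolding carrier_type_I_group by auto
  qed
  with k gr fin L0(1) _ iso show ?thesis by (rule Z.card_negative) (rule L0(2))
qed

theorem theorem6p6:
  fixes r n :: nat and \<Delta> :: division_alg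
    and G :: "('g, 'm) monoid_scheme" and \<Gamma> :: "'g \<Rightarrow> qmat set"
  assumes "r \<ge> 2"
    and "sl_has_type_A r \<Delta> n"
    and "inner_fine_grading (sl \<Delta> n) (mat_bracket n) G \<Gamma>"
  shows "\<exists>!(\<Delta>', n', m).
           (\<Delta>' = Reals_alg \<and> n' = r + 1 \<and> m \<ge> 0 \<or> \<Delta>' = Quaternions_alg \<and> 2 * n' = r + 1 \<and> m \<ge> 1) \<and>
           2 ^ m dvd r + 1 \<and> (r + 1) div 2 ^ m \<ge> 3 \<and>
           equivalent_gradings (sl \<Delta> n) (mat_bracket n) G \<Gamma>
             (sl \<Delta>' n') (mat_bracket n') (type_I_group \<Delta>' n' m) (type_I_grading \<Delta>' n' m)"
    (is "\<exists>!(\<Delta>', n', m). ?P \<Delta>' n' m")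
proof -
  \<comment> \<open>The real dimension of \<open>gl \<Delta> n\<close> is the square of r + 1 for
    either choice of \<open>\<Delta>\<close>.\<close>
  have n: "0 < n" "n\<^sup>2 * 4 ^ m0 \<Delta> = (r + 1)\<^sup>2"
  proof -
    have "0 < n \<and> n * 2 ^ m0 \<Delta> = r + 1"
      using assms(1,2) unfolding sl_has_type_A_def m0_def by (cases \<Delta>) auto
    moreover have "n\<^sup>2 * 4 ^ m0 \<Delta> = (n * 2 ^ m0 \<Delta>)\<^sup>2"
      by (simp add: power_mult_distrib power2_eq_square[of "2 ^ m0 \<Delta>"] flip: power_mult_distrib[of 2 2])
    ultimately show "0 < n" "n\<^sup>2 * 4 ^ m0 \<Delta> = (r + 1)\<^sup>2" by simp_all
  qed
  have m0: "is_quat \<Delta> \<Longrightarrow> 0 < m0 \<Delta>" by (simp add: m0_def)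
  interpret X: type_I "mat_mult n" "is_quat \<Delta>" n "m0 \<Delta>" "gl_basis \<Delta> (m0 \<Delta>)"
    using type_I_gl[of \<Delta> "m0 \<Delta>" n] m0 n(1) by simp
  have L: "X.L = sl \<Delta> n" using sl_eq_L[of \<Delta> "m0 \<Delta>" n] m0 n(1) by simp
  have fine: "fine_grading X.L (mat.br n) G \<Gamma>"
    and inner: "inner_grading X.L (mat.br n) (universal_group (mat.br n) G \<Gamma>) (universal_grading (mat.br n) G \<Gamma>)"
    using assms(3) unfolding inner_fine_grading_def L mat_bracket_eq by blast+
  have gr: "lie_grading X.L (mat.br n) G \<Gamma>" using fine unfolding fine_grading_def by blast
  have r3: "3\<^sup>2 \<le> (r + 1)\<^sup>2" using assms(1) by (intro power_mono) auto
  have ex: "\<exists>\<Delta>' n' m. ?P \<Delta>' n' m"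
  proof -
    have "9 \<le> n\<^sup>2 * 4 ^ m0 \<Delta>" using r3 n(2) by simp
    then obtain h' k m B where h: "type_I (mat_mult n) h' k m B" "h' \<Longrightarrow> 0 < m" "3 \<le> k"
      and R: "type_I.R k m B = X.R" and dim: "k\<^sup>2 * 4 ^ m = n\<^sup>2 * 4 ^ m0 \<Delta>"
      and comps: "\<And>g. g \<in> carrier G \<Longrightarrow> \<Gamma> g \<noteq> {0} \<Longrightarrow> \<exists>t\<in>pidx m. \<exists>i<k. \<exists>j<k.
        \<Gamma> g = span {B p q t | p q. p < k \<and> q < k \<and> basis_diff k p q = basis_diff k i j} \<inter> X.L"
      using X.fine_inner_structure[OF fine inner] by blast
    \<comment> \<open>The division algebra of the model is decided by whether the symplectic basis
      has a quaternion pair.\<close>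
    define \<Delta>' where "\<Delta>' = (if h' then Quaternions_alg else Reals_alg)"
    have q: "is_quat \<Delta>' = h'" unfolding \<Delta>'_def by simp
    interpret Y: type_I "mat_mult n" h' k m B by (rule h(1))
    have YL: "type_I.L (mat_mult n) k m B = X.L" unfolding Y.L_def X.L_def R ..
    \<comment> \<open>Both sides are the real dimension of the same algebra, which fixes the matrix
      size.\<close>
    have "(k * 2 ^ m)\<^sup>2 = (r + 1)\<^sup>2"
      using dim n(2) by (simp add: power_mult_distrib power2_eq_square[of "2 ^ m"] flip: power_mult_distrib[of 2 2 m])
    then have k: "k * 2 ^ m = r + 1" by (simp only: power2_eq_iff_nonneg)
    have "equivalent_gradings X.L (mat.br n) G \<Gamma> (sl \<Delta>' (k * D_size \<Delta>' m)) (mat_bracket (k * D_size \<Delta>' m))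
      (type_I_group \<Delta>' (k * D_size \<Delta>' m) m) (type_I_grading \<Delta>' (k * D_size \<Delta>' m) m)"
      using type_I_basis_equivalence[of "mat_mult n" \<Delta>' k m B G \<Gamma>] h(1,2) comps unfolding q YL by blast
    moreover have "\<Delta>' = Reals_alg \<and> k * D_size \<Delta>' m = r + 1 \<and> m \<ge> 0 \<or>
      \<Delta>' = Quaternions_alg \<and> 2 * (k * D_size \<Delta>' m) = r + 1 \<and> m \<ge> 1"
    proof (cases h')
      case True
      then obtain s where "m = Suc s" using h(2) by (cases m) auto
      then show ?thesis using True k unfolding \<Delta>'_def by simp
    qed (use k in \<open>simp add: \<Delta>'_def\<close>)
    moreover have "2 ^ m dvd r + 1" "(r + 1) div 2 ^ m \<ge> 3" unfolding k[symmetric] using h(3) by simp_all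
    ultimately show ?thesis unfolding L mat_bracket_eq by blast
  qed
  \<comment> \<open>The set counted on the left does not mention the triple, so any two admissible
    triples have equally many negative indices.\<close>
  have card: "(is_quat \<Delta>' \<longrightarrow> 0 < m) \<and>
      card {X. \<exists>g\<in>grading_support G \<Gamma>. X = \<Gamma> g \<and> negative X.L (mat.br n) X} =
      card {t \<in> pidx m. psign (is_quat \<Delta>') m t t = -1}" if P: "?P \<Delta>' n' m" for \<Delta>' n' m
  proof -
    obtain k where k: "k * D_size \<Delta>' m = n'" "3 \<le> k" "is_quat \<Delta>' \<Longrightarrow> 0 < m"
      using admissible_triple[of \<Delta>' n' r m] P by blast
    have "card {X. \<exists>g\<in>grading_support G \<Gamma>. X = \<Gamma> g \<and> negative X.L (mat.br n) X} =
      card {t \<in> pidx m. psign (is_quat \<Delta>') m t t = -1}"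
    proof (rule card_negative_equivalent[where k = k])
      show "equivalent_gradings X.L (mat.br n) G \<Gamma> (sl \<Delta>' (k * D_size \<Delta>' m)) (mat_bracket (k * D_size \<Delta>' m))
        (type_I_group \<Delta>' (k * D_size \<Delta>' m) m) (type_I_grading \<Delta>' (k * D_size \<Delta>' m) m)"
        using P unfolding k(1) L mat_bracket_eq by blast
    qed (use k gr X.finite_support[OF gr] in \<open>auto intro!: X.br_in_L\<close>)
    then show ?thesis using k(3) by blast
  qed
  have uniq: "\<Delta>1 = \<Delta>2 \<and> n1 = n2 \<and> m1 = m2" if P: "?P \<Delta>1 n1 m1" "?P \<Delta>2 n2 m2" for \<Delta>1 \<Delta>2 n1 n2 m1 m2
  proof -
    have c: "is_quat \<Delta>1 = is_quat \<Delta>2 \<and> m1 = m2"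
    proof (rule negative_indices_inject)
      show "card {t \<in> pidx m1. psign (is_quat \<Delta>1) m1 t t = -1} = card {t \<in> pidx m2. psign (is_quat \<Delta>2) m2 t t = -1}"
        using card[OF P(1)] card[OF P(2)] by simp
    qed (use card[OF P(1)] card[OF P(2)] in blast)+
    then have "\<Delta>1 = \<Delta>2" by (cases \<Delta>1; cases \<Delta>2) auto
    \<comment> \<open>For given r the matrix size is determined by the division algebra.\<close>
    moreover from this have "n1 = n2" using P by auto
    ultimately show ?thesis using c by blast
  qed
  show ?thesis
  proof (rule ex_ex1I)
    obtain \<Delta>' n' m where P: "?P \<Delta>' n' m" using ex by blast
    show "\<exists>x. case x of (\<Delta>', n', m) \<Rightarrow> ?P \<Delta>' n' m"
      by (rule exI[of _ "(\<Delta>', n', m)"], unfold case_prod_conv, rule P)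
    fix x y assume "case x of (\<Delta>', n', m) \<Rightarrow> ?P \<Delta>' n' m" "case y of (\<Delta>', n', m) \<Rightarrow> ?P \<Delta>' n' m"
    moreover obtain \<Delta>1 n1 m1 where x: "x = (\<Delta>1, n1, m1)" by (rule prod_cases3)
    moreover obtain \<Delta>2 n2 m2 where y: "y = (\<Delta>2, n2, m2)" by (rule prod_cases3)
    ultimately have P: "?P \<Delta>1 n1 m1" "?P \<Delta>2 n2 m2" by (simp_all only: case_prod_conv)
    show "x = y" unfolding x y prod.inject by (rule uniq[OF P])
  qed
qed

end
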